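(* Let $k$ be a unital commutative ring and let $\varepsilon\in k$ be invertible. For braided rook algebras over $k$, the morphism $$\mathrm{Tor}_{q}^{B\mathcal{R}_{n-1}(\varepsilon)}(\mathbf{1},\mathbf{1})\rightarrow \mathrm{Tor}_{q}^{B\mathcal{R}_{n}(\varepsilon)}(\mathbf{1},\mathbf{1})$$ induced by the inclusion map $B\mathcal{R}_{n-1}(\varepsilon)\rightarrow B\mathcal{R}_{n}(\varepsilon)$ is an isomorphism for $n\geqslant 2q+1$.
   Context: A braided rook $n$-diagram consists of two columns (left and right) of $n$ nodes and a set of disjoint strands, each joining a left node to a right node, such that each node is the endpoint of at most one strand (nodes may be unconnected; there are no left-to-left and no right-to-right connections). Whenever two strands cross, the crossing is an over-crossing or an under-crossing. Strands run as in a braid, and diagrams are considered up to isotopy fixing endpoints, as for (partial) braids. The braided rook algebra $B\mathcal{R}_n(\varepsilon)$ consists of formal $k$-linear combinations of braided rook $n$-diagrams. The product $x\cdot y$ of two diagrams is the $k$-bilinear extension of: identify the right-hand nodes of $x$ with the left-hand nodes of $y$, forget the middle nodes, and multiply by a factor $\varepsilon$ for each contractible component lying entirely in the middle, i.e. for each middle node which is attached to no strand of $x$ and no strand of $y$. A strand which reaches the middle column and is not continued is discarded without a factor, leaving its outer node unconnected. The inclusion $B\mathcal{R}_{n-1}(\varepsilon)\to B\mathcal{R}_n(\varepsilon)$ sends an $(n-1)$-diagram to the $n$-diagram obtained by adding an extra node at the end of each column and joining these two nodes by a horizontal strand (crossing no other strand). The trivial module $\mathbf{1}$ is a copy of $k$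 (as a left and as a right module) on which diagrams with no missing edges act as $1$ and all other diagrams act as $0$. *)

theory Defs
  imports "HOL-Analysis.Analysis" "HOL-Algebra.Free_Abelian_Groups" "HOL-Algebra.Module"
begin

section \<open>Braided rook diagrams\<close>

text \<open>
  The columns are the planes at times 0 (left) and 1 (right) of the box
  \<open>strip n \<times> [0,1]\<close>; the nodes \<open>1, \<dots>, n\<close> lie on the real axis, and where two strands cross in the
  projection to the real direction, the imaginary part decides which of them passes over.
\<close>

definition strip :: "nat \<Rightarrow> complex set" where
  "strip n = {z. 1/2 < Re z \<and> Re z < real n + 1/2}"

definition conf :: "nat \<Rightarrow> nat set \<Rightarrow> (nat \<Rightarrow> complex) set" where
  "conf n A = {x \<in> A \<rightarrow>\<^sub>E strip n. inj_on x A}"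

text \<open>
  A pair \<open>(A, p)\<close> consists of the set \<open>A\<close> of left nodes that carry a strand and of a path \<open>p\<close> of
  configurations: the strand starting at the left node \<open>a \<in> A\<close> is \<open>\<lambda>t. p t a\<close>.
  Configurations carry the product topology of \<open>nat \<Rightarrow> complex\<close>.
\<close>

type_synonym strands = "nat set \<times> (real \<Rightarrow> nat \<Rightarrow> complex)"

definition braided_strands :: "nat \<Rightarrow> strands set" where
  "braided_strands n = {(A, p). A \<subseteq> {1..n} \<and> path p \<and> path_image p \<subseteq> conf n A
     \<and> pathstart p = restrict of_nat A \<and> (\<forall>a\<in>A. pathfinish p a \<in> of_nat ` {1..n})}"

definition isotopy :: "nat \<Rightarrow> (strands \<times> strands) set" where
  "isotopy n = {((A, p), (B, r)). (A, p) \<in> braided_strands n \<and> (B, r) \<in> braided_strands n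
     \<and> A = B \<and> homotopic_paths (conf n A) p r}"

definition diagrams :: "nat \<Rightarrow> strands set set" where
  "diagrams n = braided_strands n // isotopy n"

definition right_end :: "strands \<Rightarrow> nat \<Rightarrow> nat" where
  "right_end = (\<lambda>(A, p) a. THE j. pathfinish p a = of_nat j)"

definition strands_comp :: "strands \<Rightarrow> strands \<Rightarrow> strands" where
  "strands_comp x y =
     (let C = {a \<in> fst x. right_end x a \<in> fst y}
      in (C, joinpaths (\<lambda>t. restrict (snd x t) C) (\<lambda>t. restrict (\<lambda>a. snd y t (right_end x a)) C)))"

definition strands_loose :: "nat \<Rightarrow> strands \<Rightarrow> strands \<Rightarrow> nat" where
  "strands_loose n x y = card ({1..n} - right_end x ` fst x - fst y)"

definition identity_diagram :: "nat \<Rightarrow> strands set" where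
  "identity_diagram n = isotopy n `` {({1..n}, \<lambda>t. restrict of_nat {1..n})}"

definition diagram_comp :: "nat \<Rightarrow> strands set \<Rightarrow> strands set \<Rightarrow> strands set" where
  "diagram_comp n X Y = (\<Union>x\<in>X. \<Union>y\<in>Y. isotopy n `` {strands_comp x y})"

definition loose_nodes :: "nat \<Rightarrow> strands set \<Rightarrow> strands set \<Rightarrow> nat" where
  "loose_nodes n X Y = the_elem (\<Union>x\<in>X. \<Union>y\<in>Y. {strands_loose n x y})"

text \<open>
  The new strand at the node \<open>n\<close> meets and crosses no other strand, since those stay in
  \<open>strip (n - 1)\<close>, to the left of \<open>n\<close>.
\<close>

definition diagram_incl :: "nat \<Rightarrow> strands set \<Rightarrow> strands set" where
  "diagram_incl n X = (\<Union>(A, p)\<in>X. isotopy n `` {(insert n A, \<lambda>t. (p t)(n := of_nat n))})"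

definition no_missing_edges :: "nat \<Rightarrow> strands set \<Rightarrow> bool" where
  "no_missing_edges n X \<longleftrightarrow> (\<forall>(A, p)\<in>X. A = {1..n})"


section \<open>The braided rook algebra\<close>

definition finsupp :: "('a, 'm) ring_scheme \<Rightarrow> 'i set \<Rightarrow> ('i \<Rightarrow> 'a) set" where
  "finsupp R S = {f. (\<forall>i. f i \<in> carrier R) \<and> finite {i. f i \<noteq> \<zero>\<^bsub>R\<^esub>} \<and> {i. f i \<noteq> \<zero>\<^bsub>R\<^esub>} \<subseteq> S}"

definition braided_rook_algebra ::
    "('k, 'm) ring_scheme \<Rightarrow> 'k \<Rightarrow> nat \<Rightarrow> (strands set \<Rightarrow> 'k) ring" where
  "braided_rook_algebra k \<epsilon> n =
    \<lparr>carrier = finsupp k (diagrams n),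
     monoid.mult = (\<lambda>f g D.
        finsum k (\<lambda>(X, Y). \<epsilon> [^]\<^bsub>k\<^esub> loose_nodes n X Y \<otimes>\<^bsub>k\<^esub> (f X \<otimes>\<^bsub>k\<^esub> g Y))
          {(X, Y). f X \<noteq> \<zero>\<^bsub>k\<^esub> \<and> g Y \<noteq> \<zero>\<^bsub>k\<^esub> \<and> diagram_comp n X Y = D}),
     one = (\<lambda>D. if D = identity_diagram n then \<one>\<^bsub>k\<^esub> else \<zero>\<^bsub>k\<^esub>),
     zero = (\<lambda>D. \<zero>\<^bsub>k\<^esub>),
     add = (\<lambda>f g D. f D \<oplus>\<^bsub>k\<^esub> g D)\<rparr>"

definition algebra_incl ::
    "('k, 'm) ring_scheme \<Rightarrow> nat \<Rightarrow> (strands set \<Rightarrow> 'k) \<Rightarrow> strands set \<Rightarrow> 'k" where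
  "algebra_incl k n f = (\<lambda>D. \<Oplus>\<^bsub>k\<^esub>X \<in> {X. f X \<noteq> \<zero>\<^bsub>k\<^esub> \<and> diagram_incl n X = D}. f X)"

text \<open>
  As \<open>k\<close> is commutative, one record serves both as left and as right module; the fields
  \<^const>\<open>monoid.mult\<close> and \<^const>\<open>monoid.one\<close> of a module record carry no meaning.
\<close>

definition trivial_module ::
    "('k, 'm) ring_scheme \<Rightarrow> nat \<Rightarrow> (strands set \<Rightarrow> 'k, 'k) module" where
  "trivial_module k n =
    \<lparr>carrier = carrier k, monoid.mult = undefined, one = undefined,
     zero = \<zero>\<^bsub>k\<^esub>, add = (\<oplus>\<^bsub>k\<^esub>),
     smult = (\<lambda>f x. (\<Oplus>\<^bsub>k\<^esub>X \<in> {X. f X \<noteq> \<zero>\<^bsub>k\<^esub> \<and> no_missing_edges n X}. f X) \<otimes>\<^bsub>k\<^esub> x)\<rparr>"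


section \<open>Modules over a ring that need not be commutative\<close>

locale left_module = R?: ring A + M?: abelian_group M
  for A :: "('a, 'm) ring_scheme" (structure) and M :: "('a, 'b, 'n) module_scheme" (structure) +
  assumes smult_closed:
      "\<lbrakk>a \<in> carrier A; x \<in> carrier M\<rbrakk> \<Longrightarrow> a \<odot>\<^bsub>M\<^esub> x \<in> carrier M"
    and smult_l_distr:
      "\<lbrakk>a \<in> carrier A; b \<in> carrier A; x \<in> carrier M\<rbrakk> \<Longrightarrow>
        (a \<oplus>\<^bsub>A\<^esub> b) \<odot>\<^bsub>M\<^esub> x = a \<odot>\<^bsub>M\<^esub> x \<oplus>\<^bsub>M\<^esub> b \<odot>\<^bsub>M\<^esub> x"
    and smult_r_distr:
      "\<lbrakk>a \<in> carrier A; x \<in> carrier M; y \<in> carrier M\<rbrakk> \<Longrightarrow>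
        a \<odot>\<^bsub>M\<^esub> (x \<oplus>\<^bsub>M\<^esub> y) = a \<odot>\<^bsub>M\<^esub> x \<oplus>\<^bsub>M\<^esub> a \<odot>\<^bsub>M\<^esub> y"
    and smult_assoc:
      "\<lbrakk>a \<in> carrier A; b \<in> carrier A; x \<in> carrier M\<rbrakk> \<Longrightarrow>
        (a \<otimes>\<^bsub>A\<^esub> b) \<odot>\<^bsub>M\<^esub> x = a \<odot>\<^bsub>M\<^esub> (b \<odot>\<^bsub>M\<^esub> x)"
    and smult_one:
      "x \<in> carrier M \<Longrightarrow> \<one>\<^bsub>A\<^esub> \<odot>\<^bsub>M\<^esub> x = x"

text \<open>Additive maps that are linear along a map \<open>\<phi>\<close> of rings; \<open>\<phi> = id\<close> gives linear maps.\<close>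

definition linear_along ::
    "('a, 'm) ring_scheme \<Rightarrow> ('a \<Rightarrow> 'c) \<Rightarrow> ('a, 'b, 'n) module_scheme \<Rightarrow>
      ('c, 'd, 'o) module_scheme \<Rightarrow> ('b \<Rightarrow> 'd) \<Rightarrow> bool" where
  "linear_along A \<phi> M N f \<longleftrightarrow>
     f \<in> carrier M \<rightarrow> carrier N
     \<and> (\<forall>x\<in>carrier M. \<forall>y\<in>carrier M. f (x \<oplus>\<^bsub>M\<^esub> y) = f x \<oplus>\<^bsub>N\<^esub> f y)
     \<and> (\<forall>a\<in>carrier A. \<forall>x\<in>carrier M. f (a \<odot>\<^bsub>M\<^esub> x) = \<phi> a \<odot>\<^bsub>N\<^esub> f x)"

abbreviation linear_map ::
    "('a, 'm) ring_scheme \<Rightarrow> ('a, 'b, 'n) module_scheme \<Rightarrow> ('a, 'd, 'o) module_scheme \<Rightarrow>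
      ('b \<Rightarrow> 'd) \<Rightarrow> bool" where
  "linear_map A \<equiv> linear_along A id"

definition free_left_module :: "('a, 'm) ring_scheme \<Rightarrow> 'i set \<Rightarrow> ('a, 'i \<Rightarrow> 'a) module" where
  "free_left_module A I =
    \<lparr>carrier = finsupp A I, monoid.mult = undefined, one = undefined,
     zero = (\<lambda>i. \<zero>\<^bsub>A\<^esub>), add = (\<lambda>f g i. f i \<oplus>\<^bsub>A\<^esub> g i),
     smult = (\<lambda>a f i. a \<otimes>\<^bsub>A\<^esub> f i)\<rparr>"

text \<open>
  Projective modules are the direct summands of free modules. Basis sets in the type of the
  elements of \<open>P\<close> suffice, since \<open>P\<close> is a quotient of the free module on its own carrier.
\<close>

definition projective_module :: "('a, 'm) ring_scheme \<Rightarrow> ('a, 'b) module \<Rightarrow> bool" where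
  "projective_module A P \<longleftrightarrow> left_module A P \<and>
     (\<exists>(I :: 'b set) s r. linear_map A P (free_left_module A I) s
        \<and> linear_map A (free_left_module A I) P r \<and> (\<forall>x\<in>carrier P. r (s x) = x))"

text \<open>A resolution \<open>\<cdots> \<rightarrow> P 2 \<rightarrow> P 1 \<rightarrow> P 0 \<rightarrow> N \<rightarrow> 0\<close> with differentials \<open>d i : P (i + 1) \<rightarrow> P i\<close>.\<close>

definition projective_resolution ::
    "('a, 'm) ring_scheme \<Rightarrow> ('a, 'c) module \<Rightarrow> (nat \<Rightarrow> ('a, 'b) module) \<Rightarrow>
      (nat \<Rightarrow> 'b \<Rightarrow> 'b) \<Rightarrow> ('b \<Rightarrow> 'c) \<Rightarrow> bool" where
  "projective_resolution A N P d e \<longleftrightarrow>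
     (\<forall>i. projective_module A (P i))
     \<and> (\<forall>i. linear_map A (P (Suc i)) (P i) (d i))
     \<and> linear_map A (P 0) N e
     \<and> e ` carrier (P 0) = carrier N
     \<and> {x \<in> carrier (P 0). e x = \<zero>\<^bsub>N\<^esub>} = d 0 ` carrier (P (Suc 0))
     \<and> (\<forall>i. {x \<in> carrier (P (Suc i)). d i x = \<zero>\<^bsub>P i\<^esub>} = d (Suc i) ` carrier (P (Suc (Suc i))))"

definition resolution_map ::
    "('a, 'm) ring_scheme \<Rightarrow> ('a \<Rightarrow> 'a2) \<Rightarrow> ('c \<Rightarrow> 'c2) \<Rightarrow>
      (nat \<Rightarrow> ('a, 'b) module) \<Rightarrow> (nat \<Rightarrow> 'b \<Rightarrow> 'b) \<Rightarrow> ('b \<Rightarrow> 'c) \<Rightarrow>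
      (nat \<Rightarrow> ('a2, 'b2) module) \<Rightarrow> (nat \<Rightarrow> 'b2 \<Rightarrow> 'b2) \<Rightarrow> ('b2 \<Rightarrow> 'c2) \<Rightarrow>
      (nat \<Rightarrow> 'b \<Rightarrow> 'b2) \<Rightarrow> bool" where
  "resolution_map A \<phi> \<nu> P d e P' d' e' f \<longleftrightarrow>
     (\<forall>i. linear_along A \<phi> (P i) (P' i) (f i))
     \<and> (\<forall>i. \<forall>x\<in>carrier (P (Suc i)). f i (d i x) = d' i (f (Suc i) x))
     \<and> (\<forall>x\<in>carrier (P 0). e' (f 0 x) = \<nu> (e x))"


section \<open>Tensor products and Tor\<close>

text \<open>For a right module \<open>M\<close>, the term \<open>a \<odot>\<^bsub>M\<^esub> x\<close> stands for the product of \<open>x\<close> with \<open>a\<close> on the right.\<close>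

definition tensor_relations ::
    "('a, 'm) ring_scheme \<Rightarrow> ('a, 'x) module \<Rightarrow> ('a, 'y) module \<Rightarrow> ('x \<times> 'y \<Rightarrow>\<^sub>0 int) set" where
  "tensor_relations A M P = generate (free_Abelian_group (carrier M \<times> carrier P))
    ({frag_of (x \<oplus>\<^bsub>M\<^esub> x', y) - frag_of (x, y) - frag_of (x', y) | x x' y.
        x \<in> carrier M \<and> x' \<in> carrier M \<and> y \<in> carrier P}
     \<union> {frag_of (x, y \<oplus>\<^bsub>P\<^esub> y') - frag_of (x, y) - frag_of (x, y') | x y y'.
        x \<in> carrier M \<and> y \<in> carrier P \<and> y' \<in> carrier P}
     \<union> {frag_of (a \<odot>\<^bsub>M\<^esub> x, y) - frag_of (x, a \<odot>\<^bsub>P\<^esub> y) | a x y.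
        a \<in> carrier A \<and> x \<in> carrier M \<and> y \<in> carrier P})"

definition tensor ::
    "('a, 'm) ring_scheme \<Rightarrow> ('a, 'x) module \<Rightarrow> ('a, 'y) module \<Rightarrow>
      ('x \<times> 'y \<Rightarrow>\<^sub>0 int) set monoid" where
  "tensor A M P = free_Abelian_group (carrier M \<times> carrier P) Mod tensor_relations A M P"

text \<open>The map into \<open>G Mod N\<close> induced on a quotient group by a map \<open>h\<close> into \<open>G\<close>.\<close>

definition quotient_map_into :: "('g, 'm) monoid_scheme \<Rightarrow> 'g set \<Rightarrow> ('h \<Rightarrow> 'g) \<Rightarrow> 'h set \<Rightarrow> 'g set" where
  "quotient_map_into G N h = (\<lambda>X. the_elem ((\<lambda>x. N #>\<^bsub>G\<^esub> h x) ` X))"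

definition tensor_map ::
    "('a, 'm) ring_scheme \<Rightarrow> ('a, 'x) module \<Rightarrow> ('a, 'y) module \<Rightarrow>
      ('x2 \<Rightarrow> 'x) \<Rightarrow> ('y2 \<Rightarrow> 'y) \<Rightarrow> ('x2 \<times> 'y2 \<Rightarrow>\<^sub>0 int) set \<Rightarrow> ('x \<times> 'y \<Rightarrow>\<^sub>0 int) set" where
  "tensor_map A M P \<mu> f =
     quotient_map_into (free_Abelian_group (carrier M \<times> carrier P)) (tensor_relations A M P)
       (frag_extend (\<lambda>(x, y). frag_of (\<mu> x, f y)))"

definition tor_cycles ::
    "('a, 'm) ring_scheme \<Rightarrow> ('a, 'x) module \<Rightarrow> (nat \<Rightarrow> ('a, 'y) module) \<Rightarrow> (nat \<Rightarrow> 'y \<Rightarrow> 'y) \<Rightarrow>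
      nat \<Rightarrow> ('x \<times> 'y \<Rightarrow>\<^sub>0 int) set set" where
  "tor_cycles A M P d q =
     (case q of 0 \<Rightarrow> carrier (tensor A M (P 0))
      | Suc i \<Rightarrow> kernel (tensor A M (P (Suc i))) (tensor A M (P i)) (tensor_map A M (P i) id (d i)))"

definition tor_boundaries ::
    "('a, 'm) ring_scheme \<Rightarrow> ('a, 'x) module \<Rightarrow> (nat \<Rightarrow> ('a, 'y) module) \<Rightarrow> (nat \<Rightarrow> 'y \<Rightarrow> 'y) \<Rightarrow>
      nat \<Rightarrow> ('x \<times> 'y \<Rightarrow>\<^sub>0 int) set set" where
  "tor_boundaries A M P d q = tensor_map A M (P q) id (d q) ` carrier (tensor A M (P (Suc q)))"

text \<open>
  \<open>tor A M P d q\<close> is the \<open>q\<close>-th Tor group over \<open>A\<close> of \<open>M\<close> and of the module resolved by the projective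
  resolution \<open>(P, d)\<close>, and \<open>tor_map A' M' P' d' \<mu> f q\<close> is the map into the Tor group over \<open>A'\<close>
  which is induced by \<open>\<mu>\<close> and by the map \<open>f\<close> of resolutions.
\<close>

definition tor ::
    "('a, 'm) ring_scheme \<Rightarrow> ('a, 'x) module \<Rightarrow> (nat \<Rightarrow> ('a, 'y) module) \<Rightarrow> (nat \<Rightarrow> 'y \<Rightarrow> 'y) \<Rightarrow>
      nat \<Rightarrow> ('x \<times> 'y \<Rightarrow>\<^sub>0 int) set set monoid" where
  "tor A M P d q = (tensor A M (P q))\<lparr>carrier := tor_cycles A M P d q\<rparr> Mod tor_boundaries A M P d q"

definition tor_map ::
    "('a, 'm) ring_scheme \<Rightarrow> ('a, 'x) module \<Rightarrow> (nat \<Rightarrow> ('a, 'y) module) \<Rightarrow> (nat \<Rightarrow> 'y \<Rightarrow> 'y) \<Rightarrow>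
      ('x2 \<Rightarrow> 'x) \<Rightarrow> (nat \<Rightarrow> 'y2 \<Rightarrow> 'y) \<Rightarrow> nat \<Rightarrow>
      ('x2 \<times> 'y2 \<Rightarrow>\<^sub>0 int) set set \<Rightarrow> ('x \<times> 'y \<Rightarrow>\<^sub>0 int) set set" where
  "tor_map A' M' P' d' \<mu> f q =
     quotient_map_into ((tensor A' M' (P' q))\<lparr>carrier := tor_cycles A' M' P' d' q\<rparr>)
       (tor_boundaries A' M' P' d' q) (tensor_map A' M' (P' q) \<mu> (f q))"

end

theory Submission
  imports Defs "HOL-Combinatorics.Permutations"
begin

text \<open>
The braid group is the group of fractions of the positive braid monoid: fractions are transported along a path of
configurations and depend only on its homotopy class. Its trivial module therefore has the resolution by the cellular
chains of the universal cover of the Salvetti complex, with a cell \<open>(X, J)\<close> for every braid \<open>X\<close> and every set \<open>J\<close> of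
standard generators; filtering the positive cells by the length of their top, that is \<open>X\<close> times the longest element
of the parabolic subgroup of \<open>J\<close>, leaves simplices, which are acyclic.

Let the diagrams with missing edges act on this resolution as 0. As \<open>\<epsilon>\<close> is invertible, some element of the rook algebra
of augmentation 1 is annihilated by all diagrams with missing edges; it makes linear maps out of the
resolution liftable as if its modules were free over the rook algebra. Hence the resolution computes Tor by comparison
with arbitrary projective resolutions, and Tor is the homology of the complex of the sets \<open>J\<close>. For this complex an acyclic
matching, based on the parity of the blocks of \<open>J\<close>, shows that adding a strand induces an isomorphism for \<open>n \<ge> 2 q + 1\<close>.
\<close>

text \<open>Braids are given here as homotopy classes of paths, so nothing is known beforehand about
  the group that they form. An invariant of these classes is needed to tell positive words apart,
  and the right-greedy normal form makes fractions rigid enough to serve as one: it yields right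
  cancellation, hence bijective transition maps. The same normal form decides divisibility on the
  right by longest elements, on which the cone in the Salvetti complex rests. Left translations
  commute with the boundary of that complex, so a power of the central full twist moves any chain to
  positive cells.

  The bound on \<open>n\<close> comes from the types \<open>J\<close> without a \<open>gap\<close>.
  They contain every number below \<open>n\<close> of the parity opposite to \<open>n\<close>, which
  forces \<open>n\<close> to be even and \<open>J\<close> to have at least \<open>n / 2\<close>
  elements. In degree \<open>q\<close> with \<open>2 * q + 1 \<le> n\<close> there is none. In
  degree \<open>q + 1\<close> there is at most one, and its boundary is zero, because each of its
  blocks is a single generator with incidence \<open>1 - 1\<close>.\<close>

abbreviation "keys \<equiv> Poly_Mapping.keys"
abbreviation "tpose \<equiv> Transposition.transpose"
abbreviation "BS \<equiv> braided_strands"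
abbreviation "dcomp \<equiv> diagram_comp"
abbreviation "idd \<equiv> identity_diagram"
abbreviation "nomiss \<equiv> no_missing_edges"
abbreviation "rend \<equiv> right_end"
abbreviation "fsupp \<equiv> finsupp"
abbreviation "FM \<equiv> free_left_module"
abbreviation "frg \<equiv> frag_of"
abbreviation "fex \<equiv> frag_extend"
abbreviation "fcm \<equiv> frag_cmul"
abbreviation "pimg \<equiv> path_image"
abbreviation "pfin \<equiv> pathfinish"
abbreviation "pst \<equiv> pathstart"
abbreviation "hpaths \<equiv> homotopic_paths"
abbreviation "cont_on \<equiv> continuous_on"
lemmas feq = fun_eq_iff
lemmas amd = a_minus_def
abbreviation "car \<equiv> carrier"
abbreviation "lin_along \<equiv> linear_along"

abbreviation iff_ascii (infixr "<->" 25) where "P <-> Q \<equiv> P \<longleftrightarrow> Q"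
abbreviation mult_of ("_ \<otimes>[_] _" [70, 0, 71] 70) where "x \<otimes>[G] y \<equiv> x \<otimes>\<^bsub>G\<^esub> y"
abbreviation one_of ("\<one>[_]") where "\<one>[G] \<equiv> \<one>\<^bsub>G\<^esub>"
abbreviation zero_of ("\<zero>[_]") where "\<zero>[G] \<equiv> \<zero>\<^bsub>G\<^esub>"
abbreviation add_of ("_ \<oplus>[_] _" [65, 0, 66] 65) where "x \<oplus>[G] y \<equiv> x \<oplus>\<^bsub>G\<^esub> y"
abbreviation a_inv_of ("\<ominus>[_] _" [0, 81] 80) where "\<ominus>[G] x \<equiv> \<ominus>\<^bsub>G\<^esub> x"
abbreviation a_minus_of ("_ \<ominus>[_] _" [65, 0, 66] 65) where "x \<ominus>[G] y \<equiv> x \<ominus>\<^bsub>G\<^esub> y"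
abbreviation smult_of ("_ \<odot>[_] _" [75, 0, 76] 75) where "a \<odot>[M] x \<equiv> a \<odot>\<^bsub>M\<^esub> x"

section \<open>The positive braid monoid\<close>

declare One_nat_def [simp del]

section \<open>Inversion sets and reduced products of permutations\<close>

abbreviation pinv :: "(nat=>nat)=>nat=>nat" where
 "pinv w == inv_into UNIV w"

definition invs :: "(nat=>nat)=>(nat \<times> nat) set" where
 "invs w = {(i,j). i < j & w j < w i}"

text \<open>As \<open>u o v\<close> applies \<open>v\<close> first, the condition says that no pair
  exchanged by \<open>v\<close> is exchanged back by \<open>u\<close>. The lengths then add up
  (\<open>invs_comp_card\<close>), and the permutation braids of \<open>u\<close> and
  \<open>v\<close> multiply to that of \<open>u o v\<close>.\<close>

definition red_pair where
 "red_pair u v <-> invs v<=invs (u o v)"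

text \<open>The values up to \<open>w i\<close> fill the interval \<open>{1..w i}\<close>; so the
  order of the values determines a permutation, as \<open>perm_eqI_ord\<close> records.\<close>

lemma perm_eq_card:
 fixes n :: nat
 assumes "w permutes {1..n}" "i : {1..n}"
 shows "w i = card {j : {1..n}. w j<=w i}"
proof -
 have im: "w j : {1..n}" if "j : {1..n}" for j using that permutes_in_image[OF assms(1)] by blast
 have "w ` {j : {1..n}. w j<=w i} = {1..w i}"
 proof
  show "w ` {j : {1..n}. w j<=w i}<={1..w i}" using im by fastforce
  show "{1..w i}<=w ` {j : {1..n}. w j<=w i}"
  proof
   fix k assume k: "k : {1..w i}"
   have "k : {1..n}" using k im assms(2) by fastforce
   hence "pinv w k : {1..n}" "w (pinv w k) = k"
    using permutes_in_image[OF permutes_inv[OF assms(1)]] permutes_inverses(1)[OF assms(1)] by blast+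
   thus "k : w ` {j : {1..n}. w j<=w i}" using k by (intro image_eqI[of _ _ "pinv w k"]) auto
  qed
 qed
 moreover have "inj_on w {j : {1..n}. w j<=w i}" using permutes_inj_on[OF assms(1)] by blast
 ultimately have "card {1..w i} = card {j : {1..n}. w j<=w i}" by (metis card_image)
 thus ?thesis by simp
qed

lemma perm_eqI_ord:
 fixes n :: nat
 assumes "u permutes {1..n}" "w permutes {1..n}"
  and "!!i j. [|i : {1..n}; j : {1..n}; i~=j|]==>u i < u j <-> w i < w j"
 shows "u = w"
proof
 fix i
 show "u i = w i"
 proof (cases "i : {1..n}")
  case True
  have "u j<=u i <-> w j<=w i" if "j : {1..n}" for j
   using assms(3)[OF True that] by (cases "i = j") (auto simp: not_less[symmetric])
  hence "{j : {1..n}. u j<=u i} = {j : {1..n}. w j<=w i}" by blast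
  thus ?thesis using perm_eq_card[OF assms(1) True] perm_eq_card[OF assms(2) True] by simp
 next
  case False
  thus ?thesis using assms(1,2) by (simp add: permutes_not_in)
 qed
qed

lemma invs_eqI:
 fixes n :: nat
 assumes "u permutes {1..n}" "w permutes {1..n}" "invs u = invs w"
 shows "u = w"
proof (rule perm_eqI_ord[OF assms(1,2)])
 fix i j :: nat assume *: "i : {1..n}" "j : {1..n}" "i~=j"
 have "u i~=u j" "w i~=w j" using *(3) by (simp_all add: inj_eq permutes_inj[OF assms(1)] permutes_inj[OF assms(2)])
 moreover have "(i,j) : invs u <-> (i,j) : invs w"
  "(j,i) : invs u <-> (j,i) : invs w" using assms(3) by auto
 ultimately show "u i < u j <-> w i < w j" using * unfolding invs_def by (cases i j rule: linorder_cases) auto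
qed

lemma strict_ord_rank:
 fixes lt :: "nat=>nat=>bool"
 assumes irrefl: "!!i. i : {1..n}==>~ lt i i"
  and trans: "!!i j k. [|i : {1..n}; j : {1..n}; k : {1..n}; lt i j; lt j k|]==>lt i k"
  and total: "!!i j. [|i : {1..n}; j : {1..n}; i~=j|]==>lt i j | lt j i"
 obtains w where "w permutes {1..n}"
  "!!i j. [|i : {1..n}; j : {1..n}|]==>w i < w j <-> lt i j"
proof -
 define S where "S i = {k : {1..n}. lt k i}" for i
 define w where "w i = (if i : {1..n} then Suc (card (S i)) else i)" for i
 have fin: "finite (S i)" for i unfolding S_def by simp
 have mono: "w i < w j" if "i : {1..n}" "j : {1..n}" "lt i j" for i j
 proof -
  have "S i \<subset> S j" unfolding S_def using that irrefl trans by blast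
  hence "card (S i) < card (S j)" using fin psubset_card_mono by blast
  thus ?thesis using that by (simp add: w_def)
 qed
 have iff: "w i < w j <-> lt i j" if "i : {1..n}" "j : {1..n}" for i j
  using mono[OF that] mono[OF that(2,1)] total[OF that] by (cases "i = j") auto
 have inj: "inj_on w {1..n}" by (metis inj_onI total iff less_irrefl)
 have "w ` {1..n}<={1..n}"
 proof
  fix k assume "k : w ` {1..n}"
  then obtain i where i: "i : {1..n}" "k = w i" by blast
  have "S i<={1..n} - {i}" unfolding S_def using irrefl i(1) by blast
  hence "card (S i) <= card ({1..n} - {i})" by (intro card_mono) auto
  thus "k : {1..n}" using i by (auto simp: w_def)
 qed
 hence "w ` {1..n} = {1..n}" using inj by (simp add: endo_inj_surj)
 hence "w permutes {1..n}" using inj by (intro bij_imp_permutes) (auto simp: bij_betw_def w_def)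
 thus thesis using iff that by blast
qed

text \<open>Reversing exactly the pairs of \<open>T\<close> in the natural order gives the relation
  \<open>lt\<close>, and the two closure conditions are what makes it transitive. This classical
  description of inversion sets is used below to construct permutations.\<close>

lemma invs_rlz:
 fixes n :: nat
 assumes sub: "T<={(i,j). i : {1..n} & j : {1..n} & i < j}"
  and closed: "!!i j k. [|(i,j) : T; (j,k) : T|]==>(i,k) : T"
  and coclosed: "!!i j k. [|(i,k) : T; i < j; j < k|]==>(i,j) : T | (j,k) : T"
 obtains w where "w permutes {1..n}" "invs w = T"
proof -
 define lt where "lt i j <-> (i < j & (i,j) ~: T) | (j < i & (j,i) : T)" for i j
 obtain w where w: "w permutes {1..n}"
  "!!i j. [|i : {1..n}; j : {1..n}|]==>w i < w j <-> lt i j"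
 proof (rule strict_ord_rank[of n lt])
  fix i j k assume *: "lt i j" "lt j k"
  have "i~=k" using * unfolding lt_def by auto
  moreover have "(i,k) ~: T" if "i < k"
  proof
   assume "(i,k) : T"
   thus False using * that closed[of i k j] closed[of j i k] coclosed[of i k j] unfolding lt_def by auto
  qed
  moreover have "(k,i) : T" if "k < i"
   using * that closed[of k j i] coclosed[of k j i] coclosed[of j i k] unfolding lt_def by auto
  ultimately show "lt i k" unfolding lt_def using nat_neq_iff by blast
 next
  fix i j :: nat assume "i~=j"
  thus "lt i j | lt j i" unfolding lt_def by auto
 qed (auto simp: lt_def)
 have "(i,j) : invs w <-> (i,j) : T" for i j
 proof -
  have "w i = i | i : {1..n}" "w j = j | j : {1..n}" using permutes_not_in[OF w(1)] by blast+
  moreover have "w i : {1..n} <-> i : {1..n}" "w j : {1..n} <-> j : {1..n}" using permutes_in_image[OF w(1)] by auto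
  ultimately have "i : {1..n} & j : {1..n} | ~ (i : {1..n} & j : {1..n}) & (i < j --> w i<=w j)"
   unfolding atLeastAtMost_iff by linarith
  then consider "i : {1..n} & j : {1..n}" | "~ (i : {1..n} & j : {1..n})" "i < j --> w i<=w j" by blast
  thus "(i,j) : invs w <-> (i,j) : T"
  proof cases
   case 1
   thus ?thesis using w(2)[of j i] sub unfolding invs_def lt_def by auto
  next
   case 2
   thus ?thesis using sub unfolding invs_def by auto
  qed
 qed
 hence "invs w = T" by (auto simp: set_eq_iff)
 thus thesis using w(1) that by blast
qed

lemma invs_subset:
 fixes n :: nat
 assumes "w permutes {1..n}"
 shows "invs w<={(i,j). i : {1..n} & j : {1..n} & i < j}"
proof clarify
 fix i j assume ij: "(i,j) : invs w"
 have "w i : {1..n} <-> i : {1..n}" "w j : {1..n} <-> j : {1..n}" using permutes_in_image[OF assms] by auto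
 moreover have "w i = i | i : {1..n}" "w j = j | j : {1..n}" using permutes_not_in[OF assms] by blast+
 ultimately show "i : {1..n} & j : {1..n} & i < j" using ij by (auto simp: invs_def)
qed

lemma invs_cl: "[|(i,j) : invs w; (j,k) : invs w|]==>(i,k) : invs w" by (auto simp: invs_def)

lemma invs_coclosed:
 "[|(i,k) : invs w; i < j; j < k|]==>(i,j) : invs w | (j,k) : invs w" by (auto simp: invs_def)

lemma invs_id [simp]: "invs id = {}" by (auto simp: invs_def)

lemma rp_id [simp]: "red_pair id v" "red_pair u id" by (auto simp: red_pair_def)

lemma rp_iff: "red_pair u v <-> (ALL i j. i < j & v j < v i --> u (v j) < u (v i))"
 by (auto simp: red_pair_def invs_def)

lemma rpI: "(!!i j. [|i < j; v j < v i|]==>u (v j) < u (v i))==>red_pair u v" by (simp add: rp_iff)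

lemma rpD: "[|red_pair u v; i < j; v j < v i|]==>u (v j) < u (v i)" by (simp add: rp_iff)

text \<open>Both sides express that no pair is exchanged twice by the three factors. This is the
  associativity of a partial product, which turns the permutations into a germ of the braid
  monoid.\<close>

lemma rp_assoc:
 assumes v: "inj v" and w: "bij w"
 shows "red_pair u v & red_pair (u o v) w <-> red_pair v w & red_pair u (v o w)"
proof
 assume "red_pair u v & red_pair (u o v) w"
 hence uv: "red_pair u v" and uvw: "red_pair (u o v) w" by auto
 show "red_pair v w & red_pair u (v o w)"
 proof (intro conjI rpI)
  fix i j assume ij: "i < j" "w j < w i"
  show "v (w j) < v (w i)"
  proof (rule ccontr)
   assume "~ v (w j) < v (w i)"
   moreover have "v (w j)~=v (w i)" using ij by (simp add: inj_eq[OF v])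
   ultimately have "v (w i) < v (w j)" by simp
   hence "u (v (w i)) < u (v (w j))" using rpD[OF uv ij(2)] by simp
   moreover have "u (v (w j)) < u (v (w i))" using rpD[OF uvw ij] by simp
   ultimately show False by simp
  qed
 next
  fix i j assume ij: "i < j" "(v o w) j < (v o w) i"
  show "u ((v o w) j) < u ((v o w) i)"
  proof (cases "w j < w i")
   case True
   thus ?thesis using rpD[OF uvw ij(1)] by simp
  next
   case False
   moreover have "w j~=w i" using ij(2) by auto
   ultimately show ?thesis using rpD[OF uv, of "w i" "w j"] ij(2) by simp
  qed
 qed
next
 assume "red_pair v w & red_pair u (v o w)"
 hence vw: "red_pair v w" and uvw: "red_pair u (v o w)" by auto
 show "red_pair u v & red_pair (u o v) w"
 proof (intro conjI rpI)
  fix i j assume ij: "i < j" "w j < w i"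
  thus "(u o v) (w j) < (u o v) (w i)" using rpD[OF uvw ij(1)] rpD[OF vw ij] by simp
 next
  fix i j assume ij: "i < j" "v j < v i"
  obtain p q where pq: "i = w p" "j = w q" using w by (metis bij_pointE)
  have "p~=q" using pq ij by auto
  moreover have "~ q < p" using rpD[OF vw, of q p] ij unfolding pq by auto
  ultimately have "p < q" by simp
  thus "u (v j) < u (v i)" using rpD[OF uvw, of p q] ij unfolding pq by simp
 qed
qed

section \<open>The weak order and largest absorbable suffixes\<close>

lemma perm_inversionsD:
 assumes "w permutes {1..n::nat}" "(i,j) : invs w"
 shows "i : {1..n}" "j : {1..n}" "i < j" using invs_subset[OF assms(1)] assms(2) by blast+

text \<open>The pairs exchanged by \<open>v\<close>, named by their positions after
  \<open>v\<close>, are the inversions of the inverse of \<open>v\<close>; the product is reduced if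
  \<open>x\<close> exchanges none of them again.\<close>

lemma rp_iff_disjoint:
 assumes "x permutes {1..n::nat}" "v permutes {1..n}"
 shows "red_pair x v <-> invs x Int invs (pinv v) = {}"
proof
 assume r: "red_pair x v"
 show "invs x Int invs (pinv v) = {}"
 proof (rule ccontr)
  assume "invs x Int invs (pinv v)~={}"
  then obtain p q where pq: "(p,q) : invs x" "(p,q) : invs (pinv v)" by auto
  have "v (pinv v p) = p" "v (pinv v q) = q" using permutes_inverses(1)[OF assms(2)] by auto
  hence "x p < x q" using rpD[OF r, of "pinv v q" "pinv v p"] pq(1,2) by (simp add: invs_def)
  thus False using pq(1) by (simp add: invs_def)
 qed
next
 assume d: "invs x Int invs (pinv v) = {}"
 show "red_pair x v"
 proof (rule rpI)
  fix i j assume ij: "i < j" "v j < v i"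
  have "(v j,v i) : invs (pinv v)" by (simp add: ij invs_def permutes_inverses(2)[OF assms(2)])
  hence "(v j,v i) ~: invs x" using d by blast
  moreover have "x (v i)~=x (v j)" using ij(2) by (simp add: inj_eq[OF permutes_inj[OF assms(1)]])
  ultimately show "x (v j) < x (v i)" using ij(2) by (simp add: invs_def)
 qed
qed

text \<open>A candidate must avoid the set \<open>R\<close> of pairs that are not inversions of
  \<open>u\<close> or that \<open>v\<close> has exchanged already. The pairs outside an inversion
  set are closed under composition, so it must even avoid the transitive closure of
  \<open>R\<close>. Both halves of \<open>R\<close> are coclosed and so is this closure, hence the
  pairs outside it form an inversion set, that of the largest candidate.\<close>

lemma meet_ex:
 assumes u: "u permutes {1..n::nat}" and v: "v permutes {1..n}"
 obtains x where "x permutes {1..n}" "invs x<=invs u" "red_pair x v"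
  "!!y. [|y permutes {1..n}; invs y<=invs u; red_pair y v|]==>invs y<=invs x"
proof -
 define D where "D = {(i,j). i : {1..n} & j : {1..n} & i < j}"
 define R where "R = (D - invs u) Un invs (pinv v)"
 have RD: "R<=D" using invs_subset[OF permutes_inv[OF v]] by (auto simp: R_def D_def)
 have TD: "R\<^sup>+<=D" using trancl_mono_subset[OF RD] by (auto simp: D_def trans_def)
 \<comment> \<open>Induction along a chain of links from \<open>R\<close>: the point
   \<open>j\<close> lies before the last link, at its start or inside it, and in the last case the
   link itself splits.\<close>
 have co: "(i,j) : R\<^sup>+ | (j,k) : R\<^sup>+" if "(i,k) : R\<^sup>+" "i < j" "j < k" for i j k using that
 proof (induction arbitrary: j rule: trancl_induct)
  case (base k)
  hence "(i,j) : R | (j,k) : R" using invs_cl[of i j u k] invs_coclosed[of i k "pinv v" j] by (auto simp: R_def D_def)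
  thus ?case by blast
 next
  case (step k l)
  consider "j < k" | "j = k" | "k < j" by linarith
  thus ?case
  proof cases
   case 1
   hence "(i,j) : R\<^sup>+ | (j,k) : R\<^sup>+" using step by blast
   thus ?thesis using step.hyps(2) by (meson trancl_into_trancl)
  next
   case 2
   thus ?thesis using step by blast
  next
   case 3
   hence "(k,j) : R | (j,l) : R" using invs_cl[of k j u l] invs_coclosed[of k l "pinv v" j] step.hyps(2) step.prems(2)
    by (auto simp: R_def D_def)
   thus ?thesis using step.hyps(1) by (meson r_into_trancl' trancl_into_trancl)
  qed
 qed
 obtain x where x: "x permutes {1..n}" "invs x = D - R\<^sup>+"
 proof (rule invs_rlz[of "D - R\<^sup>+" n])
  show "D - R\<^sup>+<={(i,j). i : {1..n} & j : {1..n} & i < j}" by (auto simp: D_def)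
  show "(i,k) : D - R\<^sup>+" if "(i,j) : D - R\<^sup>+" "(j,k) : D - R\<^sup>+" for i j k
   using that co[of i k j] by (auto simp: D_def)
  show "(i,j) : D - R\<^sup>+ | (j,k) : D - R\<^sup>+" if "(i,k) : D - R\<^sup>+" "i < j" "j < k" for i j k
   using that trancl_trans[of i j R k] by (auto simp: D_def)
 qed
 have 1: "invs x<=invs u" unfolding x(2) R_def by auto
 have 2: "red_pair x v" unfolding rp_iff_disjoint[OF x(1) v] x(2) R_def by auto
 have 3: "invs y<=invs x"
  if y: "y permutes {1..n}" "invs y<=invs u" "red_pair y v" for y
 proof -
  have yR: "invs y Int R = {}" using y rp_iff_disjoint[OF y(1) v] by (auto simp: R_def)
  have "(i,k) ~: invs y" if "(i,k) : R\<^sup>+" for i k using that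
  proof (induction rule: trancl_induct)
   case (base k)
   thus ?case using yR by auto
  next
   case (step k l)
   have "i < k" "k < l" using TD RD step.hyps by (auto simp: D_def)
   thus ?case using invs_coclosed[of i l y k] step yR by auto
  qed
  moreover have "invs y<=D" using invs_subset[OF y(1)] by (simp add: D_def)
  ultimately show ?thesis unfolding x(2) by auto
 qed
 show thesis using that[OF x(1) 1 2 3] .
qed

text \<open>Inclusion of inversion sets is the suffix order, so this is the largest suffix of
  \<open>u\<close> that \<open>v\<close> can absorb on its left.\<close>

definition meetred where
 "meetred n u v = (SOME x. x permutes {1..n} & invs x<=invs u & red_pair x v &
  (ALL y. y permutes {1..n} --> invs y<=invs u --> red_pair y v --> invs y<=invs x))"

lemma meetred:
 assumes "u permutes {1..n}" "v permutes {1..n}"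
 shows "meetred n u v permutes {1..n}" "invs (meetred n u v)<=invs u" "red_pair (meetred n u v) v"
  "!!y. [|y permutes {1..n}; invs y<=invs u; red_pair y v|]==>invs y<=invs (meetred n u v)"
proof -
 have "EX x. x permutes {1..n} & invs x<=invs u & red_pair x v &
  (ALL y. y permutes {1..n} --> invs y<=invs u --> red_pair y v --> invs y<=invs x)"
  by (rule meet_ex[OF assms]) blast
 note * = someI_ex[OF this, folded meetred_def]
 show "meetred n u v permutes {1..n}" "invs (meetred n u v)<=invs u" "red_pair (meetred n u v) v"
  "!!y. [|y permutes {1..n}; invs y<=invs u; red_pair y v|]==>invs y<=invs (meetred n u v)" using * by simp_all
qed

lemma meetred_eqI:
 assumes "u permutes {1..n}" "v permutes {1..n}" and "x permutes {1..n}" "invs x<=invs u" "red_pair x v"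
  and "!!y. [|y permutes {1..n}; invs y<=invs u; red_pair y v|]==>invs y<=invs x"
 shows "meetred n u v = x" using meetred[OF assms(1,2)] assms by (intro invs_eqI[of _ n] subset_antisym)

text \<open>Division by a suffix: the quotient \<open>w o pinv v\<close> never exchanges back a pair
  of \<open>v\<close>, since all these pairs are still exchanged in \<open>w\<close>.\<close>

lemma suf_rp:
 assumes "v permutes {1..n::nat}" "invs v<=invs w"
 shows "red_pair (w o pinv v) v" "(w o pinv v) o v = w"
proof -
 show "(w o pinv v) o v = w" by (simp add: feq permutes_inverses(2)[OF assms(1)])
 thus "red_pair (w o pinv v) v" using assms(2) by (simp add: red_pair_def)
qed

text \<open>
  The step of the right-greedy normal form: the last factor \<open>w\<close> gives its largest suffix \<open>x\<close> that
  can be absorbed by the new letter \<open>v\<close>.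
\<close>

lemma meetred_comp:
 assumes p: "w permutes {1..n}" "u permutes {1..n}" "v permutes {1..n}" and r: "red_pair u v"
 defines "x == meetred n w u" and "y == meetred n (meetred n w u o u) v" and "x' == meetred n w (u o v)"
 shows "y o v = x' o (u o v)" and "red_pair (w o pinv x) (x o u o pinv y)"
  and "(w o pinv x) o (x o u o pinv y) = w o pinv x'"
proof -
 have x: "x permutes {1..n}" "invs x<=invs w" "red_pair x u"
  and xmax: "!!y. [|y permutes {1..n}; invs y<=invs w; red_pair y u|]==>invs y<=invs x"
  unfolding x_def using meetred[OF p(1,2)] by blast+
 have xu: "x o u permutes {1..n}" using permutes_compose[OF p(2) x(1)] .
 have y: "y permutes {1..n}" "invs y<=invs (x o u)" "red_pair y v"
  and ymax: "!!z. [|z permutes {1..n}; invs z<=invs (x o u); red_pair z v|]==>invs z<=invs y"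
  unfolding y_def x_def using meetred[OF xu[unfolded x_def] p(3)] by blast+
 have uv: "u o v permutes {1..n}" using permutes_compose[OF p(3,2)] .
 have bij: "bij u" "bij v" "bij x" using p x permutes_bij by blast+
 \<comment> \<open>\<open>u\<close> itself competes for \<open>y\<close>: it is a suffix of
   \<open>x o u\<close>, and \<open>v\<close> absorbs it. So \<open>y\<close> ends in
   \<open>u\<close> and can be divided by it.\<close>
 have uy: "invs u<=invs y" using ymax[OF p(2) _ r] x(3) by (simp add: red_pair_def)
 define y' where "y' = y o pinv u"
 have y'p: "y' permutes {1..n}" unfolding y'_def using permutes_compose[OF permutes_inv[OF p(2)] y(1)] .
 have y'u: "red_pair y' u" "y' o u = y" unfolding y'_def using suf_rp[OF p(2) uy] by auto
 have y'uv: "red_pair y' (u o v)" using rp_assoc bij y'u y(3) bij_is_inj by auto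
 have "red_pair (x o u o pinv y) y" "(x o u o pinv y) o y = x o u" using suf_rp[OF y(1,2)] by auto
 hence "red_pair (x o u o pinv y) (y' o u)" "((x o u o pinv y) o y') o u = x o u" using y'u(2) by (auto simp: o_assoc)
 hence b: "red_pair (x o u o pinv y) y'" "(x o u o pinv y) o y' = x"
 proof -
  assume "red_pair (x o u o pinv y) (y' o u)"
  thus "red_pair (x o u o pinv y) y'" using rp_assoc[of y' u "x o u o pinv y"] bij y'u(1) permutes_inj[OF y'p] by blast
 next
  assume *: "((x o u o pinv y) o y') o u = x o u"
  have "(((x o u o pinv y) o y') o u) o pinv u = (x o u) o pinv u" using * by simp
  thus "(x o u o pinv y) o y' = x" by (simp add: feq permutes_inverses(1)[OF p(2)])
 qed
 have y'x: "invs y'<=invs x" using b by (metis red_pair_def)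
 \<comment> \<open>What remains of \<open>w\<close> after both absorptions is what the product
   \<open>u o v\<close> absorbs at once.\<close>
 have x'y': "x' = y'" unfolding x'_def
 proof (rule meetred_eqI[OF p(1) uv y'p _ y'uv])
  show "invs y'<=invs w" using y'x x(2) by blast
  fix z assume z: "z permutes {1..n}" "invs z<=invs w" "red_pair z (u o v)"
  hence zu: "red_pair z u" "red_pair (z o u) v" using rp_assoc[of u v z] bij r by (auto simp: bij_is_inj)
  have "red_pair (x o pinv z) z" "x o pinv z o z = x" using suf_rp xmax z(1,2) zu(1) by auto
  hence "red_pair (x o pinv z) (z o u)" "x o pinv z o (z o u) = x o u"
   using rp_assoc[of z u "x o pinv z"] permutes_inj[OF z(1)] bij(1) x(3) by (auto simp: o_assoc)
  hence "invs (z o u)<=invs (x o u)" by (metis red_pair_def)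
  hence "invs (z o u)<=invs y" using ymax[OF permutes_compose[OF p(2) z(1)] _ zu(2)] by blast
  hence zy: "invs (z o u)<=invs (y' o u)" by (simp add: y'u(2))
  show "invs z<=invs y'"
  proof
   fix e assume e: "e : invs z"
   obtain i j where ij: "e = (i,j)" by (cases e)
   define p where "p = pinv u i"
   define q where "q = pinv u j"
   have pq: "i = u p" "j = u q" using permutes_inverses(1)[OF p(2)] by (auto simp: p_def q_def)
   have e': "u p < u q" "z (u q) < z (u p)" using e ij pq by (auto simp: invs_def)
   show "e : invs y'"
   proof (cases "p < q")
    case True
    hence "(p,q) : invs (z o u)" using e' by (simp add: invs_def)
    hence "(p,q) : invs (y' o u)" using zy by blast
    thus ?thesis using ij pq e' by (simp add: invs_def)
   next
    case False
    moreover have "p~=q" using e'(1) by auto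
    ultimately have "q < p" by simp
    hence "z (u p) < z (u q)" using rpD[OF zu(1), of q p] e'(1) by blast
    thus ?thesis using e'(2) by simp
   qed
  qed
 qed
 show "y o v = x' o (u o v)" using x'y' y'u(2) by (simp add: o_assoc)
 have a: "red_pair (w o pinv x) x" "w o pinv x o x = w" using suf_rp[OF x(1,2)] by auto
 show "red_pair (w o pinv x) (x o u o pinv y)"
   by (metis rp_assoc b(1) permutes_bij y'p permutes_inj permutes_compose permutes_inv y(1) xu a b(2))
 have "((w o pinv x) o (x o u o pinv y)) o y' o pinv y' = w o pinv y'" by (metis b(2) a(2) comp_assoc)
 moreover have "((w o pinv x) o (x o u o pinv y)) o y' o pinv y' = (w o pinv x) o (x o u o pinv y)"
  by (simp add: feq permutes_inverses(1)[OF y'p])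
 ultimately show "(w o pinv x) o (x o u o pinv y) = w o pinv x'" using x'y' by simp
qed

definition bwords :: "nat=>(nat=>nat) list set" where
 "bwords n = lists {w. w permutes {1..n}}"

text \<open>The presentation of the positive braid monoid with all permutation braids as generators:
  the relations are the reduced products, and the identity stands for the empty word.\<close>

inductive weq :: "nat=>(nat=>nat) list=>(nat=>nat) list=>bool" for n where
 weq_refl: "weq n a a"
| weq_sym: "weq n a b==>weq n b a"
| weq_trans [trans]: "[|weq n a b; weq n b c|]==>weq n a c"
| weq_merge: "[|xs : bwords n; ys : bwords n; u permutes {1..n}; v permutes {1..n}; red_pair u v|]
 ==>weq n (xs @ u # v # ys) (xs @ (u o v) # ys)"
| weq_id: "[|xs : bwords n; ys : bwords n|]==>weq n (xs @ id # ys) (xs @ ys)"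

lemma bwords_simps [simp]:
 "[] : bwords n"
 "w # ws : bwords n <-> w permutes {1..n} & ws : bwords n"
 "us @ ws : bwords n <-> us : bwords n & ws : bwords n" by (auto simp: bwords_def)

lemma weq_cong:
 assumes "weq n a b" "xs : bwords n" "ys : bwords n"
 shows "weq n (xs @ a @ ys) (xs @ b @ ys)" using assms(1)
proof induction
 case (weq_merge as bs u v)
 thus ?case using weq.intros(4)[of "xs @ as" n "bs @ ys" u v] assms(2,3) by simp
next
 case (weq_id as bs)
 thus ?case using weq.intros(5)[of "xs @ as" n "bs @ ys"] assms(2,3) by simp
qed (blast intro: weq_refl weq_sym weq_trans)+

lemma weq_pair:
 assumes "u permutes {1..n}" "v permutes {1..n}" "red_pair u v"
 shows "weq n [u,v] [u o v]" using weq_merge[of "[]" n "[]" u v] assms by simp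

lemma weq_unit: "weq n [id] []" using weq_id[of "[]" n "[]"] by simp

lemma fin_invs:
 assumes "w permutes {1..n::nat}"
 shows "finite (invs w)"
proof (rule finite_subset)
 show "invs w<={1..n} \<times> {1..n}" using invs_subset[OF assms] by blast
qed simp

text \<open>\<open>v\<close> maps those inversions of \<open>u o v\<close> that are not its own
  bijectively onto the inversions of \<open>u\<close>.\<close>

lemma invs_comp_card:
 assumes u: "u permutes {1..n::nat}" and v: "v permutes {1..n}" and r: "red_pair u v"
 shows "card (invs (u o v)) = card (invs u) + card (invs v)"
proof -
 note fin = fin_invs
 have sub: "invs v<=invs (u o v)" using r by (simp add: red_pair_def)
 have uv: "u o v permutes {1..n}" using permutes_compose[OF v u] .
 have "bij_betw (map_prod v v) (invs (u o v) - invs v) (invs u)" unfolding bij_betw_def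
 proof
  show "inj_on (map_prod v v) (invs (u o v) - invs v)"
   using prod.inj_map[OF permutes_inj[OF v] permutes_inj[OF v]] by (rule inj_on_subset) simp
  show "map_prod v v ` (invs (u o v) - invs v) = invs u"
  proof
   show "map_prod v v ` (invs (u o v) - invs v)<=invs u"
   proof (rule image_subsetI)
    fix e assume e: "e : invs (u o v) - invs v"
    obtain i j where ij': "e = (i,j)" by (cases e)
    hence ij: "(i,j) : invs (u o v)" "(i,j) ~: invs v" using e by auto
    hence "v i~=v j" unfolding inj_eq[OF permutes_inj[OF v]] by (auto simp: invs_def)
    thus "map_prod v v e : invs u" using ij ij' by (auto simp: invs_def)
   qed
   show "invs u<=map_prod v v ` (invs (u o v) - invs v)"
   proof
    fix e assume e: "e : invs u"
    obtain p q where e': "e = (p,q)" by (cases e)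
    hence pq: "(p,q) : invs u" using e by simp
    define i where "i = pinv v p"
    define j where "j = pinv v q"
    have ij: "p = v i" "q = v j" using permutes_inverses(1)[OF v] by (auto simp: i_def j_def)
    have "i~=j" using pq unfolding ij by (auto simp: invs_def)
    moreover have "~ j < i" using rpD[OF r, of j i] pq unfolding ij by (auto simp: invs_def)
    ultimately have "(i,j) : invs (u o v) - invs v" using pq unfolding ij by (auto simp: invs_def)
    thus "e : map_prod v v ` (invs (u o v) - invs v)" unfolding e' ij by (intro image_eqI[of _ _ "(i,j)"]) simp_all
   qed
  qed
 qed
 hence "card (invs (u o v) - invs v) = card (invs u)" by (rule bij_betw_same_card)
 moreover have "card (invs (u o v) - invs v) = card (invs (u o v)) - card (invs v)"
  using card_Diff_subset[OF fin[OF v] sub] .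
 moreover have "card (invs v) <= card (invs (u o v))" using card_mono[OF fin[OF uv] sub] .
 ultimately show ?thesis by simp
qed

definition word_len where
 "word_len ws = (\<Sum>w\<leftarrow>ws. card (invs w))"

lemma weq_len: "weq n a b==>word_len a = word_len b"
 by (induction rule: weq.induct) (auto simp: word_len_def invs_comp_card)

lemma weq_words: "weq n a b==>a : bwords n <-> b : bwords n"
 by (induction rule: weq.induct) (auto intro: permutes_compose permutes_id)

text \<open>A state consists of the last factor and of the word in front of it. The new letter
  absorbs what it can from the last factor, and the rest joins the word without any
  renormalization.\<close>

definition gstep where
 "gstep n s v = (meetred n (fst s) v o v,snd s @ [fst s o pinv (meetred n (fst s) v)])"

definition greedy where
 "greedy n = foldl (gstep n) (id,[])"

definition gst where
 "gst n s <-> fst s permutes {1..n} & snd s : bwords n"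

text \<open>The front word is compared only up to \<open>weq\<close>. This is enough for invariance
  and for cancellation, and it avoids normalizing the front word as well.\<close>

definition greedy_eq :: "nat=>(nat=>nat) \<times> (nat=>nat) list=>(nat=>nat) \<times> (nat=>nat) list=>bool" where
 "greedy_eq n s t <-> fst s = fst t & weq n (snd s) (snd t)"

lemma gst_step:
 assumes "gst n s" "v permutes {1..n}"
 shows "gst n (gstep n s v)" using assms meetred(1)[of "fst s" n v]
 by (auto simp: gst_def gstep_def permutes_compose permutes_inv)

lemma gst_foldl:
 "[|gst n s; ws : bwords n|]==>gst n (foldl (gstep n) s ws)" by (induction ws arbitrary: s) (auto simp: gst_step)

lemma greedy_eq_refl: "greedy_eq n s s" by (simp add: greedy_eq_def weq_refl)

lemma greedy_eq_step:
 assumes "greedy_eq n s t" "gst n s" "v permutes {1..n}"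
 shows "greedy_eq n (gstep n s v) (gstep n t v)"
proof -
 have "fst s o pinv (meetred n (fst s) v) permutes {1..n}" by (metis permutes_compose permutes_inv meetred(1) assms gst_def)
 thus ?thesis using assms weq_cong[of n "snd s" "snd t" "[]" "[fst s o pinv (meetred n (fst s) v)]"]
  by (simp add: greedy_eq_def gstep_def gst_def)
qed

lemma greedy_eq_foldl:
 "[|greedy_eq n s t; gst n s; ws : bwords n|]
 ==>greedy_eq n (foldl (gstep n) s ws) (foldl (gstep n) t ws)"
 by (induction ws arbitrary: s t) (auto simp: gst_step greedy_eq_step)

lemma greedy_eq_merge:
 assumes s: "gst n s" and uv: "u permutes {1..n}" "v permutes {1..n}" "red_pair u v"
 shows "greedy_eq n (gstep n (gstep n s u) v) (gstep n s (u o v))"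
proof -
 define x where "x = meetred n (fst s) u"
 define y where "y = meetred n (x o u) v"
 have w: "fst s permutes {1..n}" using s by (simp add: gst_def)
 have x: "x permutes {1..n}" unfolding x_def by (rule meetred(1)[OF w uv(1)])
 have xu: "x o u permutes {1..n}" by (rule permutes_compose[OF uv(1) x])
 have y: "y permutes {1..n}" unfolding y_def by (rule meetred(1)[OF xu uv(2)])
 note m = meetred_comp[OF w uv, folded x_def, folded y_def]
 have "weq n (snd s @ (fst s o pinv x) # (x o u o pinv y) # [])
   (snd s @ ((fst s o pinv x) o (x o u o pinv y)) # [])"
   using s m(2) weq_merge permutes_compose[OF permutes_inv[OF x] w] permutes_compose[OF permutes_inv[OF y] xu] by (auto simp: gst_def)
 thus ?thesis using m(1,3) by (simp add: greedy_eq_def gstep_def x_def[symmetric] y_def[symmetric] o_assoc)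
qed

lemma meetred_id:
 assumes "w permutes {1..n}"
 shows "meetred n w id = w" using assms by (intro meetred_eqI) (auto simp: permutes_id)

lemma greedy_eq_unit:
 assumes s: "gst n s"
 shows "greedy_eq n (gstep n s id) s"
proof -
 have w: "fst s permutes {1..n}" using s by (simp add: gst_def)
 have "fst s o pinv (fst s) = id" using permutes_inverses(1)[OF w] by auto
 moreover have "weq n (snd s @ id # []) (snd s @ [])" using s by (intro weq_id) (auto simp: gst_def)
 ultimately show ?thesis by (simp add: greedy_eq_def gstep_def meetred_id[OF w])
qed

lemma gst_greedy: "ws : bwords n==>gst n (greedy n ws)"
 unfolding greedy_def by (rule gst_foldl) (simp_all add: gst_def permutes_id)

text \<open>The letters behind a relation preserve \<open>greedy_eq\<close>, so it suffices to apply
  each relation to an arbitrary state; \<open>greedy_eq_merge\<close> does this for the reduced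
  products.\<close>

lemma greedy_weq:
 assumes "weq n a b" "a : bwords n"
 shows "greedy_eq n (greedy n a) (greedy n b)" using assms
proof induction
 case (weq_sym a b)
 thus ?case using weq_words[OF weq_sym.hyps] by (auto simp: greedy_eq_def intro: weq.intros(2))
next
 case (weq_trans a b c)
 thus ?case using weq_words[OF weq_trans.hyps(1)] by (auto simp: greedy_eq_def intro: weq.intros(3))
next
 case (weq_merge xs ys u v)
 have "gst n (greedy n xs)" using weq_merge by (intro gst_greedy)
 thus ?case using weq_merge greedy_eq_foldl[OF greedy_eq_merge[of n "greedy n xs" u v], of ys]
  by (simp add: greedy_def gst_step)
next
 case (weq_id xs ys)
 have "gst n (greedy n xs)" using weq_id by (intro gst_greedy)
 thus ?case using weq_id greedy_eq_foldl[OF greedy_eq_unit[of n "greedy n xs"], of ys]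
  by (simp add: greedy_def gst_step permutes_id)
qed (simp add: greedy_eq_refl)

text \<open>In each step the last factor is split into the part that stays and the part that is
  absorbed, and the latter is merged with the new letter; both are instances of the defining
  relations.\<close>

lemma weq_greedy:
 assumes "ws : bwords n"
 shows "weq n ws (snd (greedy n ws) @ [fst (greedy n ws)])" using assms
proof (induction ws rule: rev_induct)
 case Nil
 thus ?case using weq_sym[OF weq_unit] by (simp add: greedy_def del: id_apply)
next
 case (snoc v ws)
 define w where "w = fst (greedy n ws)"
 define L where "L = snd (greedy n ws)"
 define x where "x = meetred n w v"
 have st: "w permutes {1..n}" "L : bwords n" "v permutes {1..n}"
  using gst_greedy[of ws n] snoc.prems by (auto simp: gst_def w_def L_def)
 have x: "x permutes {1..n}" "invs x<=invs w" "red_pair x v" unfolding x_def using meetred[OF st(1,3)] by blast+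
 have wx: "w o pinv x permutes {1..n}" using permutes_compose[OF permutes_inv[OF x(1)] st(1)] .
 have "weq n (ws @ [v]) ((L @ [w]) @ [v])" using snoc weq_cong[of n ws "L @ [w]" "[]" "[v]"] by (simp add: w_def L_def)
 also have "weq n ... (L @ [w o pinv x,x] @ [v])"
  using weq_sym[OF weq_cong[OF weq_pair[OF wx x(1)], of L "[v]"]] suf_rp[OF x(1,2)] st by simp
 also have "weq n ... (L @ [w o pinv x,x o v])"
  using weq_cong[OF weq_pair[OF x(1) st(3) x(3)], of "L @ [w o pinv x]" "[]"] st wx by simp
 finally show ?case by (simp add: greedy_def gstep_def w_def[symmetric] L_def[symmetric] x_def[symmetric]
    w_def[unfolded greedy_def, symmetric] L_def[unfolded greedy_def, symmetric] del: o_apply)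
qed

lemma greedy_snoc: "greedy n (ws @ [v]) = gstep n (greedy n ws) v" by (simp add: greedy_def)

text \<open>The last factor \<open>x o v\<close> of the state reveals \<open>x\<close>, since
  \<open>v\<close> is known. Putting \<open>x\<close> back behind the front word undoes the step, so
  the word before \<open>v\<close> is recovered up to \<open>weq\<close>.\<close>

lemma weq_can:
 assumes "weq n (a @ [v]) (b @ [v])" "a : bwords n" "b : bwords n" "v permutes {1..n}"
 shows "weq n a b"
proof -
 define w L x where "w = fst (greedy n a)" and "L = snd (greedy n a)" and "x = meetred n w v"
 define w' L' x' where "w' = fst (greedy n b)" and "L' = snd (greedy n b)" and "x' = meetred n w' v"
 have st: "w permutes {1..n}" "L : bwords n" "w' permutes {1..n}" "L' : bwords n"
  using gst_greedy assms by (auto simp: gst_def w_def L_def w'_def L'_def)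
 have x: "x permutes {1..n}" "invs x<=invs w" unfolding x_def using meetred[OF st(1) assms(4)] by blast+
 have x': "x' permutes {1..n}" "invs x'<=invs w'" unfolding x'_def using meetred[OF st(3) assms(4)] by blast+
 have g: "x o v = x' o v" "weq n (L @ [w o pinv x]) (L' @ [w' o pinv x'])" using greedy_weq[OF assms(1)] assms(2,4)
  by (simp_all add: greedy_snoc greedy_eq_def gstep_def w_def L_def w'_def L'_def x_def x'_def)
 have "x o v o pinv v = x' o v o pinv v" using g(1) by simp
 hence xx': "x = x'" by (simp add: feq permutes_inverses(1)[OF assms(4)])
 have p: "w o pinv x permutes {1..n}" "w' o pinv x' permutes {1..n}"
  using permutes_compose[OF permutes_inv[OF x(1)] st(1)] permutes_compose[OF permutes_inv[OF x'(1)] st(3)] .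
 have "weq n a (L @ [w])" using weq_greedy[OF assms(2)] by (simp add: w_def L_def)
 also have "weq n ... (L @ [w o pinv x,x])"
  using weq_sym[OF weq_cong[OF weq_pair[OF p(1) x(1)], of L "[]"]] suf_rp[OF x] st by simp
 also have "weq n ... (L' @ [w' o pinv x',x'])" using weq_cong[OF g(2), of "[]" "[x]"] x(1) xx' by simp
 also have "weq n ... (L' @ [w'])" using weq_cong[OF weq_pair[OF p(2) x'(1)], of L' "[]"] suf_rp[OF x'] st by simp
 also have "weq n ... b" using weq_sym[OF weq_greedy[OF assms(3)]] by (simp add: w'_def L'_def)
 finally show ?thesis .
qed

lemma weq_can_app:
 "[|weq n (a @ c) (b @ c); a : bwords n; b : bwords n; c : bwords n|]==>weq n a b"
proof (induction c rule: rev_induct)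
 case (snoc v c)
 thus ?case using weq_can[of n "a @ c" v "b @ c"] by simp
qed simp

definition last_fac where
 "last_fac n ws = fst (greedy n ws)"

lemma last_fac_perm: "ws : bwords n==>last_fac n ws permutes {1..n}"
 using gst_greedy by (auto simp: last_fac_def gst_def)

text \<open>Appending \<open>w\<close> leaves a last factor of the form \<open>x o w\<close> with a
  reduced product, and the last factor depends only on the class of the word. Together with
  \<open>div_last_fac\<close>, divisibility on the right by a permutation becomes inclusion of
  inversion sets.\<close>

lemma last_fac_div:
 assumes "weq n y (m @ [w])" "m : bwords n" "w permutes {1..n}"
 shows "invs w<=invs (last_fac n y)"
 using weq_words assms greedy_weq greedy_snoc meetred(3) last_fac_perm by (auto simp: greedy_eq_def last_fac_def gstep_def red_pair_def)

lemma div_last_fac: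
 assumes "y : bwords n" "w permutes {1..n}" "invs w<=invs (last_fac n y)"
 obtains m where "m : bwords n" "weq n y (m @ [w])"
proof -
 define f where "f = last_fac n y"
 define L where "L = snd (greedy n y)"
 have f: "f permutes {1..n}" "L : bwords n"
  using gst_greedy[OF assms(1)] by (auto simp: gst_def f_def L_def last_fac_def)
 have fw: "f o pinv w permutes {1..n}" using permutes_compose[OF permutes_inv[OF assms(2)] f(1)] .
 have "weq n y (L @ [f])" using weq_greedy[OF assms(1)] by (simp add: f_def L_def last_fac_def)
 also have "weq n ... (L @ [f o pinv w,w])" using weq_sym[OF weq_cong[OF weq_pair[OF fw assms(2)], of L "[]"]]
   suf_rp[OF assms(2,3)[folded f_def]] f by simp
 finally show thesis using that[of "L @ [f o pinv w]"] f fw by simp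
qed

section \<open>The half twist and the central full twist\<close>

definition hf_tw :: "nat=>nat=>nat" where
 "hf_tw n i = (if i : {1..n} then n + 1 - i else i)"

lemma hf_tw_hf_tw: "hf_tw n o hf_tw n = id" by (rule ext) (auto simp: hf_tw_def)

lemma hf_tw_perm: "hf_tw n permutes {1..n}"
proof (rule bij_imp_permutes)
 show "bij_betw (hf_tw n) {1..n} {1..n}" by (rule bij_betwI[of _ _ _ "hf_tw n"]) (auto simp: hf_tw_def)
qed (auto simp: hf_tw_def)

lemma invs_hf_tw: "invs (hf_tw n) = {(i,j). i : {1..n} & j : {1..n} & i < j}"
 by (auto simp: invs_def hf_tw_def split: if_splits)

text \<open>All pairs are inversions of the half twist, so every permutation is a suffix of it;
  \<open>hf_tw_r\<close> does the same for prefixes.\<close>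

lemma hf_tw_l:
 assumes u: "u permutes {1..n}"
 shows "weq n [hf_tw n o pinv u,u] [hf_tw n]" using weq_pair[OF permutes_compose[OF permutes_inv[OF u] hf_tw_perm] u]
  suf_rp[OF u, of "hf_tw n"] invs_subset[OF u] by (simp add: invs_hf_tw)

lemma hf_tw_r:
 assumes u: "u permutes {1..n}"
 shows "weq n [u,pinv u o hf_tw n] [hf_tw n]"
proof -
 have p: "pinv u o hf_tw n permutes {1..n}" using permutes_compose[OF hf_tw_perm permutes_inv[OF u]] .
 have e: "u o (pinv u o hf_tw n) = hf_tw n" by (simp add: feq permutes_inverses(1)[OF u])
 show ?thesis using weq_pair[OF u p] e invs_hf_tw invs_subset[OF p] by (auto simp: red_pair_def)
qed

text \<open>The word formed by the conjugate of \<open>u\<close>, the left complement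
  \<open>?x\<close> of \<open>u\<close> and \<open>u\<close> itself can be contracted to a half
  twist at either end.\<close>

lemma hf_tw_conj:
 assumes u: "u permutes {1..n}"
 shows "weq n [hf_tw n,u] [hf_tw n o u o hf_tw n,hf_tw n]"
proof -
 let ?d = "hf_tw n"
 let ?x = "?d o pinv u"
 let ?u = "?d o u o ?d"
 have x: "?x permutes {1..n}" using permutes_compose[OF permutes_inv[OF u] hf_tw_perm] .
 have u': "?u permutes {1..n}" by (intro permutes_compose hf_tw_perm u)
 have dd: "?d (?d i) = i" for i using hf_tw_hf_tw[of n] by (metis comp_apply id_apply)
 have e: "?u o ?x = ?d" by (simp add: feq dd permutes_inverses(1)[OF u])
 have "weq n [?u,?x] [?d]" using weq_pair[OF u' x] e invs_hf_tw invs_subset[OF x] by (auto simp: red_pair_def)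
 hence "weq n [?d,u] [?u,?x,u]" using weq_sym[OF weq_cong[of n "[?u,?x]" "[?d]" "[]" "[u]"]] u by simp
 also have "weq n ... [?u,?d]" using weq_cong[OF hf_tw_l[OF u], of "[?u]" "[]"] u' by simp
 finally show ?thesis .
qed

definition ftw where
 "ftw n k = concat (replicate k [hf_tw n,hf_tw n])"

lemma ftw_words [simp]: "ftw n k : bwords n" by (induction k) (auto simp: ftw_def hf_tw_perm)

lemma ftw_add: "ftw n (k + l) = ftw n k @ ftw n l" by (simp add: ftw_def replicate_add)

lemma ftw_1: "ftw n 1 = [hf_tw n,hf_tw n]" by (simp add: ftw_def One_nat_def)

lemma ftw_0 [simp]: "ftw n 0 = []" by (simp add: ftw_def)

text \<open>Conjugation by the half twist is an involution, so a letter passes two half twists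
  unchanged.\<close>

lemma ftw_cen_letter:
 assumes u: "u permutes {1..n}"
 shows "weq n (ftw n 1 @ [u]) (u # ftw n 1)"
proof -
 let ?d = "hf_tw n"
 let ?u = "?d o u o ?d"
 have u': "?u permutes {1..n}" by (intro permutes_compose hf_tw_perm u)
 have dd: "?d (?d i) = i" for i using hf_tw_hf_tw[of n] by (metis comp_apply id_apply)
 have "weq n [?d,?d,u] [?d,?u,?d]" using weq_cong[OF hf_tw_conj[OF u], of "[?d]" "[]"] hf_tw_perm by simp
 also have "weq n ... [?d o ?u o ?d,?d,?d]" using weq_cong[OF hf_tw_conj[OF u'], of "[]" "[?d]"] hf_tw_perm by simp
 also have "?d o ?u o ?d = u" by (simp add: feq dd)
 finally show ?thesis by (simp add: ftw_1)
qed

lemma ftw_cen: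
 assumes "ws : bwords n"
 shows "weq n (ftw n k @ ws) (ws @ ftw n k)"
proof -
 have 1: "weq n (ftw n 1 @ ws) (ws @ ftw n 1)" if "ws : bwords n" for ws using that
 proof (induction ws)
  case (Cons u ws)
  have "weq n (ftw n 1 @ u # ws) (u # ftw n 1 @ ws)"
   using weq_cong[OF ftw_cen_letter, of u n "[]" ws] Cons.prems by simp
  also have "weq n ... (u # ws @ ftw n 1)" using weq_cong[OF Cons.IH, of "[u]" "[]"] Cons.prems by simp
  finally show ?case by simp
 qed (simp add: weq_refl)
 show ?thesis
 proof (induction k)
  case (Suc k)
  have "weq n (ftw n k @ ftw n 1 @ ws) (ftw n k @ ws @ ftw n 1)"
   using weq_cong[OF 1[OF assms], of "ftw n k" "[]"] by simp
  also have "weq n ... (ws @ ftw n k @ ftw n 1)" using weq_cong[OF Suc.IH, of "[]" "ftw n 1"] assms by simp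
  finally show ?case using ftw_add[of n k 1] by (simp add: Suc_eq_plus1)
 qed (simp add: weq_refl)
qed

text \<open>Each letter is completed to a half twist and, by another half twist, to a full twist.
  The full twists already present are central and move out of the way, so one for each letter
  suffices.\<close>

lemma word_cpl:
 assumes "ws : bwords n"
 obtains us where "us : bwords n" "weq n (ws @ us) (ftw n (length ws))"
proof -
 have "EX us : bwords n. weq n (ws @ us) (ftw n (length ws))" using assms
 proof (induction ws)
  case Nil
  show ?case using weq_refl by force
 next
  case (Cons w ws)
  then obtain us where us: "us : bwords n" "weq n (ws @ us) (ftw n (length ws))" by auto
  let ?d = "hf_tw n"
  have w: "w permutes {1..n}" "pinv w o ?d permutes {1..n}"
   using Cons.prems permutes_compose[OF hf_tw_perm permutes_inv] by auto
  have "weq n (w # ws @ us @ [pinv w o ?d,?d]) ([w] @ ftw n (length ws) @ [pinv w o ?d,?d])"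
   using weq_cong[OF us(2), of "[w]" "[pinv w o ?d,?d]"] w hf_tw_perm by simp
  also have "weq n ... (ftw n (length ws) @ [w,pinv w o ?d,?d])"
   using weq_sym[OF weq_cong[OF ftw_cen[of "[w]" n "length ws"], of "[]" "[pinv w o ?d,?d]"]] w hf_tw_perm by simp
  also have "weq n ... (ftw n (length ws) @ [?d,?d])"
   using weq_cong[OF hf_tw_r[OF w(1)], of "ftw n (length ws)" "[?d]"] hf_tw_perm by simp
  also have "... = ftw n (length (w # ws))"
   using ftw_add[of n "length ws" 1] by (simp add: ftw_1 Suc_eq_plus1 del: add_Suc_right)
  finally show ?case using us w hf_tw_perm by (intro bexI[of _ "us @ [pinv w o ?d,?d]"]) (simp_all del: o_apply)
 qed
 thus thesis using that by blast
qed

text \<open>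
  The localization of the positive braid monoid at the central element \<open>ftw n 1\<close>; the pair
  \<open>(a, k)\<close> stands for \<open>a\<close> times the \<open>k\<close>-th power of its inverse.
\<close>

definition fcl where
 "fcl n a k = {(b,l). b : bwords n & weq n (a @ ftw n l) (b @ ftw n k)}"

definition bfracs where
 "bfracs n = {fcl n a k | a k. a : bwords n}"

definition frac_act where
 "frac_act n v S = (\<Union>(a,k)\<in>S. fcl n (a @ [v]) k)"

lemma fcl_eqI:
 assumes "a : bwords n" "b : bwords n" "weq n (a @ ftw n l) (b @ ftw n k)"
 shows "fcl n a k = fcl n b l"
proof -
 \<comment> \<open>Transitivity for equality of fractions: a common power of the full twist is
   introduced and then cancelled on the right.\<close>
 have *: "weq n (b @ ftw n m) (c @ ftw n l)"
  if ab: "a : bwords n" "b : bwords n" "c : bwords n" "weq n (a @ ftw n l) (b @ ftw n k)"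
   and c: "weq n (a @ ftw n m) (c @ ftw n k)" for a b c k l m
 proof -
  have "weq n (b @ ftw n (m + k)) ((b @ ftw n k) @ ftw n m)" by (simp add: ftw_add[symmetric] add.commute weq_refl)
  also have "weq n ... (a @ ftw n l @ ftw n m)" using weq_cong[OF weq_sym[OF ab(4)], of "[]" "ftw n m"] by simp
  also have "a @ ftw n l @ ftw n m = a @ ftw n m @ ftw n l" by (simp add: ftw_add[symmetric] add.commute)
  also have "weq n ... ((c @ ftw n k) @ ftw n l)" using weq_cong[OF c, of "[]" "ftw n l"] by simp
  also have "... = c @ ftw n (l + k)" by (simp add: ftw_add[symmetric] add.commute)
  finally have "weq n ((b @ ftw n m) @ ftw n k) ((c @ ftw n l) @ ftw n k)" by (simp add: ftw_add)
  thus ?thesis using ab by (elim weq_can_app) auto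
 qed
 show ?thesis
 proof (rule Set.set_eqI)
  fix e :: "(nat=>nat) list \<times> nat"
  obtain c m where e: "e = (c,m)" by (cases e)
  show "e : fcl n a k <-> e : fcl n b l" unfolding e fcl_def mem_Collect_eq prod.case
   using *[OF assms(1,2) _ assms(3), of c m] *[OF assms(2,1) _ weq_sym[OF assms(3)], of c m] by blast
 qed
qed

lemma fcl_self: "a : bwords n==>(a,k) : fcl n a k" by (simp add: fcl_def weq_refl)

lemma fcl_eqD:
 assumes "fcl n a k = fcl n b l" "b : bwords n"
 shows "weq n (a @ ftw n l) (b @ ftw n k)" using fcl_self[OF assms(2), of l] assms(1) by (auto simp: fcl_def)

lemma fact_class:
 assumes a: "a : bwords n" and v: "v permutes {1..n}"
 shows "frac_act n v (fcl n a k) = fcl n (a @ [v]) k"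
proof -
 have "fcl n (b @ [v]) l = fcl n (a @ [v]) k" if "(b,l) : fcl n a k" for b l
 proof -
  have b: "b : bwords n" "weq n (a @ ftw n l) (b @ ftw n k)" using that by (auto simp: fcl_def)
  have "weq n ((a @ [v]) @ ftw n l) (a @ ftw n l @ [v])"
   using weq_sym[OF weq_cong[OF ftw_cen[of "[v]" n l], of a "[]"]] a v by simp
  also have "weq n ... (b @ ftw n k @ [v])" using weq_cong[OF b(2), of "[]" "[v]"] v by simp
  also have "weq n ... ((b @ [v]) @ ftw n k)" using weq_cong[OF ftw_cen[of "[v]" n k], of b "[]"] b v by simp
  finally show ?thesis using a b v by (intro fcl_eqI[symmetric]) auto
 qed
 hence "(\<Union>(b,l)\<in>fcl n a k. fcl n (b @ [v]) l) = (\<Union>(b,l)\<in>fcl n a k. fcl n (a @ [v]) k)"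
  by (intro SUP_cong) auto
 also have "... = fcl n (a @ [v]) k" using fcl_self[OF a, of k] by auto
 finally show ?thesis unfolding frac_act_def .
qed

lemma fact_cl:
 assumes "v permutes {1..n}" "S : bfracs n"
 shows "frac_act n v S : bfracs n" using assms(2) fact_class assms(1) by (fastforce simp: bfracs_def)

lemma fact_inj:
 assumes v: "v permutes {1..n}" and S: "S : bfracs n" "T : bfracs n" and eq: "frac_act n v S = frac_act n v T"
 shows "S = T"
proof -
 obtain a k where a: "S = fcl n a k" "a : bwords n" using S(1) by (auto simp: bfracs_def)
 obtain b l where b: "T = fcl n b l" "b : bwords n" using S(2) by (auto simp: bfracs_def)
 have "fcl n (a @ [v]) k = fcl n (b @ [v]) l" using eq fact_class[OF a(2) v] fact_class[OF b(2) v] a(1) b(1) by simp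
 hence *: "weq n ((a @ [v]) @ ftw n l) ((b @ [v]) @ ftw n k)" using b v by (intro fcl_eqD) auto
 have "weq n ((a @ ftw n l) @ [v]) ((a @ [v]) @ ftw n l)"
  using weq_cong[OF ftw_cen[of "[v]" n l], of a "[]"] a v by simp
 also note *
 also have "weq n ((b @ [v]) @ ftw n k) ((b @ ftw n k) @ [v])"
  using weq_sym[OF weq_cong[OF ftw_cen[of "[v]" n k], of b "[]"]] b v by simp
 finally have "weq n (a @ ftw n l) (b @ ftw n k)" using a b v by (elim weq_can) auto
 thus ?thesis using a b by (simp add: fcl_eqI)
qed

text \<open>A letter is divided off by appending a half twist and the left complement of
  \<open>v\<close>, and by adding one full twist to the denominator.\<close>

lemma fact_surj:
 assumes v: "v permutes {1..n}" and S: "S : bfracs n"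
 obtains T where "T : bfracs n" "frac_act n v T = S"
proof -
 obtain a k where a: "S = fcl n a k" "a : bwords n" using S by (auto simp: bfracs_def)
 let ?d = "hf_tw n"
 let ?v = "?d o pinv v"
 have w: "a @ [?d,?v] : bwords n" by (simp add: a hf_tw_perm permutes_compose permutes_inv v)
 have "weq n (a @ [?d,?v,v]) (a @ [?d,?d])" using weq_cong[OF hf_tw_l[OF v], of "a @ [?d]" "[]"] a hf_tw_perm by simp
 hence "weq n ((a @ [?d,?v,v]) @ ftw n k) ((a @ [?d,?d]) @ ftw n k)"
  using weq_cong[of n "a @ [?d,?v,v]" "a @ [?d,?d]" "[]" "ftw n k"] by simp
 hence "weq n ((a @ [?d,?v] @ [v]) @ ftw n k) (a @ ftw n (Suc k))"
  using ftw_add[of n 1 k] by (simp add: ftw_1 plus_1_eq_Suc)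
 hence "fcl n ((a @ [?d,?v]) @ [v]) (Suc k) = S" unfolding a(1) using w v a by (intro fcl_eqI) auto
 hence "frac_act n v (fcl n (a @ [?d,?v]) (Suc k)) = S" using fact_class[OF w v] by simp
 moreover have "fcl n (a @ [?d,?v]) (Suc k) : bfracs n" using w by (auto simp: bfracs_def)
 ultimately show thesis using that by blast
qed

lemma fact_comp:
 assumes "u permutes {1..n}" "v permutes {1..n}" "red_pair u v" "S : bfracs n"
 shows "frac_act n v (frac_act n u S) = frac_act n (u o v) S"
proof -
 obtain a k where a: "S = fcl n a k" "a : bwords n" using assms(4) by (auto simp: bfracs_def)
 have uv: "u o v permutes {1..n}" using permutes_compose assms by blast
 have "weq n ((a @ [u,v]) @ ftw n k) ((a @ [u o v]) @ ftw n k)"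
  using weq_cong[OF weq_pair[OF assms(1-3)], of a "ftw n k"] a by simp
 hence "fcl n (a @ [u,v]) k = fcl n (a @ [u o v]) k" using assms a uv by (intro fcl_eqI) auto
 thus ?thesis using assms a uv by (simp add: fact_class)
qed

lemma fact_id:
 assumes "S : bfracs n"
 shows "frac_act n id S = S"
proof -
 obtain a k where a: "S = fcl n a k" "a : bwords n" using assms by (auto simp: bfracs_def)
 have "weq n ((a @ [id]) @ ftw n k) (a @ ftw n k)" using weq_cong[OF weq_unit, of a n "ftw n k"] a by simp
 hence "fcl n (a @ [id]) k = fcl n a k" using a by (intro fcl_eqI) (auto simp: permutes_id)
 thus ?thesis using a by (simp add: fact_class permutes_id)
qed

section \<open>Transport of fractions along paths of configurations\<close>

text \<open>A local system with fibre \<open>X\<close> over \<open>S\<close>: \<open>g t s\<close>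
  compares the fibres at \<open>t\<close> and \<open>s\<close>. The comparisons are bijective for
  all pairs of points, but they compose only along nearby points, and \<open>near\<close> need not
  be symmetric.\<close>

locale transport =
 fixes X :: "'x set" and S :: "'t::topological_space set" and near :: "'t=>'t=>bool" and g :: "'t=>'t=>'x=>'x"
 assumes eventually_near: "t : S==>\<forall>\<^sub>F s in at t within S. near t s"
  and closed: "[|t : S; s : S; x : X|]==>g t s x : X"
  and inj: "[|t : S; s : S; x : X; y : X; g t s x = g t s y|]==>x = y"
  and surj: "[|t : S; s : S; y : X|]==>EX x:X. g t s x = y" and g_refl: "[|t : S; x : X|]==>g t t x = x"
  and cocycle: "[|t : S; s : S; r : S; near t s; near s r; x : X|]==>g s r (g t s x) = g t r x"
begin

text \<open>Flat sections over \<open>R\<close>. Every point is compared with the points close to it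
  and in this direction only, because \<open>near\<close> has a direction.\<close>

definition compat where
 "compat R Ph <-> Ph : R \<rightarrow> X & (ALL t:R. \<forall>\<^sub>F s in at t within R. Ph s = g t s (Ph t))"

definition lift where
 "lift R <-> (ALL t:R. ALL y:X. EX Ph. compat R Ph & Ph t = y)"

lemma cpt_subset: "[|compat R Ph; Q<=R|] ==> compat Q Ph"
 unfolding compat_def using filter_leD[OF at_le, of Q R] by blast

text \<open>As \<open>g\<close> is injective, two flat sections agree at a point exactly if they
  agree at the points close to it. Agreement is thus a locally constant property.\<close>

lemma cpt_unique:
 assumes R: "connected R" "R<=S" and c: "compat R Ph" "compat R Ps" and t: "t : R" "Ph t = Ps t" and s: "s : R"
 shows "Ph s = Ps s"
proof -
 have "(Ph t = Ps t) = (Ph s = Ps s)"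
 proof (rule connected_local_const[OF R(1) t(1) s(1), of "%t. Ph t = Ps t"], intro ballI)
  fix a assume a: "a : R"
  have "\<forall>\<^sub>F b in at a within R. Ph b = g a b (Ph a) & Ps b = g a b (Ps a) & b : R"
   using c a by (auto simp: compat_def eventually_conj_iff eventually_at_topological intro!: exI[of _ UNIV])
  thus "\<forall>\<^sub>F b in at a within R. (Ph a = Ps a) = (Ph b = Ps b)"
  proof (rule eventually_mono)
   fix b assume b: "Ph b = g a b (Ph a) & Ps b = g a b (Ps a) & b : R"
   have "Ph a : X" "Ps a : X" using c a by (auto simp: compat_def)
   thus "(Ph a = Ps a) = (Ph b = Ps b)" using b inj[of a b "Ph a" "Ps a"] a R(2) by auto
  qed
 qed
 thus ?thesis using t(2) by blast
qed

lemma ev_near_subset: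
 assumes "R<=S" "a : R"
 shows "\<forall>\<^sub>F s in at a within R. near a s & s : R"
proof -
 have "\<forall>\<^sub>F s in at a within R. near a s"
  using filter_leD[OF at_le[OF assms(1)] eventually_near, of a] assms by blast
 moreover have "\<forall>\<^sub>F s in at a within R. s : R"
  unfolding eventually_at_topological by (intro exI[of _ UNIV]) auto
 ultimately show ?thesis by (rule eventually_conj)
qed

text \<open>If all points of \<open>R\<close> are near \<open>t\<^sub>0\<close>, transport directly
  from \<open>t\<^sub>0\<close> is flat by the cocycle rule.\<close>

lemma lift_small:
 assumes R: "R<=S" "t\<^sub>0 : R" "!!s. [|s : R; s~=t\<^sub>0|]==>near t\<^sub>0 s"
 shows "lift R" unfolding lift_def
proof (intro ballI)
 fix t y assume t: "t : R" "y : X"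
 have t0: "t\<^sub>0 : S" using R by blast
 obtain x where x: "x : X" "g t\<^sub>0 t x = y" using surj[of t\<^sub>0 t y] t R by blast
 have "compat R (%s. g t\<^sub>0 s x)" unfolding compat_def
 proof (intro conjI ballI)
  show "(%s. g t\<^sub>0 s x) : R \<rightarrow> X" using closed x R by blast
  fix a assume a: "a : R"
  show "\<forall>\<^sub>F s in at a within R. g t\<^sub>0 s x = g a s (g t\<^sub>0 a x)"
  proof (rule eventually_mono[OF ev_near_subset[OF R(1) a]])
   fix s assume s: "near a s & s : R"
   have aS: "a : S" "s : S" using a s R(1) by blast+
   show "g t\<^sub>0 s x = g a s (g t\<^sub>0 a x)" by (metis g_refl x(1) R(3) a cocycle[OF t0 aS _ _ x(1)] aS s)
  qed
 qed
 thus "EX Ph. compat R Ph & Ph t = y" using x by blast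
qed

text \<open>As the sets are closed, a point outside one of them has a neighbourhood that meets only
  the other. Flatness can therefore be checked on each set separately.\<close>

lemma cpt_union:
 assumes cl: "closed A" "closed B" and c: "compat A Ph" "compat B Ps" and agree: "!!s. s : A Int B==>Ph s = Ps s"
 shows "compat (A Un B) (%s. if s : A then Ph s else Ps s)" unfolding compat_def
proof (intro conjI ballI)
 let ?\<Xi> = "%s. if s : A then Ph s else Ps s"
 show "?\<Xi> : A Un B \<rightarrow> X" using c by (auto simp: compat_def)
 fix t assume t: "t : A Un B"
 have B: "?\<Xi> s = Ps s" if "s : B" for s using agree that by auto
 have 1: "\<forall>\<^sub>F s in at t within A. ?\<Xi> s = g t s (?\<Xi> t)"
 proof (cases "t : A")
  case True
  hence "\<forall>\<^sub>F s in at t within A. Ph s = g t s (Ph t)" using c by (auto simp: compat_def)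
  thus ?thesis using True unfolding eventually_at_topological by auto
 next
  case False
  thus ?thesis using cl(1) unfolding eventually_at_topological by (intro exI[of _ "- A"]) (auto simp: open_Compl)
 qed
 have 2: "\<forall>\<^sub>F s in at t within B. ?\<Xi> s = g t s (?\<Xi> t)"
 proof (cases "t : B")
  case True
  hence "\<forall>\<^sub>F s in at t within B. Ps s = g t s (Ps t)" using c by (auto simp: compat_def)
  thus ?thesis using True B unfolding eventually_at_topological by metis
 next
  case False
  thus ?thesis using cl(2) unfolding eventually_at_topological by (intro exI[of _ "- B"]) (auto simp: open_Compl)
 qed
 show "\<forall>\<^sub>F s in at t within A Un B. ?\<Xi> s = g t s (?\<Xi> t)"
  using 1 2 by (simp add: at_within_union eventually_sup)
qed

text \<open>Two flat sections that agree at one point of the connected intersection agree on all of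
  it and can be glued.\<close>

lemma lift_union:
 assumes "closed A" "closed B" "A Un B<=S" "connected (A Int B)" "A Int B~={}" "lift A" "lift B"
 shows "lift (A Un B)"
proof -
 have *: "EX Ph. compat (A Un B) Ph & Ph t = y"
  if h: "closed A" "closed B" "A Un B<=S" "connected (A Int B)" "A Int B~={}" "lift A" "lift B"
   "t : A" "y : X" for A B t y
 proof -
  obtain Ph where Ph: "compat A Ph" "Ph t = y" using h(6)[unfolded lift_def] h(8,9) by blast
  obtain e where e: "e : A" "e : B" using h(5) by blast
  have "Ph e : X" using Ph(1) e(1) by (auto simp: compat_def)
  then obtain Ps where Ps: "compat B Ps" "Ps e = Ph e" using h(7)[unfolded lift_def] e(2) by blast
  have "Ph s = Ps s" if "s : A Int B" for s
   using cpt_unique[OF h(4) _ cpt_subset[OF Ph(1)] cpt_subset[OF Ps(1)], of e s] h(3) e Ps(2) that by auto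
  thus ?thesis using cpt_union[OF h(1,2) Ph(1) Ps(1)] Ph(2) h(8) by force
 qed
 show ?thesis unfolding lift_def
 proof (intro ballI)
  fix t y assume ty: "t : A Un B" "y : X"
  show "EX Ph. compat (A Un B) Ph & Ph t = y"
  proof (cases "t : A")
   case True
   thus ?thesis using *[of A B] assms ty by blast
  next
   case False
   have "EX Ph. compat (B Un A) Ph & Ph t = y"
    by (rule *) (use assms ty False in \<open>auto simp: Int_commute Un_commute\<close>)
   thus ?thesis by (simp add: Un_commute)
  qed
 qed
qed

end

text \<open>The rule \<open>Bolzano\<close> is used in both directions: small rectangles are glued
  to vertical strips, and thin strips to the square. Neighbouring rectangles meet in a segment,
  which is connected.\<close>

lemma lift_square:
 fixes near :: "real \<times> real=>real \<times> real=>bool"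
 assumes "transport X ({0..1} \<times> {0..1}) near g"
 shows "transport.lift X g ({0..1} \<times> {0..1})"
proof -
 interpret transport X "{0..1} \<times> {0..1}" near g by fact
 define P where "P a b c d <-> (0<=a & a<=b & b<=1 & 0 <= c & c<=d & d<=1 --> lift ({a..b} \<times> {c..d}))" for a b c d :: real
 have local: "EX e>0. ALL a b c d. a<=x & x<=b & b - a < e & c<=y & y<=d & d - c < e --> P a b c d"
  if xy: "0<=x" "x<=1" "0<=y" "y<=1" for x y
 proof -
  have "\<forall>\<^sub>F s in at (x,y) within {0..1} \<times> {0..1}. near (x,y) s" using xy by (intro eventually_near) auto
  then obtain r where r: "r > 0" "!!s. [|s : {0..1} \<times> {0..1}; s~=(x,y); dist s (x,y) < r|]==>near (x,y) s"
   unfolding eventually_at by blast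
  show ?thesis
  proof (intro exI[of _ "r / 2"] conjI allI impI)
   show "r / 2 > 0" using r by simp
   fix a b c d assume h: "a<=x & x<=b & b - a < r / 2 & c<=y & y<=d & d - c < r / 2"
   show "P a b c d" unfolding P_def
   proof
    assume k: "0<=a & a<=b & b<=1 & 0 <= c & c<=d & d<=1"
    let ?R = "{a..b} \<times> {c..d}"
    have "near (x,y) s" if s: "s : ?R" "s~=(x,y)" for s
    proof (rule r(2))
     show "s : {0..1} \<times> {0..1}" "s~=(x,y)" using s k by auto
     have "dist s (x,y)<=\<bar>fst s - x\<bar> + \<bar>snd s - y\<bar>"
      by (cases s) (simp add: dist_prod_def dist_real_def sqrt_sum_squares_le_sum_abs)
     also have "... < r" using s h by auto
     finally show "dist s (x,y) < r" .
    qed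
    have R: "?R<={0..1} \<times> {0..1}" using k by auto
    show "lift ?R" by (rule lift_small[of _ "(x,y)"]) (use R h `!!s. s : ?R==>s~=(x,y)==>near (x,y) s` in auto)
   qed
  qed
 qed
 have mergev: "P a b c e" if "P a b c d" "P a b d e" "c<=d" "d<=e" for a b c d e unfolding P_def
 proof
  assume k: "0<=a & a<=b & b<=1 & 0 <= c & c<=e & e<=1"
  have "{a..b} \<times> {c..e} = ({a..b} \<times> {c..d}) Un ({a..b} \<times> {d..e})" using that(3,4) by auto
  moreover have "({a..b} \<times> {c..d}) Int ({a..b} \<times> {d..e}) = {a..b} \<times> {d}" using that(3,4) by auto
  moreover have "connected ({a..b} \<times> {d})" by (intro connected_Times) auto
  moreover have sub: "{a..b} \<times> {c..d}<={0..1} \<times> {0..1}" "{a..b} \<times> {d..e}<={0..1} \<times> {0..1}" using that(3,4) k by auto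
  ultimately show "lift ({a..b} \<times> {c..e})"
   using lift_union[of "{a..b} \<times> {c..d}" "{a..b} \<times> {d..e}"] that k sub by (simp add: P_def closed_Times)
 qed
 have mergeh: "P a e c d" if "P a b c d" "P b e c d" "a<=b" "b<=e" for a b c d e unfolding P_def
 proof
  assume k: "0<=a & a<=e & e<=1 & 0 <= c & c<=d & d<=1"
  have "{a..e} \<times> {c..d} = ({a..b} \<times> {c..d}) Un ({b..e} \<times> {c..d})" using that(3,4) by auto
  moreover have "({a..b} \<times> {c..d}) Int ({b..e} \<times> {c..d}) = {b} \<times> {c..d}" using that(3,4) by auto
  moreover have "connected ({b} \<times> {c..d})" by (intro connected_Times) auto
  moreover have sub: "{a..b} \<times> {c..d}<={0..1} \<times> {0..1}" "{b..e} \<times> {c..d}<={0..1} \<times> {0..1}" using that(3,4) k by auto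
  ultimately show "lift ({a..e} \<times> {c..d})"
   using lift_union[of "{a..b} \<times> {c..d}" "{b..e} \<times> {c..d}"] that k sub by (simp add: P_def closed_Times)
 qed
 have strip: "EX \<delta>>0. ALL a b. a<=x & x<=b & b - a < \<delta> --> P a b 0 1" if x: "0<=x" "x<=1" for x
 proof -
  define Q where "Q c d <-> (EX \<delta>>0. ALL a b. a<=x & x<=b & b - a < \<delta> --> P a b c d)" for c d
  have "Q 0 1"
  proof (rule Bolzano[of 0 1 Q])
   fix a b c :: real assume h: "Q a b" "Q b c" "a<=b" "b <= c"
   obtain d1 where d1: "d1 > 0" "ALL u v. u<=x & x<=v & v - u < d1 --> P u v a b" using h(1) unfolding Q_def by blast
   obtain d2 where d2: "d2 > 0" "ALL u v. u<=x & x<=v & v - u < d2 --> P u v b c" using h(2) unfolding Q_def by blast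
   show "Q a c"  by (smt (verit) Q_def d1 d2 mergev h(3,4))
  next
   fix y :: real assume y: "0<=y" "y<=1"
   show "EX d>0. ALL a b. a<=y & y<=b & b - a < d --> Q a b" by (metis local x y Q_def)
  qed simp
  thus ?thesis by (simp add: Q_def)
 qed
 have "P 0 1 0 1"
 proof (rule Bolzano[of 0 1 "%a b. P a b 0 1"])
  show "P a c 0 1" if "P a b 0 1" "P b c 0 1" "a<=b" "b <= c" for a b c using mergeh that by blast
 qed (use strip in auto)
 thus ?thesis by (simp add: P_def)
qed

section \<open>The order of the points in a configuration and its changes\<close>

definition before :: "(nat => complex)=>nat=>nat=>bool" where
 "before z a b <-> Re (z a) < Re (z b) | Re (z a) = Re (z b) & Im (z a) < Im (z b)"

definition rank where
 "rank n z = (THE w. w permutes {1..n} & (ALL a:{1..n}. ALL b:{1..n}. w a < w b <-> before z a b))"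

lemma rank_eqI:
 assumes "w permutes {1..n}" "!!a b. [|a : {1..n}; b : {1..n}; a~=b|]==>w a < w b <-> before z a b"
 shows "rank n z = w" unfolding rank_def
proof (rule the_equality)
 show "w permutes {1..n} & (ALL a:{1..n}. ALL b:{1..n}. w a < w b <-> before z a b)"
   using assms(1) assms(2) by (fastforce simp: before_def)
 fix v assume "v permutes {1..n} & (ALL a:{1..n}. ALL b:{1..n}. v a < v b <-> before z a b)"
 thus "v = w" using assms by (intro perm_eqI_ord[of v n w]) auto
qed

lemma rank:
 assumes z: "inj_on z {1..n}"
 shows "rank n z permutes {1..n}"
  "[|a : {1..n}; b : {1..n}|]==>rank n z a < rank n z b <-> before z a b"
proof -
 obtain w where w: "w permutes {1..n}" "!!a b. [|a : {1..n}; b : {1..n}|]==>w a < w b <-> before z a b"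
 by (smt (verit) strict_ord_rank z inj_onD before_def complex_eq_iff)
 hence "rank n z = w" by (intro rank_eqI) auto
 thus "rank n z permutes {1..n}"
  "[|a : {1..n}; b : {1..n}|]==>rank n z a < rank n z b <-> before z a b" using w by auto
qed

text \<open>Positions in the order at \<open>z'\<close> are sent to positions in the order at
  \<open>z\<close>. Being expressed by positions, it is unaffected by a renaming of the points
  (\<open>ochg_rel\<close>).\<close>

definition ochg where
 "ochg n z z' = rank n z o pinv (rank n z')"

text \<open>
  \<open>near_conf n z\<close> is a neighbourhood of \<open>z\<close>: it fixes the order of the real parts that differ at \<open>z\<close>,
  and the order of the imaginary parts of points on the same vertical line.
\<close>

definition near_conf :: "nat=>(nat => complex)=>(nat => complex)=>bool" where
 "near_conf n z z' <-> (ALL a:{1..n}. ALL b:{1..n}.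
  (Re (z a) < Re (z b) --> Re (z' a) < Re (z' b)) &
  (Re (z a) = Re (z b) & Im (z a) < Im (z b) --> Im (z' a) < Im (z' b)))"

text \<open>The consequence of \<open>near_conf n z z'\<close> on which \<open>ochg_rp\<close>
  rests. Unlike nearness it persists along a whole \<open>cpath\<close>.\<close>

definition adapted where
 "adapted n z z' <-> (ALL a:{1..n}. ALL b:{1..n}.
  Re (z' a) = Re (z' b) & Im (z' a) < Im (z' b) --> before z a b)"

lemma near_conf_adapted:
 assumes z: "inj_on z {1..n}" and near: "near_conf n z z'"
 shows "adapted n z z'" by (smt (verit) adapted_def z inj_onD near near_conf_def before_def complex_eq_iff)

lemma ochg_perm:
 assumes "inj_on z {1..n}" "inj_on z' {1..n}"
 shows "ochg n z z' permutes {1..n}"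
 unfolding ochg_def using permutes_compose[OF permutes_inv[OF rank(1)[OF assms(2)]] rank(1)[OF assms(1)]] .

lemma ochg_comp:
 assumes "inj_on z' {1..n}"
 shows "ochg n z z' o ochg n z' z'' = ochg n z z''"
 using permutes_inverses(2)[OF rank(1)[OF assms]] by (simp add: ochg_def feq)

lemma ochg_refl:
 assumes "inj_on z {1..n}"
 shows "ochg n z z = id" using permutes_inverses(1)[OF rank(1)[OF assms]] by (simp add: ochg_def feq)

text \<open>On the way from \<open>z'\<close> to a nearby \<open>z''\<close> only points on a common
  vertical line at \<open>z'\<close> can change their order. There the order is that of the
  imaginary parts, and \<open>adapted\<close> says that it was the same at \<open>z\<close>. So no
  pair changes its order twice.\<close>

lemma ochg_rp:
 assumes z: "inj_on z {1..n}" "inj_on z' {1..n}" "inj_on z'' {1..n}"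
  and ad: "adapted n z z'" and near: "near_conf n z' z''"
 shows "red_pair (ochg n z z') (ochg n z' z'')"
proof (rule rpI)
 fix i j :: nat assume ij: "i < j" "ochg n z' z'' j < ochg n z' z'' i"
 note r = rank[OF z(1)] and r' = rank[OF z(2)] and r'' = rank[OF z(3)]
 have "(i,j) : invs (ochg n z' z'')" using ij by (simp add: invs_def)
 hence ijn: "i : {1..n}" "j : {1..n}" using perm_inversionsD[OF ochg_perm[OF z(2,3)]] by blast+
 define a where "a = pinv (rank n z'') i"
 define b where "b = pinv (rank n z'') j"
 have ab: "a : {1..n}" "b : {1..n}" "i = rank n z'' a" "j = rank n z'' b"
  using ijn permutes_in_image[OF permutes_inv[OF r''(1)]] permutes_inverses(1)[OF r''(1)] unfolding a_def b_def by auto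
 have oc: "ochg n z' z'' i = rank n z' a" "ochg n z' z'' j = rank n z' b" by (simp_all add: ochg_def a_def b_def)
 have ba: "before z' b a" using ij(2) r'(2)[OF ab(2,1)] oc by simp
 have ab'': "before z'' a b" using ij(1) r''(2)[OF ab(1,2)] ab(3,4) by simp
 have "Re (z' b) = Re (z' a) & Im (z' b) < Im (z' a)" using ba ab'' near ab(1,2) by (fastforce simp: before_def near_conf_def)
 hence "before z b a" using ad ab(1,2) unfolding adapted_def by blast
 hence "rank n z b < rank n z a" using r(2)[OF ab(2,1)] by simp
 moreover have "ochg n z z' (rank n z' b) = rank n z b" "ochg n z z' (rank n z' a) = rank n z a"
  using permutes_inverses(2)[OF r'(1)] by (simp_all add: ochg_def)
 ultimately show "ochg n z z' (ochg n z' z'' j) < ochg n z z' (ochg n z' z'' i)" unfolding oc by simp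
qed

lemma conf_inj: "z : conf n {1..n}==>inj_on z {1..n}" by (simp add: conf_def)

lemma ev_near_conf:
 fixes h :: "'t::topological_space=>nat => complex"
 assumes "cont_on S h" "t : S"
 shows "\<forall>\<^sub>F s in at t within S. near_conf n (h t) (h s)"
proof -
 have lim: "((%s. h s a) \<longlongrightarrow> h t a) (at t within S)" for a
  using continuous_on_product_then_coordinatewise[OF assms(1), of a] assms(2) by (simp add: continuous_on_def)
 have "\<forall>\<^sub>F s in at t within S. (Re (h t a) < Re (h t b) --> Re (h s a) < Re (h s b)) &
  (Re (h t a) = Re (h t b) & Im (h t a) < Im (h t b) --> Im (h s a) < Im (h s b))" for a b
 proof (rule eventually_conj)
  have "((%s. Re (h s b) - Re (h s a)) \<longlongrightarrow> Re (h t b) - Re (h t a)) (at t within S)"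
   by (intro tendsto_intros lim)
  hence "Re (h t b) - Re (h t a) > 0==>\<forall>\<^sub>F s in at t within S. Re (h s b) - Re (h s a) > 0"
   by (rule order_tendstoD(1))
  thus "\<forall>\<^sub>F s in at t within S. Re (h t a) < Re (h t b) --> Re (h s a) < Re (h s b)"
   by (cases "Re (h t a) < Re (h t b)") auto
  have "((%s. Im (h s b) - Im (h s a)) \<longlongrightarrow> Im (h t b) - Im (h t a)) (at t within S)"
   by (intro tendsto_intros lim)
  hence "Im (h t b) - Im (h t a) > 0==>\<forall>\<^sub>F s in at t within S. Im (h s b) - Im (h s a) > 0"
   by (rule order_tendstoD(1))
  thus "\<forall>\<^sub>F s in at t within S. Re (h t a) = Re (h t b) & Im (h t a) < Im (h t b) --> Im (h s a) < Im (h s b)"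
   by (cases "Im (h t a) < Im (h t b)") auto
 qed
 thus ?thesis unfolding near_conf_def by (intro eventually_ball_finite ballI) auto
qed

text \<open>Fractions form a local system along every map into the configurations: right
  cancellation and complements make the transition maps bijective, and \<open>ochg_rp\<close> gives
  the cocycle rule.\<close>

lemma tr_conf:
 fixes h :: "'t::topological_space=>nat => complex"
 assumes h: "cont_on S h" "h ` S <= conf n {1..n}"
 shows "transport (bfracs n) S (%t s. near_conf n (h t) (h s))
  (%t s. frac_act n (ochg n (h t) (h s)))"
proof
 have inj: "inj_on (h t) {1..n}" if "t : S" for t using h(2) that conf_inj by blast
 show "\<forall>\<^sub>F s in at t within S. near_conf n (h t) (h s)" if "t : S" for t
  using ev_near_conf[OF h(1) that] .
 fix t s assume t: "t : S" "s : S"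
 note p = ochg_perm[OF inj[OF t(1)] inj[OF t(2)]]
 show "frac_act n (ochg n (h t) (h s)) x : bfracs n" if "x : bfracs n" for x using fact_cl[OF p that] .
 show "x = y" if "x : bfracs n" "y : bfracs n"
  "frac_act n (ochg n (h t) (h s)) x = frac_act n (ochg n (h t) (h s)) y" for x y using fact_inj[OF p that] .
 show "EX x:bfracs n. frac_act n (ochg n (h t) (h s)) x = y" if "y : bfracs n" for y using fact_surj[OF p that] by blast
 show "frac_act n (ochg n (h t) (h t)) x = x" if "x : bfracs n" for x
  using ochg_refl[OF inj[OF t(1)]] fact_id[OF that] by simp
 fix r x assume r: "r : S" and near: "near_conf n (h t) (h s)" "near_conf n (h s) (h r)" and x: "x : bfracs n"
 show "frac_act n (ochg n (h s) (h r)) (frac_act n (ochg n (h t) (h s)) x)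
   = frac_act n (ochg n (h t) (h r)) x"
   by (simp add: fact_comp ochg_perm inj t(2) r x ochg_comp ochg_rp t(1) near_conf_adapted near(1) near(2))
qed

text \<open>The notion \<open>transport.compat\<close> for configurations, detached from the locale
  so that a section can be pulled back along a map of the base.\<close>

definition conf_cpt where
 "conf_cpt n h R Ph <-> Ph : R \<rightarrow> bfracs n &
  (ALL t:R. \<forall>\<^sub>F s in at t within R. Ph s = frac_act n (ochg n (h t) (h s)) (Ph t))"

lemma conf_cpt_eq:
 assumes "cont_on S h" "h ` S <= conf n {1..n}"
 shows "transport.compat (bfracs n) (%t s. frac_act n (ochg n (h t) (h s))) = conf_cpt n h"
 using transport.compat_def[OF tr_conf[OF assms]] by (simp add: feq conf_cpt_def)

lemma conf_cpt_comp:
 assumes h: "!!t. t : R==>inj_on (h t) {1..n}" and c: "conf_cpt n h R Ph" and f: "cont_on Q f" "f ` Q<=R"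
 shows "conf_cpt n (h o f) Q (Ph o f)" unfolding conf_cpt_def
proof (intro conjI ballI)
 show "Ph o f : Q \<rightarrow> bfracs n" using c f(2) unfolding conf_cpt_def Pi_iff comp_apply by blast
 fix t assume t: "t : Q"
 let ?P = "%s. Ph s = frac_act n (ochg n (h (f t)) (h s)) (Ph (f t))"
 have ft: "f t : R" using t f(2) by blast
 hence "\<forall>\<^sub>F s in at (f t) within R. ?P s" using c by (auto simp: conf_cpt_def)
 moreover have "?P (f t)" using ochg_refl[OF h[OF ft]] fact_id c ft by (auto simp: conf_cpt_def)
 ultimately obtain U where U: "open U" "f t : U" "!!s. [|s : U; s : R|]==>?P s"
  unfolding eventually_at_topological by metis
 have "\<forall>\<^sub>F s in at t within Q. f s : U" using U(1,2) f(1) t by (auto simp: tendsto_def continuous_on_def)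
 moreover have "\<forall>\<^sub>F s in at t within Q. s : Q"
  unfolding eventually_at_topological by (intro exI[of _ UNIV]) auto
 ultimately show "\<forall>\<^sub>F s in at t within Q. (Ph o f) s = frac_act n (ochg n ((h o f) t) ((h o f) s)) ((Ph o f) t)"
  by eventually_elim (use U(3) f(2) in auto)
qed

lemma conf_cpt_cong:
 assumes "!!t. t : R==>h t = h' t" "!!t. t : R==>Ph t = Ph' t" "conf_cpt n h R Ph"
 shows "conf_cpt n h' R Ph'" using assms(3) unfolding conf_cpt_def eventually_at_topological
 by (auto simp: assms(1,2) Pi_iff)

definition path_tr :: "nat=>(real=>nat => complex)=>((nat=>nat) list \<times> nat) set =>
  ((nat=>nat) list \<times> nat) set=>bool" where
 "path_tr n p x y <-> (EX Ph. conf_cpt n p {0..1} Ph & Ph 0 = x & Ph 1 = y)"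

text \<open>A flat section over the square of the homotopy restricts to flat sections along both
  paths. On the two edges where the end points rest it is constant, so the values at the ends
  agree.\<close>

lemma path_tr_htpc:
 assumes h: "hpaths (conf n {1..n}) p q" and x: "path_tr n p x y"
 shows "path_tr n q x y"
proof -
 obtain H where H: "cont_on ({0..1} \<times> {0..1}) H" "H : ({0..1} \<times> {0..1}) \<rightarrow> conf n {1..n}"
  "!!t. t : {0..1}==>H (0,t) = p t" "!!t. t : {0..1}==>H (1,t) = q t"
  "!!t. t : {0..1::real}==>H (t,0) = p 0" "!!t. t : {0..1::real}==>H (t,1) = p 1"
  using h unfolding homotopic_paths by (auto simp: pathstart_def pathfinish_def)
 let ?S = "{0..1::real} \<times> {0..1::real}"
 have HS: "H ` ?S <= conf n {1..n}" using H(2) by blast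
 have inj: "inj_on (H t) {1..n}" if "t : ?S" for t using HS that conf_inj by blast
 obtain Ph\<^sub>0 where Ph\<^sub>0: "conf_cpt n p {0..1} Ph\<^sub>0" "Ph\<^sub>0 0 = x" "Ph\<^sub>0 1 = y"
  using x by (auto simp: path_tr_def)
 have xX: "x : bfracs n" using Ph\<^sub>0 by (force simp: conf_cpt_def)
 note tr = tr_conf[OF H(1) HS]
 from lift_square[OF tr] obtain Ph where "transport.compat (bfracs n) (%t s. frac_act n (ochg n (H t) (H s))) ?S Ph" "Ph (0,0) = x"
  unfolding transport.lift_def[OF tr] using xX by force
 hence Ph: "conf_cpt n H ?S Ph" by (simp add: conf_cpt_eq[OF H(1) HS])
 have edge: "conf_cpt n (%t. H (f t)) {0..1} (%t. Ph (f t))" if "cont_on {0..1} f" "f ` {0..1::real}<=?S" for f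
  using conf_cpt_comp[OF inj Ph that] by (simp add: o_def)
 have const: "Ph (1,c) = Ph (0,c)" if c: "c : {0,1}" for c
 proof -
  have "conf_cpt n (%t. H (t,c)) {0..1} (%t. Ph (t,c))" using c by (intro edge) (auto intro!: continuous_intros)
  hence *: "ALL t:{0..1}. \<forall>\<^sub>F s in at t within {0..1}. Ph (t,c) = Ph (s,c)" unfolding conf_cpt_def
  proof (elim conjE, intro ballI)
   fix t :: real assume t: "t : {0..1}" and X: "(%t. Ph (t,c)) : {0..1} \<rightarrow> bfracs n"
    and a: "ALL t:{0..1}. \<forall>\<^sub>F s in at t within {0..1}. Ph (s,c) = frac_act n (ochg n (H (t,c)) (H (s,c))) (Ph (t,c))"
   have "\<forall>\<^sub>F s in at t within {0..1}. s : {0..1}"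
    unfolding eventually_at_topological by (intro exI[of _ UNIV]) auto
   with a[rule_format, OF t] show "\<forall>\<^sub>F s in at t within {0..1}. Ph (t,c) = Ph (s,c)"
   proof eventually_elim
    case (elim s)
    have "H (s,c) = H (t,c)" using H(5,6) c t elim(2) by auto
    moreover have "ochg n (H (t,c)) (H (t,c)) = id" using c t by (intro ochg_refl inj) auto
    moreover have "Ph (t,c) : bfracs n" using X t by auto
    ultimately show ?case using elim(1) by (simp add: fact_id)
   qed
  qed
  show ?thesis by (rule connected_local_const[of "{0..1::real}" 1 0 "%t. Ph (t,c)"]) (use * in auto)
 qed
 have 0: "conf_cpt n p {0..1} (%t. Ph (0,t))"
 proof (rule conf_cpt_cong)
  show "conf_cpt n (%t. H (0,t)) {0..1} (%t. Ph (0,t))" by (rule edge) (auto intro!: continuous_intros)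
 qed (use H(3) in auto)
 have 1: "conf_cpt n q {0..1} (%t. Ph (1,t))"
 proof (rule conf_cpt_cong)
  show "conf_cpt n (%t. H (1,t)) {0..1} (%t. Ph (1,t))" by (rule edge) (auto intro!: continuous_intros)
 qed (use H(4) in auto)
 have p: "cont_on {0..1} p" "p ` {0..1} <= conf n {1..n}"
  using homotopic_paths_imp_path[OF h] homotopic_paths_imp_subset[OF h] by (auto simp: path_def path_image_def)
 have "Ph\<^sub>0 1 = Ph (0,1)"
  by (rule transport.cpt_unique[OF tr_conf[OF p], of "{0..1}" Ph\<^sub>0 "%t. Ph (0,t)" 0 1])
   (use Ph\<^sub>0 0 `Ph (0,0) = x` in \<open>auto simp: conf_cpt_eq[OF p]\<close>)
 thus ?thesis unfolding path_tr_def using 1 const[of 0] const[of 1] Ph\<^sub>0 `Ph (0,0) = x`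
  by (intro exI[of _ "%t. Ph (1,t)"]) auto
qed

lemma path_tr_unique:
 assumes "path p" "pimg p <= conf n {1..n}" "path_tr n p x y" "path_tr n p x y'"
 shows "y = y'"
proof -
 have p: "cont_on {0..1} p" "p ` {0..1} <= conf n {1..n}" using assms by (auto simp: path_def path_image_def)
 obtain Ph Ps where "conf_cpt n p {0..1} Ph" "Ph 0 = x" "Ph 1 = y" "conf_cpt n p {0..1} Ps" "Ps 0 = x" "Ps 1 = y'"
  using assms(3,4) by (auto simp: path_tr_def)
 thus ?thesis using transport.cpt_unique[OF tr_conf[OF p], of "{0..1}" Ph Ps 0 1] by (auto simp: conf_cpt_eq[OF p])
qed

lemma path_tr_join:
 assumes p: "path p" "pimg p <= conf n {1..n}" and q: "path q" "pimg q <= conf n {1..n}"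
  and j: "pfin p = pst q" and t: "path_tr n p x y" "path_tr n q y w"
 shows "path_tr n (p +++ q) x w"
proof -
 obtain Ph Ps where c: "conf_cpt n p {0..1} Ph" "Ph 0 = x" "Ph 1 = y" "conf_cpt n q {0..1} Ps" "Ps 0 = y" "Ps 1 = w"
  using t by (auto simp: path_tr_def)
 have pq: "cont_on {0..1} (p +++ q)" "(p +++ q) ` {0..1} <= conf n {1..n}"
  using path_join_imp[OF p(1) q(1) j] path_image_join_subset[of p q] p(2) q(2) by (auto simp: path_def path_image_def)
 have inj: "inj_on (p t) {1..n}" "inj_on (q t) {1..n}" if "t : {0..1}" for t
  using p(2) q(2) that conf_inj unfolding path_image_def by blast+
 have "conf_cpt n (p o (%t. 2 * t)) {0..1/2} (Ph o (%t. 2 * t))"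
  by (rule conf_cpt_comp[OF inj(1) c(1)]) (auto intro!: continuous_intros)
 hence 1: "conf_cpt n (p +++ q) {0..1/2} (%t. Ph (2 * t))" by (rule conf_cpt_cong[rotated 2]) (auto simp: joinpaths_def)
 have "conf_cpt n (q o (%t. 2 * t - 1)) {1/2..1} (Ps o (%t. 2 * t - 1))"
  by (rule conf_cpt_comp[OF inj(2) c(4)]) (auto intro!: continuous_intros)
 moreover have "q (2 * t - 1) = (p +++ q) t" if "t : {1/2..1}" for t
 proof (cases "t = 1/2")
  case True
  thus ?thesis using j unfolding True by (simp add: joinpaths_def pathfinish_def pathstart_def)
 qed (use that in \<open>auto simp: joinpaths_def\<close>)
 ultimately have 2: "conf_cpt n (p +++ q) {1/2..1} (%t. Ps (2 * t - 1))" by (elim conf_cpt_cong[rotated 2]) auto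
 have "conf_cpt n (p +++ q) ({0..1/2} Un {1/2..1}) (%s. if s : {0..1/2} then Ph (2 * s) else Ps (2 * s - 1))"
 proof (rule transport.cpt_union[OF tr_conf[OF pq], unfolded conf_cpt_eq[OF pq], OF _ _ 1 2])
  fix s :: real assume "s : {0..1/2} Int {1/2..1}"
  hence s: "2 * s = 1" by auto
  show "Ph (2 * s) = Ps (2 * s - 1)" unfolding s using c by simp
 qed auto
 moreover have "{0..1/2} Un {1/2..1} = {0..1::real}" by auto
 ultimately show ?thesis unfolding path_tr_def using c
  by (intro exI[of _ "%s. if s : {0..1/2} then Ph (2 * s) else Ps (2 * s - 1)"]) simp
qed

section \<open>Braids are fractions of positive braids\<close>

text \<open>The strand \<open>a\<close> of the new configuration is the strand \<open>r a\<close> of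
  the old one. Composition requires this because the strands of the right factor are named by its
  own left nodes.\<close>

definition relabel :: "nat set=>(nat=>nat)=>(nat => complex)=>nat => complex" where
 "relabel C r z = restrict (%a. z (r a)) C"

lemma continuous_rel: "cont_on S (relabel C r)"
proof (rule continuous_on_coordinatewise_then_product)
 fix a show "cont_on S (%z. relabel C r z a)"
  by (cases "a : C") (simp_all add: relabel_def continuous_on_product_coordinates[THEN continuous_on_subset])
qed

lemma rel_conf: "[|inj_on r C; r ` C<=B; z : conf n B|]==>relabel C r z : conf n C"
 unfolding conf_def relabel_def by (auto simp: inj_on_def image_subset_iff PiE_iff)

lemma rel_rel: "r ` C<=B==>relabel C r (relabel B s z) = relabel C (s o r) z"
 unfolding relabel_def by (auto simp: feq restrict_def)

lemma path_rel:
 assumes "path p" "pimg p <= conf n B" "inj_on r C" "r ` C<=B"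
 shows "path (relabel C r o p)" "pimg (relabel C r o p) <= conf n C"
proof -
 show "path (relabel C r o p)" using assms(1) continuous_rel by (rule path_continuous_image)
 show "pimg (relabel C r o p) <= conf n C" unfolding path_image_compose using rel_conf[OF assms(3,4)] assms(2) by blast
qed

lemma htpc_rel:
 assumes "hpaths (conf n B) p q" "inj_on r C" "r ` C<=B"
 shows "hpaths (conf n C) (relabel C r o p) (relabel C r o q)"
 using assms by (intro homotopic_paths_continuous_image[OF assms(1)] continuous_rel) (auto intro: rel_conf)

lemma rel_self: "z : conf n A==>relabel A (%a. a) z = z"
 by (auto simp: relabel_def conf_def PiE_iff extensional_restrict)

section \<open>Composition of diagrams and isotopy classes\<close>

lemma BSD:
 assumes "(A,p) : BS n"
 shows "A<={1..n}" "path p" "pimg p <= conf n A" "pst p = restrict of_nat A"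
  "!!a. a : A==>pfin p a : of_nat ` {1..n}" using assms by (auto simp: braided_strands_def)

lemma right_end:
 assumes x: "(A,p) : BS n" and a: "a : A"
 shows "pfin p a = of_nat (rend (A,p) a)" "rend (A,p) a : {1..n}"
proof -
 obtain j where j: "j : {1..n}" "pfin p a = of_nat j" using BSD(5)[OF x a] by auto
 show "pfin p a = of_nat (rend (A,p) a)" "rend (A,p) a : {1..n}" using j by (auto simp: right_end_def)
qed

lemma r_end_eqI: "pfin p a = of_nat j==>rend (A,p) a = j"
 unfolding right_end_def prod.case by (intro the_equality) auto

lemma pathfinish_conf: "(A,p) : BS n==>pfin p : conf n A" using BSD(3) pathfinish_in_path_image by blast

lemma r_end_inj:
 assumes x: "(A,p) : BS n"
 shows "inj_on (rend (A,p)) A" using right_end(1) x pathfinish_conf by (auto simp: conf_def inj_on_def)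

definition csupp :: "strands=>strands=>nat set" where
 "csupp x y = {a : fst x. rend x a : fst y}"

lemma str_comp_eq:
 "strands_comp (A,p) (B,q) = (csupp (A,p) (B,q),
  (relabel (csupp (A,p) (B,q)) (%a. a) o p) +++ (relabel (csupp (A,p) (B,q)) (rend (A,p)) o q))"
 by (simp add: strands_comp_def csupp_def relabel_def o_def Let_def)

lemma csupp_inj:
 assumes "(A,p) : BS n"
 shows "inj_on (%a. a) (csupp (A,p) (B,q))" "(%a. a) ` csupp (A,p) (B,q)<=A"
  "inj_on (rend (A,p)) (csupp (A,p) (B,q))" "rend (A,p) ` csupp (A,p) (B,q)<=B"
 using r_end_inj[OF assms] by (auto simp: csupp_def inj_on_def)

lemma str_comp_join:
 assumes x: "(A,p) : BS n" and y: "(B,q) : BS n"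
 defines "C == csupp (A,p) (B,q)"
 shows "pfin (relabel C (%a. a) o p) = pst (relabel C (rend (A,p)) o q)"
proof -
 have "pfin p a = pst q (rend (A,p) a)" if "a : C" for a
  using that right_end(1)[OF x, of a] BSD(4)[OF y] by (auto simp: C_def csupp_def)
 thus ?thesis by (auto simp: pathfinish_compose pathstart_compose relabel_def feq restrict_def)
qed

lemma str_comp_cl:
 assumes x: "(A,p) : BS n" and y: "(B,q) : BS n"
 shows "strands_comp (A,p) (B,q) : BS n"
  "!!a. a : csupp (A,p) (B,q) ==>
   rend (strands_comp (A,p) (B,q)) a = rend (B,q) (rend (A,p) a)"
proof -
 define C where "C = csupp (A,p) (B,q)"
 let ?p = "relabel C (%a. a) o p" and ?q = "relabel C (rend (A,p)) o q"
 note inj = csupp_inj[OF x, of B q, folded C_def]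
 have C: "C<=A" "!!a. a : C==>rend (A,p) a : B" by (auto simp: C_def csupp_def)
 have P: "path ?p" "pimg ?p <= conf n C" using path_rel[OF BSD(2,3)[OF x]] inj by auto
 have Q: "path ?q" "pimg ?q <= conf n C" using path_rel[OF BSD(2,3)[OF y]] inj by auto
 note j = str_comp_join[OF x y, folded C_def]
 have fin: "pfin (?p +++ ?q) a = of_nat (rend (B,q) (rend (A,p) a))" if "a : C" for a
  using that right_end(1)[OF y] C(2) by (simp add: pathfinish_compose relabel_def)
 show "strands_comp (A,p) (B,q) : BS n"
  unfolding str_comp_eq C_def[symmetric] braided_strands_def mem_Collect_eq prod.case
 proof (intro conjI ballI)
  show "C<={1..n}" using C(1) BSD(1)[OF x] by auto
  show "path (?p +++ ?q)" using P Q j by (intro path_join_imp)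
  show "pimg (?p +++ ?q) <= conf n C" using P Q path_image_join_subset by blast
  show "pst (?p +++ ?q) = restrict of_nat C"
   using BSD(4)[OF x] C(1) by (auto simp: pathstart_compose relabel_def restrict_def feq)
  fix a assume a: "a : C"
  show "pfin (?p +++ ?q) a : of_nat ` {1..n}" unfolding fin[OF a] using right_end(2)[OF y] C(2)[OF a] by blast
 qed
 fix a assume "a : csupp (A,p) (B,q)"
 thus "rend (strands_comp (A,p) (B,q)) a = rend (B,q) (rend (A,p) a)"
  unfolding str_comp_eq using fin unfolding C_def by (intro r_end_eqI) auto
qed

lemma isotopy_iff:
 "((A,p),(B,q)) : isotopy n <-> (A,p) : BS n & (B,q) : BS n
  & A = B & hpaths (conf n A) p q" by (simp add: isotopy_def)

lemma equiv_isotopy: "equiv (BS n) (isotopy n)"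
proof (rule equivI)
 show "isotopy n<=BS n \<times> BS n" by (auto simp: isotopy_iff)
 show "refl_on (BS n) (isotopy n)" using BSD(2,3) by (auto simp: refl_on_def isotopy_iff)
 show "sym (isotopy n)" by (auto simp: sym_def isotopy_iff intro: homotopic_paths_sym)
 show "trans (isotopy n)" by (auto simp: trans_def isotopy_iff intro: homotopic_paths_trans)
qed

definition iclass where
 "iclass n x = isotopy n `` {x}"

lemma icls_self: "x : BS n==>x : iclass n x" unfolding iclass_def using equiv_class_self[OF equiv_isotopy] .

lemma icls_eq_iff: "[|x : BS n; y : BS n|]==>iclass n x = iclass n y <-> (x,y) : isotopy n"
 unfolding iclass_def using eq_equiv_class_iff[OF equiv_isotopy] .

lemma icls_eqI: "(x,y) : isotopy n==>iclass n x = iclass n y"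
 unfolding iclass_def using equiv_class_eq[OF equiv_isotopy] .

lemma icls_dias: "x : BS n==>iclass n x : diagrams n" unfolding iclass_def diagrams_def by (rule quotientI)

lemma dias_cases:
 assumes "X : diagrams n"
 obtains A p where "(A,p) : BS n" "X = iclass n (A,p)"
 using assms unfolding diagrams_def iclass_def by (auto elim!: quotientE)

lemma icls_mem: "y : iclass n x <-> (x,y) : isotopy n" by (simp add: iclass_def)

lemma r_end_isotopic:
 assumes "((A,p),(B,q)) : isotopy n"
 shows "rend (A,p) = rend (B,q)"
using assms isotopy_iff homotopic_paths_imp_pathfinish by (fastforce simp: right_end_def)

lemma str_comp_isotopic:
 assumes x: "((A,p),(A',p')) : isotopy n" and y: "((B,q),(B',q')) : isotopy n"
 shows "(strands_comp (A,p) (B,q),strands_comp (A',p') (B',q')) : isotopy n"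
proof -
 define C where "C = csupp (A,p) (B,q)"
 have e: "A' = A" "B' = B" and h: "hpaths (conf n A) p p'" "hpaths (conf n B) q q'"
  and m: "(A,p) : BS n" "(A,p') : BS n" "(B,q) : BS n" "(B,q') : BS n" using x y by (auto simp: isotopy_iff)
 have r: "rend (A,p') = rend (A,p)" using r_end_isotopic[OF x] e by simp
 hence C': "csupp (A,p') (B,q') = C" by (simp add: C_def csupp_def)
 note inj = csupp_inj[OF m(1), of B q, folded C_def]
 have "hpaths (conf n C) ((relabel C (%a. a) o p) +++ (relabel C (rend (A,p)) o q))
   ((relabel C (%a. a) o p') +++ (relabel C (rend (A,p)) o q'))"
  using htpc_rel[OF h(1) inj(1,2)] htpc_rel[OF h(2) inj(3,4)]
   str_comp_join[OF m(1,3), folded C_def] by (rule homotopic_paths_join)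
 moreover have "strands_comp (A,p) (B,q) : BS n" "strands_comp (A,p') (B,q') : BS n" using str_comp_cl(1) m by auto
 ultimately show ?thesis unfolding e str_comp_eq C' r C_def[symmetric] by (simp add: isotopy_iff)
qed

text \<open>All pairs of representatives give one and the same class, so the union in the definition
  of \<open>diagram_comp\<close> is a single isotopy class.\<close>

lemma dia_comp_icls:
 assumes x: "(A,p) : BS n" and y: "(B,q) : BS n"
 shows "dcomp n (iclass n (A,p)) (iclass n (B,q)) = iclass n (strands_comp (A,p) (B,q))"
proof -
 have *: "iclass n (strands_comp x' y') = iclass n (strands_comp (A,p) (B,q))"
  if "x' : iclass n (A,p)" "y' : iclass n (B,q)" for x' y'
  using that str_comp_isotopic by (cases x'; cases y') (auto simp: icls_mem intro!: icls_eqI[symmetric])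
 have "dcomp n (iclass n (A,p)) (iclass n (B,q)) =
   (\<Union>x'\<in>iclass n (A,p). \<Union>y'\<in>iclass n (B,q). iclass n (strands_comp (A,p) (B,q)))"
  unfolding diagram_comp_def iclass_def[of n "strands_comp _ _", symmetric]
  by (rule SUP_cong[OF refl], rule SUP_cong[OF refl], rule *)
 thus ?thesis using icls_self[OF x] icls_self[OF y] by auto
qed

lemma dia_comp_cl: "[|X : diagrams n; Y : diagrams n|]==>dcomp n X Y : diagrams n"
 by (elim dias_cases) (auto simp: dia_comp_icls intro!: icls_dias str_comp_cl(1))

lemma lse_nds_icls:
 assumes x: "(A,p) : BS n" and y: "(B,q) : BS n"
 shows "loose_nodes n (iclass n (A,p)) (iclass n (B,q)) = card ({1..n} - rend (A,p) ` A - B)"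
proof -
 have "strands_loose n x' y' = strands_loose n (A,p) (B,q)"
  if "x' : iclass n (A,p)" "y' : iclass n (B,q)" for x' y'
  using that r_end_isotopic by (cases x'; cases y') (auto simp: icls_mem strands_loose_def isotopy_iff)
 hence "(\<Union>x'\<in>iclass n (A,p). \<Union>y'\<in>iclass n (B,q). {strands_loose n x' y'}) =
   (\<Union>x'\<in>iclass n (A,p). \<Union>y'\<in>iclass n (B,q). {strands_loose n (A,p) (B,q)})"
  by (intro SUP_cong refl arg_cong[of _ _ "%x. {x}"])
 also have "... = {strands_loose n (A,p) (B,q)}" using icls_self[OF x] icls_self[OF y] by auto
 finally show ?thesis by (simp add: loose_nodes_def strands_loose_def)
qed

lemma nomiss_icls:
 assumes "(A,p) : BS n"
 shows "nomiss n (iclass n (A,p)) <-> A = {1..n}"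
proof
 assume "nomiss n (iclass n (A,p))"
 thus "A = {1..n}" using icls_self[OF assms] unfolding no_missing_edges_def by blast
next
 assume "A = {1..n}"
 hence "B = {1..n}" if "(B,q) : iclass n (A,p)" for B q using that by (simp add: icls_mem isotopy_iff)
 thus "nomiss n (iclass n (A,p))" unfolding no_missing_edges_def by blast
qed

lemma r_end_img_full:
 assumes "({1..n},p) : BS n"
 shows "rend ({1..n},p) ` {1..n} = {1..n}"
 using r_end_inj[OF assms] right_end(2)[OF assms] by (intro endo_inj_surj) auto

text \<open>A strand is lost as soon as one factor is incomplete; the right ends of a complete
  factor exhaust all nodes. Hence diagrams with missing edges absorb products, so that they can be
  made to act as 0.\<close>

lemma nomiss_comp:
 assumes "X : diagrams n" "Y : diagrams n"
 shows "nomiss n (dcomp n X Y) <-> nomiss n X & nomiss n Y"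
proof -
 obtain A p where x: "(A,p) : BS n" "X = iclass n (A,p)" using assms(1) by (rule dias_cases)
 obtain B q where y: "(B,q) : BS n" "Y = iclass n (B,q)" using assms(2) by (rule dias_cases)
 have "nomiss n (dcomp n X Y) <-> csupp (A,p) (B,q) = {1..n}"
  unfolding x(2) y(2) dia_comp_icls[OF x(1) y(1)] str_comp_eq
  by (rule nomiss_icls) (rule str_comp_cl(1)[OF x(1) y(1), unfolded str_comp_eq])
 also have "... <-> A = {1..n} & B = {1..n}"
 proof
  assume C: "csupp (A,p) (B,q) = {1..n}"
  have CA: "csupp (A,p) (B,q)<=A" "rend (A,p) ` csupp (A,p) (B,q)<=B" unfolding csupp_def by auto
  have A: "A = {1..n}" using CA(1) BSD(1)[OF x(1)] unfolding C by (rule subset_antisym[rotated])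
  show "A = {1..n} & B = {1..n}" using A r_end_img_full[of n p] x(1) CA(2) C BSD(1)[OF y(1)] by blast
 next
  assume "A = {1..n} & B = {1..n}"
  hence A: "A = {1..n}" and B: "B = {1..n}" by auto
  show "csupp (A,p) (B,q) = {1..n}" using A B right_end(2) x(1) by (auto simp: csupp_def)
 qed
 finally show ?thesis unfolding x(2) y(2) nomiss_icls[OF x(1)] nomiss_icls[OF y(1)] .
qed

text \<open>A complete factor touches every middle node, so no power of \<open>\<epsilon>\<close>
  arises when it is multiplied.\<close>

lemma lse_nds_full:
 assumes "X : diagrams n" "Y : diagrams n" "nomiss n X | nomiss n Y"
 shows "loose_nodes n X Y = 0"
proof -
 obtain A p where x: "(A,p) : BS n" "X = iclass n (A,p)" using assms(1) by (rule dias_cases)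
 obtain B q where y: "(B,q) : BS n" "Y = iclass n (B,q)" using assms(2) by (rule dias_cases)
 show ?thesis using x(2) y(2) lse_nds_icls x(1) y(1) assms(3) nomiss_icls r_end_img_full by auto
qed

text \<open>Two reparametrizations with the same ends are joined by a straight homotopy inside the
  interval. The laws for units, inverses and subdivided paths below are special cases.\<close>

lemma htpc_reparam:
 assumes p: "path p" "pimg p<=S" and fg: "path f" "path g" "pimg f<={0..1}" "pimg g<={0..1::real}"
   "pst g = pst f" "pfin g = pfin f"
 shows "hpaths S (p o f) (p o g)"
proof (rule homotopic_paths_continuous_image[where S = "{0..1}"])
 show "hpaths {0..1} f g"
 proof (rule homotopic_paths_linear[OF fg(1,2,5,6)])
  fix t :: real assume "t : {0..1}"
  hence "f t : {0..1}" "g t : {0..1}" using fg(3,4) unfolding path_image_def by blast+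
  thus "closed_segment (f t) (g t)<={0..1}" by (intro closed_segment_subset) auto
 qed
 show "cont_on {0..1} p" using p(1) by (simp add: path_def)
 show "p : {0..1} \<rightarrow> S" using p(2) by (auto simp: path_image_def)
qed

lemma comp_linepath: "p o linepath 0 1 = p" "p o linepath 1 0 = reversepath p" "p o linepath c c = (%t. p (c::real))"
 by (simp_all add: feq linepath_def reversepath_def algebra_simps flip: distrib_right)

lemma htpc_rid:
 assumes "path p" "pimg p<=S"
 shows "hpaths S (p +++ (%t. pfin p)) p"
proof -
 have "hpaths S (p o (linepath 0 1 +++ linepath 1 1)) (p o linepath 0 1)"
  by (rule htpc_reparam[OF assms]) (simp_all add: subset_path_image_join closed_segment_eq_real_ivl)
 thus ?thesis by (simp add: path_compose_join comp_linepath pathfinish_def)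
qed

lemma htpc_lid:
 assumes "path p" "pimg p<=S"
 shows "hpaths S ((%t. pst p) +++ p) p"
proof -
 have "hpaths S (p o (linepath 0 0 +++ linepath 0 1)) (p o linepath 0 1)"
  by (rule htpc_reparam[OF assms]) (simp_all add: subset_path_image_join closed_segment_eq_real_ivl)
 thus ?thesis by (simp add: path_compose_join comp_linepath pathstart_def)
qed

lemma htpc_rinv:
 assumes "path p" "pimg p<=S"
 shows "hpaths S (p +++ reversepath p) (%t. pst p)"
proof -
 have "hpaths S (p o (linepath 0 1 +++ linepath 1 0)) (p o linepath 0 0)"
  by (rule htpc_reparam[OF assms]) (simp_all add: subset_path_image_join closed_segment_eq_real_ivl)
 thus ?thesis by (simp add: path_compose_join comp_linepath pathstart_def)
qed

lemma path_part:
 assumes "path p" "pimg p<=S" "u : {0..1}" "v : {0..1}"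
 shows "path (p o linepath u v)" "pimg (p o linepath u v)<=S"
proof -
 have sub: "pimg (linepath u v)<={0..1}" using assms(3,4) by (simp add: closed_segment_subset)
 thus "path (p o linepath u v)"
  using assms(1) unfolding path_def by (intro continuous_on_compose) (auto simp: path_image_def intro: continuous_on_subset)
 show "pimg (p o linepath u v)<=S" unfolding path_image_compose using sub assms(2) by (auto simp: path_image_def)
qed

lemma htpc_part_join:
 assumes "path p" "pimg p<=S" "u : {0..1}" "v : {0..1}" "w : {0..1}"
 shows "hpaths S ((p o linepath u v) +++ (p o linepath v w)) (p o linepath u w)"
proof -
 have "hpaths S (p o (linepath u v +++ linepath v w)) (p o linepath u w)"
  using assms(3-5) by (intro htpc_reparam[OF assms(1,2)] subset_path_image_join) (auto simp: closed_segment_subset)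
 thus ?thesis by (simp add: path_compose_join)
qed

text \<open>
  Two paths of configurations with the same end points are joined by a straight homotopy as soon as the
  difference vectors of every pair of strands never point in opposite directions; these are sufficient conditions.
\<close>

definition same_side where
 "same_side d e <-> 0 < Re d & 0 < Re e | Re d < 0 & Re e < 0 |
  0 < Im d & 0<=Im e | 0<=Im d & 0 < Im e | d = e"

lemma convex_comb_pos: "[|0 < a; 0 < b; 0<=s; s<=1|]==>0 < (1 - s) * a + s * (b::real)"
 by (cases "s = 0") (auto intro: add_nonneg_pos)

lemma same_side_segment:
 assumes "same_side d e" "d~=0" "e~=0" "0<=s" "s<=1"
 shows "of_real (1 - s) * d + of_real s * e~=0"
proof
 assume "of_real (1 - s) * d + of_real s * e = 0"
 hence z: "(1 - s) * Re d + s * Re e = 0" "(1 - s) * Im d + s * Im e = 0" by (auto simp: complex_eq_iff)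
 note pos = convex_comb_pos[OF _ _ assms(4,5)]
 consider "0 < Re d & 0 < Re e" | "Re d < 0 & Re e < 0" | "0 < Im d & 0<=Im e" | "0<=Im d & 0 < Im e" | "d = e"
  using assms(1) by (auto simp: same_side_def)
 thus False
 proof cases
  case 1 thus False using pos[of "Re d" "Re e"] z by simp
 next
  case 2 thus False using pos[of "- Re d" "- Re e"] z by (simp add: algebra_simps)
 next
  case 3
  have "(1 - s) * Im d >= 0" "s * Im e >= 0" using 3 assms(4,5) by auto
  hence "(1 - s) * Im d = 0" "s * Im e = 0" using z(2) by linarith+
  hence "s = 1" using 3 by auto
  thus False using z assms(3) by (auto simp: complex_eq_iff)
 next
  case 4
  have "(1 - s) * Im d >= 0" "s * Im e >= 0" using 4 assms(4,5) by auto
  hence "(1 - s) * Im d = 0" "s * Im e = 0" using z(2) by linarith+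
  hence "s = 0" using 4 by auto
  thus False using z assms(2) by (auto simp: complex_eq_iff)
 next
  case 5
  thus False using z assms(2) by (auto simp: complex_eq_iff algebra_simps)
 qed
qed

lemma conf_memberI:
 assumes "!!a. a : A==>1/2 < Re (z a) & Re (z a) < real n + 1/2" "!!a. a ~: A==>z a = undefined"
  "!!a b. [|a : A; b : A; a < b|]==>z b - z a~=0"
 shows "z : conf n A"
proof -
 have "inj_on z A"
 proof (rule inj_onI)
  fix a b assume "a : A" "b : A" "z a = z b"
  thus "a = b" using assms(3)[of a b] assms(3)[of b a] by (cases a b rule: linorder_cases) auto
 qed
 moreover have "z : A \<rightarrow>\<^sub>E strip n" using assms(1,2) by (auto simp: PiE_iff strip_def extensional_def)
 ultimately show ?thesis by (simp add: conf_def)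
qed

lemma conf_strip: "[|z : conf n A; a : A|]==>1/2 < Re (z a) & Re (z a) < real n + 1/2"
 by (auto simp: conf_def PiE_iff strip_def)

lemma conf_distinct: "[|z : conf n A; a : A; b : A; a~=b|]==>z b - z a~=0" by (auto simp: conf_def inj_on_def)

lemma conf_undefined: "[|z : conf n A; a ~: A|]==>z a = undefined" by (auto simp: conf_def PiE_iff extensional_def)

text \<open>In the straight homotopy the strip is no obstacle, being convex, and \<open>side\<close>
  keeps every two strands apart. The disjunction in \<open>side\<close> lets each pair be treated in
  whichever order suits.\<close>

lemma htpc_conf_lin:
 assumes p: "path p" "pimg p <= conf n A" and q: "path q" "pimg q <= conf n A"
  and ends: "pst p = pst q" "pfin p = pfin q"
  and side: "!!t a b. [|t : {0..1}; a : A; b : A; a~=b|]==>same_side (p t b - p t a) (q t b - q t a) | same_side (p t a - p t b) (q t a - q t b)"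
 shows "hpaths (conf n A) p q"
proof -
 define H where "H = (%x::real \<times> real. restrict (%a. of_real (1 - fst x) * p (snd x) a + of_real (fst x) * q (snd x) a) A)"
 have pc: "p t : conf n A" "q t : conf n A" if "t : {0..1}" for t
  using p(2) q(2) that unfolding path_image_def by blast+
 have cont: "cont_on ({0..1} \<times> {0..1}) H"
 proof (rule continuous_on_coordinatewise_then_product)
  fix a
  show "cont_on ({0..1} \<times> {0..1}) (%x. H x a)"
  proof (cases "a : A")
   case True
   have "cont_on {0..1} (%t. p t a)" "cont_on {0..1} (%t. q t a)"
    using continuous_on_product_then_coordinatewise[OF p(1)[unfolded path_def]]
     continuous_on_product_then_coordinatewise[OF q(1)[unfolded path_def]] .
   hence "cont_on ({0..1} \<times> {0..1}) (%x::real \<times> real. p (snd x) a)" "cont_on ({0..1} \<times> {0..1}) (%x::real \<times> real. q (snd x) a)"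
    by (auto elim!: continuous_on_compose2 intro: continuous_on_snd continuous_on_id)
   thus ?thesis using True by (simp add: H_def) (intro continuous_intros)
  qed (simp add: H_def)
 qed
 have mem: "H (s,t) : conf n A" if st: "s : {0..1}" "t : {0..1}" for s t
 proof (rule conf_memberI)
  fix a assume a: "a : A"
  have e: "Re (H (s,t) a) = (1 - s) * Re (p t a) + s * Re (q t a)" using a by (simp add: H_def)
  have "1/2 < Re (p t a) & Re (p t a) < real n + 1/2" "1/2 < Re (q t a) & Re (q t a) < real n + 1/2"
   using conf_strip[OF pc(1)[OF st(2)] a] conf_strip[OF pc(2)[OF st(2)] a] .
  hence "0 < (1 - s) * (Re (p t a) - 1/2) + s * (Re (q t a) - 1/2)"
    "0 < (1 - s) * (real n + 1/2 - Re (p t a)) + s * (real n + 1/2 - Re (q t a))"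
   using st by (auto intro!: convex_comb_pos)
  thus "1/2 < Re (H (s,t) a) & Re (H (s,t) a) < real n + 1/2"
   unfolding e by (simp add: algebra_simps diff_divide_distrib)
 next
  fix a b assume ab: "a : A" "b : A" "a < b"
  have e: "H (s,t) b - H (s,t) a = of_real (1 - s) * (p t b - p t a) + of_real s * (q t b - q t a)"
   using ab by (simp add: H_def algebra_simps)
  have e': "H (s,t) b - H (s,t) a = - (of_real (1 - s) * (p t a - p t b) + of_real s * (q t a - q t b))"
   using ab by (simp add: H_def algebra_simps)
  have nz: "p t b - p t a~=0" "q t b - q t a~=0" "p t a - p t b~=0" "q t a - q t b~=0"
   using conf_distinct[OF pc(1)[OF st(2)] ab(1,2)] conf_distinct[OF pc(2)[OF st(2)] ab(1,2)]
    conf_distinct[OF pc(1)[OF st(2)] ab(2,1)] conf_distinct[OF pc(2)[OF st(2)] ab(2,1)] ab(3) by simp_all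
  have "a~=b" using ab by simp
  from side[OF st(2) ab(1,2) this] consider "same_side (p t b - p t a) (q t b - q t a)" | "same_side (p t a - p t b) (q t a - q t b)" by blast
  thus "H (s,t) b - H (s,t) a~=0"
  proof cases
   case 1
   thus ?thesis unfolding e using nz st by (intro same_side_segment) auto
  next
   case 2
   thus ?thesis unfolding e' neg_equal_0_iff_equal using nz st by (intro same_side_segment) auto
  qed
 qed (simp add: H_def)
 have restr: "restrict z A = z" if "z : conf n A" for z using that by (auto simp: conf_def PiE_iff extensional_restrict)
 show ?thesis unfolding homotopic_paths
 proof (intro exI[of _ H] conjI ballI)
  show "H : {0..1} \<times> {0..1} \<rightarrow> conf n A" using mem by auto
  fix t :: real assume t: "t : {0..1}"
  show "H (0,t) = p t" using restr[OF pc(1)[OF t]] by (simp add: H_def)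
  show "H (1,t) = q t" using restr[OF pc(2)[OF t]] by (simp add: H_def)
  have "of_real (1 - t) * c + of_real t * c = c" for c :: complex by (simp add: algebra_simps)
  thus "pst (H o Pair t) = pst p" "pfin (H o Pair t) = pfin p"
   using ends restr[OF pc(1), of 0] restr[OF pc(1), of 1] by (simp_all add: H_def pathstart_def pathfinish_def)
 qed (rule cont)
qed

lemma path_confI:
 assumes "!!a. a : A ==> cont_on {0..1} (%t. p t a)" "!!t. t : {0..1}==>p t : conf n A"
 shows "path p" "pimg p <= conf n A"
proof -
 have "cont_on {0..1} (%t. p t a)" for a
 proof (cases "a : A")
  case False
  hence "p t a = undefined" if "t : {0..1}" for t using conf_undefined[OF assms(2)[OF that]] by blast
  hence "cont_on {0..1} (%t. p t a) <-> cont_on {0..1} (%t::real. undefined::complex)"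
   by (intro continuous_on_cong) auto
  thus ?thesis by simp
 qed (rule assms(1))
 thus "path p" unfolding path_def by (rule continuous_on_coordinatewise_then_product)
 show "pimg p <= conf n A" using assms(2) by (auto simp: path_image_def)
qed

section \<open>The braid group\<close>

definition braids where
 "braids n = {p. ({1..n},p) : BS n}"

definition bclass where
 "bclass n p = iclass n ({1..n},p)"

definition fdias where
 "fdias n = {X : diagrams n. nomiss n X}"

definition bend where
 "bend n p = rend ({1..n},p)"

abbreviation rlab :: "nat=>(nat=>nat)=>(real=>nat => complex)=>real=>nat => complex" where
 "rlab n r p == relabel {1..n} r o p"

text \<open>\<open>strands_comp\<close> for complete diagrams. Relabelling by the identity changes
  nothing on configurations, and \<open>bcomp_hom\<close> removes it up to homotopy.\<close>

definition bcomp where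
 "bcomp n p q = rlab n (%a. a) p +++ rlab n (bend n p) q"

definition stdc :: "nat=>nat => complex" where
 "stdc n = restrict of_nat {1..n}"

abbreviation bhom :: "nat=>(real=>nat => complex)=>(real=>nat => complex)=>bool" where
 "bhom n == hpaths (conf n {1..n})"

lemma braidsD:
 assumes "p : braids n"
 shows "path p" "pimg p <= conf n {1..n}" "pst p = stdc n"
 using BSD[of "{1..n}" p n] assms by (auto simp: braids_def stdc_def)

lemma braidsI:
 assumes "path p" "pimg p <= conf n {1..n}" "pst p = stdc n"
  "!!a. a : {1..n}==>pfin p a = of_nat (r a)" "r ` {1..n}<={1..n}"
 shows "p : braids n" "!!a. a : {1..n}==>bend n p a = r a"
 using assms(4) assms(5) assms(1-3) r_end_eqI by (auto simp: braids_def braided_strands_def stdc_def bend_def)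

lemma bend:
 assumes "p : braids n" "a : {1..n}"
 shows "pfin p a = of_nat (bend n p a)" "bend n p a : {1..n}"
 using right_end[of "{1..n}" p n a] assms by (auto simp: braids_def bend_def)

lemma bend_bij:
 assumes "p : braids n"
 shows "inj_on (bend n p) {1..n}" "bend n p ` {1..n} = {1..n}"
 using r_end_inj[of "{1..n}" p n] r_end_img_full[of n p] assms by (auto simp: braids_def bend_def)

lemma pathfinish_br:
 assumes "p : braids n"
 shows "pfin p = restrict (%a. of_nat (bend n p a)) {1..n}" using braidsD(2) assms bend(1) conf_undefined by fastforce

lemma fdias_cases:
 assumes "X : fdias n"
 obtains p where "p : braids n" "X = bclass n p"
proof -
 have "X : diagrams n" using assms by (simp add: fdias_def)
 then obtain A p where x: "(A,p) : BS n" "X = iclass n (A,p)" by (rule dias_cases)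
 moreover have "A = {1..n}" using assms nomiss_icls[OF x(1)] x(2) by (simp add: fdias_def)
 ultimately show thesis using that by (auto simp: braids_def bclass_def)
qed

lemma bclass_full: "p : braids n==>bclass n p : fdias n"
 using icls_dias nomiss_icls by (auto simp: braids_def bclass_def fdias_def)

lemma bclass_eq_iff: "[|p : braids n; q : braids n|]==>bclass n p = bclass n q <-> bhom n p q"
 using icls_eq_iff[of "({1..n},p)" n "({1..n},q)"] by (simp add: braids_def bclass_def isotopy_iff)

lemma str_comp_full:
 assumes "p : braids n"
 shows "strands_comp ({1..n},p) ({1..n},q) = ({1..n},bcomp n p q)"
  "csupp ({1..n},p) ({1..n},q) = {1..n}"
proof -
 show C: "csupp ({1..n},p) ({1..n},q) = {1..n}" using bend(2)[OF assms] unfolding csupp_def bend_def fst_conv by blast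
 show "strands_comp ({1..n},p) ({1..n},q) = ({1..n},bcomp n p q)" unfolding str_comp_eq C bcomp_def bend_def ..
qed

lemma bcomp:
 assumes "p : braids n" "q : braids n"
 shows "bcomp n p q : braids n" "!!a. a : {1..n}==>bend n (bcomp n p q) a = bend n q (bend n p a)"
  "dcomp n (bclass n p) (bclass n q) = bclass n (bcomp n p q)"
proof -
 have b: "({1..n},p) : BS n" "({1..n},q) : BS n" using assms by (auto simp: braids_def)
 show "bcomp n p q : braids n" using str_comp_cl(1)[OF b] str_comp_full(1)[OF assms(1)] by (simp add: braids_def)
 show "bend n (bcomp n p q) a = bend n q (bend n p a)" if "a : {1..n}" for a
  using str_comp_cl(2)[OF b, unfolded str_comp_full[OF assms(1)], OF that] by (simp add: bend_def)
 show "dcomp n (bclass n p) (bclass n q) = bclass n (bcomp n p q)"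
  unfolding bclass_def dia_comp_icls[OF b] str_comp_full(1)[OF assms(1)] ..
qed

lemma rlab_path:
 assumes "path p" "pimg p <= conf n {1..n}" "inj_on r {1..n}" "r ` {1..n}<={1..n}"
 shows "path (rlab n r p)" "pimg (rlab n r p) <= conf n {1..n}" using path_rel[OF assms] .

lemma rlab_rlab:
 assumes "r ` {1..n}<={1..n}"
 shows "rlab n r (rlab n s p) = rlab n (s o r) p" using rel_rel[OF assms] by (simp add: feq)

lemma rlab_cong: "(!!a. a : {1..n}==>r a = s a)==>rlab n r p = rlab n s p" by (auto simp: feq relabel_def)

lemma rlab_join: "rlab n r (p +++ q) = rlab n r p +++ rlab n r q" by (rule path_compose_join)

lemma rlab_self:
 assumes "path p" "pimg p <= conf n {1..n}"
 shows "bhom n (rlab n (%a. a) p) p"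
proof (rule homotopic_paths_sym, rule homotopic_paths_eq[OF assms])
 fix t :: real assume "t : {0..1}"
 hence "p t : conf n {1..n}" using assms(2) by (auto simp: path_image_def)
 thus "p t = rlab n (%a. a) p t" by (simp add: rel_self)
qed

lemma rlab_start: "pst (rlab n r q) = relabel {1..n} r (pst q)"
 "pfin (rlab n r q) = relabel {1..n} r (pfin q)" by (simp_all add: pathstart_compose pathfinish_compose)

lemma bcomp_join:
 assumes "p : braids n" "pst q = stdc n"
 shows "pfin p = pst (rlab n (bend n p) q)" unfolding rlab_start assms(2) pathfinish_br[OF assms(1)]
 using bend(2)[OF assms(1)] by (auto simp: relabel_def stdc_def feq restrict_def)

lemma bcomp_hom:
 assumes "p : braids n" "q : braids n"
 shows "bhom n (bcomp n p q) (p +++ rlab n (bend n p) q)"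
 by (auto simp: bcomp_def homotopic_paths_join rlab_self braidsD(1,2)[OF assms(1)] rlab_path braidsD(1,2)[OF assms(2)] bend_bij[OF assms(1)] bcomp_join[OF assms(1) braidsD(3)[OF assms(2)], symmetric] rlab_start(2) rel_self[OF subsetD[OF braidsD(2)[OF assms(1)] pathfinish_in_path_image]])

lemma bcomp_assoc:
 assumes p: "p : braids n" and q: "q : braids n" and s: "s : braids n"
 shows "bhom n (bcomp n (bcomp n p q) s) (bcomp n p (bcomp n q s))"
proof -
 let ?q = "rlab n (bend n p) q" and ?s = "rlab n (bend n q) s"
 let ?s' = "rlab n (bend n p) ?s"
 note P = braidsD(1,2)[OF p] and Q = braidsD(1,2)[OF q] and S = braidsD(1,2)[OF s]
 note ip = bend_bij[OF p] and iq = bend_bij[OF q]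
 have Q': "path ?q" "pimg ?q <= conf n {1..n}" using rlab_path[OF Q ip(1)] ip(2) by simp_all
 have S'': "path ?s'" "pimg ?s' <= conf n {1..n}" by (auto simp: rlab_path ip(1) ip(2) S iq(1) iq(2))
 have pq: "bcomp n p q : braids n" and qs: "bcomp n q s : braids n" using bcomp(1) p q s by auto
 have e: "rlab n (bend n (bcomp n p q)) s = ?s'"
  unfolding rlab_rlab[OF eq_refl[OF ip(2)]] by (rule rlab_cong) (simp add: bcomp(2)[OF p q])
 have j1: "pfin p = pst ?q" by (rule bcomp_join[OF p braidsD(3)[OF q]])
 have j2: "pfin ?q = pst ?s'"
  unfolding rlab_start(1)[of n "bend n p"] bcomp_join[OF q braidsD(3)[OF s], symmetric] rlab_start(2) ..
 have "bhom n (bcomp n (bcomp n p q) s) (bcomp n p q +++ ?s')" using bcomp_hom[OF pq s] unfolding e .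
 also have "bhom n ... ((p +++ ?q) +++ ?s')"
 using homotopic_paths_join[OF bcomp_hom[OF p q]] S'' bcomp_join pq braidsD(3)[OF s] e by auto
 also have "bhom n ... (p +++ (?q +++ ?s'))"
  using homotopic_paths_assoc[OF P Q' S'' j1 j2] by (rule homotopic_paths_sym)
 also have "bhom n ... (p +++ rlab n (bend n p) (bcomp n q s))"
 proof (rule homotopic_paths_join)
  show "bhom n p p" using P by simp
  show "bhom n (?q +++ ?s') (rlab n (bend n p) (bcomp n q s))" unfolding rlab_join[symmetric]
   using htpc_rel[OF homotopic_paths_sym[OF bcomp_hom[OF q s]] ip(1) eq_refl[OF ip(2)]] .
 qed (use j1 in simp)
 also have "bhom n ... (bcomp n p (bcomp n q s))" using bcomp_hom[OF p qs] by (rule homotopic_paths_sym)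
 finally show ?thesis .
qed

lemma stdc_conf: "stdc n : conf n {1..n}" by (rule conf_memberI) (auto simp: stdc_def)

lemma const_br: "(%t. stdc n) : braids n" "a : {1..n}==>bend n (%t. stdc n) a = a"
 using braidsI[of "%t. stdc n" n "%a. a"] stdc_conf[of n]
 by (auto simp: path_def path_image_def pathstart_def pathfinish_def stdc_def)

lemma ident_bclass: "idd n = bclass n (%t. stdc n)" by (simp add: identity_diagram_def bclass_def iclass_def stdc_def)

lemma bcomp_const_l:
 assumes "p : braids n"
 shows "bhom n (bcomp n (%t. stdc n) p) p"
proof -
 have "bhom n (bcomp n (%t. stdc n) p) ((%t. stdc n) +++ rlab n (bend n (%t. stdc n)) p)"
  by (rule bcomp_hom[OF const_br(1) assms])
 also have "rlab n (bend n (%t. stdc n)) p = rlab n (%a. a) p" by (rule rlab_cong) (rule const_br(2))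
 also have "bhom n ((%t. stdc n) +++ rlab n (%a. a) p) ((%t. stdc n) +++ p)"
  using rlab_self[OF braidsD(1,2)[OF assms]] braidsD(1,2)[OF const_br(1)[of n]] braidsD(3)[OF assms]
  by (intro homotopic_paths_join) (auto simp: rlab_start pathfinish_def rel_self[OF stdc_conf])
 also have "bhom n ... p" using htpc_lid[OF braidsD(1,2)[OF assms]] braidsD(3)[OF assms] by simp
 finally show ?thesis .
qed

lemma bcomp_const_r:
 assumes "p : braids n"
 shows "bhom n (bcomp n p (%t. stdc n)) p"
 using bcomp_join assms homotopic_paths_trans[OF bcomp_hom[OF assms const_br(1)]] htpc_rid[OF braidsD(1,2)[OF assms]] by (auto simp: pathstart_def)

text \<open>The inverse is the reversed path, with the strands renamed so that they start at the
  standard nodes.\<close>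

lemma br_inv:
 assumes p: "p : braids n"
 obtains q where "q : braids n" "bhom n (bcomp n p q) (%t. stdc n)"
proof -
 define s where "s = inv_into {1..n} (bend n p)"
 define q where "q = rlab n s (reversepath p)"
 note b = bend_bij[OF p]
 have s: "inj_on s {1..n}" "s ` {1..n} = {1..n}" "!!a. a : {1..n}==>bend n p (s a) = a" "!!a. a : {1..n}==>s (bend n p a) = a"
  using inj_on_inv_into[of "{1..n}" "bend n p" "{1..n}"] inv_into_image_cancel[OF b(1), of "{1..n}"] b
   f_inv_into_f[of _ "bend n p" "{1..n}"] inv_into_f_f[OF b(1)] by (simp_all add: s_def)
 note P = braidsD(1,2)[OF p]
 have R: "path (reversepath p)" "pimg (reversepath p) <= conf n {1..n}" using P by simp_all
 have Q: "path q" "pimg q <= conf n {1..n}" using rlab_path[OF R s(1)] s(2) by (simp_all add: q_def)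
 have q: "q : braids n"
 proof (rule braidsI(1)[OF Q])
  have sa: "s a : {1..n}" if "a : {1..n}" for a using s(2) that by blast
  show "pst q = stdc n" unfolding q_def rlab_start pathstart_reversepath pathfinish_br[OF p]
   using s(3) sa by (auto simp: relabel_def stdc_def feq restrict_def)
  show "pfin q a = of_nat (s a)" if "a : {1..n}" for a
   unfolding q_def rlab_start pathfinish_reversepath braidsD(3)[OF p]
   using sa[OF that] that by (simp add: relabel_def stdc_def)
  show "s ` {1..n}<={1..n}" using s(2) by simp
 qed
 have "rlab n (bend n p) q = rlab n (%a. a) (reversepath p)"
  unfolding q_def rlab_rlab[OF eq_refl[OF b(2)]] by (rule rlab_cong) (simp add: s(4))
 hence "bhom n (bcomp n p q) (p +++ rlab n (%a. a) (reversepath p))" using bcomp_hom[OF p q] by simp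
 also have "bhom n ... (p +++ reversepath p)"
 proof (rule homotopic_paths_join)
  show "pfin p = pst (rlab n (%a. a) (reversepath p))" using rlab_start rel_self P(2) by auto
 qed (use P rlab_self[OF R] in simp_all)
 also have "bhom n ... (%t. stdc n)" using htpc_rinv[OF P] braidsD(3)[OF p] by simp
 finally show thesis using that q by blast
qed

definition bgrp where
 "bgrp n = \<lparr>carrier = fdias n,monoid.mult = dcomp n,one = idd n\<rparr>"

lemma bgrp_simps [simp]:
 "car (bgrp n) = fdias n"
 "mult (bgrp n) = dcomp n"
 "one (bgrp n) = idd n" by (simp_all add: bgrp_def)

lemma bclass_eqI: "[|p : braids n; q : braids n; bhom n p q|]==>bclass n p = bclass n q" by (simp add: bclass_eq_iff)

lemma grp_bgrp: "group (bgrp n)"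
proof -
 have closed: "dcomp n X Y : fdias n" if "X : fdias n" "Y : fdias n" for X Y
  using that by (elim fdias_cases) (simp add: bcomp bclass_full)
 have one: "idd n : fdias n" by (simp add: ident_bclass bclass_full const_br)
 have assoc: "dcomp n (dcomp n X Y) Z = dcomp n X (dcomp n Y Z)"
  if XYZ: "X : fdias n" "Y : fdias n" "Z : fdias n" for X Y Z
 by (smt (verit) XYZ(1) fdias_cases XYZ(2) XYZ(3) bcomp_assoc bcomp bclass_eqI)
 have l: "dcomp n (idd n) X = X" "dcomp n X (idd n) = X"
  if X: "X : fdias n" for X
 proof -
  obtain p where p: "p : braids n" "X = bclass n p" using X by (rule fdias_cases)
  show "dcomp n (idd n) X = X" "dcomp n X (idd n) = X"
   unfolding p(2) ident_bclass using p(1) const_br[of n] bcomp_const_l[OF p(1)] bcomp_const_r[OF p(1)]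
   by (simp_all add: bcomp bclass_eqI)
 qed
 have inv: "EX Y : fdias n. dcomp n X Y = idd n" if X: "X : fdias n" for X
 by (metis X fdias_cases br_inv ident_bclass const_br bcomp bclass_eqI bclass_full)
 show ?thesis
 proof (rule groupI; simp)
  fix X assume X: "X : fdias n"
  obtain Y where Y: "Y : fdias n" "dcomp n X Y = idd n" using inv[OF X] by blast
  \<comment> \<open>Only right inverses have been constructed; the right inverse of the right
    inverse shows that they are left inverses as well.\<close>
  obtain Z where Z: "Z : fdias n" "dcomp n Y Z = idd n" using inv[OF Y(1)] by blast
  show "EX Y:fdias n. dcomp n Y X = idd n" using Y(1) Z(2) l(1) Z(1) Y(2) assoc[OF X Y(1) Z(1)] l(2)[OF X] by auto
 qed (use closed one assoc l in simp_all)
qed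

text \<open>The permutation braid of \<open>w\<close>. The factor \<open>t * (1 - t)\<close> lifts
  the strands to heights ordered by their left nodes, so they stay apart when their real parts meet,
  and all crossings have the same sign. The end points are given by the inverse of \<open>w\<close>;
  this makes transport along the path the action of \<open>w\<close> itself.\<close>

definition cpath where
 "cpath n w t = restrict (%a. Complex ((1 - t) * real a + t * real (pinv w a)) (real a * (t * (1 - t)))) {1..n}"

lemma cpath_Re: "a : {1..n}==>Re (cpath n w t a) = (1 - t) * real a + t * real (pinv w a)"
 and crossing_path_Im: "a : {1..n}==>Im (cpath n w t a) = real a * (t * (1 - t))" by (simp_all add: cpath_def)

lemma interval_comb:
 assumes "real a : {1..real n}" "real b : {1..real n}" "t : {0..1}"
 shows "1/2 < (1 - t) * real a + t * real b" "(1 - t) * real a + t * real b < real n + 1/2"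
proof -
 have "0 < (1 - t) * (real a - 1/2) + t * (real b - 1/2)" "0 < (1 - t) * (real n + 1/2 - real a) + t * (real n + 1/2 - real b)"
  using assms by (auto intro!: convex_comb_pos)
 thus "1/2 < (1 - t) * real a + t * real b" "(1 - t) * real a + t * real b < real n + 1/2"
  by (simp_all add: algebra_simps diff_divide_distrib)
qed

lemma pinv_range:
 assumes "w permutes {1..n::nat}" "a : {1..n}"
 shows "pinv w a : {1..n}" using permutes_in_image[OF permutes_inv[OF assms(1)], of a] assms(2) by blast

lemma pinv_inj: "[|w permutes {1..n::nat}; pinv w a = pinv w b|]==>a = b"
 by (erule injD[OF permutes_inj[OF permutes_inv]])

lemma Im_profile_pos: "[|t : {0..1}; t~=0; t~=1; a < b|]==>real a * (t * (1 - t)) < real b * (t * (1 - t))"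
 by (intro mult_strict_right_mono mult_pos_pos) auto

lemma cpath_conf:
 assumes w: "w permutes {1..n}" and t: "t : {0..1}"
 shows "cpath n w t : conf n {1..n}"
proof (rule conf_memberI)
 fix a assume a: "a : {1..n}"
 thus "1/2 < Re (cpath n w t a) & Re (cpath n w t a) < real n + 1/2"
  using interval_comb[of a n "pinv w a" t] pinv_range[OF w a] t by (simp add: cpath_Re)
next
 fix a b assume ab: "a : {1..n}" "b : {1..n}" "a < b"
 consider "t = 0" | "t = 1" | "t~=0" "t~=1" by blast
 thus "cpath n w t b - cpath n w t a~=0"
 proof cases
  case 1
  thus ?thesis using ab by (simp add: cpath_def complex_eq_iff)
 next
  case 2
  thus ?thesis using ab pinv_inj[OF w, of a b] by (auto simp: cpath_def complex_eq_iff)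
 next
  case 3
  thus ?thesis using Im_profile_pos[OF t 3 ab(3)] ab by (auto simp: cpath_def complex_eq_iff)
 qed
qed (auto simp: cpath_def)

lemma cpath_start: "cpath n w 0 = stdc n" by (rule ext) (auto simp: cpath_def stdc_def complex_eq_iff restrict_def)

lemma cpath_finish: "a : {1..n} ==> cpath n w 1 a = of_nat (pinv w a)" by (simp add: cpath_def complex_eq_iff)

lemma cpath_br:
 assumes w: "w permutes {1..n}"
 shows "cpath n w : braids n" "!!a. a : {1..n}==>bend n (cpath n w) a = pinv w a"
proof -
 have c: "cont_on {0..1} (%t. cpath n w t a)" if "a : {1..n}" for a
  using that by (simp add: cpath_def Complex_eq) (intro continuous_intros)
 note p = path_confI[OF c cpath_conf[OF w]]
 show "cpath n w : braids n" "!!a. a : {1..n}==>bend n (cpath n w) a = pinv w a"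
  using braidsI[OF p, where r = "pinv w"] pinv_range[OF w] cpath_start[of n w] cpath_finish[of _ n w]
  by (auto simp: pathstart_def pathfinish_def image_subset_iff)
qed

lemma rank_rel:
 assumes z: "inj_on z {1..n}" and r: "inj_on r {1..n}" "r ` {1..n} = {1..n}" and a: "a : {1..n}"
 shows "rank n (relabel {1..n} r z) a = rank n z (r a)"
proof -
 define w where "w a = (if a : {1..n} then rank n z (r a) else a)" for a
 have rr: "r a : {1..n}" if "a : {1..n}" for a using r(2) that by blast
 have "bij_betw (rank n z o r) {1..n} {1..n}" by (metis permutes_imp_bij rank(1) z bij_betw_trans r bij_betw_def)
 hence "bij_betw w {1..n} {1..n}" by (rule bij_betw_cong[THEN iffD1, rotated]) (simp add: w_def)
 hence "w permutes {1..n}" by (rule bij_imp_permutes) (auto simp: w_def)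
 hence "rank n (relabel {1..n} r z) = w"
 proof (rule rank_eqI)
  fix a b assume "a : {1..n}" "b : {1..n}"
  thus "w a < w b <-> before (relabel {1..n} r z) a b"
   using rank(2)[OF z rr rr] by (simp add: w_def before_def relabel_def)
 qed
 thus ?thesis using a by (simp add: w_def)
qed

text \<open>Renaming the points multiplies both ranks by the same permutation, which drops out.
  Transport is therefore insensitive to the relabelling inside compositions.\<close>

lemma ochg_rel:
 assumes z: "inj_on z {1..n}" "inj_on z' {1..n}" and r: "inj_on r {1..n}" "r ` {1..n} = {1..n}"
 shows "ochg n (relabel {1..n} r z) (relabel {1..n} r z') = ochg n z z'"
proof -
 have inj: "inj_on (relabel {1..n} r y) {1..n}" if "inj_on y {1..n}" for y
 proof (rule inj_onI)
  fix a b assume ab: "a : {1..n}" "b : {1..n}" and eq: "relabel {1..n} r y a = relabel {1..n} r y b"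
  have "y (r a) = y (r b)" using eq ab by (simp add: relabel_def)
  moreover have "r a : {1..n}" "r b : {1..n}" using r(2) ab by blast+
  ultimately have "r a = r b" by (rule inj_onD[OF that])
  thus "a = b" using ab by (rule inj_onD[OF r(1)])
 qed
 note p = rank(1)[OF z(1)] rank(1)[OF z(2)] and p' = rank(1)[OF inj[OF z(1)]] rank(1)[OF inj[OF z(2)]]
 show ?thesis
 proof
  fix i
  show "ochg n (relabel {1..n} r z) (relabel {1..n} r z') i = ochg n z z' i"
  proof (cases "i : {1..n}")
   case True
   define a where "a = pinv (rank n (relabel {1..n} r z')) i"
   have a: "a : {1..n}" "rank n (relabel {1..n} r z') a = i"
    using pinv_range[OF p'(2) True] permutes_inverses(1)[OF p'(2)] by (simp_all add: a_def)
   hence "i = rank n z' (r a)" using rank_rel[OF z(2) r] by simp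
   hence "pinv (rank n z') i = r a" using permutes_inverses(2)[OF p(2), of "r a"] by simp
   thus ?thesis using rank_rel[OF z(1) r a(1)] by (simp add: ochg_def a_def)
  next
   case False
   thus ?thesis using permutes_not_in[OF ochg_perm[OF inj[OF z(1)] inj[OF z(2)]]]
     permutes_not_in[OF ochg_perm[OF z]] by simp
  qed
 qed
qed

lemma path_tr_rlab:
 assumes p: "pimg p <= conf n {1..n}" and r: "inj_on r {1..n}" "r ` {1..n} = {1..n}" and t: "path_tr n p x y"
 shows "path_tr n (rlab n r p) x y"
proof -
 obtain Ph where Ph: "conf_cpt n p {0..1} Ph" "Ph 0 = x" "Ph 1 = y" using t by (auto simp: path_tr_def)
 have inj: "inj_on (p t) {1..n}" if "t : {0..1}" for t using p that conf_inj by (fastforce simp: path_image_def)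
 have "conf_cpt n (rlab n r p) {0..1} Ph" unfolding conf_cpt_def
 proof (intro conjI ballI)
  show "Ph : {0..1} \<rightarrow> bfracs n" using Ph(1) by (simp add: conf_cpt_def)
  fix t :: real assume t: "t : {0..1}"
  have "\<forall>\<^sub>F s in at t within {0..1}. s : {0..1}"
   unfolding eventually_at_topological by (intro exI[of _ UNIV]) auto
  moreover have "\<forall>\<^sub>F s in at t within {0..1}. Ph s = frac_act n (ochg n (p t) (p s)) (Ph t)"
   using Ph(1) t by (simp add: conf_cpt_def)
  ultimately show "\<forall>\<^sub>F s in at t within {0..1}. Ph s = frac_act n (ochg n (rlab n r p t) (rlab n r p s)) (Ph t)"
   by eventually_elim (simp add: ochg_rel[OF inj[OF t] inj r])
 qed
 thus ?thesis using Ph by (auto simp: path_tr_def)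
qed

lemma rank_stdc: "rank n (stdc n) = id" by (rule rank_eqI) (auto simp: before_def stdc_def permutes_id)

text \<open>Transport directly from time 0 is flat along the whole path and not only near 0: points
  with equal real parts lie above each other in the order of their starting points, so
  \<open>adapted\<close> always holds.\<close>

lemma path_tr_simple:
 assumes w: "w permutes {1..n}" and x: "x : bfracs n"
 shows "path_tr n (cpath n w) x (frac_act n w x)"
proof -
 let ?p = "cpath n w"
 have p: "cont_on {0..1} ?p" using braidsD[OF cpath_br(1)[OF w]] by (simp add: path_def)
 have inj: "inj_on (?p t) {1..n}" if "t : {0..1}" for t using cpath_conf[OF w that] by (rule conf_inj)
 define Ph where "Ph t = frac_act n (ochg n (?p 0) (?p t)) x" for t
 note e0 = cpath_start[of n w]
 have inj0: "inj_on (?p 0) {1..n}" by (rule inj) simp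
 have 1: "Ph 1 = frac_act n w x"
   using rank_eqI permutes_inv[OF w] e0 rank_stdc permutes_inv_inv[OF w] by (auto simp: Ph_def before_def cpath_def ochg_def)
 have 0: "Ph 0 = x" by (simp add: Ph_def ochg_refl[OF inj0] fact_id[OF x])
 have "conf_cpt n ?p {0..1} Ph" unfolding conf_cpt_def
 proof (intro conjI ballI)
  show "Ph : {0..1} \<rightarrow> bfracs n" unfolding Ph_def using fact_cl[OF ochg_perm[OF inj0 inj] x] by blast
  fix t :: real assume t: "t : {0..1}"
  have ad: "adapted n (?p 0) (?p t)" unfolding adapted_def
  proof (intro ballI impI)
   fix a b assume ab: "a : {1..n}" "b : {1..n}" and h: "Re (?p t a) = Re (?p t b) & Im (?p t a) < Im (?p t b)"
   have "real a * (t * (1 - t)) < real b * (t * (1 - t))" using h ab by (simp add: crossing_path_Im)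
   moreover have "t * (1 - t) >= 0" using t by simp
   ultimately have "real a < real b" by (simp add: mult_less_cancel_right)
   thus "before (?p 0) a b" using ab by (simp add: before_def e0 stdc_def)
  qed
  have "\<forall>\<^sub>F s in at t within {0..1}. s : {0..1}"
   unfolding eventually_at_topological by (intro exI[of _ UNIV]) auto
  with ev_near_conf[OF p t, of n]
  show "\<forall>\<^sub>F s in at t within {0..1}. Ph s = frac_act n (ochg n (?p t) (?p s)) (Ph t)"
  proof eventually_elim
   case (elim s)
   have "red_pair (ochg n (?p 0) (?p t)) (ochg n (?p t) (?p s))"
    by (rule ochg_rp[OF inj0 inj[OF t] inj[OF elim(2)] ad elim(1)])
   thus ?case unfolding Ph_def
    using fact_comp[OF ochg_perm[OF inj0 inj[OF t]] ochg_perm[OF inj[OF t] inj[OF elim(2)]] _ x]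
    by (simp add: ochg_comp[OF inj[OF t]])
  qed
 qed
 thus ?thesis using 0 1 by (auto simp: path_tr_def)
qed

section \<open>Positive words as braids\<close>

fun word_path :: "nat=>(nat=>nat) list=>real=>nat => complex" where
 "word_path n [] = (%t. stdc n)"
| "word_path n (w # ws) = bcomp n (cpath n w) (word_path n ws)"

definition wbr where
 "wbr n ws = bclass n (word_path n ws)"

lemma word_path_br: "ws : bwords n==>word_path n ws : braids n" by (induction ws) (auto simp: const_br bcomp cpath_br)

lemma wbr_full: "ws : bwords n==>wbr n ws : fdias n" unfolding wbr_def by (intro bclass_full word_path_br)

lemma wbr_Nil: "wbr n [] = idd n" by (simp add: wbr_def ident_bclass)

lemma wbr_Cons:
 assumes "w permutes {1..n}" "ws : bwords n"
 shows "wbr n (w # ws) = dcomp n (bclass n (cpath n w)) (wbr n ws)"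
 using assms by (simp add: wbr_def bcomp cpath_br word_path_br)

lemma wbr_sg:
 assumes "w permutes {1..n}"
 shows "wbr n [w] = bclass n (cpath n w)"
 using wbr_Cons[OF assms, of "[]"] monoid.r_one[OF group.is_monoid[OF grp_bgrp], of "bclass n (cpath n w)" n]
  bclass_full[OF cpath_br(1)[OF assms]] by (simp add: wbr_Nil)

lemma wbr_app:
 assumes "us : bwords n" "ws : bwords n"
 shows "wbr n (us @ ws) = dcomp n (wbr n us) (wbr n ws)" using assms(1)
proof (induction us)
 case Nil
 thus ?case using monoid.l_one[OF group.is_monoid[OF grp_bgrp], of "wbr n ws" n] wbr_full[OF assms(2)]
  by (simp add: wbr_Nil)
next
 case (Cons u us)
 hence u: "u permutes {1..n}" "us : bwords n" by auto
 show ?case using Cons.IH[OF u(2)] wbr_Cons[OF u(1), of "us @ ws"] wbr_Cons[OF u] u assms(2)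
   monoid.m_assoc[OF group.is_monoid[OF grp_bgrp], of "bclass n (cpath n u)" n "wbr n us" "wbr n ws"]
   bclass_full[OF cpath_br(1)[OF u(1)]] wbr_full by simp
qed

lemma path_tr_word:
 assumes "ws : bwords n" "a : bwords n"
 shows "path_tr n (word_path n ws) (fcl n a k) (fcl n (a @ ws) k)" using assms
proof (induction ws arbitrary: a)
 case Nil
 have X: "fcl n a k : bfracs n" using Nil by (auto simp: bfracs_def)
 have "conf_cpt n (%t. stdc n) {0..1} (%t. fcl n a k)"
   by (simp add: X conf_cpt_def ochg_refl fact_id stdc_conf conf_inj)
 thus ?case by (auto simp: path_tr_def)
next
 case (Cons w ws)
 hence w: "w permutes {1..n}" "ws : bwords n" by auto
 have X: "fcl n a k : bfracs n" using Cons.prems by (auto simp: bfracs_def)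
 let ?p = "cpath n w" and ?q = "word_path n ws"
 have p: "?p : braids n" and q: "?q : braids n" using cpath_br(1)[OF w(1)] word_path_br[OF w(2)] by auto
 note P = braidsD(1,2)[OF p] and Q = braidsD(1,2)[OF q] and b = bend_bij[OF p]
 have Q': "path (rlab n (bend n ?p) ?q)" "pimg (rlab n (bend n ?p) ?q) <= conf n {1..n}"
  using rlab_path[OF Q b(1)] b(2) by simp_all
 have 1: "path_tr n ?p (fcl n a k) (fcl n (a @ [w]) k)"
  using path_tr_simple[OF w(1) X] fact_class[OF Cons.prems(2) w(1)] by simp
 have "path_tr n ?q (fcl n (a @ [w]) k) (fcl n (a @ w # ws) k)"
  using Cons.IH[OF w(2), of "a @ [w]"] Cons.prems w(1) by simp
 hence 2: "path_tr n (rlab n (bend n ?p) ?q) (fcl n (a @ [w]) k) (fcl n (a @ w # ws) k)"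
  by (rule path_tr_rlab[OF Q(2) b])
 have "path_tr n (?p +++ rlab n (bend n ?p) ?q) (fcl n a k) (fcl n (a @ w # ws) k)"
  by (rule path_tr_join[OF P Q' bcomp_join[OF p braidsD(3)[OF q]] 1 2])
 thus ?case using path_tr_htpc[OF homotopic_paths_sym[OF bcomp_hom[OF p q]]] by simp
qed

text \<open>Transport of the trivial fraction along the path of a word yields this word as a
  fraction, and transport depends only on the homotopy class. With denominator exponent 0, equality
  of fractions is equivalence of words.\<close>

theorem wbr_eqD:
 assumes "wbr n u = wbr n v" "u : bwords n" "v : bwords n"
 shows "weq n u v"
proof -
 have h: "bhom n (word_path n u) (word_path n v)"
  using assms bclass_eq_iff[OF word_path_br[OF assms(2)] word_path_br[OF assms(3)]] by (simp add: wbr_def)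
 have v: "path (word_path n v)" "pimg (word_path n v) <= conf n {1..n}"
  using braidsD(1,2)[OF word_path_br[OF assms(3)]] .
 have "path_tr n (word_path n v) (fcl n [] 0) (fcl n u 0)"
  using path_tr_htpc[OF h path_tr_word[OF assms(2), of "[]"]] by simp
 moreover have "path_tr n (word_path n v) (fcl n [] 0) (fcl n v 0)" using path_tr_word[OF assms(3), of "[]"] by simp
 ultimately have "fcl n u 0 = fcl n v 0" by (rule path_tr_unique[OF v])
 from fcl_eqD[OF this assms(3)] show ?thesis by simp
qed

lemma path_coordinate: "path p ==> cont_on {0..1} (%t. p t a)"
 unfolding path_def by (rule continuous_on_product_then_coordinatewise)

lemma path_value: "[|pimg p<=S; t : {0..1}|]==>p t : S" by (auto simp: path_image_def)

text \<open>Two straight homotopies: from the concatenation \<open>P\<close> to the path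
  \<open>Q\<close>, which has the real parts of \<open>P\<close> but the heights of a single
  \<open>cpath\<close>, and from \<open>Q\<close> to the \<open>cpath\<close> of the product. The
  first one rests on the fact that no pair crosses twice.\<close>

lemma cpath_red:
 assumes u: "u permutes {1..n}" and v: "v permutes {1..n}" and r: "red_pair u v"
 shows "dcomp n (bclass n (cpath n u)) (bclass n (cpath n v)) = bclass n (cpath n (u o v))"
proof -
 have bu: "cpath n u : braids n" and bv: "cpath n v : braids n" and buv: "cpath n (u o v) : braids n"
   using cpath_br(1) u v permutes_compose[OF v u] by auto
 define P where "P = cpath n u +++ rlab n (pinv u) (cpath n v)"
 define Q where "Q t = restrict (%a. Complex (Re (P t a)) (real a * (t * (1 - t)))) {1..n}" for t
 have rl: "rlab n (bend n (cpath n u)) (cpath n v) = rlab n (pinv u) (cpath n v)"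
  by (rule rlab_cong) (rule cpath_br(2)[OF u])
 have h0: "bhom n (bcomp n (cpath n u) (cpath n v)) P" using bcomp_hom[OF bu bv] unfolding rl P_def .
 hence P: "path P" "pimg P <= conf n {1..n}" "pst P = stdc n"
  using homotopic_paths_imp_path[OF h0] homotopic_paths_imp_subset[OF h0]
   homotopic_paths_imp_pathstart[OF h0] braidsD(3)[OF bcomp(1)[OF bu bv]] by auto
 have Pc: "P t : conf n {1..n}" if "t : {0..1}" for t by (rule path_value[OF P(2) that])
 have uvi: "pinv (u o v) a = pinv v (pinv u a)" for a
  using o_inv_distrib[OF permutes_bij[OF u] permutes_bij[OF v]] by simp
 have P1: "Re (P t a) = (1 - 2 * t) * real a + 2 * t * real (pinv u a)" "Im (P t a) = real a * (2 * t * (1 - 2 * t))"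
  if "t<=1/2" "a : {1..n}" for t a using that by (simp_all add: P_def joinpaths_def cpath_Re crossing_path_Im)
 have P2: "Re (P t a) = (1 - (2 * t - 1)) * real (pinv u a) + (2 * t - 1) * real (pinv v (pinv u a))"
  "Im (P t a) = real (pinv u a) * ((2 * t - 1) * (1 - (2 * t - 1)))"
  if "t > 1/2" "a : {1..n}" for t a
  using that pinv_range[OF u that(2)] by (simp_all add: P_def joinpaths_def cpath_Re crossing_path_Im relabel_def)
 have Qi: "Im (Q t a) = real a * (t * (1 - t))" "Re (Q t a) = Re (P t a)" if "a : {1..n}" for t a
  using that by (simp_all add: Q_def)
 have main: "same_side (P t b - P t a) (Q t b - Q t a) & Q t b - Q t a~=0"
  if t: "t : {0..1}" and ab: "a : {1..n}" "b : {1..n}" "a < b" for t a b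
 proof -
  have ne: "pinv u a~=pinv u b" using pinv_inj[OF u, of a b] ab(3) by auto
  have Qpos: "0 < Im (Q t b - Q t a)" if "t~=0" "t~=1" using t that ab Qi by auto
  have re: "Re (Q t b - Q t a) = Re (P t b - P t a)" using ab by (simp add: Qi)
  have byRe: ?thesis if "Re (P t b - P t a)~=0"
   using that re unfolding same_side_def by (metis linorder_neqE_linordered_idom zero_complex.simps(1))
  have byIm: ?thesis if "0 < Im (P t b - P t a)" "0 < Im (Q t b - Q t a)"
   using that unfolding same_side_def by (metis less_eq_real_def less_irrefl zero_complex.simps(2))
  consider "t = 0" | "0 < t" "t < 1/2" | "t = 1/2" | "1/2 < t" "t < 1" | "t = 1" using t by fastforce
  thus ?thesis
  proof cases
   case 1
   thus ?thesis using ab by (intro byRe) (simp add: P1)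
  next
   case 2
   show ?thesis using 2 ab Qpos byIm P1 by auto
  next
   case 3
   show ?thesis using ab ne by (intro byRe) (simp add: P1 3)
  next
   case 4
   show ?thesis
   proof (cases "pinv u a < pinv u b")
    case True
    have "real (pinv u a) * ((2 * t - 1) * (1 - (2 * t - 1))) < real (pinv u b) * ((2 * t - 1) * (1 - (2 * t - 1)))"
     using Im_profile_pos[of "2 * t - 1" "pinv u a" "pinv u b"] 4 True by auto
    hence "0 < Im (P t b - P t a)" using 4 ab by (simp only: minus_complex.simps P2)
    thus ?thesis using 4 Qpos by (intro byIm) simp_all
   next
    case False
    \<comment> \<open>In the second half the heights in \<open>P\<close> follow the order reached in
      the middle. If this order is reversed, the pair has crossed already and by
      \<open>red_pair\<close> does not cross again; so its real parts keep it apart.\<close>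
    hence lt: "pinv u b < pinv u a" using ne by simp
    define i where "i = pinv v (pinv u a)"
    define j where "j = pinv v (pinv u b)"
    have ij: "v i = pinv u a" "v j = pinv u b" "u (v i) = a" "u (v j) = b"
     using permutes_inverses(1)[OF v] permutes_inverses(1)[OF u] by (simp_all add: i_def j_def)
    have "i~=j" using lt ij by auto
    moreover have "~ i < j" using rpD[OF r, of i j] lt ij ab(3) by auto
    ultimately have "j < i" by simp
    have "0 < (1 - (2 * t - 1)) * (real (pinv u a) - real (pinv u b)) + (2 * t - 1) * (real i - real j)"
     using lt `j < i` 4 by (intro convex_comb_pos) auto
    hence "Re (P t b - P t a) < 0"
     using 4 ab by (simp only: minus_complex.simps P2 i_def j_def) (simp add: algebra_simps)
    thus ?thesis by (intro byRe) simp
   qed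
  next
   case 5
   have "pinv v (pinv u a)~=pinv v (pinv u b)" using pinv_inj[OF v] ne by blast
   thus ?thesis using 5 ab by (intro byRe) (simp add: P2)
  qed
 qed
 have Qc: "Q t : conf n {1..n}" if t: "t : {0..1}" for t
 proof (rule conf_memberI)
  fix a assume a: "a : {1..n}"
  show "1/2 < Re (Q t a) & Re (Q t a) < real n + 1/2" using conf_strip[OF Pc[OF t] a] Qi(2)[OF a] by simp
 next
  fix a b assume "a : {1..n}" "b : {1..n}" "a < b"
  thus "Q t b - Q t a~=0" using main[OF t] by blast
 qed (auto simp: Q_def)
 have "cont_on {0..1} (%t. Q t a)" if "a : {1..n}" for a
  using that path_coordinate[OF P(1), of a] by (simp add: Q_def Complex_eq) (intro continuous_intros)
 note Q = path_confI[OF this Qc]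
 have P_ends: "P 0 = Q 0" "P 1 = Q 1" "Q 0 = cpath n (u o v) 0" "Q 1 = cpath n (u o v) 1"
 proof -
  have und: "P t a = undefined" if "t : {0..1}" "a ~: {1..n}" for t a by (rule conf_undefined[OF Pc[OF that(1)] that(2)])
  show "P 0 = Q 0" "P 1 = Q 1" using und[of 0] und[of 1] by (auto simp: Q_def feq complex_eq_iff P1 P2 restrict_def)
  show "Q 0 = cpath n (u o v) 0" "Q 1 = cpath n (u o v) 1" by (auto simp: Q_def cpath_def feq P1 P2 restrict_def uvi)
 qed
 have "bhom n P Q" by (metis htpc_conf_lin P(1,2) Q main linorder_cases pathstart_def pathfinish_def P_ends(1,2))
 moreover have "bhom n Q (cpath n (u o v))"
 proof (rule htpc_conf_lin[OF Q braidsD(1,2)[OF buv]])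
  have *: "same_side (Q t b - Q t a) (cpath n (u o v) t b - cpath n (u o v) t a)"
   if t: "t : {0..1}" and ab: "a : {1..n}" "b : {1..n}" "a < b" for t :: real and a b :: nat
 using P_ends(3,4) Im_profile_pos[OF t _ _ ab(3)] ab Qi crossing_path_Im by (fastforce simp: same_side_def)
  fix t :: real and a b :: nat assume t: "t : {0..1}" and ab: "a : {1..n}" "b : {1..n}" "a~=b"
  thus "same_side (Q t b - Q t a) (cpath n (u o v) t b - cpath n (u o v) t a) |
   same_side (Q t a - Q t b) (cpath n (u o v) t a - cpath n (u o v) t b)"
   using *[OF t ab(1,2)] *[OF t ab(2,1)] by (cases a b rule: linorder_cases) auto
 qed (simp_all add: pathstart_def pathfinish_def P_ends(3,4))
 ultimately have "bhom n (bcomp n (cpath n u) (cpath n v)) (cpath n (u o v))" using h0 homotopic_paths_trans by blast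
 thus ?thesis using bcomp[OF bu bv] buv by (simp add: bclass_eqI)
qed

lemma wbr_weq:
 assumes "weq n a b" "a : bwords n"
 shows "wbr n a = wbr n b" using assms
proof induction
 case (weq_sym a b)
 thus ?case using weq_words[OF weq_sym.hyps] by simp
next
 case (weq_trans a b c)
 thus ?case using weq_words[OF weq_trans.hyps(1)] by simp
next
 case (weq_merge xs ys u v)
 have uv: "u o v permutes {1..n}" using permutes_compose weq_merge.hyps by blast
 have "wbr n [u,v] = wbr n [u o v]" using weq_merge.hyps cpath_red[of u n v] wbr_Cons[of u n "[v]"] wbr_sg uv by simp
 thus ?case using wbr_app[of xs n "u # v # ys"] wbr_app[of xs n "(u o v) # ys"]
   wbr_app[of "[u,v]" n ys] wbr_app[of "[u o v]" n ys] weq_merge.hyps uv by simp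
next
 case (weq_id xs ys)
 have "cpath n id : braids n" using cpath_br(1) permutes_id by blast
 moreover have "bhom n (%t. stdc n) (cpath n id)"
 proof (rule htpc_conf_lin[OF braidsD(1,2)[OF const_br(1)] braidsD(1,2)[OF calculation]])
  fix t :: real and a b :: nat assume t: "t : {0..1}" and ab: "a : {1..n}" "b : {1..n}" "a~=b"
  have "Re (cpath n id t c) = real c" if "c : {1..n}" for c using that by (simp add: cpath_Re algebra_simps inv_id)
  thus "same_side (stdc n b - stdc n a) (cpath n id t b - cpath n id t a) |
   same_side (stdc n a - stdc n b) (cpath n id t a - cpath n id t b)" using ab by (auto simp: same_side_def stdc_def)
 qed (auto simp: pathstart_def pathfinish_def cpath_start cpath_finish feq stdc_def cpath_def inv_id complex_eq_iff restrict_def)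
 ultimately have "wbr n [id] = wbr n []"
  using wbr_sg[OF permutes_id] bclass_eqI[OF const_br(1)] by (simp add: wbr_Nil ident_bclass)
 thus ?case using wbr_app[of xs n "id # ys"] wbr_app[of xs n ys] wbr_app[of "[id]" n ys]
   wbr_app[of "[]" n ys] weq_id.hyps by (simp add: permutes_id)
qed simp

section \<open>Straightening a braid at an intermediate time\<close>

definition canon where
 "canon n z t = restrict (%a. of_real (1 - t) * of_nat (rank n z a) + of_real t * z a) {1..n}"

definition std_at :: "nat=>(nat => complex)=>nat => complex" where
 "std_at n z = restrict (%a. of_nat (rank n z a)) {1..n}"

lemma canon_Re: "a : {1..n}==>Re (canon n z t a) = (1 - t) * real (rank n z a) + t * Re (z a)"
 and canon_Im: "a : {1..n}==>Im (canon n z t a) = t * Im (z a)" by (simp_all add: canon_def)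

lemma rank_range: "[|inj_on z {1..n}; a : {1..n}|]==>rank n z a : {1..n}"
 using permutes_in_image[OF rank(1)[of z n], of a] by blast

text \<open>The target positions are in the same order as the points. A pair with different real
  parts keeps this order strictly, and a pair on a vertical line has different heights until the
  standard end, where the positions differ.\<close>

lemma canon_path:
 assumes z: "z : conf n {1..n}"
 shows "path (canon n z)" "pimg (canon n z) <= conf n {1..n}"
  "pst (canon n z) = std_at n z" "pfin (canon n z) = z"
proof -
 note inj = conf_inj[OF z]
 have "cont_on {0..1} (%t. canon n z t a)" if "a : {1..n}" for a
  using that by (simp add: canon_def) (intro continuous_intros)
 moreover have "canon n z t : conf n {1..n}" if t: "t : {0..1}" for t
 proof (rule conf_memberI)
  fix a assume a: "a : {1..n}"
  have "0 < (1 - t) * (real (rank n z a) - 1/2) + t * (Re (z a) - 1/2)"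
   "0 < (1 - t) * (real n + 1/2 - real (rank n z a)) + t * (real n + 1/2 - Re (z a))"
   using rank_range[OF inj a] conf_strip[OF z a] t by (auto intro!: convex_comb_pos)
  thus "1/2 < Re (canon n z t a) & Re (canon n z t a) < real n + 1/2"
   unfolding canon_Re[OF a] by (simp add: algebra_simps diff_divide_distrib)
 next
  fix a b assume ab: "a : {1..n}" "b : {1..n}" "a < b"
  have *: "canon n z t b - canon n z t a~=0" if ab: "a : {1..n}" "b : {1..n}" and bef: "before z a b" for a b
  proof
   assume "canon n z t b - canon n z t a = 0"
   hence eq: "(1 - t) * real (rank n z a) + t * Re (z a) = (1 - t) * real (rank n z b) + t * Re (z b)"
    "t * Im (z a) = t * Im (z b)" using ab by (auto simp: complex_eq_iff canon_Re canon_Im)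
   have lt: "rank n z a < rank n z b" using rank(2)[OF inj ab] bef by simp
   show False
   proof (cases "Re (z a) < Re (z b)")
    case True
    hence "0 < (1 - t) * (real (rank n z b) - real (rank n z a)) + t * (Re (z b) - Re (z a))"
     using lt t by (intro convex_comb_pos) auto
    thus False using eq(1) by (simp add: algebra_simps)
   next
    case False
    hence im: "Re (z a) = Re (z b)" "Im (z a) < Im (z b)" using bef by (auto simp: before_def)
    hence "t = 0" using eq(2) by auto
    thus False using eq(1) lt by simp
   qed
  qed
  have "before z a b | before z b a" using complex_eq_iff inj_onD[OF inj, of a b] ab by (fastforce simp: before_def)
  thus "canon n z t b - canon n z t a~=0" using *[OF ab(1,2)] *[OF ab(2,1)] by auto
 qed (auto simp: canon_def)
 ultimately have "path (canon n z) & pimg (canon n z) <= conf n {1..n}" using path_confI[of "{1..n}" "canon n z" n] by blast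
 thus "path (canon n z)" "pimg (canon n z) <= conf n {1..n}" by blast+
 show "pst (canon n z) = std_at n z" by (simp add: pathstart_def canon_def std_at_def)
 show "pfin (canon n z) = z" using conf_undefined[OF z] by (auto simp: pathfinish_def canon_def feq)
qed

definition leg :: "real=>real=>(real=>nat => complex)=>real=>nat => complex" where
 "leg u v p = p o linepath u v"

lemma leg_path:
 assumes "path p" "pimg p <= conf n {1..n}" "u : {0..1}" "v : {0..1}"
 shows "path (leg u v p)" "pimg (leg u v p) <= conf n {1..n}" unfolding leg_def using path_part[OF assms] .

lemma leg_ends [simp]: "pst (leg u v p) = p u" "pfin (leg u v p) = p v"
 by (simp_all add: leg_def pathstart_compose pathfinish_compose)

lemma leg_apply: "leg u v p x = p ((1 - x) * u + x * v)" by (simp add: leg_def linepath_def)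

lemma leg_join:
 assumes "path p" "pimg p <= conf n {1..n}" "u : {0..1}" "v : {0..1}" "w : {0..1}"
 shows "bhom n (leg u v p +++ leg v w p) (leg u w p)" unfolding leg_def using htpc_part_join[OF assms] .

text \<open>The path \<open>p\<close> is followed up to time \<open>t\<close> and then closed to a
  braid by moving the points straight to the standard nodes.\<close>

definition retr_br where
 "retr_br n p t = leg 0 t p +++ reversepath (canon n (p t))"

lemma retr_br:
 assumes p: "p : braids n" and t: "t : {0..1}"
 shows "retr_br n p t : braids n" "!!a. a : {1..n}==>bend n (retr_br n p t) a = rank n (p t) a"
proof -
 have pt: "p t : conf n {1..n}" by (rule path_value[OF braidsD(2)[OF p] t])
 note c = canon_path[OF pt]
 have s: "path (leg 0 t p)" "pimg (leg 0 t p) <= conf n {1..n}" using leg_path[OF braidsD(1,2)[OF p], of 0 t] t by auto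
 have 1: "path (retr_br n p t)" unfolding retr_br_def using s c by (intro path_join_imp) simp_all
 have 2: "pimg (retr_br n p t) <= conf n {1..n}" unfolding retr_br_def
  using s c by (intro subset_path_image_join) simp_all
 have 3: "pst (retr_br n p t) = stdc n" using braidsD(3)[OF p] by (simp add: retr_br_def pathstart_def[of p])
 have 4: "pfin (retr_br n p t) = std_at n (p t)" using c by (simp add: retr_br_def)
 show "retr_br n p t : braids n" "!!a. a : {1..n}==>bend n (retr_br n p t) a = rank n (p t) a"
  using braidsI[OF 1 2 3, of "rank n (p t)"] rank_range[OF conf_inj[OF pt]] unfolding 4
  by (auto simp: std_at_def image_subset_iff)
qed

lemma near_before_sides:
 assumes z: "inj_on z {1..n}" and near: "near_conf n z y" and y: "inj_on y {1..n}"
  and ab: "a : {1..n}" "b : {1..n}" "before z a b"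
 shows "Re (z a) < Re (z b)==>Re (y a) < Re (y b) & rank n y a < rank n y b"
  "~ Re (z a) < Re (z b)==>Im (y a) < Im (y b)"
using near ab(1,2) rank(2) y ab(3) by (auto simp: near_conf_def before_def)

lemma near_conf_refl: "near_conf n z z" by (simp add: near_conf_def)

text \<open>After the common part up to time \<open>t\<close>, path \<open>A\<close> goes on along
  \<open>p\<close> and straightens at \<open>s\<close>, while \<open>B\<close> straightens at
  \<open>t\<close> and appends a permutation braid. The straight homotopy between them is collision
  free: pairs with different real parts at \<open>t\<close> are separated by real parts, pairs on a
  vertical line by heights.\<close>

lemma retr_step:
 assumes p: "p : braids n" and ts: "t : {0..1}" "s : {0..1}"
  and near: "!!r. r : closed_segment t s==>near_conf n (p t) (p r)"
 shows "bclass n (retr_br n p s) =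
  dcomp n (bclass n (retr_br n p t)) (bclass n (cpath n (ochg n (p t) (p s))))"
proof -
 define g where "g = ochg n (p t) (p s)"
 have pc: "p r : conf n {1..n}" if "r : {0..1}" for r by (rule path_value[OF braidsD(2)[OF p] that])
 note z = conf_inj[OF pc[OF ts(1)]] and z' = conf_inj[OF pc[OF ts(2)]]
 have g: "g permutes {1..n}" unfolding g_def by (rule ochg_perm[OF z z'])
 define rk where "rk = rank n (p t)"
 define rk' where "rk' = rank n (p s)"
 have rk: "rk permutes {1..n}" "rk' permutes {1..n}" unfolding rk_def rk'_def using rank(1)[OF z] rank(1)[OF z'] .
 have pg: "pinv g (rk a) = rk' a" for a
 proof -
  have "g (rk' a) = rk a" using permutes_inverses(2)[OF rk(2), of a] by (simp add: g_def ochg_def rk_def rk'_def)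
  thus ?thesis using permutes_inverses(2)[OF g, of "rk' a"] by simp
 qed
 have rr: "rk a : {1..n}" if "a : {1..n}" for a unfolding rk_def by (rule rank_range[OF z that])
 define A where "A = leg t s p +++ reversepath (canon n (p s))"
 define Cz where "Cz = reversepath (canon n (p t))"
 define X where "X = rlab n rk (cpath n g)"
 define B where "B = Cz +++ X"
 note c = canon_path[OF pc[OF ts(1)]] and c' = canon_path[OF pc[OF ts(2)]]
 note P = braidsD(1,2)[OF p]
 have sp: "path (leg t s p)" "pimg (leg t s p) <= conf n {1..n}" using leg_path[OF P ts] .
 have s0: "path (leg 0 t p)" "pimg (leg 0 t p) <= conf n {1..n}" using leg_path[OF P, of 0 t] ts by auto
 have R: "path (reversepath (canon n (p s)))" "pimg (reversepath (canon n (p s))) <= conf n {1..n}" using c' by simp_all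
 have j: "pfin (leg t s p) = pst (reversepath (canon n (p s)))" using c' by simp
 have A: "path A" "pimg A <= conf n {1..n}"
  unfolding A_def using path_join_imp[OF sp(1) R(1) j] subset_path_image_join[OF sp(2) R(2)] .
 have cb: "cpath n g : braids n" using cpath_br(1)[OF g] .
 have X: "path X" "pimg X <= conf n {1..n}"
   by (auto simp: X_def rlab_path braidsD(1,2)[OF cb] permutes_inj_on[OF rk(1)] permutes_image[OF rk(1)])
 have CX: "pfin Cz = pst X" unfolding Cz_def X_def rlab_start braidsD(3)[OF cb] using c rr
  by (auto simp: std_at_def relabel_def stdc_def rk_def feq restrict_def)
 have Cz: "path Cz" "pimg Cz <= conf n {1..n}" using c by (simp_all add: Cz_def)
 have B: "path B" "pimg B <= conf n {1..n}"
  unfolding B_def using path_join_imp[OF Cz(1) X(1) CX] subset_path_image_join[OF Cz(2) X(2)] .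
 have starts: "pst A = pst B" using c by (simp add: A_def B_def Cz_def)
 have finishes: "pfin A = pfin B"
 proof -
  have "pfin A = std_at n (p s)" using c' by (simp add: A_def)
  also have "... = pfin X" unfolding X_def rlab_start
   using rr by (auto simp: std_at_def relabel_def pathfinish_def cpath_finish pg rk'_def[symmetric] feq restrict_def)
  finally show ?thesis by (simp add: B_def)
 qed
 have A1: "A u = p (t + 2 * u * (s - t))" if "u<=1/2" for u using that by (simp add: A_def joinpaths_def leg_apply algebra_simps)
 have A2: "A u = canon n (p s) (2 - 2 * u)" if "u > 1/2" for u using that by (simp add: A_def joinpaths_def reversepath_def algebra_simps)
 have B1: "B u = canon n (p t) (1 - 2 * u)" if "u<=1/2" for u using that by (simp add: B_def Cz_def joinpaths_def reversepath_def)
 have B2: "Re (B u a) = (1 - (2 * u - 1)) * real (rk a) + (2 * u - 1) * real (rk' a)"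
  "Im (B u a) = real (rk a) * ((2 * u - 1) * (1 - (2 * u - 1)))" if "u > 1/2" "a : {1..n}" for u a
  using that rr[OF that(2)] by (simp_all add: B_def X_def joinpaths_def relabel_def cpath_Re crossing_path_Im pg)
 have seg: "t + 2 * u * (s - t) : closed_segment t s" if "0<=u" "u<=1/2" for u
  using that by (auto simp: closed_segment_def algebra_simps intro!: exI[of _ "2 * u"])
 have seg01: "closed_segment t s<={0..1}" using ts by (simp add: closed_segment_subset)
 have side: "same_side (A u b - A u a) (B u b - B u a)"
  if u: "u : {0..1}" and ab: "a : {1..n}" "b : {1..n}" and bef: "before (p t) a b" for u a b
 proof -
  have y: "inj_on (p r) {1..n}" if "r : closed_segment t s" for r by (rule conf_inj[OF pc[OF subsetD[OF seg01 that]]])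
  note nb = near_before_sides[OF z near y ab bef]
  have tin: "t : closed_segment t s" and sin: "s : closed_segment t s" by auto
  have lt: "rk a < rk b" using rank(2)[OF z ab] bef by (simp add: rk_def)
  show ?thesis
  proof (cases "Re (p t a) < Re (p t b)")
   case True
   note n1 = nb(1)[OF _ _ True]
   have ra: "rk' a < rk' b" using n1[OF sin sin] by (simp add: rk'_def)
   have "0 < Re (A u b - A u a)"
   proof (cases "u<=1/2")
    case h: True
    thus ?thesis using n1[OF seg seg] u by (simp add: A1)
   next
    case h: False
    have "0 < (1 - (2 - 2 * u)) * (real (rk' b) - real (rk' a)) + (2 - 2 * u) * (Re (p s b) - Re (p s a))"
     using n1[OF sin sin] ra u h by (intro convex_comb_pos) auto
    thus ?thesis using h ab by (simp add: A2 canon_Re rk'_def[symmetric]) (simp add: algebra_simps)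
   qed
   moreover have "0 < Re (B u b - B u a)"
   proof (cases "u<=1/2")
    case h: True
    have "0 < (1 - (1 - 2 * u)) * (real (rk b) - real (rk a)) + (1 - 2 * u) * (Re (p t b) - Re (p t a))"
     using True lt u h by (intro convex_comb_pos) auto
    thus ?thesis using h ab by (simp add: B1 canon_Re rk_def[symmetric]) (simp add: algebra_simps)
   next
    case h: False
    have "0 < (1 - (2 * u - 1)) * (real (rk b) - real (rk a)) + (2 * u - 1) * (real (rk' b) - real (rk' a))"
     using ra lt u h by (intro convex_comb_pos) auto
    thus ?thesis using h ab by (simp add: B2) (simp add: algebra_simps)
   qed
   ultimately show ?thesis by (simp add: same_side_def)
  next
   case False
   note n2 = nb(2)[OF _ _ False]
   \<comment> \<open>At \<open>u = 1\<close> the heights have come down to zero, but there both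
     paths have reached the same configuration.\<close>
   show ?thesis
   proof (cases "u = 1")
    case True
    thus ?thesis using finishes by (simp add: pathfinish_def same_side_def)
   next
    case u1: False
    have "0 < Im (A u b - A u a)"
    proof (cases "u<=1/2")
     case h: True
     thus ?thesis using n2[OF seg seg] u by (simp add: A1)
    next
     case h: False
     thus ?thesis using n2[OF sin sin] ab u u1 by (simp add: A2 canon_Im)
    qed
    moreover have "0<=Im (B u b - B u a)"
    proof (cases "u<=1/2")
     case h: True
     have "0<=(1 - 2 * u) * (Im (p t b) - Im (p t a))" using n2[OF tin tin] h by simp
     thus ?thesis using h ab by (simp add: B1 canon_Im algebra_simps)
    next
     case h: False
     have "0<=(real (rk b) - real (rk a)) * ((2 * u - 1) * (1 - (2 * u - 1)))" using lt h u by auto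
     thus ?thesis using h ab by (simp add: B2 algebra_simps)
    qed
    ultimately show ?thesis by (simp add: same_side_def)
   qed
  qed
 qed
 have AB: "bhom n A B" by (smt (verit) htpc_conf_lin A B starts finishes inj_onD z before_def complex_eq_iff side)
 have j0: "pfin (leg 0 t p) = pst (leg t s p)" by simp
 have j1: "pfin (leg 0 t p) = pst Cz" using c by (simp add: Cz_def)
 note rb = retr_br[OF p ts(1)]
 have "bhom n (retr_br n p s) ((leg 0 t p +++ leg t s p) +++ reversepath (canon n (p s)))" unfolding retr_br_def
 proof (rule homotopic_paths_join)
  show "bhom n (leg 0 s p) (leg 0 t p +++ leg t s p)"
   using leg_join[OF P, of 0 t s] ts by (auto intro: homotopic_paths_sym)
  show "bhom n (reversepath (canon n (p s))) (reversepath (canon n (p s)))" using R by simp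
  show "pfin (leg 0 s p) = pst (reversepath (canon n (p s)))" using c' by simp
 qed
 also have "bhom n ... (leg 0 t p +++ A)"
  unfolding A_def using homotopic_paths_assoc[OF s0 sp R j0 j] by (rule homotopic_paths_sym)
 also have "bhom n ... (leg 0 t p +++ B)" using homotopic_paths_join[OF _ AB] s0 by (auto simp: A_def)
 also have "bhom n ... ((leg 0 t p +++ Cz) +++ X)" unfolding B_def using homotopic_paths_assoc[OF s0 Cz X j1 CX] .
 also have "(leg 0 t p +++ Cz) +++ X = retr_br n p t +++ rlab n (bend n (retr_br n p t)) (cpath n g)"
 by (metis X_def rlab_cong rb(2) rk_def retr_br_def Cz_def)
 also have "bhom n ... (bcomp n (retr_br n p t) (cpath n g))" by (rule homotopic_paths_sym[OF bcomp_hom[OF rb(1) cb]])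
 finally have "bclass n (retr_br n p s) = bclass n (bcomp n (retr_br n p t) (cpath n g))"
  by (rule bclass_eqI[OF retr_br(1)[OF p ts(2)] bcomp(1)[OF rb(1) cb]])
 thus ?thesis using bcomp(3)[OF rb(1) cb] by (simp add: g_def)
qed

lemma bgrp_assoc:
 "[|X : fdias n; Y : fdias n; Z : fdias n|]
 ==>dcomp n (dcomp n X Y) Z = dcomp n X (dcomp n Y Z)"
 using monoid.m_assoc[OF group.is_monoid[OF grp_bgrp], of X n Y Z] by simp

text \<open>Every braid is a fraction of positive braids: this property propagates along the path of a braid.\<close>

theorem br_frac:
 assumes X: "X : fdias n"
 obtains u v where "u : bwords n" "v : bwords n" "dcomp n X (wbr n u) = wbr n v"
proof -
 obtain p where p: "p : braids n" "X = bclass n p" using X by (rule fdias_cases)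
 define c where "c t = bclass n (retr_br n p t)" for t :: real
 define good where "good t <-> (EX u v. u : bwords n & v : bwords n & dcomp n (c t) (wbr n u) = wbr n v)" for t
 have cf: "c t : fdias n" if "t : {0..1}" for t unfolding c_def by (rule bclass_full[OF retr_br(1)[OF p(1) that]])
 have step: "good t = good s" if ts: "t : {0..1}" "s : {0..1}"
  and near: "!!r. r : closed_segment t s==>near_conf n (p t) (p r)" for t s
 proof -
  define g where "g = ochg n (p t) (p s)"
  have g: "g permutes {1..n}" using ochg_perm conf_inj path_value[OF braidsD(2)[OF p(1)]] ts by (auto simp: g_def)
  have cs: "c s = dcomp n (c t) (wbr n [g])"
   unfolding c_def g_def using retr_step[OF p(1) ts near] wbr_sg[OF g] by (simp add: g_def)
  have mul: "dcomp n (c s) (wbr n u) = dcomp n (c t) (wbr n (g # u))" if "u : bwords n" for u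
   unfolding cs using bgrp_assoc[OF cf[OF ts(1)] wbr_full wbr_full, of "[g]" u]
    wbr_app[of "[g]" n u] that g by simp
  show ?thesis
  proof
   assume "good t"
   then obtain u v where uv: "u : bwords n" "v : bwords n" "dcomp n (c t) (wbr n u) = wbr n v" by (auto simp: good_def)
   \<comment> \<open>The letter \<open>g\<close> moves to the other side of the fraction by means of
     its complement; the full twist that arises is central and passes \<open>u\<close>.\<close>
   obtain us where us: "us : bwords n" "weq n ([g] @ us) (ftw n (length [g]))" using word_cpl[of "[g]" n] g by auto
   let ?z = "ftw n (length [g])"
   have w: "us @ u : bwords n" using us uv by simp
   have "weq n (g # us @ u) (?z @ u)" using weq_cong[OF us(2), of "[]" u] uv by simp
   also have "weq n ... (u @ ?z)" by (rule ftw_cen[OF uv(1)])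
   finally have "dcomp n (c s) (wbr n (us @ u)) = dcomp n (c t) (wbr n (u @ ?z))"
    using mul[OF w] wbr_weq[of n "g # us @ u" "u @ ?z"] g us uv by simp
   also have "... = wbr n (v @ ?z)" using wbr_app[OF uv(1), of ?z] wbr_app[OF uv(2), of ?z] uv(3)
     bgrp_assoc[OF cf[OF ts(1)] wbr_full[OF uv(1)] wbr_full[OF ftw_words]] by simp
   finally show "good s" unfolding good_def using w uv by (intro exI[of _ "us @ u"] exI[of _ "v @ ?z"]) simp
  next
   assume "good s"
   then obtain u v where uv: "u : bwords n" "v : bwords n" "dcomp n (c s) (wbr n u) = wbr n v" by (auto simp: good_def)
   thus "good t" unfolding good_def using mul[OF uv(1)] g by (intro exI[of _ "g # u"] exI[of _ v]) simp
  qed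
 qed
 have cont: "cont_on {0..1} p" using braidsD(1)[OF p(1)] by (simp add: path_def)
 have "good 0 = good 1"
 proof (rule connected_local_const[of "{0..1::real}" 0 1 good], simp_all, intro ballI)
  fix t :: real assume t: "t : {0..1}"
  obtain d where d: "d > 0" "!!r. [|r : {0..1}; r~=t; dist r t < d|]==>near_conf n (p t) (p r)"
   using ev_near_conf[OF cont t, of n] unfolding eventually_at by blast
  show "\<forall>\<^sub>F s in at t within {0..1}. good t = good s" unfolding eventually_at
  proof (intro exI[of _ d] conjI ballI impI)
   fix s :: real assume s: "s : {0..1}" "s~=t & dist s t < d"
   show "good t = good s"
   proof (rule step[OF t s(1)])
    fix r assume r: "r : closed_segment t s"
    have "closed_segment t s<={0..1}" using t s(1) by (simp add: closed_segment_subset)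
    moreover have "dist r t<=dist s t" using segment_bound1[OF r] by (simp add: dist_norm)
    ultimately show "near_conf n (p t) (p r)" using d(2)[of r] r s(2) near_conf_refl[of n "p t"] by (cases "r = t") auto
   qed
  qed (rule d(1))
 qed
 \<comment> \<open>At time 0 the braid is trivial, which is a positive word. At time 1, treated
   next, the points have reached the nodes and straightening does nothing.\<close>
 moreover have "good 0"
 proof -
  have p0: "p 0 = stdc n" using braidsD(3)[OF p(1)] by (simp add: pathstart_def)
  have "stdc n a = (if a : {1..n} then of_nat a else undefined)" for a by (simp add: stdc_def)
  hence "canon n (stdc n) t = stdc n" for t by (intro ext) (simp add: canon_def rank_stdc algebra_simps)
  hence "retr_br n p 0 t = stdc n" for t using p0 by (simp add: retr_br_def joinpaths_def leg_apply reversepath_def)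
  hence "c 0 = wbr n []" unfolding c_def wbr_def by (simp add: feq) (metis (no_types) ext)
  thus ?thesis unfolding good_def using wbr_app[of "[]" n "[]"] by (intro exI[of _ "[]"] exI[of _ "[]"]) simp
 qed
 moreover have "c 1 = X"
 proof -
  have f: "pfin p = p 1" by (simp add: pathfinish_def)
  have rk: "rank n (p 1) a = bend n p a" if "a : {1..n}" for a
  proof -
   define w where "w a = (if a : {1..n} then bend n p a else a)" for a
   have "w permutes {1..n}" by (metis bij_imp_permutes w_def bend_bij[OF p(1)] bij_betw_def bij_betw_cong)
   hence "rank n (p 1) = w"
   proof (rule rank_eqI)
    fix a b assume "a : {1..n}" "b : {1..n}"
    thus "w a < w b <-> before (p 1) a b" using pathfinish_br[OF p(1)] by (simp add: w_def before_def f)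
   qed
   thus ?thesis using that by (simp add: w_def)
  qed
  have "canon n (p 1) t = p 1" for t
  proof
   fix a
   show "canon n (p 1) t a = p 1 a" using pathfinish_br[OF p(1)] rk[of a] by (auto simp: canon_def f algebra_simps)
  qed
  hence "retr_br n p 1 = p +++ (%t. pfin p)" by (simp add: retr_br_def reversepath_def f feq joinpaths_def leg_apply)
  hence "bhom n (retr_br n p 1) p" using htpc_rid[OF braidsD(1,2)[OF p(1)]] by simp
  thus ?thesis unfolding c_def p(2) using retr_br(1)[OF p(1), of 1] p(1) by (simp add: bclass_eqI)
 qed
 ultimately show thesis using that by (auto simp: good_def)
qed

section \<open>The Salvetti complex\<close>

lemma trans_invs_ch:
 assumes "!!k. [|i<=k; k < j|]==>w (Suc k) < w k" "i < (j::nat)"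
 shows "w j < (w i :: nat)" using assms(2,1)
proof (induction j)
 case (Suc j)
 show ?case
 proof (cases "i = j")
  case True
  thus ?thesis using Suc.prems(2)[of j] by simp
 next
  case False
  hence "w j < w i" using Suc by simp
  moreover have "w (Suc j) < w j" using Suc.prems False by simp
  ultimately show ?thesis by simp
 qed
qed simp

text \<open>Two positions are paired if all generators between them belong to \<open>J\<close>, that
  is, if they lie in the same block. These pairs form the inversion set of the longest element of
  the parabolic subgroup of \<open>J\<close>.\<close>

definition blk_prs :: "nat set=>(nat \<times> nat) set" where
 "blk_prs J = {(i,j). i < j & {i..<j}<=J}"

lemma blk_prs_mono: "K<=J==>blk_prs K<=blk_prs J" by (auto simp: blk_prs_def)

lemma blk_prs_cl: "[|(i,j) : blk_prs J; (j,k) : blk_prs J|]==>(i,k) : blk_prs J"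
 by (force simp: blk_prs_def ivl_disj_un_two(3)[of i j k, symmetric])

lemma blk_prs_sub: "[|(i,k) : blk_prs J; i<=a; a < b; b<=k|]==>(a,b) : blk_prs J" by (auto simp: blk_prs_def)

lemma blk_prs_range:
 assumes "J<={1..<n}"
 shows "blk_prs J<={(i,j). i : {1..n} & j : {1..n} & i < j}"
proof clarify
 fix i j assume h: "(i,j) : blk_prs J"
 hence ij: "i < j" "{i..<j}<=J" by (auto simp: blk_prs_def)
 hence "i : J" "j - 1 : J" by auto
 hence "i : {1..<n}" "j - 1 : {1..<n}" using assms by auto
 thus "i : {1..n} & j : {1..n} & i < j" using ij(1) by auto
qed

lemma blk_prs_step: "(i,Suc i) : blk_prs J <-> i : J" by (auto simp: blk_prs_def)

text \<open>The parabolic subgroup of \<open>J\<close>, that is, the permutations that preserve the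
  blocks, encoded by inversions alone.\<close>

definition para where
 "para n J = {w. w permutes {1..n} & invs w<=blk_prs J}"

text \<open>The minimal representatives of the left cosets of the parabolic subgroup of
  \<open>K\<close> in that of \<open>J\<close>, characterized by having no descent in
  \<open>K\<close>.\<close>

definition mcr where
 "mcr n J K = {w : para n J. ALL i:K. w i < w (Suc i)}"

definition lng where
 "lng n J = (SOME w. w permutes {1..n} & invs w = blk_prs J)"

lemma lng:
 assumes "J<={1..<n}"
 shows "lng n J permutes {1..n}" "invs (lng n J) = blk_prs J"
proof -
 obtain w where "w permutes {1..n}" "invs w = blk_prs J"
 proof (rule invs_rlz[OF blk_prs_range[OF assms]])
  show "(i,k) : blk_prs J" if "(i,j) : blk_prs J" "(j,k) : blk_prs J" for i j k using that by (rule blk_prs_cl)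
  show "(i,j) : blk_prs J | (j,k) : blk_prs J" if "(i,k) : blk_prs J" "i < j" "j < k" for i j k
   using blk_prs_sub[OF that(1), of i j] that by simp
 qed
 hence "EX w. w permutes {1..n} & invs w = blk_prs J" by blast
 from someI_ex[OF this] show "lng n J permutes {1..n}" "invs (lng n J) = blk_prs J" unfolding lng_def by simp_all
qed

lemma invs_blk_prs:
 assumes "!!i. i : J==>(i,Suc i) : invs w"
 shows "blk_prs J<=invs w"
proof clarify
 fix i j assume h: "(i,j) : blk_prs J"
 have "w j < w i"
 proof (rule trans_invs_ch[of i j w])
  fix k assume "i<=k" "k < j"
  hence "k : J" using h by (auto simp: blk_prs_def)
  thus "w (Suc k) < w k" using assms[of k] by (simp add: invs_def)
 qed (use h in \<open>simp add: blk_prs_def\<close>)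
 thus "(i,j) : invs w" using h by (simp add: invs_def blk_prs_def)
qed

lemma increasing_blk:
 assumes "!!i. i : K==>w i < (w (Suc i) :: nat)" "(i,j) : blk_prs K"
 shows "w i < w j"
proof -
 have "i < j" "{i..<j}<=K" using assms(2) by (auto simp: blk_prs_def)
 thus ?thesis
 proof (induction j)
  case (Suc j)
  show ?case
  proof (cases "i = j")
   case True
   thus ?thesis using Suc.prems assms(1)[of j] by auto
  next
   case False
   hence "i < j" "{i..<j}<=K" using Suc.prems by auto
   hence "w i < w j" by (rule Suc.IH)
   moreover have "w j < w (Suc j)" using Suc.prems by (intro assms(1)) auto
   ultimately show ?thesis by simp
  qed
 qed simp
qed

text \<open>Counting: if one value crosses the boundary upwards, another crosses it downwards, and
  the two positions form an inversion across \<open>k\<close>.\<close>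

lemma para_boundary:
 assumes w: "w : para n J" and k: "k ~: J" and i: "i<=k"
 shows "w i<=k"
proof (rule ccontr)
 assume "~ w i<=k"
 hence wi: "w i > k" by simp
 have p: "w permutes {1..n}" and inv: "invs w<=blk_prs J" using w by (auto simp: para_def)
 have "card (w ` {..k}) = card {..k}" by (simp add: card_image permutes_inj_on[OF p])
 moreover have "w i : w ` {..k}" "w i ~: {..k}" using i wi by auto
 ultimately have "~ {..k}<=w ` {..k}" by (metis card_subset_eq finite_atMost finite_imageI)
 then obtain m where m: "m<=k" "m ~: w ` {..k}" by auto
 define j where "j = pinv w m"
 have wj: "w j = m" using permutes_inverses(1)[OF p] by (simp add: j_def)
 hence "j > k" using m(2) by (metis atMost_iff image_eqI linorder_not_le)
 hence "(i,j) : invs w" using i wi m(1) wj by (simp add: invs_def)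
 hence "(i,j) : blk_prs J" using inv by blast
 hence "k : J" using i `j > k` by (auto simp: blk_prs_def)
 thus False using k by contradiction
qed

lemma para_boundary_iff:
 assumes w: "w : para n J" and k: "k ~: J"
 shows "w i<=k <-> i<=k"
proof
 assume "i<=k"
 thus "w i<=k" by (rule para_boundary[OF w k])
next
 assume wi: "w i<=k"
 have p: "w permutes {1..n}" using w by (auto simp: para_def)
 have "inj_on w {..k}" using permutes_inj_on[OF p] by blast
 moreover have "w ` {..k}<={..k}" using para_boundary[OF w k] by auto
 ultimately have "w ` {..k} = {..k}" by (simp add: endo_inj_surj)
 then obtain j where "j<=k" "w j = w i" using wi by (metis atMost_iff imageE)
 thus "i<=k" using permutes_inj[OF p] by (auto dest: injD)
qed

lemma para_blk:
 assumes w: "w : para n J" and ij: "(i,j) : blk_prs J"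
 shows "(w i,w j) : blk_prs J | (w j,w i) : blk_prs J"
proof -
 have p: "w permutes {1..n}" using w by (auto simp: para_def)
 have h: "i < j" "{i..<j}<=J" using ij by (auto simp: blk_prs_def)
 have ne: "w i~=w j" using h(1) permutes_inj[OF p] by (auto dest: injD)
 have "k : J" if "min (w i) (w j)<=k" "k < max (w i) (w j)" for k
 proof (rule ccontr)
  assume k: "k ~: J"
  have "w i<=k <-> i<=k" "w j<=k <-> j<=k" using para_boundary_iff[OF w k] by auto
  hence "i<=k & k < j" using that h(1) by (auto simp: min_def max_def split: if_splits)
  thus False using h(2) k by auto
 qed
 thus ?thesis using ne by (auto simp: blk_prs_def min_def max_def split: if_splits)
qed

text \<open>The inversions of \<open>w\<close> inside the blocks of \<open>K\<close> are closed and
  coclosed, hence belong to a permutation \<open>b\<close>. Dividing by this suffix leaves no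
  descent in \<open>K\<close>.\<close>

lemma para_fac:
 assumes KJ: "K<=J" and J: "J<={1..<n}" and w: "w : para n J"
 obtains a b where "a : mcr n J K" "b : para n K" "w = a o b" "invs b = invs w Int blk_prs K"
proof -
 have p: "w permutes {1..n}" and inv: "invs w<=blk_prs J" using w by (auto simp: para_def)
 obtain b where b: "b permutes {1..n}" "invs b = invs w Int blk_prs K"
 proof (rule invs_rlz[of "invs w Int blk_prs K" n])
  show "invs w Int blk_prs K<={(i,j). i : {1..n} & j : {1..n} & i < j}" using invs_subset[OF p] by blast
  show "(i,k) : invs w Int blk_prs K"
   if "(i,j) : invs w Int blk_prs K" "(j,k) : invs w Int blk_prs K" for i j k
   using that invs_cl[of i j w k] blk_prs_cl[of i j K k] by blast
  show "(i,j) : invs w Int blk_prs K | (j,k) : invs w Int blk_prs K"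
   if "(i,k) : invs w Int blk_prs K" "i < j" "j < k" for i j k
   using that invs_coclosed[of i k w j] blk_prs_sub[of i k K i j] blk_prs_sub[of i k K j k] by simp
 qed
 have bK: "b : para n K" using b by (simp add: para_def)
 have sub: "invs b<=invs w" using b(2) by blast
 define a where "a = w o pinv b"
 have ab: "red_pair a b" "a o b = w" unfolding a_def using suf_rp[OF b(1) sub] by auto
 have ap: "a permutes {1..n}" unfolding a_def using permutes_compose[OF permutes_inv[OF b(1)] p] .
 have wa: "w i = a (b i)" for i using ab(2) by (metis comp_apply)
 have bb: "b (pinv b i) = i" for i using permutes_inverses(1)[OF b(1)] by simp
 have "invs a<=blk_prs J"
 proof clarify
  fix i j assume ij: "(i,j) : invs a"
  define q where "q = pinv b i"
  define r where "r = pinv b j"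
  have e: "b q = i" "b r = j" using bb by (auto simp: q_def r_def)
  have lt: "b q < b r" "a (b r) < a (b q)" using ij e by (auto simp: invs_def)
  have "q~=r" using lt by auto
  moreover have "~ r < q" using rpD[OF ab(1), of r q] lt by auto
  ultimately have "q < r" by simp
  hence "(q,r) : invs w" using lt by (simp add: invs_def wa)
  hence qr: "(q,r) : blk_prs J" using inv by blast
  have "b : para n J" using bK blk_prs_mono[OF KJ] by (auto simp: para_def)
  from para_blk[OF this qr] show "(i,j) : blk_prs J" using e lt by (auto simp: blk_prs_def)
 qed
 moreover have "a i < a (Suc i)" if i: "i : K" for i
 proof (rule ccontr)
  assume "~ a i < a (Suc i)"
  moreover have "a i~=a (Suc i)" using injD[OF permutes_inj[OF ap], of i "Suc i"] by auto
  ultimately have lt: "a (Suc i) < a i" by simp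
  define q where "q = pinv b i"
  define r where "r = pinv b (Suc i)"
  have e: "b q = i" "b r = Suc i" using bb by (auto simp: q_def r_def)
  have "q~=r" using e by auto
  moreover have "~ r < q" using rpD[OF ab(1), of r q] lt e by auto
  ultimately have qr: "q < r" by simp
  hence "(q,r) : invs w" using lt e by (simp add: invs_def wa)
  moreover have "(q,r) : blk_prs K"
  proof -
   have "k : K" if "q<=k" "k < r" for k
   proof (rule ccontr)
    assume k: "k ~: K"
    have "k = i" using para_boundary_iff[OF bK k, of q] para_boundary_iff[OF bK k, of r] e that by auto
    thus False using i k by simp
   qed
   thus ?thesis using qr by (auto simp: blk_prs_def)
  qed
  ultimately have "(q,r) : invs b" using b(2) by blast
  thus False using e by (simp add: invs_def)
 qed
 ultimately have "a : mcr n J K" using ap by (simp add: mcr_def para_def)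
 thus thesis using that bK ab(2) b(2) by blast
qed

text \<open>\<open>b\<close> exchanges only positions within blocks of \<open>K\<close>, and on
  these \<open>a\<close> is increasing. So \<open>b\<close> can be read off from the
  product.\<close>

lemma cos_rp:
 assumes a: "a : mcr n J K" and b: "b : para n K"
 shows "red_pair a b" "invs (a o b) Int blk_prs K = invs b"
proof -
 have inc: "a i < a (Suc i)" if "i : K" for i using a that by (simp add: mcr_def)
 have K: "invs b<=blk_prs K" using b by (simp add: para_def)
 show r: "red_pair a b"
 proof (rule rpI)
  fix i j assume ij: "i < j" "b j < b i"
  hence "(i,j) : blk_prs K" using K by (auto simp: invs_def)
  from para_blk[OF b this] have "(b j,b i) : blk_prs K" using ij by (auto simp: blk_prs_def)
  from increasing_blk[of K a, OF inc this] show "a (b j) < a (b i)" by simp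
 qed
 show "invs (a o b) Int blk_prs K = invs b"
 proof
  show "invs b<=invs (a o b) Int blk_prs K" using r K by (auto simp: red_pair_def)
  show "invs (a o b) Int blk_prs K<=invs b"
  proof clarify
   fix i j assume h: "(i,j) : invs (a o b)" "(i,j) : blk_prs K"
   have "~ (b i,b j) : blk_prs K"
   proof
    assume "(b i,b j) : blk_prs K"
    from increasing_blk[of K a, OF inc this] show False using h(1) by (simp add: invs_def)
   qed
   hence "(b j,b i) : blk_prs K" using para_blk[OF b h(2)] by blast
   thus "(i,j) : invs b" using h(1) by (auto simp: invs_def blk_prs_def)
  qed
 qed
qed

text \<open>Representatives for a two-step chain of subgroups are the products of those for the
  steps. This is the core of \<open>bdry_twice\<close>: omitting \<open>i\<close> and then
  \<open>j\<close> is indexed by the same permutations as in the other order.\<close>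

lemma mcr_comp:
 assumes LK: "L<=K" and KJ: "K<=J" and J: "J<={1..<n}"
 shows "bij_betw (%(a,b). a o b) (mcr n J K \<times> mcr n K L) (mcr n J L)" unfolding bij_betw_def
proof
 have par: "b : para n K" if "b : mcr n K L" for b using that by (simp add: mcr_def)
 show "inj_on (%(a,b). a o b) (mcr n J K \<times> mcr n K L)"
 proof (rule inj_onI, clarify)
  fix a b a' b' assume h: "a : mcr n J K" "b : mcr n K L" "a' : mcr n J K"
   "b' : mcr n K L" and eq: "a o b = a' o b'"
  have bp: "b permutes {1..n}" "b' permutes {1..n}" using par[OF h(2)] par[OF h(4)] by (auto simp: para_def)
  have bb: "b = b'" using invs_eqI bp cos_rp(2)[OF h(1) par[OF h(2)]] cos_rp(2)[OF h(3) par[OF h(4)]] eq by auto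
  have "(a o b) o pinv b = (a' o b) o pinv b" using eq bb by simp
  hence "a = a'" by (simp add: feq permutes_inverses(1)[OF bp(1)])
  thus "a = a' & b = b'" using bb by simp
 qed
 show "(%(a,b). a o b) ` (mcr n J K \<times> mcr n K L) = mcr n J L"
 proof
  show "(%(a,b). a o b) ` (mcr n J K \<times> mcr n K L)<=mcr n J L"
  proof clarify
   fix a b assume h: "a : mcr n J K" "b : mcr n K L"
   have ab: "a permutes {1..n}" "b permutes {1..n}" "invs a<=blk_prs J" "invs b<=blk_prs K"
    using h by (auto simp: mcr_def para_def)
   note r = cos_rp(1)[OF h(1) par[OF h(2)]]
   have "invs (a o b)<=blk_prs J"
   proof clarify
    fix i j assume ij: "(i,j) : invs (a o b)"
    show "(i,j) : blk_prs J"
    proof (cases "(i,j) : invs b")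
     case True
     thus ?thesis using ab(4) blk_prs_mono[OF KJ] by blast
    next
     case False
     have "b i~=b j" using ij by (auto simp: invs_def)
     hence "b i < b j" using False ij by (auto simp: invs_def)
     hence "(b i,b j) : invs a" using ij by (simp add: invs_def)
     hence bl: "(b i,b j) : blk_prs J" using ab(3) by blast
     have bJ: "b : para n J" using ab(2,4) blk_prs_mono[OF KJ] by (auto simp: para_def)
     have "k : J" if "i<=k" "k < j" for k
     proof (rule ccontr)
      assume k: "k ~: J"
      have "b i<=k" "~ b j<=k" using para_boundary_iff[OF bJ k] that by auto
      hence "k : {b i..<b j}" by simp
      thus False using bl k unfolding blk_prs_def by blast
     qed
     thus ?thesis using ij by (auto simp: blk_prs_def invs_def)
    qed
   qed
   moreover have "(a o b) i < (a o b) (Suc i)" if i: "i : L" for i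
   proof (rule ccontr)
    assume n: "~ (a o b) i < (a o b) (Suc i)"
    have "(a o b) i~=(a o b) (Suc i)"
     using injD[OF permutes_inj[OF permutes_compose[OF ab(2,1)]], of i "Suc i"] by auto
    hence "(i,Suc i) : invs (a o b) Int blk_prs K" using n i LK by (auto simp: invs_def blk_prs_def)
    hence "(i,Suc i) : invs b" using cos_rp(2)[OF h(1) par[OF h(2)]] by blast
    thus False using h(2) i by (auto simp: mcr_def invs_def)
   qed
   ultimately show "a o b : mcr n J L" using permutes_compose[OF ab(2,1)] by (simp add: mcr_def para_def)
  qed
  show "mcr n J L<=(%(a,b). a o b) ` (mcr n J K \<times> mcr n K L)"
  proof
   fix w assume w: "w : mcr n J L"
   hence wJ: "w : para n J" by (simp add: mcr_def)
   obtain a b where ab: "a : mcr n J K" "b : para n K" "w = a o b" "invs b = invs w Int blk_prs K"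
    using para_fac[OF KJ J wJ] .
   have bp: "b permutes {1..n}" using ab(2) by (simp add: para_def)
   have "b i < b (Suc i)" if i: "i : L" for i
   proof (rule ccontr)
    assume "~ b i < b (Suc i)"
    moreover have "b i~=b (Suc i)" using injD[OF permutes_inj[OF bp], of i "Suc i"] by auto
    ultimately have "(i,Suc i) : invs w" using ab(4) by (auto simp: invs_def)
    thus False using w i by (auto simp: mcr_def invs_def)
   qed
   hence "b : mcr n K L" using ab(2) by (simp add: mcr_def)
   thus "w : (%(a,b). a o b) ` (mcr n J K \<times> mcr n K L)" using ab by force
  qed
 qed
qed

section \<open>Positive braids, their length and their descents\<close>

abbreviation binv :: "nat=>strands set=>strands set" where
 "binv n X == m_inv (bgrp n) X"

lemma bgrp_cl: "[|X : fdias n; Y : fdias n|]==>dcomp n X Y : fdias n"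
 using monoid.m_closed[OF group.is_monoid[OF grp_bgrp], of X n Y] by simp

lemma bgrp_one: "idd n : fdias n" using monoid.one_closed[OF group.is_monoid[OF grp_bgrp], of n] by simp

lemma bgrp_one_simps:
 assumes "X : fdias n"
 shows "dcomp n (idd n) X = X" "dcomp n X (idd n) = X" using monoid.l_one[OF group.is_monoid[OF grp_bgrp], of X n]
  monoid.r_one[OF group.is_monoid[OF grp_bgrp], of X n] assms by simp_all

lemma binv_cl: "X : fdias n==>binv n X : fdias n" using group.inv_closed[OF grp_bgrp, of X n] by simp

lemma binv_comp:
 assumes "X : fdias n"
 shows "dcomp n (binv n X) X = idd n" "dcomp n X (binv n X) = idd n"
 using group.l_inv[OF grp_bgrp, of X n] group.r_inv[OF grp_bgrp, of X n] assms by simp_all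

lemma binv_can_r:
 assumes "X : fdias n" "Y : fdias n"
 shows "dcomp n (dcomp n X Y) (binv n Y) = X" "dcomp n (dcomp n X (binv n Y)) Y = X"
 using bgrp_assoc[OF assms binv_cl[OF assms(2)]] bgrp_assoc[OF assms(1) binv_cl[OF assms(2)] assms(2)]
  binv_comp[OF assms(2)] bgrp_one_simps(2)[OF assms(1)] by simp_all

lemma br_r_can:
 assumes "dcomp n X Z = dcomp n Y Z" "X : fdias n" "Y : fdias n" "Z : fdias n"
 shows "X = Y" using binv_can_r(1)[OF assms(2,4), symmetric] assms(1) binv_can_r(1)[OF assms(3,4)] by auto

definition sbraid where
 "sbraid n w = wbr n [w]"

lemma sbraid_full: "w permutes {1..n}==>sbraid n w : fdias n" by (simp add: sbraid_def wbr_full)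

lemma sbraid_comp:
 assumes "u permutes {1..n}" "v permutes {1..n}" "red_pair u v"
 shows "dcomp n (sbraid n u) (sbraid n v) = sbraid n (u o v)"
 using wbr_app[of "[u]" n "[v]"] wbr_weq[OF weq_pair[OF assms]] assms by (simp add: sbraid_def)

lemma sbraid_id: "sbraid n id = idd n" using wbr_weq[OF weq_unit, of n] by (simp add: sbraid_def wbr_Nil permutes_id)

definition positive where
 "positive n = wbr n ` bwords n"

lemma pos_full: "X : positive n==>X : fdias n" by (auto simp: positive_def wbr_full)

lemma pos_one: "idd n : positive n" unfolding positive_def by (rule image_eqI[of _ _ "[]"]) (simp_all add: wbr_Nil)

lemma pos_sbraid: "[|X : positive n; w permutes {1..n}|]==>dcomp n X (sbraid n w) : positive n"
 unfolding positive_def sbraid_def by (auto simp: wbr_app[symmetric] intro!: imageI)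

definition pos_word where
 "pos_word n y = (SOME a. a : bwords n & wbr n a = y)"

lemma pos_word:
 assumes "y : positive n"
 shows "pos_word n y : bwords n" "wbr n (pos_word n y) = y"
proof -
 have "EX a. a : bwords n & wbr n a = y" using assms by (auto simp: positive_def)
 from someI_ex[OF this] show "pos_word n y : bwords n" "wbr n (pos_word n y) = y" unfolding pos_word_def by simp_all
qed

lemma pos_word_weq:
 assumes "a : bwords n"
 shows "weq n (pos_word n (wbr n a)) a" using assms pos_word wbr_eqD by (auto simp: positive_def)

text \<open>A word is chosen, but the value does not depend on it: equal braids have equivalent
  words by \<open>wbr_eqD\<close>, and the relations preserve \<open>word_len\<close>.\<close>

definition blength where
 "blength n y = word_len (pos_word n y)"

lemma blength_word: "a : bwords n==>blength n (wbr n a) = word_len a"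
 unfolding blength_def by (rule weq_len[OF pos_word_weq])

lemma blength_sbraid:
 assumes "X : positive n" "w permutes {1..n}"
 shows "blength n (dcomp n X (sbraid n w)) = blength n X + card (invs w)"
proof -
 obtain a where a: "a : bwords n" "X = wbr n a" using assms(1) by (auto simp: positive_def)
 have "dcomp n X (sbraid n w) = wbr n (a @ [w])" using a assms(2) by (simp add: wbr_app sbraid_def)
 thus ?thesis using a assms(2) by (simp add: blength_word word_len_def)
qed

definition desc where
 "desc n y = {i : {1..<n}. (i,Suc i) : invs (last_fac n (pos_word n y))}"

text \<open>Descents at all generators of a block put the adjacent pairs into the inversion set of
  the last factor, and by transitivity all pairs of the block. Thus the longest element of
  \<open>J\<close> is the least common multiple of its generators.\<close>

lemma desc_div:
 assumes y: "y : positive n" and J: "J<={1..<n}"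
 shows "J<=desc n y <-> (EX x:positive n. y = dcomp n x (sbraid n (lng n J)))"
proof
 note w = pos_word[OF y] and l = lng[OF J]
 assume "J<=desc n y"
 hence "blk_prs J<=invs (last_fac n (pos_word n y))" by (intro invs_blk_prs) (auto simp: desc_def)
 hence "invs (lng n J)<=invs (last_fac n (pos_word n y))" by (simp add: l(2))
 from div_last_fac[OF w(1) l(1) this] obtain m where m: "m : bwords n" "weq n (pos_word n y) (m @ [lng n J])" .
 show "EX x:positive n. y = dcomp n x (sbraid n (lng n J))"
   using m(1) wbr_weq m(2) w(1) w(2) l(1) wbr_app by (auto simp: positive_def sbraid_def)
next
 note l = lng[OF J]
 assume "EX x:positive n. y = dcomp n x (sbraid n (lng n J))"
 then obtain a where a: "a : bwords n" "y = dcomp n (wbr n a) (sbraid n (lng n J))" by (auto simp: positive_def)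
 hence "y = wbr n (a @ [lng n J])" using l(1) by (simp add: wbr_app sbraid_def)
 hence "weq n (pos_word n y) (a @ [lng n J])" using pos_word_weq[of "a @ [lng n J]" n] a(1) l(1) by simp
 from last_fac_div[OF this a(1) l(1)]
 have *: "blk_prs J<=invs (last_fac n (pos_word n y))" by (simp add: l(2))
 show "J<=desc n y"
 proof
  fix i assume i: "i : J"
  hence "(i,Suc i) : blk_prs J" by (simp add: blk_prs_step)
  thus "i : desc n y" using * i J by (auto simp: desc_def)
 qed
qed

lemma perm_no_descent:
 assumes "w permutes {1..n::nat}" "!!i. i : {1..<n}==>(i,Suc i) ~: invs w"
 shows "w = id"
proof (rule invs_eqI[OF assms(1) permutes_id])
 have "(i,j) ~: invs w" for i j
 proof
  assume h: "(i,j) : invs w"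
  have r: "i : {1..n}" "j : {1..n}" "i < j" using perm_inversionsD[OF assms(1) h] .
  have "w i < w j"
  proof (rule increasing_blk[of "{1..<n}" w])
   fix k assume k: "k : {1..<n}"
   have "w k~=w (Suc k)" using injD[OF permutes_inj[OF assms(1)], of k "Suc k"] by auto
   thus "w k < w (Suc k)" using assms(2)[OF k] by (auto simp: invs_def)
  qed (use r in \<open>auto simp: blk_prs_def\<close>)
  thus False using h by (simp add: invs_def)
 qed
 thus "invs w = invs id" by auto
qed

text \<open>Without descents the last factor is the identity. A last factor always has the last
  letter as a suffix, so this letter is trivial, and so are the others in turn.\<close>

lemma desc_empty:
 assumes y: "y : positive n" and d: "desc n y = {}"
 shows "y = idd n"
proof -
 note w = pos_word[OF y]
 have *: "fst (greedy n ws) = id==>weq n ws []" if "ws : bwords n" for ws using that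
 proof (induction ws rule: rev_induct)
  case Nil
  thus ?case by (simp add: weq_refl)
 next
  case (snoc v ws)
  have ws: "ws : bwords n" "v permutes {1..n}" using snoc.prems by auto
  have lf: "fst (greedy n ws) permutes {1..n}" using last_fac_perm[OF ws(1)] by (simp add: last_fac_def)
  define x where "x = meetred n (fst (greedy n ws)) v"
  have x: "x permutes {1..n}" "red_pair x v" unfolding x_def using meetred[OF lf ws(2)] by blast+
  have "fst (greedy n (ws @ [v])) = x o v" by (simp add: greedy_snoc gstep_def x_def)
  hence "x o v = id" using snoc.prems(1) by (simp only:)
  hence "invs v<={}" using x(2) by (simp add: red_pair_def)
  hence v: "v = id" using invs_eqI[OF ws(2) permutes_id] by simp
  have "x = id" using `x o v = id` v by simp
  moreover have "x = fst (greedy n ws)" unfolding x_def v by (rule meetred_id[OF lf])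
  ultimately have "weq n ws []" using snoc.IH ws(1) by simp
  moreover have "weq n (ws @ [v]) (ws @ [])" unfolding v using weq.intros(5)[OF ws(1), of "[]"] by simp
  ultimately show ?case using weq_trans[of n "ws @ [v]" ws "[]"] by simp
 qed
 have "last_fac n (pos_word n y) = id"
  using d by (intro perm_no_descent[OF last_fac_perm[OF w(1)]]) (auto simp: desc_def)
 hence "weq n (pos_word n y) []" using *[OF w(1)] by (simp add: last_fac_def)
 from wbr_weq[OF this w(1)] show ?thesis unfolding w(2) wbr_Nil .
qed

text \<open>A high power of the full twist is a multiple of the denominator of \<open>X\<close>, so
  \<open>X\<close> times this power is positive. The power is wanted on the left, for the sake of
  translations; that it commutes with \<open>X\<close> follows by cancelling the
  denominator.\<close>

lemma ftw_clear:
 assumes "X : fdias n"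
 obtains k where "!!l. l >= k==>dcomp n (wbr n (ftw n l)) X : positive n"
proof -
 obtain u v where uv: "u : bwords n" "v : bwords n" "dcomp n X (wbr n u) = wbr n v" using br_frac[OF assms] .
 obtain us where us: "us : bwords n" "weq n (u @ us) (ftw n (length u))" using word_cpl[OF uv(1)] .
 have "dcomp n (wbr n (ftw n l)) X : positive n" if l: "l >= length u" for l
 proof -
  let ?z = "wbr n (ftw n l)"
  define m where "m = l - length u"
  have z: "?z : fdias n" by (rule wbr_full[OF ftw_words])
  have "weq n (u @ us @ ftw n m) (ftw n l)"
   using weq_cong[OF us(2), of "[]" "ftw n m"] l by (simp add: ftw_add[symmetric] m_def)
  hence "wbr n (u @ us @ ftw n m) = ?z" using uv us by (intro wbr_weq) auto
  hence e: "dcomp n (wbr n u) (wbr n (us @ ftw n m)) = ?z" using wbr_app[OF uv(1), of "us @ ftw n m"] us by simp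
  have Xz: "dcomp n X ?z = wbr n (v @ us @ ftw n m)"
   using bgrp_assoc[OF assms wbr_full[OF uv(1)] wbr_full, of "us @ ftw n m"] e uv us by (simp add: wbr_app)
  have c: "dcomp n ?z (wbr n a) = dcomp n (wbr n a) ?z" if "a : bwords n" for a
   using wbr_weq[OF ftw_cen[OF that, of l]] that by (simp add: wbr_app)
  have "dcomp n (dcomp n ?z X) (wbr n u) = dcomp n ?z (wbr n v)"
   using bgrp_assoc[OF z assms wbr_full[OF uv(1)]] uv(3) by simp
  also have "... = dcomp n X (dcomp n (wbr n u) ?z)"
   using c[OF uv(2)] uv(3) bgrp_assoc[OF assms wbr_full[OF uv(1)] z] by simp
  also have "... = dcomp n (dcomp n X ?z) (wbr n u)" using c[OF uv(1)] bgrp_assoc[OF assms z wbr_full[OF uv(1)]] by simp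
  finally have "dcomp n ?z X = dcomp n X ?z" using assms z uv by (elim br_r_can) (simp_all add: bgrp_cl wbr_full)
  moreover have "dcomp n X ?z : positive n" unfolding Xz positive_def by (rule imageI) (simp add: uv us)
  ultimately show ?thesis by (simp only:)
 qed
 thus thesis by (rule that)
qed

section \<open>The boundary and the cone\<close>

type_synonym cell = "strands set \<times> nat set"

text \<open>The sign of the face opposite to the vertex \<open>j\<close> in the simplex with vertex
  set \<open>J\<close>.\<close>

definition psgn :: "nat=>nat set=>int" where
 "psgn j J = (- 1) ^ card {i : J. i < j}"

text \<open>
  The cellular chain complex of the universal cover of the Salvetti complex of the braid group, with a cell
  \<open>(X, J)\<close> for every braid \<open>X\<close> and every set \<open>J\<close> of standard generators.
\<close>

definition bdry where
 "bdry n c = (\<Sum>j\<in>snd c. \<Sum>w\<in>mcr n (snd c) (snd c - {j}).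
  fcm (psgn j (snd c) * sign w) (frg (dcomp n (fst c) (sbraid n w),snd c - {j})))"

lemma fin_perms: "finite {w. w permutes {1..n::nat}}" by (rule finite_permutations) simp

lemma mcr_perm: "w : mcr n J K==>w permutes {1..n}" by (simp add: mcr_def para_def)

lemma fin_mcr: "finite (mcr n J K)" by (rule finite_subset[OF _ fin_perms[of n]]) (auto dest: mcr_perm)

lemma sgn_comp_perm:
 assumes "u permutes {1..n::nat}" "v permutes {1..n}"
 shows "sign (u o v) = sign u * sign v"
 using sign_compose[OF permutes_imp_permutation[OF _ assms(1)] permutes_imp_permutation[OF _ assms(2)]] by simp

lemma sgn_square: "sign w * sign w = 1" by (simp add: sign_def)

lemma fin_gens: "J<={1..<n::nat}==>finite J" by (rule finite_subset) auto

lemma psgn_swap: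
 assumes "finite J" "i : J" "j : J" "i < j"
 shows "psgn i J * psgn j (J - {i}) = - (psgn j J * psgn i (J - {j}))"
proof -
 have "{k : J - {i}. k < j} = {k : J. k < j} - {i}" by auto
 moreover have "card ({k : J. k < j}) = Suc (card ({k : J. k < j} - {i}))" by (rule card.remove) (use assms in auto)
 moreover have "{k : J - {j}. k < i} = {k : J. k < i}" using assms(4) by auto
 ultimately show ?thesis by (simp add: psgn_def)
qed

lemma psgn_square: "psgn j J * psgn j J = 1" by (simp add: psgn_def power_add[symmetric])

text \<open>By \<open>mcr_comp\<close> the terms that omit \<open>i\<close> and \<open>j\<close>
  depend on the order of omission only through the simplicial signs, which are opposite. So the
  double sum equals its own negative.\<close>

lemma bdry_twice:
 assumes X: "X : fdias n" and J: "J<={1..<n}"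
 shows "fex (bdry n) (bdry n (X,J)) = 0"
proof -
 define E where "E L = (\<Sum>v\<in>mcr n J L. fcm (sign v) (frg (dcomp n X (sbraid n v),L)))" for L
 have fin: "finite J" using J by (rule fin_gens)
 define G where "G i j = fcm (psgn i J * psgn j (J - {i})) (E (J - {i} - {j}))" for i j
 have inner: "fex (bdry n) (\<Sum>w\<in>mcr n J (J - {i}). fcm (psgn i J * sign w) (frg (dcomp n X (sbraid n w),J - {i})))
  = (\<Sum>j\<in>J - {i}. G i j)" for i
 proof -
  have "fex (bdry n) (\<Sum>w\<in>mcr n J (J - {i}). fcm (psgn i J * sign w) (frg (dcomp n X (sbraid n w),J - {i})))
   = (\<Sum>w\<in>mcr n J (J - {i}). fcm (psgn i J * sign w) (bdry n (dcomp n X (sbraid n w),J - {i})))"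
   by (simp add: frag_extend_sum fin_mcr frag_extend_cmul)
  also have "... = (\<Sum>w\<in>mcr n J (J - {i}). \<Sum>j\<in>J - {i}. \<Sum>v\<in>mcr n (J - {i}) (J - {i} - {j}).
    fcm (psgn i J * psgn j (J - {i})) (fcm (sign (w o v)) (frg (dcomp n X (sbraid n (w o v)),J - {i} - {j}))))"
  proof (rule sum.cong[OF HOL.refl])
   fix w assume w: "w : mcr n J (J - {i})"
   have wp: "w permutes {1..n}" using w by (rule mcr_perm)
   show "fcm (psgn i J * sign w) (bdry n (dcomp n X (sbraid n w),J - {i})) = (\<Sum>j\<in>J - {i}. \<Sum>v\<in>mcr n (J - {i}) (J - {i} - {j}).
    fcm (psgn i J * psgn j (J - {i})) (fcm (sign (w o v)) (frg (dcomp n X (sbraid n (w o v)),J - {i} - {j}))))"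
    unfolding bdry_def fst_conv snd_conv frag_cmul_sum
   proof (intro sum.cong HOL.refl)
    fix j v assume v: "v : mcr n (J - {i}) (J - {i} - {j})"
    have vp: "v permutes {1..n}" using v by (rule mcr_perm)
    have vpar: "v : para n (J - {i})" using v by (simp add: mcr_def)
    show "fcm (psgn i J * sign w) (fcm (psgn j (J - {i}) * sign v) (frg (dcomp n (dcomp n X (sbraid n w)) (sbraid n v),J - {i} - {j})))
     = fcm (psgn i J * psgn j (J - {i})) (fcm (sign (w o v)) (frg (dcomp n X (sbraid n (w o v)),J - {i} - {j})))"
   by (simp add: sgn_comp_perm[OF wp vp] mult_ac bgrp_assoc X sbraid_full[OF wp] sbraid_full[OF vp] sbraid_comp[OF wp vp cos_rp(1)[OF w vpar]])
   qed
  qed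
  also have "... = (\<Sum>j\<in>J - {i}. \<Sum>w\<in>mcr n J (J - {i}). \<Sum>v\<in>mcr n (J - {i}) (J - {i} - {j}).
    fcm (psgn i J * psgn j (J - {i})) (fcm (sign (w o v)) (frg (dcomp n X (sbraid n (w o v)),J - {i} - {j}))))"
   by (rule sum.swap)
  also have "... = (\<Sum>j\<in>J - {i}. G i j)"
  proof (rule sum.cong[OF HOL.refl])
   fix j assume "j : J - {i}"
   let ?f = "%v. fcm (psgn i J * psgn j (J - {i})) (fcm (sign v) (frg (dcomp n X (sbraid n v),J - {i} - {j})))"
   have "(\<Sum>w\<in>mcr n J (J - {i}). \<Sum>v\<in>mcr n (J - {i}) (J - {i} - {j}). ?f (w o v))
     = (\<Sum>(w,v)\<in>mcr n J (J - {i}) \<times> mcr n (J - {i}) (J - {i} - {j}). ?f (w o v))"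
    by (rule sum.cartesian_product)
   also have "... = (\<Sum>p\<in>mcr n J (J - {i}) \<times> mcr n (J - {i}) (J - {i} - {j}). ?f ((%(w,v). w o v) p))"
    by (simp add: case_prod_beta')
   also have "... = (\<Sum>v\<in>mcr n J (J - {i} - {j}). ?f v)"
    by (rule sum.reindex_bij_betw[OF mcr_comp]) (use J in auto)
   also have "... = G i j" by (simp add: G_def E_def frag_cmul_sum)
   finally show "(\<Sum>w\<in>mcr n J (J - {i}). \<Sum>v\<in>mcr n (J - {i}) (J - {i} - {j}). ?f (w o v)) = G i j" .
  qed
  finally show ?thesis .
 qed
 have anti: "G j i = - G i j" if "i : J" "j : J" "i~=j" for i j
 proof -
  have *: "psgn j J * psgn i (J - {j}) = - (psgn i J * psgn j (J - {i}))"
   using psgn_swap[OF fin, of i j] psgn_swap[OF fin, of j i] that by (cases i j rule: linorder_cases) auto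
  have "J - {j} - {i} = J - {i} - {j}" by auto
  thus ?thesis unfolding G_def * by (simp add: minus_frag_cmul)
 qed
 define P where "P = {(i,j). i : J & j : J & i~=j}"
 have P: "P = Sigma J (%i. J - {i})" by (auto simp: P_def)
 define S where "S = (\<Sum>p\<in>P. G (fst p) (snd p))"
 have "fex (bdry n) (bdry n (X,J)) = (\<Sum>i\<in>J. \<Sum>j\<in>J - {i}. G i j)"
  unfolding bdry_def[of n "(X,J)"] fst_conv snd_conv by (simp add: frag_extend_sum fin inner)
 also have "... = S" unfolding S_def P using sum.Sigma[of J "%i. J - {i}" G] fin by (simp add: case_prod_beta')
 finally have 1: "fex (bdry n) (bdry n (X,J)) = S" .
 have "S = (\<Sum>p\<in>P. G (snd p) (fst p))"
  unfolding S_def by (rule sum.reindex_bij_witness[of _ prod.swap prod.swap]) (auto simp: P_def)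
 also have "... = (\<Sum>p\<in>P. - G (fst p) (snd p))" by (intro sum.cong HOL.refl anti) (auto simp: P_def)
 also have "... = - S" by (simp add: S_def sum_negf)
 finally have "S = - S" .
 \<comment> \<open>Integral chains have no 2-torsion.\<close>
 have "Poly_Mapping.lookup S c = 0" for c
  using arg_cong[OF `S = - S`, of "%S. Poly_Mapping.lookup S c"] unfolding lookup_uminus by linarith
 hence "S = 0" by (simp add: poly_mapping_eqI)
 thus ?thesis using 1 by simp
qed

definition top_of where
 "top_of n c = dcomp n (fst c) (sbraid n (lng n (snd c)))"

text \<open>The cell of type \<open>J\<close> with top \<open>y\<close>, obtained by division. For a
  positive \<open>y\<close> it is a positive cell exactly if \<open>J\<close> consists of descents
  of \<open>y\<close>.\<close>

definition cell_blw where
 "cell_blw n y J = (dcomp n y (binv n (sbraid n (lng n J))),J)"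

definition lowc where
 "lowc n i l = {(X,J). X : positive n & J<={1..<n} & card J = i & blength n (top_of n (X,J)) < l}"

text \<open>The least descent serves as the apex because its \<open>psgn\<close> in any set of
  descents containing it is 1. A cell that contains the apex already is sent to 0, as in the cone of
  a simplex.\<close>

definition cone where
 "cone n c = (let y = top_of n c; J = snd c; s = Min (desc n y) in
  if desc n y = {} | s : J then 0
  else fcm (sign (lng n J) * sign (lng n (insert s J))) (frg (cell_blw n y (insert s J))))"

lemma top_cell_blw:
 assumes "y : fdias n" "J<={1..<n}"
 shows "top_of n (cell_blw n y J) = y"
 using binv_can_r(2)[OF assms(1) sbraid_full[OF lng(1)[OF assms(2)]]] by (simp add: top_of_def cell_blw_def)

lemma cell_blw_top:
 assumes "X : fdias n" "J<={1..<n}"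
 shows "cell_blw n (top_of n (X,J)) J = (X,J)"
 using binv_can_r(1)[OF assms(1) sbraid_full[OF lng(1)[OF assms(2)]]] by (simp add: top_of_def cell_blw_def)

lemma top_pos: "[|X : positive n; J<={1..<n}|]==>top_of n (X,J) : positive n"
 unfolding top_of_def by (simp add: pos_sbraid lng(1))

lemma top_desc: "[|X : positive n; J<={1..<n}|]==>J<=desc n (top_of n (X,J))"
 using desc_div[of "top_of n (X,J)" n J] top_pos[of X n J] by (auto simp: top_of_def)

lemma cell_blw_pos:
 assumes y: "y : positive n" and J: "J<=desc n y"
 shows "fst (cell_blw n y J) : positive n" "J<={1..<n}"
proof -
 show Jn: "J<={1..<n}" using J by (auto simp: desc_def)
 obtain x where x: "x : positive n" "y = dcomp n x (sbraid n (lng n J))" using desc_div[OF y Jn] J by blast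
 thus "fst (cell_blw n y J) : positive n"
  using binv_can_r(1)[OF pos_full[OF x(1)] sbraid_full[OF lng(1)[OF Jn]]] by (simp add: cell_blw_def)
qed

lemma sum_frag_keys:
 assumes "!!x. x : A==>keys (f x)<=S"
 shows "keys (\<Sum>x\<in>A. f x :: 'a \<Rightarrow>\<^sub>0 int)<=S"
proof (cases "finite A")
 case True
 thus ?thesis using assms
 proof (induction A)
  case (insert x A)
  thus ?case using keys_add[of "f x" "sum f A"] by auto
 qed simp
qed simp

text \<open>The top of the face given by \<open>w\<close> has the length of \<open>X\<close> plus
  that of \<open>w o lng n (J - {j})\<close>. The latter is a longest element of the parabolic
  subgroup of \<open>J\<close> only if \<open>w\<close> is the longest representative
  \<open>m j\<close>, so all other faces are shorter.\<close>

lemma bdry_leading: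
 assumes y: "y : positive n" and J: "J<=desc n y"
 obtains r where "keys r<=lowc n (card J - 1) (blength n y)"
  "bdry n (cell_blw n y J) = (\<Sum>j\<in>J. fcm (psgn j J * sign (lng n J) * sign (lng n (J - {j}))) (frg (cell_blw n y (J - {j})))) + r"
proof -
 note cb = cell_blw_pos[OF y J]
 define X where "X = fst (cell_blw n y J)"
 have X: "X : positive n" "cell_blw n y J = (X,J)" using cb(1) by (auto simp: X_def cell_blw_def)
 note Xf = pos_full[OF X(1)] and lJ = lng[OF cb(2)] and fin = fin_gens[OF cb(2)]
 have top: "dcomp n X (sbraid n (lng n J)) = y"
  using top_cell_blw[OF pos_full[OF y] cb(2)] X(2) by (simp add: top_of_def)
 have len: "blength n y = blength n X + card (blk_prs J)" using blength_sbraid[OF X(1) lJ(1)] top lJ(2) by simp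
 define m where "m j = lng n J o pinv (lng n (J - {j}))" for j
 define face where "face j w = fcm (psgn j J * sign w) (frg (dcomp n X (sbraid n w),J - {j}))" for j w
 have mj: "m j : mcr n J (J - {j})" and tm: "face j (m j) = fcm (psgn j J * sign (lng n J) * sign (lng n (J - {j}))) (frg (cell_blw n y (J - {j})))"
  and low: "!!w. [|w : mcr n J (J - {j}); w~=m j|]==>keys (face j w)<=lowc n (card J - 1) (blength n y)"
  if j: "j : J" for j
 proof -
  let ?K = "J - {j}"
  have K: "?K<={1..<n}" using cb(2) by auto
  note lK = lng[OF K]
  have lpar: "lng n J : para n J" using lJ by (simp add: para_def)
  obtain a b where ab: "a : mcr n J ?K" "b : para n ?K" "lng n J = a o b" "invs b = invs (lng n J) Int blk_prs ?K"
   using para_fac[OF _ cb(2) lpar, of ?K] by blast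
  have bp: "b permutes {1..n}" using ab(2) by (simp add: para_def)
  have b: "b = lng n ?K" using invs_eqI[OF bp lK(1)] ab(4) lJ(2) lK(2) blk_prs_mono J by blast
  have "m j = a" unfolding m_def ab(3) b[symmetric] by (simp add: feq permutes_inverses(1)[OF bp])
  thus mj: "m j : mcr n J ?K" using ab(1) by simp
  have mp: "m j permutes {1..n}" by (rule mcr_perm[OF mj])
  have lKpar: "lng n ?K : para n ?K" using lK by (simp add: para_def)
  have ml: "m j o lng n ?K = lng n J" using `m j = a` ab(3) b by simp
  have "dcomp n X (sbraid n (m j)) = dcomp n y (binv n (sbraid n (lng n ?K)))"
   using binv_can_r(1)[OF bgrp_cl[OF Xf sbraid_full[OF mp]] sbraid_full[OF lK(1)]] bgrp_assoc[OF Xf sbraid_full[OF mp] sbraid_full[OF lK(1)]] sbraid_comp[OF mp lK(1) cos_rp(1)[OF mj lKpar]] ml top by auto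
  moreover have "sign (m j) = sign (lng n J) * sign (lng n ?K)" using sgn_comp_perm[OF mp lK(1)] ml by auto
  ultimately show "face j (m j) = fcm (psgn j J * sign (lng n J) * sign (lng n ?K)) (frg (cell_blw n y ?K))"
   by (simp add: face_def cell_blw_def mult.assoc)
  fix w assume w: "w : mcr n J ?K" "w~=m j"
  have wp: "w permutes {1..n}" by (rule mcr_perm[OF w(1)])
  have wl: "w o lng n ?K permutes {1..n}" by (rule permutes_compose[OF lK(1) wp])
  have r: "red_pair w (lng n ?K)" by (rule cos_rp(1)[OF w(1) lKpar])
  have "lng n ?K : mcr n ?K {}" using lKpar by (simp add: mcr_def)
  hence "w o lng n ?K : mcr n J {}"
   using bij_betw_apply[OF mcr_comp[of "{}" ?K J n], of "(w,lng n ?K)"] w(1) cb(2) by auto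
  hence sub: "invs (w o lng n ?K)<=blk_prs J" by (simp add: mcr_def para_def)
  have "invs (w o lng n ?K)~=blk_prs J"
  proof
   assume "invs (w o lng n ?K) = blk_prs J"
   hence "w o lng n ?K = lng n J" using invs_eqI[OF wl lJ(1)] lJ(2) by simp
   hence "(w o lng n ?K) o pinv (lng n ?K) = m j" by (simp add: m_def)
   hence "w = m j" by (simp add: feq permutes_inverses(1)[OF lK(1)])
   thus False using w(2) by simp
  qed
  moreover have "finite (blk_prs J)" using fin_invs[OF lJ(1)] lJ(2) by simp
  ultimately have "card (invs (w o lng n ?K)) < card (blk_prs J)" using sub by (simp add: psubset_card_mono psubset_eq)
  moreover have "dcomp n X (sbraid n w) : positive n" by (rule pos_sbraid[OF X(1) wp])
  moreover have "top_of n (dcomp n X (sbraid n w),?K) = dcomp n X (sbraid n (w o lng n ?K))"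
   using bgrp_assoc[OF Xf sbraid_full[OF wp] sbraid_full[OF lK(1)]] sbraid_comp[OF wp lK(1) r] by (simp add: top_of_def)
  ultimately have "(dcomp n X (sbraid n w),?K) : lowc n (card J - 1) (blength n y)"
   using K len blength_sbraid[OF X(1) wl] j fin by (simp add: lowc_def card_Diff_singleton)
  thus "keys (face j w)<=lowc n (card J - 1) (blength n y)"
   unfolding face_def using keys_cmul[of _ "frg (dcomp n X (sbraid n w),?K)"] by (auto simp: keys_frag_of)
 qed
 define r where "r = (\<Sum>j\<in>J. \<Sum>w\<in>mcr n J (J - {j}) - {m j}. face j w)"
 have "bdry n (cell_blw n y J) = (\<Sum>j\<in>J. \<Sum>w\<in>mcr n J (J - {j}). face j w)"
  by (simp add: X(2) bdry_def face_def)
 also have "... = (\<Sum>j\<in>J. face j (m j) + (\<Sum>w\<in>mcr n J (J - {j}) - {m j}. face j w))"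
  by (intro sum.cong HOL.refl sum.remove fin_mcr mj)
 also have "... = (\<Sum>j\<in>J. fcm (psgn j J * sign (lng n J) * sign (lng n (J - {j}))) (frg (cell_blw n y (J - {j})))) + r"
  by (simp add: sum.distrib r_def tm)
 finally have "bdry n (cell_blw n y J) = ..." .
 moreover have "keys r<=lowc n (card J - 1) (blength n y)" unfolding r_def by (intro sum_frag_keys low) auto
 ultimately show thesis using that by blast
qed

lemma bdry_empty: "bdry n (X,{}) = 0" by (simp add: bdry_def)

lemma cone_keys:
 assumes c: "c : lowc n i l"
 shows "keys (cone n c)<=lowc n (Suc i) l"
proof -
 obtain X J where XJ: "c = (X,J)" "X : positive n" "J<={1..<n}" "card J = i" "blength n (top_of n (X,J)) < l"
  using c by (auto simp: lowc_def)
 define y where "y = top_of n (X,J)"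
 define s where "s = Min (desc n y)"
 have y: "y : positive n" "J<=desc n y" using XJ by (simp_all add: y_def top_pos top_desc)
 show ?thesis
 proof (cases "desc n y = {} | s : J")
  case True
  hence "cone n c = 0" by (simp add: cone_def XJ(1) y_def[symmetric] s_def[symmetric])
  thus ?thesis by simp
 next
  case False
  have "finite (desc n y)" by (simp add: desc_def)
  hence s: "s : desc n y" using False by (simp add: s_def)
  hence sub: "insert s J<=desc n y" using y(2) by simp
  note cb = cell_blw_pos[OF y(1) sub]
  have card: "card (insert s J) = Suc i" using False fin_gens[OF XJ(3)] XJ(4) by simp
  have "cell_blw n y (insert s J) : lowc n (Suc i) l"
   using cb card XJ(5) top_cell_blw pos_full y(1) by (fastforce simp: lowc_def y_def cell_blw_def)
  moreover have "cone n c = fcm (sign (lng n J) * sign (lng n (insert s J))) (frg (cell_blw n y (insert s J)))"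
   using False by (simp add: cone_def XJ(1) y_def[symmetric] s_def[symmetric])
  ultimately show ?thesis using keys_cmul[of _ "frg (cell_blw n y (insert s J))"] by fastforce
 qed
qed

lemma fext_keys:
 assumes "!!x. x : keys c==>keys (f x)<=S"
 shows "keys (fex f c)<=S" using keys_frag_extend[of f c] assms by blast

lemma fext_cone_low:
 assumes "keys r<=lowc n i l"
 shows "keys (fex (cone n) r)<=lowc n (Suc i) l" by (rule fext_keys) (rule cone_keys, use assms in blast)

lemma keys_diff_sub:
 fixes a b :: "'a \<Rightarrow>\<^sub>0 int"
 assumes "keys a<=S" "keys b<=S"
 shows "keys (a - b)<=S" "keys (a + b)<=S" using keys_diff[of a b] keys_add[of a b] assms by auto

lemma frag_cmul_diff2: "fcm c (a - b) = fcm c a - fcm c b"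
 by (rule poly_mapping_eqI) (simp add: lookup_minus right_diff_distrib)

text \<open>
  With the sign of the longest element absorbed into each cell, the leading terms of \<open>bdry\<close> on the cells with a
  common top form an augmented simplex on the descents, and \<open>cone\<close> is the cone from its least vertex.
\<close>

lemma cone_htpy:
 assumes X: "X : positive n" and J: "J<={1..<n}" and ne: "desc n (top_of n (X,J))~={}"
 shows "keys (fex (bdry n) (cone n (X,J)) + fex (cone n) (bdry n (X,J)) - frg (X,J))
 <=lowc n (card J) (blength n (top_of n (X,J)))"
proof -
 define y where "y = top_of n (X,J)"
 define D where "D = desc n y"
 define s where "s = Min D"
 define sg :: "nat set=>int" where "sg K = sign (lng n K)" for K
 define L where "L = lowc n (card J) (blength n y)"
 have y: "y : positive n" "J<=D" using X J by (simp_all add: y_def D_def top_pos top_desc)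
 have fD: "finite D" "D<={1..<n}" by (auto simp: D_def desc_def)
 have s: "s : D" using ne fD(1) by (simp add: s_def D_def y_def)
 have smin: "s<=j" if "j : D" for j using fD(1) that by (simp add: s_def)
 have fJ: "finite J" by (rule fin_gens[OF J])
 have cbJ: "cell_blw n y J = (X,J)" unfolding y_def by (rule cell_blw_top[OF pos_full[OF X] J])
 have sg2: "sg K * sg K = 1" for K by (simp add: sg_def sgn_square)
 define E where "E K = fcm (sg K) (frg (cell_blw n y K))" for K
 have XE: "frg (X,J) = fcm (sg J) (E J)" by (simp add: E_def cbJ sg2)
 have hcb: "cone n (cell_blw n y K) = (if s : K then 0 else fcm (sg K) (E (insert s K)))" if K: "K<=D" for K
 using top_cell_blw pos_full y(1) K fD s by (fastforce simp: cell_blw_def cone_def Let_def D_def s_def E_def sg_def)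
 have bE: "EX r. keys r<=lowc n (card K - 1) (blength n y) &
   bdry n (cell_blw n y K) = (\<Sum>j\<in>K. fcm (psgn j K * sg K) (E (K - {j}))) + r" if K: "K<=D" for K
 proof -
  obtain r where r: "keys r<=lowc n (card K - 1) (blength n y)"
   "bdry n (cell_blw n y K) = (\<Sum>j\<in>K. fcm (psgn j K * sign (lng n K) * sign (lng n (K - {j}))) (frg (cell_blw n y (K - {j})))) + r"
   using bdry_leading[OF y(1) K[unfolded D_def]] .
  show ?thesis using r by (intro exI[of _ r]) (simp add: E_def sg_def mult.assoc)
 qed
 have hE: "fex (cone n) (E K) = (if s : K then 0 else E (insert s K))" if "K<=D" for K
  using hcb[OF that] sg2 by (simp add: E_def[of K] frag_extend_cmul)
 have goal: "fex (bdry n) (cone n (X,J)) + fex (cone n) (bdry n (X,J)) - frg (X,J) = t==>keys t<=L==>?thesis" for t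
  by (simp add: L_def y_def)
 have hlow: "keys (fex (cone n) r)<=L" if "keys r<=lowc n (card J - 1) (blength n y)" "J~={}" for r
  using fext_cone_low[OF that(1)] that(2) fJ by (simp add: L_def card_gt_0_iff)
 have hb: "EX r. keys r<=L & fex (cone n) (bdry n (X,J))
  = (\<Sum>j\<in>J. fcm (psgn j J * sg J) (fex (cone n) (E (J - {j})))) + r"
 proof (cases "J = {}")
  case True
  thus ?thesis by (intro exI[of _ 0]) (simp add: bdry_empty)
 next
  case False
  from bE[OF y(2)] obtain r where r: "keys r<=lowc n (card J - 1) (blength n y)"
   "bdry n (cell_blw n y J) = (\<Sum>j\<in>J. fcm (psgn j J * sg J) (E (J - {j}))) + r" by blast
  show ?thesis using r(2) by (intro exI[of _ "fex (cone n) r"] conjI hlow[OF r(1) False])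
    (simp add: cbJ frag_extend_add frag_extend_sum fJ frag_extend_cmul)
 qed
 then obtain r where r: "keys r<=L" "fex (cone n) (bdry n (X,J))
  = (\<Sum>j\<in>J. fcm (psgn j J * sg J) (fex (cone n) (E (J - {j})))) + r" by blast
 show ?thesis
 proof (cases "s : J")
  case True
  have "{i : J. i < s} = {}" using smin y(2) by force
  hence ps: "psgn s J = 1" by (simp only: psgn_def card.empty power_0)
  \<comment> \<open>The cone annihilates all faces that still contain \<open>s\<close>; from the
    face without \<open>s\<close> it restores the cell.\<close>
  have "fcm (psgn j J * sg J) (fex (cone n) (E (J - {j}))) = (if j = s then frg (X,J) else 0)" if "j : J" for j
  proof (cases "j = s")
   case True
   have "fex (cone n) (E (J - {s})) = E J" using hE[of "J - {s}"] y(2) `s : J` by (auto simp: insert_absorb)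
   thus ?thesis using True by (simp add: ps XE)
  next
   case False
   hence "fex (cone n) (E (J - {j})) = 0" using hE[of "J - {j}"] y(2) `s : J` by auto
   thus ?thesis using False by simp
  qed
  hence "(\<Sum>j\<in>J. fcm (psgn j J * sg J) (fex (cone n) (E (J - {j})))) = (\<Sum>j\<in>J. if j = s then frg (X,J) else 0)"
   by (rule sum.cong[OF HOL.refl])
  also have "... = frg (X,J)" using True fJ by simp
  finally have "fex (cone n) (bdry n (X,J)) = frg (X,J) + r" unfolding r(2) by simp
  moreover have "cone n (X,J) = 0" using hcb[OF y(2)] True by (simp add: cbJ)
  ultimately show ?thesis using r(1) by (intro goal[of r]) simp_all
 next
  case False
  let ?K = "insert s J"
  have K: "?K<=D" using s y(2) by simp
  from bE[OF K] obtain r' where r': "keys r'<=lowc n (card ?K - 1) (blength n y)"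
   "bdry n (cell_blw n y ?K) = (\<Sum>j\<in>?K. fcm (psgn j ?K * sg ?K) (E (?K - {j}))) + r'" by blast
  have r'L: "keys r'<=L" using r'(1) fJ False by (simp add: L_def)
  have "{i : ?K. i < s} = {}" using smin K by force
  hence ps: "psgn s ?K = 1" by (simp only: psgn_def card.empty power_0)
  \<comment> \<open>The new least element shifts every other generator by one place. The resulting
    change of sign is what makes the two sums cancel.\<close>
  have psj: "psgn j ?K = - psgn j J" if "j : J" for j
  proof -
   have "s < j" using smin[of j] that y(2) False by (cases "s = j") auto
   hence "{i : ?K. i < j} = insert s {i : J. i < j}" by auto
   thus ?thesis using False fJ by (simp add: psgn_def)
  qed
  have hX: "cone n (X,J) = fcm (sg J) (E ?K)" using hcb[OF y(2)] False by (simp add: cbJ)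
  have "fex (bdry n) (E ?K) = fcm (sg ?K) ((\<Sum>j\<in>?K. fcm (psgn j ?K * sg ?K) (E (?K - {j}))) + r')"
   unfolding E_def[of ?K] by (simp only: frag_extend_cmul frag_extend_of r'(2))
  also have "(\<Sum>j\<in>?K. fcm (psgn j ?K * sg ?K) (E (?K - {j})))
    = fcm (sg ?K) (E J) + (\<Sum>j\<in>J. fcm (psgn j ?K * sg ?K) (E (?K - {j})))" using fJ False by (simp add: ps)
  also have "(\<Sum>j\<in>J. fcm (psgn j ?K * sg ?K) (E (?K - {j}))) = (\<Sum>j\<in>J. fcm (sg ?K) (- fcm (psgn j J) (E (insert s (J - {j})))))"
  proof (rule sum.cong[OF HOL.refl])
   fix j assume j: "j : J"
   have "?K - {j} = insert s (J - {j})" using j False by auto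
   thus "fcm (psgn j ?K * sg ?K) (E (?K - {j})) = fcm (sg ?K) (- fcm (psgn j J) (E (insert s (J - {j}))))"
    by (simp add: psj[OF j] mult.commute)
  qed
  also have "... = fcm (sg ?K) (- (\<Sum>j\<in>J. fcm (psgn j J) (E (insert s (J - {j})))))"
   by (simp only: frag_cmul_sum[symmetric] sum_negf)
  finally have "fex (bdry n) (E ?K) = E J - (\<Sum>j\<in>J. fcm (psgn j J) (E (insert s (J - {j})))) + fcm (sg ?K) r'"
   by (simp add: frag_cmul_distrib2 sg2)
  hence dh: "fex (bdry n) (cone n (X,J)) = frg (X,J) - fcm (sg J) (\<Sum>j\<in>J. fcm (psgn j J) (E (insert s (J - {j})))) + fcm (sg J * sg ?K) r'"
   by (simp add: hX frag_extend_cmul frag_cmul_distrib2 frag_cmul_diff2 XE)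
  have "fcm (psgn j J * sg J) (fex (cone n) (E (J - {j}))) = fcm (sg J) (fcm (psgn j J) (E (insert s (J - {j}))))" if "j : J" for j
  proof -
   have "J - {j}<=D" "s ~: J - {j}" using y(2) False by auto
   hence "fex (cone n) (E (J - {j})) = E (insert s (J - {j}))" using hE[of "J - {j}"] by (simp only: if_False)
   thus ?thesis by (simp add: mult.commute)
  qed
  hence "fex (cone n) (bdry n (X,J)) = (\<Sum>j\<in>J. fcm (sg J) (fcm (psgn j J) (E (insert s (J - {j}))))) + r"
   unfolding r(2) by simp
  also have "(\<Sum>j\<in>J. fcm (sg J) (fcm (psgn j J) (E (insert s (J - {j}))))) = fcm (sg J) (\<Sum>j\<in>J. fcm (psgn j J) (E (insert s (J - {j}))))"
   by (simp only: frag_cmul_sum)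
  finally have "fex (bdry n) (cone n (X,J)) + fex (cone n) (bdry n (X,J)) - frg (X,J) = fcm (sg J * sg ?K) r' + r"
   unfolding dh by simp
  moreover have "keys (fcm (sg J * sg ?K) r' + r)<=L"
   using keys_cmul[of _ r'] r'L r(1) by (intro keys_diff_sub) blast+
  ultimately show ?thesis by (rule goal)
 qed
qed

section \<open>Chains with coefficients in a ring\<close>

definition single where
 "single R b c = (%x. if x = b then c else \<zero>[R])"

text \<open>Additivity is enough to compare maps: \<open>amap_eqI\<close> tests them on basis
  elements with arbitrary coefficients.\<close>

definition addmap :: "('a,'b,'m) module_scheme=>('c,'d,'n) module_scheme=>('b=>'d)=>bool" where
 "addmap M N F <-> F : car M \<rightarrow> car N &
  (ALL x:car M. ALL y:car M. F (x \<oplus>[M] y) = F x \<oplus>[N] F y)"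

lemma amapD:
 assumes "addmap M N F"
 shows "x : car M==>F x : car N"
  "[|x : car M; y : car M|]==>F (x \<oplus>[M] y) = F x \<oplus>[N] F y" using assms by (auto simp: addmap_def)

lemma amapI:
 assumes "!!x. x : car M==>F x : car N"
  "!!x y. [|x : car M; y : car M|]==>F (x \<oplus>[M] y) = F x \<oplus>[N] F y"
 shows "addmap M N F" using assms by (simp add: addmap_def)

lemma lin_amap: "lin_along A ph M N F==>addmap M N F" by (simp add: linear_along_def addmap_def)

lemma amap_zero:
 assumes "abelian_group M" "abelian_group N" "addmap M N F"
 shows "F \<zero>[M] = \<zero>[N]"
proof -
 interpret M: abelian_group M by fact
 interpret N: abelian_group N by fact
 show ?thesis using amapD(2) assms(3) amapD(1) by fastforce
qed

lemma amap_mns: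
 assumes "abelian_group M" "abelian_group N" "addmap M N F" "x : car M"
 shows "F (\<ominus>[M] x) = \<ominus>[N] F x"
proof -
 interpret M: abelian_group M by fact
 interpret N: abelian_group N by fact
 note F = amapD[OF assms(3)]
 have "F (\<ominus>[M] x) \<oplus>[N] F x = F (\<ominus>[M] x \<oplus>[M] x)" using assms(4) by (intro F(2)[symmetric]) simp_all
 also have "... = \<zero>[N]" using assms(4) amap_zero[OF assms(1-3)] by (simp add: M.l_neg)
 finally show ?thesis using N.minus_equality F(1) assms(4) by simp
qed

lemma amap_comp: "[|addmap M N F; addmap N P G|]==>addmap M P (%x. G (F x))"
 by (rule amapI) (simp_all add: amapD[of M N F] amapD[of N P G])

lemma amap_add:
 assumes "abelian_group N" "addmap M N F" "addmap M N G"
 shows "addmap M N (%x. F x \<oplus>[N] G x)"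
proof -
 interpret N: abelian_group N by fact
 note F = amapD[OF assms(2)] and G = amapD[OF assms(3)]
 show ?thesis by (rule amapI) (simp_all add: F G N.a_ac)
qed

lemma amap_umns:
 assumes "abelian_group N" "addmap M N F"
 shows "addmap M N (%x. \<ominus>[N] F x)"
proof -
 interpret N: abelian_group N by fact
 note F = amapD[OF assms(2)]
 show ?thesis by (rule amapI) (simp_all add: F N.minus_add)
qed

context ring
begin

lemma fsD:
 assumes "f : fsupp R S"
 shows "f i : car R" "finite {i. f i~=\<zero>}" "f i~=\<zero>==>i : S" "i ~: S==>f i = \<zero>"
 using assms by (auto simp: finsupp_def)

lemma fsI:
 assumes "!!i. f i : car R" "finite T" "!!i. f i~=\<zero>==>i : T" "!!i. f i~=\<zero>==>i : S"
 shows "f : fsupp R S" using assms finite_subset[of "{i. f i~=\<zero>}" T] by (auto simp: finsupp_def)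

lemma fs_mono: "[|f : fsupp R S; S<=T|]==>f : fsupp R T" by (auto simp: finsupp_def)

lemma fs_zero: "(%i. \<zero>) : fsupp R S" by (simp add: finsupp_def)

lemma fs_add:
 assumes "f : fsupp R S" "g : fsupp R S"
 shows "(%i. f i \<oplus> g i) : fsupp R S"
proof (rule fsI[of _ "{i. f i~=\<zero>} Un {i. g i~=\<zero>}"])
 show "f i \<oplus> g i : car R" for i using fsD(1)[OF assms(1)] fsD(1)[OF assms(2)] by simp
 show "finite ({i. f i~=\<zero>} Un {i. g i~=\<zero>})" using fsD(2) assms by blast
 show *: "i : {i. f i~=\<zero>} Un {i. g i~=\<zero>}" if "f i \<oplus> g i~=\<zero>" for i using that by auto
 show "i : S" if "f i \<oplus> g i~=\<zero>" for i using *[OF that] fsD(3)[OF assms(1)] fsD(3)[OF assms(2)] by blast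
qed

lemma fs_umns: "f : fsupp R S==>(%i. \<ominus> f i) : fsupp R S"
proof -
 assume f: "f : fsupp R S"
 have *: "f i~=\<zero>" if "\<ominus> f i~=\<zero>" for i using that by auto
 show ?thesis by (rule fsI[of _ "{i. f i~=\<zero>}"]) (simp_all add: fsD(1,2)[OF f] fsD(3)[OF f *] *)
qed

lemma fs_sg: "[|b : S; c : car R|]==>single R b c : fsupp R S"
 by (rule fsI[of _ "{b}"]) (auto simp: single_def split: if_splits)

lemma fs_rstr:
 assumes "f : fsupp R S"
 shows "(%i. if P i then f i else \<zero>) : fsupp R {i : S. P i}"
 by (rule fsI[of _ "{i. f i~=\<zero>}"]) (simp_all add: fsD(1-3)[OF assms] split: if_splits)

lemma fs_ind [consumes 1, case_names zero add]:
 assumes f: "f : fsupp R S" and 0: "P (%i. \<zero>)"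
  and add: "!!b c g. [|b : S; c : car R; g : fsupp R S; P g|]==>P (%i. single R b c i \<oplus> g i)"
 shows "P f" using f
proof (induction "card {i. f i~=\<zero>}" arbitrary: f)
 case 0
 hence "{i. f i~=\<zero>} = {}" using fsD(2)[OF "0.prems"] by (metis card_0_eq)
 hence "f = (%i. \<zero>)" by (simp add: feq)
 thus ?case using assms(2) by simp
next
 case (Suc m)
 hence "{i. f i~=\<zero>}~={}" by force
 then obtain b where b: "f b~=\<zero>" by blast
 define g where "g = (%i. if i~=b then f i else \<zero>)"
 have g: "g : fsupp R S" unfolding g_def using fs_mono[OF fs_rstr[OF Suc.prems, of "%i. i~=b"]] by auto
 have "{i. g i~=\<zero>} = {i. f i~=\<zero>} - {b}" by (auto simp: g_def)
 hence "card {i. g i~=\<zero>} = m" using Suc.hyps(2) b fsD(2)[OF Suc.prems] by (simp add: card_Diff_singleton)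
 hence "P g" using Suc.hyps(1) g by blast
 moreover have "f = (%i. single R b (f b) i \<oplus> g i)"
  using fsD(1)[OF Suc.prems] by (auto simp: single_def g_def feq)
 ultimately show ?case using add[of b "f b" g] fsD(1,3)[OF Suc.prems] b g by auto
qed

lemma free_mod_simps [simp]:
 "car (FM R S) = fsupp R S"
 "zero (FM R S) = (%i. \<zero>)"
 "add (FM R S) = (%f g i. f i \<oplus> g i)"
 "smult (FM R S) = (%a f i. a \<otimes> f i)" by (simp_all add: free_left_module_def)

lemma fag: "abelian_group (FM R S)"
proof (rule abelian_groupI; simp)
 show "(%i. f i \<oplus> g i) : fsupp R S" if "f : fsupp R S" "g : fsupp R S" for f g using fs_add that .
 show "(%i. \<zero>) : fsupp R S" by (rule fs_zero)
 show "(%i. (f i \<oplus> g i) \<oplus> h i) = (%i. f i \<oplus> (g i \<oplus> h i))"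
  if "f : fsupp R S" "g : fsupp R S" "h : fsupp R S" for f g h
  by (simp add: a_assoc fsD(1)[OF that(1)] fsD(1)[OF that(2)] fsD(1)[OF that(3)])
 show "(%i. f i \<oplus> g i) = (%i. g i \<oplus> f i)" if "f : fsupp R S" "g : fsupp R S" for f g
  by (simp add: a_comm[OF fsD(1)[OF that(1)] fsD(1)[OF that(2)]])
 show "(%i. \<zero> \<oplus> f i) = f" if "f : fsupp R S" for f by (simp add: fsD(1)[OF that])
 show "EX g:fsupp R S. (%i. g i \<oplus> f i) = (%i. \<zero>)" if "f : fsupp R S" for f
  by (rule bexI[OF _ fs_umns[OF that]]) (simp add: l_neg fsD(1)[OF that])
qed

lemma free_umns:
 assumes "f : fsupp R S"
 shows "\<ominus>[FM R S] f = (%i. \<ominus> f i)"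
proof -
 interpret F: abelian_group "FM R S" by (rule fag)
 show ?thesis by (rule F.minus_equality) (use assms fs_umns fsD(1)[OF assms] in \<open>auto simp: l_neg\<close>)
qed

lemma amap_eqI:
 assumes M: "abelian_group M" and F: "addmap (FM R S) M F" and G: "addmap (FM R S) M G"
  and eq: "!!b c. [|b : S; c : car R|]==>F (single R b c) = G (single R b c)" and f: "f : fsupp R S"
 shows "F f = G f" using f
proof (induction rule: fs_ind)
 case zero
 show ?case using amap_zero[OF fag M F] amap_zero[OF fag M G] by simp
next
 case (add b c g)
 thus ?case
  using amapD(2)[OF F, of "single R b c" g] amapD(2)[OF G, of "single R b c" g] fs_sg[of b S c] eq[of b c] by simp
qed

text \<open>The integral chain \<open>t\<close> tensored with the ring element
  \<open>c\<close>.\<close>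

definition cvec :: "'a=>('c \<Rightarrow>\<^sub>0 int)=>'c=>'a" where
 "cvec c t = (%x. [Poly_Mapping.lookup t x] \<cdot> c)"

lemma cvec_add: "c : car R ==> cvec c (s + t) = (%x. cvec c s x \<oplus> cvec c t x)"
 by (simp add: cvec_def feq lookup_add add.int_pow_mult)

lemma add_pow_zero [simp]: "[(0::int)] \<cdot> c = \<zero>" by (simp add: add_pow_def int_pow_def2)

lemma cvec_zero: "cvec c 0 = (%x. \<zero>)" by (simp add: cvec_def)

lemma cvec_umns: "c : car R ==> cvec c (- t) = (%x. \<ominus> cvec c t x)"
 by (simp add: cvec_def feq add.int_pow_neg a_inv_def)

lemma cvec_of: "c : car R ==> cvec c (frg b) = single R b c" by (auto simp: cvec_def single_def feq)

lemma cvec_cl: "c : car R ==> cvec c t : fsupp R (keys t)"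
 by (rule fsI[of _ "keys t"]) (auto simp: cvec_def in_keys_iff)

lemma cvec_plus_scalar: "[|c : car R; d : car R|] ==> cvec (c \<oplus> d) t = (%x. cvec c t x \<oplus> cvec d t x)"
 by (simp add: cvec_def feq add.int_pow_distrib)

lemma cvec_zero_scalar: "cvec \<zero> t = (%x. \<zero>)" by (simp add: cvec_def)

text \<open>The extension of an integral map on cells to coefficients in \<open>R\<close>. By
  \<open>klift2\<close>, identities between integral maps such as \<open>bdry_twice\<close> carry
  over.\<close>

definition klift where
 "klift T f = (%x. \<Oplus>b\<in>{b. f b~=\<zero>}. cvec (f b) (T b) x)"

lemma cvec_in: "c : car R ==> cvec c t x : car R" by (simp add: cvec_def)

lemma klift_superset:
 assumes "finite A" "{b. f b~=\<zero>}<=A" "!!b. f b : car R"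
 shows "klift T f x = (\<Oplus>b\<in>A. cvec (f b) (T b) x)" unfolding klift_def
 by (rule add.finprod_mono_neutral_cong_left[OF assms(1,2)]) (auto simp: assms(3) cvec_in cvec_zero_scalar)

lemma klift_add:
 assumes "f : fsupp R S" "g : fsupp R S"
 shows "klift T (%i. f i \<oplus> g i) = (%x. klift T f x \<oplus> klift T g x)"
proof
 fix x
 let ?A = "{b. f b~=\<zero>} Un {b. g b~=\<zero>}"
 note F = fsD[OF assms(1)] and G = fsD[OF assms(2)]
 have A: "finite ?A" using F(2) G(2) by simp
 have "klift T (%i. f i \<oplus> g i) x = (\<Oplus>b\<in>?A. cvec (f b \<oplus> g b) (T b) x)"
  using F(1) G(1) by (intro klift_superset[OF A]) auto
 also have "... = (\<Oplus>b\<in>?A. cvec (f b) (T b) x \<oplus> cvec (g b) (T b) x)"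
  using F(1) G(1) by (simp add: cvec_plus_scalar)
 also have "... = (\<Oplus>b\<in>?A. cvec (f b) (T b) x) \<oplus> (\<Oplus>b\<in>?A. cvec (g b) (T b) x)"
  using F(1) G(1) by (intro finsum_addf) (auto simp: cvec_in)
 also have "... = klift T f x \<oplus> klift T g x"
  using klift_superset[OF A, of f T x] klift_superset[OF A, of g T x] F(1) G(1) by auto
 finally show "klift T (%i. f i \<oplus> g i) x = klift T f x \<oplus> klift T g x" .
qed

lemma klift_zero: "klift T (%i. \<zero>) = (%x. \<zero>)" by (simp add: klift_def)

lemma klift_sg: "c : car R==>klift T (single R b c) = cvec c (T b)"
proof
 fix x assume c: "c : car R"
 hence "klift T (single R b c) x = (\<Oplus>b'\<in>{b}. cvec (single R b c b') (T b') x)"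
  by (intro klift_superset) (auto simp: single_def)
 thus "klift T (single R b c) x = cvec c (T b) x" using c by (simp add: single_def cvec_in)
qed

lemma klift_cl:
 assumes f: "f : fsupp R S" and T: "!!b. b : S==>keys (T b)<=S'"
 shows "klift T f : fsupp R S'" using f
proof (induction rule: fs_ind)
 case zero
 thus ?case by (simp add: klift_zero fs_zero)
next
 case (add b c g)
 have "klift T (single R b c) : fsupp R S'"
  using fs_mono[OF cvec_cl[OF add(2)] T[OF add(1)]] by (simp add: klift_sg add(2))
 thus ?case using add fs_add[of "klift T (single R b c)" S' "klift T g"] fs_sg[of b S c]
  by (simp add: klift_add[of _ S])
qed

lemma klift_amap:
 assumes "!!b. b : S==>keys (T b)<=S'"
 shows "addmap (FM R S) (FM R S') (klift T)"
 unfolding addmap_def using klift_cl[of _ S T S', OF _ assms] by (auto simp: klift_add[of _ S])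

lemma klift_cvec:
 assumes c: "c : car R"
 shows "klift T (cvec c t) = cvec c (fex T t)"
proof -
 have "keys t<=UNIV" by simp
 thus ?thesis
 proof (induction t rule: frag_induction)
  case zero
  thus ?case by (simp add: cvec_zero klift_zero)
 next
  case (one a)
  thus ?case by (simp add: cvec_of c klift_sg)
 next
  case (diff s t)
  have fs: "cvec c s : fsupp R UNIV" for s :: "'i \<Rightarrow>\<^sub>0 int" using fs_mono[OF cvec_cl[OF c] subset_UNIV] .
  have neg: "klift T (%x. \<ominus> f x) = (%x. \<ominus> klift T f x)" if f: "f : fsupp R UNIV" for f
   using amap_mns[OF fag fag klift_amap[of UNIV T UNIV], of f] f
    free_umns[OF f] free_umns[OF klift_cl[OF f, of T UNIV]] by simp
  have "cvec c (s - t) = (%x. cvec c s x \<oplus> (\<ominus> cvec c t x))"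
   using cvec_add[OF c, of s "- t"] by (simp add: cvec_umns c)
  hence "klift T (cvec c (s - t)) = (%x. klift T (cvec c s) x \<oplus> (\<ominus> klift T (cvec c t) x))"
   using klift_add[OF fs[of s] fs_umns[OF fs[of t]], of T] neg[OF fs[of t]] by simp
  also have "... = cvec c (fex T s + - fex T t)" using diff by (simp only: cvec_add[OF c] cvec_umns[OF c])
  finally show ?case by (simp add: frag_extend_diff)
 qed
qed

lemma klift2:
 assumes f: "f : fsupp R S"
 shows "klift T (klift U f) = klift (%b. fex T (U b)) f"
proof -
 have 1: "addmap (FM R S) (FM R UNIV) (%f. klift T (klift U f))"
  by (rule amap_comp[OF klift_amap[of S U UNIV] klift_amap[of UNIV T UNIV]]) simp_all
 have 2: "addmap (FM R S) (FM R UNIV) (klift (%b. fex T (U b)))" by (rule klift_amap) simp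
 show ?thesis by (rule amap_eqI[OF fag 1 2 _ f]) (simp add: klift_sg klift_cvec)
qed

lemma klift_cong:
 assumes "f : fsupp R S" "!!b. b : S==>T b = U b"
 shows "klift T f = klift U f"
proof
 fix x
 note F = fsD[OF assms(1)]
 show "klift T f x = klift U f x" unfolding klift_def
 proof (rule finsum_cong'[OF HOL.refl])
  show "(%b. cvec (f b) (U b) x) : {b. f b~=\<zero>} \<rightarrow> car R" using F(1) by (simp add: cvec_in)
  show "cvec (f b) (T b) x = cvec (f b) (U b) x" if "b : {b. f b~=\<zero>}" for b
   using that assms(2)[OF F(3)[of b]] by simp
 qed
qed

lemma klift_plus:
 assumes f: "f : fsupp R S"
 shows "klift (%b. T b + U b) f = (%x. klift T f x \<oplus> klift U f x)"
proof -
 have 1: "addmap (FM R S) (FM R UNIV) (klift (%b. T b + U b))" by (rule klift_amap) simp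
 have 2: "addmap (FM R S) (FM R UNIV) (%f. klift T f \<oplus>[FM R UNIV] klift U f)"
  by (rule amap_add[OF fag]) (rule klift_amap, simp)+
 show ?thesis using amap_eqI[OF fag 1 2 _ f] by (simp add: klift_sg cvec_add)
qed

lemma klift_mns:
 assumes f: "f : fsupp R S"
 shows "klift (%b. - T b) f = (%x. \<ominus> klift T f x)"
proof -
 have 1: "addmap (FM R S) (FM R UNIV) (klift (%b. - T b))" by (rule klift_amap) simp
 have 2: "addmap (FM R S) (FM R UNIV) (%f. \<ominus>[FM R UNIV] klift T f)"
  by (rule amap_umns[OF fag]) (rule klift_amap, simp)
 have U: "klift T g : fsupp R UNIV" if "g : fsupp R S" for g by (rule klift_cl[OF that]) simp
 have "klift (%b. - T b) f = \<ominus>[FM R UNIV] klift T f" by (rule amap_eqI[OF fag 1 2 _ f])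
   (use free_umns[OF U[OF fs_sg]] in \<open>simp add: klift_sg cvec_umns\<close>)
 thus ?thesis using free_umns[OF U[OF f]] by simp
qed

lemma klift_of:
 assumes f: "f : fsupp R S"
 shows "klift frg f = f"
proof -
 have 1: "addmap (FM R S) (FM R UNIV) (klift frg)" by (rule klift_amap) simp
 have 2: "addmap (FM R S) (FM R UNIV) (%f. f)" by (rule amapI) (simp_all add: fs_mono[of _ S UNIV])
 show ?thesis by (rule amap_eqI[OF fag 1 2 _ f]) (simp add: klift_sg cvec_of)
qed

lemma klift_zero_map: "klift (%b. 0) f = (%x. \<zero>)" by (simp add: klift_def cvec_zero)

end

section \<open>Exactness of the Salvetti complex\<close>

definition cells where
 "cells n i = {(X,J). X : fdias n & J<={1..<n} & card J = i}"

definition pcells where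
 "pcells n i = {(X,J). X : positive n & J<={1..<n} & card J = i}"

lemma pcells_sub: "pcells n i <= cells n i" by (auto simp: pcells_def cells_def pos_full)

lemma lowc_pos: "lowc n i l<=pcells n i" by (auto simp: lowc_def pcells_def)

lemma lowc_mono: "l<=m==>lowc n i l<=lowc n i m" by (auto simp: lowc_def)

lemma lowcI: "[|c : pcells n i; blength n (top_of n c) < l|] ==> c : lowc n i l" by (auto simp: lowc_def pcells_def)

lemma bdry_keys_gen:
 assumes J: "J<={1..<n}" "card J = Suc i" and S: "!!w. w permutes {1..n}==>dcomp n X (sbraid n w) : S"
 shows "keys (bdry n (X,J))<={(Y,K). Y : S & K<={1..<n} & card K = i}" unfolding bdry_def fst_conv snd_conv
proof (intro sum_frag_keys)
 fix j w assume j: "j : J" and w: "w : mcr n J (J - {j})"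
 let ?c = "(dcomp n X (sbraid n w),J - {j})"
 show "keys (fcm (psgn j J * sign w) (frg ?c))<={(Y,K). Y : S & K<={1..<n} & card K = i}"
   using S mcr_perm w J j by auto
qed

lemma bdry_keys:
 assumes "c : cells n (Suc i)"
 shows "keys (bdry n c) <= cells n i"
proof -
 obtain X J where c: "c = (X,J)" "X : fdias n" "J<={1..<n}" "card J = Suc i" using assms by (auto simp: cells_def)
 show ?thesis unfolding c(1) cells_def by (rule bdry_keys_gen[OF c(3,4)]) (simp add: bgrp_cl sbraid_full c(2))
qed

lemma bdry_keys_pos:
 assumes "c : pcells n (Suc i)"
 shows "keys (bdry n c)<=pcells n i"
proof -
 obtain X J where c: "c = (X,J)" "X : positive n" "J<={1..<n}" "card J = Suc i" using assms by (auto simp: pcells_def)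
 show ?thesis unfolding c(1) pcells_def by (rule bdry_keys_gen[OF c(3,4)]) (simp add: pos_sbraid c(2))
qed

lemma para_sg:
 assumes "j : {1..<n}"
 shows "para n {j} = {id,tpose j (Suc j)}" "sign (tpose j (Suc j)) = - 1"
proof -
 have bp: "blk_prs {j} = {(j,Suc j)}"
 proof -
  have "{a..<b}<={j}==>a < b==>a = j & b = Suc j" for a b :: nat
  proof -
   assume h: "{a..<b}<={j}" "a < b"
   have "a : {a..<b}" "b - 1 : {a..<b}" using h(2) by auto
   hence "a = j" "b - 1 = j" using h(1) by blast+
   thus ?thesis using h(2) by auto
  qed
  thus ?thesis by (auto simp: blk_prs_def)
 qed
 have t: "tpose j (Suc j) permutes {1..n}" by (rule permutes_swap_id) (use assms in auto)
 have it: "invs (tpose j (Suc j)) = {(j,Suc j)}" by (auto simp: invs_def Transposition.transpose_def split: if_splits)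
 show "para n {j} = {id,tpose j (Suc j)}"
 proof
  show "para n {j}<={id,tpose j (Suc j)}"
  proof
   fix w assume "w : para n {j}"
   hence w: "w permutes {1..n}" "invs w<={(j,Suc j)}" by (simp_all add: para_def bp)
   hence "invs w = invs id | invs w = invs (tpose j (Suc j))" using it by auto
   thus "w : {id,tpose j (Suc j)}" using invs_eqI[OF w(1) permutes_id] invs_eqI[OF w(1) t] by auto
  qed
  show "{id,tpose j (Suc j)}<=para n {j}" using t it by (auto simp: para_def bp permutes_id)
 qed
 show "sign (tpose j (Suc j)) = - 1" by (simp add: sign_swap_id)
qed

lemma psgn_sg: "psgn j {j} = 1"
proof -
 have "{i : {j}. i < j} = {}" by auto
 thus ?thesis by (simp only: psgn_def card.empty power_0)
qed

lemma mcr_empty: "mcr n J {} = para n J" by (simp add: mcr_def)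

text \<open>An edge has two ends, given by the identity and by one transposition, and these have
  opposite signs.\<close>

lemma augmentation_bdry:
 assumes "c : cells n 1"
 shows "fex (%_. frg ()) (bdry n c) = 0"
proof -
 obtain X J where c: "c = (X,J)" "J<={1..<n}" "card J = 1" using assms by (auto simp: cells_def)
 then obtain j where j: "J = {j}" "j : {1..<n}" by (auto simp: card_1_singleton_iff One_nat_def)
 have ne: "id~=tpose j (Suc j)"
 proof
  assume "id = tpose j (Suc j)"
  hence "id j = tpose j (Suc j) j" by (rule fun_cong)
  thus False by simp
 qed
 have "fex (%_. frg ()) (bdry n c) = (\<Sum>w\<in>para n {j}. fcm (sign w) (frg ()))"
  by (simp add: c(1) bdry_def j(1) frag_extend_sum fin_mcr mcr_empty[symmetric] frag_extend_cmul psgn_sg)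
 also have "... = 0" using ne by (simp add: para_sg[OF j(2)] sign_id)
 finally show ?thesis .
qed

text \<open>The boundary multiplies braids on the right, so translation on the left commutes with
  it.\<close>

definition tran :: "nat=>strands set => cell => cell \<Rightarrow>\<^sub>0 int" where
 "tran n Z c = frg (dcomp n Z (fst c),snd c)"

lemma tran_bdry:
 assumes Z: "Z : fdias n" and X: "X : fdias n"
 shows "fex (bdry n) (tran n Z (X,J)) = fex (tran n Z) (bdry n (X,J))"
proof (cases "finite J")
 case True
 have "dcomp n (dcomp n Z X) (sbraid n w) = dcomp n Z (dcomp n X (sbraid n w))"
  if "w : mcr n J (J - {j})" for j w by (rule bgrp_assoc[OF Z X sbraid_full[OF mcr_perm[OF that]]])
 thus ?thesis by (simp add: tran_def bdry_def frag_extend_sum True fin_mcr frag_extend_cmul cong: sum.cong)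
next
 case False
 thus ?thesis by (simp add: tran_def bdry_def)
qed

lemma tran_keys:
 assumes "Z : fdias n" "c : cells n i"
 shows "keys (tran n Z c) <= cells n i" using assms by (auto simp: tran_def cells_def keys_frag_of bgrp_cl)

lemma tran_inv:
 assumes Z: "Z : fdias n" and c: "c : cells n i"
 shows "fex (tran n (binv n Z)) (tran n Z c) = frg c"
proof -
 obtain X J where XJ: "c = (X,J)" "X : fdias n" using c by (auto simp: cells_def)
 show ?thesis
   using XJ(1) bgrp_assoc[OF binv_cl[OF Z] Z XJ(2)] binv_comp(1)[OF Z] bgrp_one_simps(1)[OF XJ(2)] by (auto simp: tran_def)
qed

context ring
begin

definition aug :: "(cell=>'a)=>'a" where
 "aug f = klift (%_. frg ()) f ()"

lemma klift_diff:
 assumes "f : fsupp R S" "g : fsupp R S"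
 shows "klift T (%i. f i \<ominus> g i) = (%x. klift T f x \<ominus> klift T g x)"
proof -
 have U: "klift T h : fsupp R UNIV" if "h : fsupp R S" for h by (rule klift_cl[OF that]) simp
 show ?thesis
   using klift_add[OF assms(1) fs_umns[OF assms(2)], of T] assms(2) amap_mns[OF fag fag klift_amap[of S T UNIV], of g] free_umns[OF assms(2)] free_umns[OF U[OF assms(2)]] by (auto simp: amd)
qed

lemma fs_diff: "[|f : fsupp R S; g : fsupp R S|]==>(%i. f i \<ominus> g i) : fsupp R S"
 using fs_add[OF _ fs_umns] by (simp add: amd)

lemma kbdry_cl: "f : fsupp R (cells n (Suc i))==>klift (bdry n) f : fsupp R (cells n i)"
 by (rule klift_cl[OF _ bdry_keys])

lemma kbdry_cl_pos: "f : fsupp R (pcells n (Suc i))==>klift (bdry n) f : fsupp R (pcells n i)"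
 by (rule klift_cl[OF _ bdry_keys_pos])

lemma kbdry_twice:
 assumes f: "f : fsupp R (cells n i)"
 shows "klift (bdry n) (klift (bdry n) f) = (%x. \<zero>)"
proof -
 have "klift (bdry n) (klift (bdry n) f) = klift (%c. 0 :: cell \<Rightarrow>\<^sub>0 int) f"
  unfolding klift2[OF f] by (rule klift_cong[OF f]) (auto simp: cells_def bdry_twice)
 thus ?thesis by (simp add: klift_zero_map)
qed

lemma fs_empty:
 assumes "f : fsupp R {}"
 shows "f = (%x. \<zero>)" by (rule ext, rule fsD(4)[OF assms]) simp

text \<open>Induction on the length of the tops. \<open>cone\<close> is a contracting homotopy up to
  the error \<open>T\<close>; applied to a cycle, the error is again a cycle, with shorter tops, and
  hence a boundary.\<close>

lemma kbdry_exact_low: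
 assumes "f : fsupp R (lowc n (Suc i) l)" "klift (bdry n) f = (%x. \<zero>)"
 shows "EX g:fsupp R (pcells n (Suc (Suc i))). f = klift (bdry n) g" using assms
proof (induction l arbitrary: f)
 case 0
 hence "f : fsupp R {}" by (simp add: lowc_def)
 from fs_empty[OF this] show ?case by (intro bexI[of _ "%x. \<zero>"]) (simp_all add: klift_zero fs_zero)
next
 case (Suc l)
 define T where "T c = fex (bdry n) (cone n c) + fex (cone n) (bdry n c) + - frg c" for c
 have T: "keys (T c)<=lowc n (Suc i) l" if c: "c : lowc n (Suc i) (Suc l)" for c
 proof -
  obtain X J where XJ: "c = (X,J)" "X : positive n" "J<={1..<n}" "card J = Suc i" "blength n (top_of n (X,J))<=l"
   using c by (auto simp: lowc_def)
  \<comment> \<open>In positive degree the type is nonempty and consists of descents of the top; so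
    the cone has an apex.\<close>
  have "desc n (top_of n (X,J))~={}" using top_desc[OF XJ(2,3)] XJ(4) by fastforce
  from cone_htpy[OF XJ(2,3) this] show ?thesis using lowc_mono[OF XJ(5), of n "Suc i"] by (auto simp: T_def XJ(1,4))
 qed
 note f = Suc.prems(1)
 define h where "h = klift (cone n) f"
 have h: "h : fsupp R (lowc n (Suc (Suc i)) (Suc l))" unfolding h_def by (rule klift_cl[OF f cone_keys])
 have f1: "klift T f : fsupp R (lowc n (Suc i) l)" by (rule klift_cl[OF f T])
 have hp: "h : fsupp R (pcells n (Suc (Suc i)))" by (rule fs_mono[OF h lowc_pos])
 have hc: "h : fsupp R (cells n (Suc (Suc i)))" by (rule fs_mono[OF hp pcells_sub])
 have bh: "klift (bdry n) h : fsupp R (cells n (Suc i))" by (rule kbdry_cl[OF hc])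
 have fc: "f : fsupp R (cells n (Suc i))" by (rule fs_mono[OF fs_mono[OF f lowc_pos] pcells_sub])
 note fC = fsD(1)[OF f] and bhC = fsD(1)[OF bh]
 have Tf: "klift T f = (%x. klift (bdry n) h x \<ominus> f x)"
 proof
  fix x
  have "klift T f x = klift (%c. fex (bdry n) (cone n c) + fex (cone n) (bdry n c)) f x \<oplus> klift (%c. - frg c) f x"
   unfolding T_def by (simp only: klift_plus[OF f])
  also have "... = klift (bdry n) h x \<oplus> \<zero> \<ominus> f x"
   by (simp add: klift_plus[OF f] klift_mns[OF f] klift_of[OF f] klift2[OF f, symmetric] Suc.prems(2) klift_zero h_def amd)
  finally show "klift T f x = klift (bdry n) h x \<ominus> f x" using bhC by simp
 qed
 have "klift (bdry n) (klift T f) = (%x. \<zero>)"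
  unfolding Tf klift_diff[OF bh fc] kbdry_twice[OF hc] Suc.prems(2) by (simp add: amd)
 from Suc.IH[OF f1 this] obtain g where g: "g : fsupp R (pcells n (Suc (Suc i)))" "klift T f = klift (bdry n) g" by blast
 have bgC: "klift (bdry n) g x : car R" for x using fsD(1)[OF kbdry_cl_pos[OF g(1)]] .
 have "f x = klift (bdry n) h x \<ominus> klift (bdry n) g x" for x
 proof -
  have "klift (bdry n) g x = klift (bdry n) h x \<ominus> f x" using fun_cong[OF g(2), of x] fun_cong[OF Tf, of x] by simp
  thus ?thesis using fC[of x] bhC[of x] by (simp add: amd minus_add a_assoc[symmetric] r_neg)
 qed
 hence "f = klift (bdry n) (%x. h x \<ominus> g x)" unfolding klift_diff[OF hp g(1)] by (rule ext)
 thus ?case using fs_diff[OF hp g(1)] by blast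
qed

lemma fs_bounded:
 assumes f: "f : fsupp R S"
 obtains l :: nat where "!!x. f x~=\<zero>==>m x < l"
proof -
 have "m x < Suc (Max (m ` {x. f x~=\<zero>}))" if "f x~=\<zero>" for x by (simp add: that le_imp_less_Suc fsD(2)[OF f])
 thus thesis by (rule that)
qed

lemma fs_subI:
 assumes f: "f : fsupp R S" and "!!x. [|x : S; f x~=\<zero>|]==>x : T"
 shows "f : fsupp R T" by (rule fsI[OF fsD(1)[OF f] fsD(2)[OF f]]) (simp_all add: assms(2)[OF fsD(3)[OF f]])

lemma kbdry_exact_pos:
 assumes f: "f : fsupp R (pcells n (Suc i))" and z: "klift (bdry n) f = (%x. \<zero>)"
 shows "EX g:fsupp R (pcells n (Suc (Suc i))). f = klift (bdry n) g"
proof -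
 obtain l where l: "!!x. f x~=\<zero>==>blength n (top_of n x) < l" by (rule fs_bounded[OF f]) (rule that)
 have "f : fsupp R (lowc n (Suc i) l)" by (rule fs_subI[OF f]) (rule lowcI[OF _ l])
 from kbdry_exact_low[OF this z] show ?thesis .
qed

text \<open>The same reduction in degree 0. It ends at the vertex of the trivial braid, the only
  positive one without descents.\<close>

lemma vertex_class:
 assumes "f : fsupp R (lowc n 0 l Un {(idd n,{})})"
 shows "EX g:fsupp R (pcells n 1). EX c:car R. f = (%x. klift (bdry n) g x \<oplus> single R (idd n,{}) c x)"
 using assms
proof (induction l arbitrary: f)
 case 0
 hence f: "f : fsupp R {(idd n,{})}" by (simp add: lowc_def)
 have "f = (%x. klift (bdry n) (%x. \<zero>) x \<oplus> single R (idd n,{}) (f (idd n,{})) x)"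
  using fsD(1)[OF f] fsD(4)[OF f] by (auto simp: klift_zero single_def feq)
 thus ?case using fsD(1)[OF f] fs_zero by blast
next
 case (Suc l)
 let ?o = "(idd n,{}) :: cell"
 note f = Suc.prems
 have top: "top_of n (X,{}) = X" if "X : positive n" for X
   by (simp add: bgrp_one_simps(2) pos_full that top_of_def sbraid_id invs_eqI[OF lng(1) permutes_id] lng(2) blk_prs_def)
 define U where "U c = frg c + - fex (bdry n) (cone n c)" for c
 have cpos: "c : lowc n 0 (Suc (blength n (fst c)))" if "c : lowc n 0 (Suc l) Un {?o}" for c
  using that top fin_gens pos_one[of n] by (auto simp: lowc_def)
 have ck: "keys (cone n c)<=pcells n 1" if "c : lowc n 0 (Suc l) Un {?o}" for c
  using cone_keys[OF cpos[OF that]] lowc_pos[of n 1] unfolding One_nat_def by (rule subset_trans)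
 have U: "keys (U c)<=lowc n 0 l Un {?o}" if c: "c : lowc n 0 (Suc l) Un {?o}" for c
 proof (cases "desc n (fst c) = {}")
  case True
  have c': "fst c : positive n" "snd c = {}" using c pos_one[of n] fin_gens by (auto simp: lowc_def)
  have co: "c = ?o" using desc_empty[OF c'(1) True] c'(2) by (simp add: prod_eq_iff)
  have "cone n c = 0" using True top[OF c'(1)] co by (simp add: cone_def)
  thus ?thesis by (simp add: U_def co)
 next
  case False
  have "c~=?o"
  proof
   assume "c = ?o"
   hence c0: "?o : lowc n 0 (Suc (blength n (idd n)))" using cpos[OF c] by simp
   \<comment> \<open>A descent would be a factor of length 1 of a braid of length 0.\<close>
   have "s ~: desc n (idd n)" for s
   proof
    assume s: "s : desc n (idd n)"
    hence "{s}<=desc n (idd n)" "{s}<={1..<n}" by (auto simp: desc_def)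
    then obtain x where x: "x : positive n" "idd n = dcomp n x (sbraid n (lng n {s}))"
     using desc_div[OF pos_one] by blast
    have "blength n (idd n) = 0" using blength_word[of "[]" n] by (simp add: wbr_Nil word_len_def)
    hence "card (invs (lng n {s})) = 0" using blength_sbraid[OF x(1) lng(1)[OF `{s}<={1..<n}`]] x(2) by simp
    hence "blk_prs {s} = {}" using fin_invs[OF lng(1)[OF `{s}<={1..<n}`]] lng(2)[OF `{s}<={1..<n}`] by simp
    thus False using blk_prs_step[of s "{s}"] by simp
   qed
   thus False using False `c = ?o` by auto
  qed
  then obtain X where X: "c = (X,{})" "X : positive n" "blength n X<=l" using c top fin_gens by (auto simp: lowc_def)
  have "keys (fex (bdry n) (cone n (X,{})) - frg (X,{}))<=lowc n 0 (blength n X)"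
   using cone_htpy[OF X(2), of "{}"] False by (simp add: top[OF X(2)] bdry_empty X(1))
  hence "keys (U c)<=lowc n 0 (blength n X)" using keys_minus[of "U c"] by (simp add: U_def X(1))
  thus ?thesis using lowc_mono[OF X(3), of n 0] by blast
 qed
 define h where "h = klift (cone n) f"
 have h: "h : fsupp R (pcells n 1)" unfolding h_def by (rule klift_cl[OF f ck])
 have Uf: "klift U f : fsupp R (lowc n 0 l Un {?o})" by (rule klift_cl[OF f U])
 from Suc.IH[OF this] obtain g c where g: "g : fsupp R (pcells n 1)" "c : car R"
  "klift U f = (%x. klift (bdry n) g x \<oplus> single R ?o c x)" by blast
 have bC: "klift (bdry n) g x : car R" if "g : fsupp R (pcells n 1)" for g x
  using fsD(1)[OF kbdry_cl_pos[of g n 0]] that by (simp add: One_nat_def)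
 have "klift U f = (%x. f x \<ominus> klift (bdry n) h x)"
  unfolding U_def klift_plus[OF f] klift_mns[OF f] klift_of[OF f] h_def klift2[OF f] amd ..
 hence "f x = klift (bdry n) h x \<oplus> klift U f x" for x
  using bC[OF h, of x] fsD(1)[OF f, of x] by (simp add: amd a_ac r_neg2 r_neg)
 also have "klift (bdry n) h x \<oplus> klift U f x = klift (bdry n) (%i. h i \<oplus> g i) x \<oplus> single R ?o c x" for x
  using bC[OF h, of x] bC[OF g(1), of x] g(2) by (simp add: klift_add[OF h g(1)] g(3) a_assoc single_def)
 finally have "f = (%x. klift (bdry n) (%i. h i \<oplus> g i) x \<oplus> single R ?o c x)" by (rule ext)
 thus ?case using fs_add[OF h g(1)] g(2) by blast
qed

lemma aug_add:
 "[|f : fsupp R S; g : fsupp R S|]==>aug (%x. f x \<oplus> g x) = aug f \<oplus> aug g"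
 by (simp add: aug_def klift_add[of _ S])

lemma aug_cl: "f : fsupp R S==>aug f : car R" unfolding aug_def by (rule fsD(1)[OF klift_cl]) auto

lemma aug_sg: "c : car R==>aug (single R b c) = c"
 unfolding aug_def by (simp only: klift_sg cvec_of) (simp add: single_def)

lemma aug_kbdry:
 assumes f: "f : fsupp R (cells n 1)"
 shows "aug (klift (bdry n) f) = \<zero>" by (smt (verit) klift2 f klift_cong augmentation_bdry aug_def klift_zero_map)

lemma kbdry_exact_aug_pos:
 assumes f: "f : fsupp R (pcells n 0)" and z: "aug f = \<zero>"
 shows "EX g:fsupp R (pcells n 1). f = klift (bdry n) g"
proof -
 obtain l where l: "!!x. f x~=\<zero>==>blength n (top_of n x) < l" by (rule fs_bounded[OF f]) (rule that)
 have "f : fsupp R (lowc n 0 l)" by (rule fs_subI[OF f]) (rule lowcI[OF _ l])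
 from vertex_class[OF fs_mono[OF this Un_upper1]] obtain g c where g: "g : fsupp R (pcells n 1)" "c : car R"
  "f = (%x. klift (bdry n) g x \<oplus> single R (idd n,{}) c x)" by blast
 have gc: "g : fsupp R (cells n 1)" by (rule fs_mono[OF g(1) pcells_sub])
 have bg: "klift (bdry n) g : fsupp R (cells n 0)" using kbdry_cl[of g n 0] gc by (simp add: One_nat_def)
 have sc: "single R (idd n,{}) c : fsupp R (cells n 0)" by (rule fs_sg[OF _ g(2)]) (simp add: cells_def bgrp_one)
 have "f = klift (bdry n) g"
   using g(3) fsD(1)[OF bg] aug_add[OF bg sc] aug_kbdry gc aug_sg g(2) z by (auto simp: single_def)
 thus ?thesis using g(1) by blast
qed

lemma tran_klift:
 assumes Z: "Z : fdias n" and f: "f : fsupp R (cells n i)"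
 shows "klift (tran n Z) f : fsupp R (cells n i)"
  "klift (bdry n) (klift (tran n Z) f) = klift (tran n Z) (klift (bdry n) f)"
  "klift (tran n (binv n Z)) (klift (tran n Z) f) = f"
  "aug (klift (tran n Z) f) = aug f"
proof -
 show "klift (tran n Z) f : fsupp R (cells n i)" by (rule klift_cl[OF f tran_keys[OF Z]])
 show "klift (bdry n) (klift (tran n Z) f) = klift (tran n Z) (klift (bdry n) f)"
  unfolding klift2[OF f] by (rule klift_cong[OF f]) (auto simp: cells_def tran_bdry[OF Z])
 have "klift (tran n (binv n Z)) (klift (tran n Z) f) = klift frg f"
  unfolding klift2[OF f] by (rule klift_cong[OF f]) (rule tran_inv[OF Z])
 thus "klift (tran n (binv n Z)) (klift (tran n Z) f) = f" by (simp add: klift_of[OF f])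
 show "aug (klift (tran n Z) f) = aug f" unfolding aug_def klift2[OF f] by (simp add: tran_def)
qed

text \<open>The support is finite, so one power of the full twist makes all its braids positive at
  once.\<close>

lemma tran_to_pos:
 assumes f: "f : fsupp R (cells n i)"
 obtains Z where "Z : fdias n" "klift (tran n Z) f : fsupp R (pcells n i)"
proof -
 define K where "K c = (LEAST k. ALL l>=k. dcomp n (wbr n (ftw n l)) (fst c) : positive n)" for c :: cell
 obtain l where l: "!!c. f c~=\<zero>==>K c < l" by (rule fs_bounded[OF f]) (rule that)
 let ?Z = "wbr n (ftw n l)"
 have Z: "?Z : fdias n" by (rule wbr_full[OF ftw_words])
 have p: "dcomp n ?Z (fst c) : positive n" if c: "f c~=\<zero>" for c
 proof -
  have "fst c : fdias n" using fsD(3)[OF f c] by (auto simp: cells_def)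
  then obtain k where "!!l. l >= k==>dcomp n (wbr n (ftw n l)) (fst c) : positive n" by (rule ftw_clear) (rule that)
  hence "ALL l>=K c. dcomp n (wbr n (ftw n l)) (fst c) : positive n"
   unfolding K_def by (intro LeastI[of "%k. ALL l>=k. dcomp n (wbr n (ftw n l)) (fst c) : positive n" k]) simp
  thus ?thesis using l[OF c] by simp
 qed
 have f': "f : fsupp R {c : cells n i. dcomp n ?Z (fst c) : positive n}" by (rule fs_subI[OF f]) (simp add: p)
 have "klift (tran n ?Z) f : fsupp R (pcells n i)"
  by (rule klift_cl[OF f']) (auto simp: tran_def keys_frag_of pcells_def cells_def)
 thus thesis by (rule that[OF Z])
qed

lemma kbdry_exact:
 assumes f: "f : fsupp R (cells n (Suc i))" and z: "klift (bdry n) f = (%x. \<zero>)"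
 shows "EX g:fsupp R (cells n (Suc (Suc i))). f = klift (bdry n) g"
proof -
 obtain Z where Z: "Z : fdias n" "klift (tran n Z) f : fsupp R (pcells n (Suc i))" by (rule tran_to_pos[OF f])
 have "klift (bdry n) (klift (tran n Z) f) = (%x. \<zero>)" unfolding tran_klift(2)[OF Z(1) f] z by (rule klift_zero)
 from kbdry_exact_pos[OF Z(2) this] obtain g where g: "g : fsupp R (pcells n (Suc (Suc i)))" "klift (tran n Z) f = klift (bdry n) g" by blast
 have gc: "g : fsupp R (cells n (Suc (Suc i)))" by (rule fs_mono[OF g(1) pcells_sub])
 show ?thesis by (metis tran_klift(1) binv_cl Z(1) gc tran_klift(3) f g(2) tran_klift(2))
qed

lemma kbdry_exact_aug:
 assumes f: "f : fsupp R (cells n 0)" and z: "aug f = \<zero>"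
 shows "EX g:fsupp R (cells n 1). f = klift (bdry n) g"
 by (smt (verit) tran_to_pos f tran_klift(4) z kbdry_exact_aug_pos fs_mono pcells_sub tran_klift(3) tran_klift(2) binv_cl tran_klift(1))

end

section \<open>Lifting in resolutions\<close>

lemma linD:
 assumes "lin_along A ph M N f"
 shows "x : car M==>f x : car N"
  "[|x : car M; y : car M|]==>f (x \<oplus>[M] y) = f x \<oplus>[N] f y"
  "[|a : car A; x : car M|]==>f (a \<odot>[M] x) = ph a \<odot>[N] f x" using assms by (auto simp: linear_along_def)

lemma lin_alongI:
 assumes "addmap M N f" "!!a x. [|a : car A; x : car M|]==>f (a \<odot>[M] x) = ph a \<odot>[N] f x"
 shows "lin_along A ph M N f" using assms by (simp add: linear_along_def addmap_def)

lemma lin_comp: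
 assumes "lin_along A ph M N f" "lin_along B ps0 N P g" "!!a. a : car A==>ph a : car B"
 shows "lin_along A (%a. ps0 (ph a)) M P (%x. g (f x))" using assms by (auto simp: linear_along_def Pi_iff)

lemma amap_diff:
 assumes "abelian_group N" "addmap M N F" "addmap M N G"
 shows "addmap M N (%x. F x \<ominus>[N] G x)" unfolding amd by (rule amap_add[OF assms(1,2) amap_umns[OF assms(1,3)]])

lemma amap_mns_eq:
 assumes "abelian_group M" "abelian_group N" "addmap M N F" "x : car M" "y : car M"
 shows "F (x \<ominus>[M] y) = F x \<ominus>[N] F y"
 using amapD(2)[OF assms(3,4) abelian_group.a_inv_closed[OF assms(1,5)]] amap_mns[OF assms(1-3,5)] by (simp add: amd)

lemma l_mod_ring: "left_module A M==>ring A" by (simp add: left_module_def)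

lemma l_mod_grp: "left_module A M==>abelian_group M" by (simp add: left_module_def)

lemma l_mod_axioms':
 assumes "left_module A M"
 shows "[|a : car A; x : car M|]==>a \<odot>[M] x : car M"
  "[|a : car A; b : car A; x : car M|]==>(a \<oplus>[A] b) \<odot>[M] x = a \<odot>[M] x \<oplus>[M] b \<odot>[M] x"
  "[|a : car A; x : car M; y : car M|]==>a \<odot>[M] (x \<oplus>[M] y) = a \<odot>[M] x \<oplus>[M] a \<odot>[M] y"
  "[|a : car A; b : car A; x : car M|]==>(a \<otimes>[A] b) \<odot>[M] x = a \<odot>[M] (b \<odot>[M] x)"
  "x : car M==>\<one>[A] \<odot>[M] x = x"
 by (simp_all add: left_module.smult_closed[OF assms] left_module.smult_l_distr[OF assms] left_module.smult_r_distr[OF assms]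
  left_module.smult_assoc[OF assms] left_module.smult_one[OF assms])

lemma l_mod_mns:
 assumes M: "left_module A M" and a: "a : car A" and x: "x : car M"
 shows "a \<odot>[M] (\<ominus>[M] x) = \<ominus>[M] (a \<odot>[M] x)" "(\<ominus>[A] a) \<odot>[M] x = \<ominus>[M] (a \<odot>[M] x)" "\<zero>[A] \<odot>[M] x = \<zero>[M]"
proof -
 interpret left_module A M by fact
 have "addmap M M (%x. a \<odot>[M] x)" using a by (intro amapI) (simp_all add: smult_closed smult_r_distr)
 from amap_mns[OF M.abelian_group_axioms M.abelian_group_axioms this x]
 show "a \<odot>[M] (\<ominus>[M] x) = \<ominus>[M] (a \<odot>[M] x)" .
 have z: "\<zero>[A] \<odot>[M] x \<oplus>[M] \<zero>[A] \<odot>[M] x = \<zero>[A] \<odot>[M] x"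
  using smult_l_distr[of "\<zero>[A]" "\<zero>[A]" x] x by simp
 show z0: "\<zero>[A] \<odot>[M] x = \<zero>[M]" using z x smult_closed by auto
 have "(\<ominus>[A] a) \<odot>[M] x \<oplus>[M] a \<odot>[M] x = \<zero>[M]"
  using smult_l_distr[of "\<ominus>[A] a" a x] a x by (simp add: R.l_neg z0)
 thus "(\<ominus>[A] a) \<odot>[M] x = \<ominus>[M] (a \<odot>[M] x)"
  using M.minus_equality[of "(\<ominus>[A] a) \<odot>[M] x" "a \<odot>[M] x"] a x by (simp add: smult_closed)
qed

text \<open>The values lie in an arbitrary abelian group, typically a module over another ring; so
  the maps \<open>T i\<close> of the coefficients are only asked to be additive.\<close>

definition alift :: "('a,'m) ring_scheme=>('c,'d,'n) module_scheme=>('i=>'a=>'d)=>('i=>'a)=>'d" where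
 "alift R N T f = finsum N (%i. T i (f i)) {i. f i~=\<zero>[R]}"

lemma alift:
 assumes R: "ring R" and N: "abelian_group N" and T: "!!i c. [|i : S; c : car R|]==>T i c : car N"
  "!!i c d. [|i : S; c : car R; d : car R|]==>T i (c \<oplus>[R] d) = T i c \<oplus>[N] T i d"
 shows "addmap (FM R S) N (alift R N T)"
  "[|b : S; c : car R|]==>alift R N T (single R b c) = T b c"
proof -
 interpret R: ring R by fact
 interpret N: abelian_group N by fact
 have z: "T i \<zero>[R] = \<zero>[N]" if "i : S" for i
  using T(2)[OF that, of "\<zero>[R]" "\<zero>[R]"] T(1)[OF that, of "\<zero>[R]"] by (simp add: N.add.r_cancel_one)
 have sup: "alift R N T f = finsum N (%i. T i (f i)) B" if "finite B" "{i. f i~=\<zero>[R]}<=B" "B<=S" "!!i. f i : car R" for f B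
  unfolding alift_def
 proof (rule N.add.finprod_mono_neutral_cong_left[OF that(1,2)])
  show "T i (f i) = \<zero>[N]" if "i : B - {i. f i~=\<zero>[R]}" for i using that z `B<=S` by auto
  show "(%i. T i (f i)) : B \<rightarrow> car N" using T(1) that(4) that(3) by auto
 qed simp
 show "addmap (FM R S) N (alift R N T)"
 proof (rule amapI)
  fix f assume "f : car (FM R S)"
  hence f: "f : fsupp R S" by simp
  note F = R.fsD[OF f]
  show "alift R N T f : car N"  using T(1) F(3) F(1) by (auto simp: alift_def)
  fix g assume "g : car (FM R S)"
  hence g: "g : fsupp R S" by simp
  note G = R.fsD[OF g]
  let ?B = "{i. f i~=\<zero>[R]} Un {i. g i~=\<zero>[R]}"
  have B: "finite ?B" "?B<=S" using F(2) G(2) F(3) G(3) by auto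
  have i: "i : S" if "i : ?B" for i using that B(2) by (rule rev_subsetD)
  have TF: "T j (f j) : car N" and TG: "T j (g j) : car N" if "j : ?B" for j
   using T(1)[OF i[OF that] F(1)] T(1)[OF i[OF that] G(1)] .
  have s: "{i. f i \<oplus>[R] g i~=\<zero>[R]}<=?B" by auto
  have "alift R N T (%i. f i \<oplus>[R] g i) = finsum N (%i. T i (f i \<oplus>[R] g i)) ?B"
   by (rule sup[OF B(1) s B(2)]) (simp add: F(1) G(1))
  also have "... = finsum N (%i. T i (f i) \<oplus>[N] T i (g i)) ?B"
  proof (rule N.add.finprod_cong'[OF HOL.refl])
   show "(%i. T i (f i) \<oplus>[N] T i (g i)) : ?B \<rightarrow> car N" by (rule Pi_I, rule N.a_closed[OF TF TG])
   show "T i (f i \<oplus>[R] g i) = T i (f i) \<oplus>[N] T i (g i)" if "i : ?B" for i by (rule T(2)[OF i[OF that] F(1) G(1)])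
  qed
  also have "... = finsum N (%i. T i (f i)) ?B \<oplus>[N] finsum N (%i. T i (g i)) ?B"
   by (rule N.finsum_addf) (rule Pi_I, erule TF TG)+
  also have "... = alift R N T f \<oplus>[N] alift R N T g"
   using sup[OF B(1) Un_upper1 B(2) F(1)] sup[OF B(1) Un_upper2 B(2) G(1)] by simp
  finally show "alift R N T (f \<oplus>[FM R S] g) = alift R N T f \<oplus>[N] alift R N T g" by simp
 qed
 assume b: "b : S" "c : car R"
 have "alift R N T (single R b c) = finsum N (%i. T i (single R b c i)) {b}"
  by (rule sup) (use b in \<open>auto simp: single_def\<close>)
 thus "alift R N T (single R b c) = T b c" using T(1)[OF b] by (simp add: single_def)
qed

text \<open>The lifting property of projective modules, for maps along a homomorphism of rings. It
  is isolated as a predicate because it is all that the comparison theorems ask for, and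
  \<open>Qmod_lifts\<close> provides it for the Salvetti resolution too.\<close>

definition lifts :: "('a,'m) ring_scheme=>('a=>'c)=>('a,'b) module=>('c,'d) module=>('c,'e) module=>('d=>'e)=>bool" where
 "lifts A ph S N N' p <-> (ALL u. lin_along A ph S N' u --> (ALL x:car S. u x : p ` car N) -->
  (EX v. lin_along A ph S N v & (ALL x:car S. p (v x) = u x)))"

definition ring_map where
 "ring_map A B ph <-> ph : car A \<rightarrow> car B &
  (ALL a:car A. ALL b:car A. ph (a \<oplus>[A] b) = ph a \<oplus>[B] ph b & ph (a \<otimes>[A] b) = ph a \<otimes>[B] ph b)"

lemma ring_mapD:
 assumes "ring_map A B ph"
 shows "a : car A==>ph a : car B"
  "[|a : car A; b : car A|]==>ph (a \<oplus>[A] b) = ph a \<oplus>[B] ph b"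
  "[|a : car A; b : car A|]==>ph (a \<otimes>[A] b) = ph a \<otimes>[B] ph b" using assms by (auto simp: ring_map_def)

lemma ring_map_id: "ring_map A A id" by (simp add: ring_map_def)

text \<open>The composite of \<open>u\<close> with the retraction is lifted on the basis of the free
  module; then the lift is restricted along the embedding \<open>s\<close> of the summand.\<close>

lemma proj_lifts:
 fixes S :: "('a,'b) module" and A :: "('a,'m) ring_scheme"
 assumes S: "projective_module A S" and ph: "ring_map A B ph" and N: "left_module B N" and N': "abelian_group N'"
  and p: "linear_map B N N' p"
 shows "lifts A ph S N N' p" unfolding lifts_def
proof (intro allI impI)
 fix u assume u: "lin_along A ph S N' u" and im: "ALL x:car S. u x : p ` car N"
 from S obtain I s r where sr: "linear_map A S (FM A (I :: 'b set)) s" "linear_map A (FM A I) S r" "!!x. x : car S==>r (s x) = x"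
  and lS: "left_module A S" unfolding projective_module_def by blast
 interpret A: ring A by (rule l_mod_ring[OF lS])
 interpret N: abelian_group N by (rule l_mod_grp[OF N])
 note Nsm = l_mod_axioms'[OF N]
 let ?F = "FM A I"
 note s = linD[OF sr(1)] and r = linD[OF sr(2)] and u' = linD[OF u] and p' = linD[OF p] and h = ring_mapD[OF ph]
 define e where "e i = single A i \<one>[A]" for i :: 'b
 have e: "e i : car ?F" if "i : I" for i using that by (simp add: e_def A.fs_sg)
 have "EX m. m : car N & p m = u (r (e i))" if "i : I" for i using im r(1)[OF e[OF that]] by (metis imageE)
 then obtain m where m: "!!i. i : I==>m i : car N" "!!i. i : I==>p (m i) = u (r (e i))" by metis
 define T where "T i a = ph a \<odot>[N] m i" for i a
 note w = alift[of A N I T, OF A.ring_axioms N.abelian_group_axioms]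
 have T1: "T i c : car N" if "i : I" "c : car A" for i c using that by (simp add: T_def Nsm(1) h m(1))
 have T2: "T i (c \<oplus>[A] d) = T i c \<oplus>[N] T i d" if "i : I" "c : car A" "d : car A" for i c d
  using that by (simp add: T_def Nsm(2) h m(1))
 let ?v = "alift A N T"
 have va: "addmap ?F N ?v" by (rule alift(1)[OF A.ring_axioms N.abelian_group_axioms T1 T2])
 have vs: "?v (single A i c) = T i c" if "i : I" "c : car A" for i c
  by (rule alift(2)[OF A.ring_axioms N.abelian_group_axioms T1 T2 that])
 have smS: "(%j. a \<otimes>[A] single A i c j) = single A i (a \<otimes>[A] c)" if "a : car A" for a i c
  using that by (auto simp: single_def feq)
 have Fsm: "addmap ?F ?F (%x. a \<odot>[?F] x)" if a: "a : car A" for a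
 proof (rule amapI)
  show "a \<odot>[?F] x : car ?F" if "x : car ?F" for x
  proof -
   have x: "x : fsupp A I" using that by simp
   have "x i~=\<zero>[A]" if "a \<otimes>[A] x i~=\<zero>[A]" for i using that a by auto
   hence "(%i. a \<otimes>[A] x i) : fsupp A I"
    by (intro A.fsI[of _ "{i. x i~=\<zero>[A]}"]) (simp_all add: A.fsD(1-3)[OF x] a)
   thus ?thesis by simp
  qed
  show "a \<odot>[?F] (x \<oplus>[?F] y) = a \<odot>[?F] x \<oplus>[?F] a \<odot>[?F] y" if "x : car ?F" "y : car ?F" for x y
   using that a by (simp add: A.fsD(1)[of x I] A.fsD(1)[of y I] A.r_distr)
 qed
 have vl: "?v (a \<odot>[?F] x) = ph a \<odot>[N] ?v x" if a: "a : car A" and x: "x : car ?F" for a x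
 proof (rule A.amap_eqI[where F = "%x. ?v (a \<odot>[?F] x)" and G = "%x. ph a \<odot>[N] ?v x", OF N.abelian_group_axioms])
  show "addmap ?F N (%x. ?v (a \<odot>[?F] x))" by (rule amap_comp[OF Fsm[OF a] va])
  show "addmap ?F N (%x. ph a \<odot>[N] ?v x)" by (simp add: amap_comp[OF va] amapI Nsm(1) Nsm(3) h a)
  show "?v (a \<odot>[?F] single A b c) = ph a \<odot>[N] ?v (single A b c)" if "b : I" "c : car A" for b c
   using that a by (simp add: smS vs) (simp add: T_def h Nsm(4) m(1))
  show "x : fsupp A I" using x by simp
 qed
 have pv: "p (?v x) = u (r x)" if x: "x : car ?F" for x
 proof (rule A.amap_eqI[where F = "%x. p (?v x)" and G = "%x. u (r x)", OF N'])
  show "addmap ?F N' (%x. p (?v x))" by (rule amap_comp[OF va lin_amap[OF p]])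
  show "addmap ?F N' (%x. u (r x))" by (rule amap_comp[OF lin_amap[OF sr(2)] lin_amap[OF u]])
  show "p (?v (single A b c)) = u (r (single A b c))" if b: "b : I" "c : car A" for b c
  proof -
   have "p (?v (single A b c)) = ph c \<odot>[N'] u (r (e b))" using b by (simp add: vs T_def p'(3) h m)
   also have "... = u (r (c \<odot>[?F] e b))" using u'(3)[OF b(2) r(1)[OF e[OF b(1)]]] r(3)[OF b(2) e[OF b(1)]] by simp
   also have "c \<odot>[?F] e b = single A b c" using smS[OF b(2), of b "\<one>[A]"] b(2) by (simp add: e_def)
   finally show ?thesis .
  qed
  show "x : fsupp A I" using x by simp
 qed
 show "EX v. lin_along A ph S N v & (ALL x:car S. p (v x) = u x)"
 proof (intro exI[of _ "%x. ?v (s x)"] conjI ballI lin_alongI)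
  show "addmap S N (%x. ?v (s x))" by (rule amap_comp[OF lin_amap[OF sr(1)] va])
  show "?v (s (a \<odot>[S] x)) = ph a \<odot>[N] ?v (s x)" if "a : car A" "x : car S" for a x
   using vl[OF that(1) s(1)[OF that(2)]] s(3)[OF that] by simp
  show "p (?v (s x)) = u x" if "x : car S" for x using pv[OF s(1)[OF that]] sr(3)[OF that] by simp
 qed
qed

text \<open>\<open>projective_resolution\<close> with projectivity relaxed to the module axioms, so
  that the Salvetti resolution is covered as well.\<close>

definition resolution ::
  "('a,'m) ring_scheme=>('a,'c) module=>(nat=>('a,'b) module)=>(nat=>'b=>'b)=>('b=>'c)=>bool" where
 "resolution A N P d e <-> abelian_group N & (ALL i. left_module A (P i))
  & (ALL i. linear_map A (P (Suc i)) (P i) (d i))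
  & linear_map A (P 0) N e
  & e ` car (P 0) = car N
  & {x : car (P 0). e x = \<zero>[N]} = d 0 ` car (P (Suc 0))
  & (ALL i. {x : car (P (Suc i)). d i x = \<zero>[P i]} = d (Suc i) ` car (P (Suc (Suc i))))"

lemma proj_res_res: "[|projective_resolution A N P d e; abelian_group N|]==>resolution A N P d e"
 by (simp add: projective_resolution_def resolution_def projective_module_def)

definition cyc where
 "cyc N P d e i x <-> (case i of 0=>e x = \<zero>[N] | Suc j=>d j x = \<zero>[P j])"

lemma resD:
 assumes "resolution A N P d e"
 shows "abelian_group N" "left_module A (P i)" "abelian_group (P i)" "linear_map A (P (Suc i)) (P i) (d i)" "linear_map A (P 0) N e"
  "e ` car (P 0) = car N"
  "[|x : car (P i); cyc N P d e i x|]==>x : d i ` car (P (Suc i))"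
  "x : car (P (Suc i)) ==> cyc N P d e i (d i x)"
proof -
 show m: "left_module A (P i)" for i using assms by (simp add: resolution_def)
 interpret left_module A "P i" by (rule m)
 show "abelian_group (P i)" by unfold_locales
 show "abelian_group N" "linear_map A (P (Suc i)) (P i) (d i)" "linear_map A (P 0) N e" "e ` car (P 0) = car N"
  using assms by (simp_all add: resolution_def)
 have e0: "{x : car (P 0). e x = \<zero>[N]} = d 0 ` car (P (Suc 0))"
  and es: "!!i. {x : car (P (Suc i)). d i x = \<zero>[P i]} = d (Suc i) ` car (P (Suc (Suc i)))"
  using assms by (simp_all add: resolution_def)
 show "x : d i ` car (P (Suc i))" if "x : car (P i)" "cyc N P d e i x"
 proof (cases i)
  case 0
  thus ?thesis using that unfolding cyc_def by (simp add: e0[symmetric])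
 next
  case (Suc j)
  thus ?thesis using that unfolding cyc_def by (simp add: es[symmetric])
 qed
 show "cyc N P d e i (d i x)" if "x : car (P (Suc i))"
 proof (cases i)
  case 0
  hence "d i x : {x : car (P 0). e x = \<zero>[N]}" using that by (simp add: e0)
  thus ?thesis by (simp add: cyc_def 0)
 next
  case (Suc j)
  hence "d i x : {x : car (P (Suc j)). d j x = \<zero>[P j]}" using that unfolding Suc es by simp
  thus ?thesis by (simp add: cyc_def Suc)
 qed
qed

lemma cyc_simps: "cyc N P d e 0 x <-> e x = \<zero>[N]" "cyc N P d e (Suc j) x <-> d j x = \<zero>[P j]"
 by (simp_all add: cyc_def)

text \<open>The usual comparison theorem. The invariant \<open>G\<close> says that a component maps
  boundaries to cycles; by exactness of the target, this is what the next lift needs.\<close>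

theorem ch_map_ex:
 assumes S: "resolution A M S dS eS" and T: "resolution B N T dT eT" and nu0: "lin_along A ph M N nu0"
  and ph: "ring_map A B ph"
  and l0: "lifts A ph (S 0) (T 0) N eT" and ls: "!!i. lifts A ph (S (Suc i)) (T (Suc i)) (T i) (dT i)"
 obtains f where "resolution_map A ph nu0 S dS eS T dT eT f"
proof -
 note sd = resD[OF S] and td = resD[OF T]
 define G where "G i v <-> lin_along A ph (S i) (T i) v & (ALL x:car (S (Suc i)). cyc N T dT eT i (v (dS i x)))
  & (i = 0 --> (ALL x:car (S 0). eT (v x) = nu0 (eS x)))" for i v
 have zM: "eS (dS 0 x) = \<zero>[M]" if "x : car (S (Suc 0))" for x using sd(8)[OF that] by (simp add: cyc_simps)
 have dd: "dS i (dS (Suc i) x) = \<zero>[S i]" if "x : car (S (Suc (Suc i)))" for i x using sd(8)[OF that] by (simp add: cyc_simps)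
 have base: "EX v. G 0 v"
 proof -
  obtain v where v: "lin_along A ph (S 0) (T 0) v" "ALL x:car (S 0). eT (v x) = nu0 (eS x)"
   using l0 lin_comp[OF sd(5) nu0] td(6) linD(1)[OF nu0 linD(1)[OF sd(5)]] by (auto simp: lifts_def)
  have "eT (v (dS 0 x)) = \<zero>[N]" if x: "x : car (S (Suc 0))" for x
   using v(2) linD(1)[OF sd(4) x] zM[OF x] amap_zero[OF sd(1) td(1) lin_amap[OF nu0]] by simp
  thus ?thesis using v by (auto simp: G_def cyc_simps)
 qed
 have step: "EX w. G (Suc i) w & (ALL x:car (S (Suc i)). v (dS i x) = dT i (w x))" if v: "G i v" for i v
 proof -
  have vl: "lin_along A ph (S i) (T i) v" using v by (simp add: G_def)
  have "lin_along A ph (S (Suc i)) (T i) (%x. v (dS i x))" using lin_comp[OF sd(4)[of i] vl] by simp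
  moreover have "ALL x:car (S (Suc i)). v (dS i x) : dT i ` car (T (Suc i))"
   using v td(7) linD(1)[OF vl linD(1)[OF sd(4)]] by (auto simp: G_def)
  ultimately obtain w where w: "lin_along A ph (S (Suc i)) (T (Suc i)) w" "ALL x:car (S (Suc i)). dT i (w x) = v (dS i x)"
   using ls[of i] unfolding lifts_def by blast
  have "dT i (w (dS (Suc i) x)) = \<zero>[T i]" if x: "x : car (S (Suc (Suc i)))" for x
   using w(2) linD(1)[OF sd(4) x] dd[OF x] amap_zero[OF sd(3) td(3) lin_amap[OF vl]] by simp
  thus ?thesis using w by (auto simp: G_def cyc_simps)
 qed
 obtain f where f: "!!i. G i (f i)" "!!i. ALL x:car (S (Suc i)). f i (dS i x) = dT i (f (Suc i) x)"
  using dependent_nat_choice[of G "%i v w. ALL x:car (S (Suc i)). v (dS i x) = dT i (w x)", OF base step] by blast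
 show thesis using that f(1) f(2) by (auto simp: resolution_map_def G_def)
qed

lemma ab_grp_diff_self: "[|abelian_group X; x : car X|]==>x \<ominus>[X] x = \<zero>[X]"
 using abelian_group.r_neg[of X x] by (simp add: amd)

lemma lin_diff:
 assumes Y: "left_module B Y" and ph: "ring_map A B ph" and u: "lin_along A ph X Y u" and v: "lin_along A ph X Y v"
 shows "lin_along A ph X Y (%x. u x \<ominus>[Y] v x)"
proof (rule lin_alongI)
 interpret Y: left_module B Y by fact
 note u' = linD[OF u] and v' = linD[OF v] and h = ring_mapD[OF ph]
 show "addmap X Y (%x. u x \<ominus>[Y] v x)" by (rule amap_diff[OF _ lin_amap[OF u] lin_amap[OF v]]) unfold_locales
 show "u (a \<odot>[X] x) \<ominus>[Y] v (a \<odot>[X] x) = ph a \<odot>[Y] (u x \<ominus>[Y] v x)" if "a : car A" "x : car X" for a x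
  using that by (simp add: u' v' amd Y.smult_r_distr h l_mod_mns(1)[OF Y])
qed

text \<open>The difference \<open>u\<close> of the two maps is contracted degree by degree.
  \<open>D\<close> is the defect that the next component has to lift, and \<open>G\<close> ensures
  that it is a cycle.\<close>

theorem ch_htpy_ex:
 assumes S: "resolution A M S dS eS" and T: "resolution B N T dT eT" and ph: "ring_map A B ph"
  and f: "resolution_map A ph nu0 S dS eS T dT eT f" and g: "resolution_map A ph nu0 S dS eS T dT eT g"
  and ls: "!!i. lifts A ph (S i) (T (Suc i)) (T i) (dT i)"
 obtains h where "!!i. lin_along A ph (S i) (T (Suc i)) (h i)"
  "!!x. x : car (S 0)==>f 0 x \<ominus>[T 0] g 0 x = dT 0 (h 0 x)"
  "!!i x. x : car (S (Suc i))==>f (Suc i) x \<ominus>[T (Suc i)] g (Suc i) x \<ominus>[T (Suc i)] h i (dS i x) = dT (Suc i) (h (Suc i) x)"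
proof -
 note sd = resD[OF S] and td = resD[OF T]
 note f' = f[unfolded resolution_map_def] and g' = g[unfolded resolution_map_def]
 have fl: "lin_along A ph (S i) (T i) (f i)" and gl: "lin_along A ph (S i) (T i) (g i)" for i using f' g' by blast+
 have fd: "f i (dS i x) = dT i (f (Suc i) x)" and gd: "g i (dS i x) = dT i (g (Suc i) x)" if "x : car (S (Suc i))" for i x
  using f' g' that by blast+
 define u where "u i x = f i x \<ominus>[T i] g i x" for i x
 have ul: "lin_along A ph (S i) (T i) (u i)" for i unfolding u_def by (rule lin_diff[OF td(2) ph fl gl])
 have dsub: "dT i (x \<ominus>[T (Suc i)] y) = dT i x \<ominus>[T i] dT i y" if "x : car (T (Suc i))" "y : car (T (Suc i))" for i x y
  by (rule amap_mns_eq[OF td(3) td(3) lin_amap[OF td(4)] that])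
 have ud: "dT i (u (Suc i) x) = u i (dS i x)" if x: "x : car (S (Suc i))" for i x
  unfolding u_def dsub[OF linD(1)[OF fl x] linD(1)[OF gl x]] fd[OF x] gd[OF x] ..
 have dd: "dS i (dS (Suc i) x) = \<zero>[S i]" if "x : car (S (Suc (Suc i)))" for i x using sd(8)[OF that] by (simp add: cyc_simps)
 define D where "D i h x = u (Suc i) x \<ominus>[T (Suc i)] h (dS i x)" for i h x
 define G where "G i h <-> lin_along A ph (S i) (T (Suc i)) h & (ALL x:car (S (Suc i)). dT i (D i h x) = \<zero>[T i])
  & (i = 0 --> (ALL x:car (S 0). u 0 x = dT 0 (h x)))" for i h
 have base: "EX h. G 0 h"
 proof -
  have z: "eT (u 0 x) = \<zero>[N]" if x: "x : car (S 0)" for x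
 using amap_mns_eq[OF td(3) td(1) lin_amap[OF td(5)] linD(1)[OF fl x] linD(1)[OF gl x]] x f' g' abelian_group.r_neg[OF td(1) linD(1)[OF td(5) linD(1)[OF fl x]]] by (auto simp: u_def amd)
  have "u 0 x : dT 0 ` car (T (Suc 0))" if x: "x : car (S 0)" for x
   by (rule td(7)[OF linD(1)[OF ul x]]) (simp add: cyc_simps z[OF x])
  then obtain h where h: "lin_along A ph (S 0) (T (Suc 0)) h" "ALL x:car (S 0). dT 0 (h x) = u 0 x"
   using ls[of 0] ul[of 0] unfolding lifts_def by blast
  have "dT 0 (D 0 h x) = \<zero>[T 0]" if x: "x : car (S (Suc 0))" for x
 by (metis linD(1) sd(4) x D_def dsub linD(1)[OF ul x] ul h(1) ud h(2) ab_grp_diff_self td(3))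
  thus ?thesis using h by (auto simp: G_def)
 qed
 have step: "EX w. G (Suc i) w & (ALL x:car (S (Suc i)). D i v x = dT (Suc i) (w x))" if v: "G i v" for i v
 proof -
  have vl: "lin_along A ph (S i) (T (Suc i)) v" using v by (simp add: G_def)
  have vd: "lin_along A ph (S (Suc i)) (T (Suc i)) (%x. v (dS i x))" using lin_comp[OF sd(4)[of i] vl] by simp
  have Dl: "lin_along A ph (S (Suc i)) (T (Suc i)) (D i v)" unfolding D_def by (rule lin_diff[OF td(2) ph ul vd])
  have "D i v x : dT (Suc i) ` car (T (Suc (Suc i)))" if x: "x : car (S (Suc i))" for x
   by (rule td(7)[OF linD(1)[OF Dl x]]) (use v x in \<open>simp add: cyc_simps G_def\<close>)
  then obtain w where w: "lin_along A ph (S (Suc i)) (T (Suc (Suc i))) w" "ALL x:car (S (Suc i)). dT (Suc i) (w x) = D i v x"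
   using ls[of "Suc i"] Dl unfolding lifts_def by blast
  have "dT (Suc i) (D (Suc i) w x) = \<zero>[T (Suc i)]" if x: "x : car (S (Suc (Suc i)))" for x
  proof -
   note dx = linD(1)[OF sd(4) x]
   have "dT (Suc i) (D (Suc i) w x) = u (Suc i) (dS (Suc i) x) \<ominus>[T (Suc i)] dT (Suc i) (w (dS (Suc i) x))"
    unfolding D_def dsub[OF linD(1)[OF ul x] linD(1)[OF w(1) dx]] ud[OF x] ..
   also have "dT (Suc i) (w (dS (Suc i) x)) = D i v (dS (Suc i) x)" using w(2) dx by blast
   also have "D i v (dS (Suc i) x) = u (Suc i) (dS (Suc i) x)"
   proof -
    interpret T: abelian_group "T (Suc i)" by (rule td(3))
    show ?thesis unfolding D_def dd[OF x] amap_zero[OF sd(3) td(3) lin_amap[OF vl]]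
     using linD(1)[OF ul dx] by (simp add: amd)
   qed
   finally show ?thesis using ab_grp_diff_self[OF td(3) linD(1)[OF ul dx]] by simp
  qed
  thus ?thesis using w by (auto simp: G_def)
 qed
 obtain h where h: "!!i. G i (h i)" "!!i. ALL x:car (S (Suc i)). D i (h i) x = dT (Suc i) (h (Suc i) x)"
  using dependent_nat_choice[of G "%i v w. ALL x:car (S (Suc i)). D i v x = dT (Suc i) (w x)", OF base step] by blast
 show thesis by (metis that h(1) G_def u_def h(2) D_def)
qed

section \<open>Stability of the coinvariants\<close>

text \<open>A product of \<open>k\<close> adjacent transpositions (\<open>cycp_Suc\<close>), hence
  of sign \<open>(- 1) ^ k\<close>; its inversions all start at \<open>a\<close>.\<close>

definition cycp :: "nat=>nat=>nat=>nat" where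
 "cycp a k x = (if x = a then a + k else if a < x & x<=a + k then x - 1 else x)"

lemma cycp_Suc: "cycp a (Suc k) = tpose (a + k) (Suc (a + k)) o cycp a k"
 by (auto simp: cycp_def feq Transposition.transpose_def)

lemma cycp:
 assumes "1<=a" "a + k<=n"
 shows "cycp a k permutes {1..n}" "sign (cycp a k) = (- 1) ^ k"
proof -
 have "a + k<=n ==> cycp a k permutes {1..n} & sign (cycp a k) = (- 1) ^ k"
 proof (induction k)
  case 0
  have "cycp a 0 = id" by (auto simp: cycp_def feq)
  thus ?case by (simp only: permutes_id sign_id power_0 simp_thms)
 next
  case (Suc k)
  have t: "tpose (a + k) (Suc (a + k)) permutes {1..n}" by (rule permutes_swap_id) (use assms(1) Suc.prems in auto)
  have IH: "cycp a k permutes {1..n}" "sign (cycp a k) = (- 1) ^ k" using Suc by simp_all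
  have "cycp a (Suc k) permutes {1..n}" unfolding cycp_Suc by (rule permutes_compose[OF IH(1) t])
  moreover have "sign (cycp a (Suc k)) = (- 1) ^ Suc k"
   unfolding cycp_Suc sgn_comp_perm[OF t IH(1)] IH(2) by (simp add: sign_swap_id)
  ultimately show ?case ..
 qed
 thus "cycp a k permutes {1..n}" "sign (cycp a k) = (- 1) ^ k" using assms(2) by simp_all
qed

lemma invs_cycp: "invs (cycp a k) = {(a,t) | t. a < t & t<=a + k}" by (auto simp: invs_def cycp_def split: if_splits)

text \<open>These are the left cosets of a symmetric group in the next one, whose minimal representatives are cycles.\<close>

lemma mcr_cyc:
 assumes J: "J<={1..<n}" and a: "a : J" "a - 1 ~: J" and r: "{a..<a + r}<=J" "a + r ~: J"
 shows "mcr n J (J - {a}) = cycp a ` {..r}"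
proof
 have a1: "1<=a" using a(1) J by auto
 have "r > 0" using a(1) r(2) by (cases r) auto
 hence "a + r - 1 : J" using r(1) by auto
 hence arn: "a + r<=n" using J by force
 have 0: "(a,t) : blk_prs J <-> a < t & t<=a + r" for t
 proof
  assume "(a,t) : blk_prs J"
  hence h: "a < t" "{a..<t}<=J" by (auto simp: blk_prs_def)
  have "t<=a + r"
  proof (rule ccontr)
   assume "~ t<=a + r"
   hence "a + r : {a..<t}" by auto
   thus False using h(2) r(2) by blast
  qed
  thus "a < t & t<=a + r" using h(1) by simp
 next
  assume h: "a < t & t<=a + r"
  hence "{a..<t}<={a..<a + r}" by auto
  hence "{a..<t}<=J" using r(1) by (rule subset_trans)
  thus "(a,t) : blk_prs J" using h by (simp add: blk_prs_def)
 qed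
 show "cycp a ` {..r}<=mcr n J (J - {a})"
 proof
  fix w assume "w : cycp a ` {..r}"
  then obtain k where k: "w = cycp a k" "k<=r" by auto
  have wp: "w permutes {1..n}" unfolding k(1) by (rule cycp) (use a1 arn k(2) in auto)
  have "invs w<=blk_prs J" using k(1) invs_cycp k(2) 0 by auto
  moreover have "w i < w (Suc i)" if "i : J - {a}" for i
  proof -
   have "(i,Suc i) ~: invs w" using that by (auto simp: k(1) invs_cycp)
   moreover have "w i~=w (Suc i)" using injD[OF permutes_inj[OF wp], of i "Suc i"] by auto
   ultimately show ?thesis by (simp add: invs_def)
  qed
  ultimately show "w : mcr n J (J - {a})" using wp by (simp add: mcr_def para_def)
 qed
 show "mcr n J (J - {a}) <= cycp a ` {..r}"
 proof
  fix w assume w: "w : mcr n J (J - {a})"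
  have wp: "w permutes {1..n}" by (rule mcr_perm[OF w])
  have inv: "invs w<=blk_prs J" using w by (simp add: mcr_def para_def)
  have inc: "w i < w j" if "(i,j) : blk_prs (J - {a})" for i j
   by (rule increasing_blk[OF _ that]) (use w in \<open>simp add: mcr_def\<close>)
  \<comment> \<open>Every inversion starts at \<open>a\<close>. As \<open>a\<close> is the start of
    its block, any other pair within a block avoids the generator \<open>a\<close>, and there
    \<open>w\<close> is increasing.\<close>
  have first: "i = a" if h: "(i,t) : invs w" for i t
  proof (rule ccontr)
   assume ne: "i~=a"
   have b: "i < t" "{i..<t}<=J" using h inv by (auto simp: blk_prs_def)
   have "a ~: {i..<t}"
   proof
    assume "a : {i..<t}"
    hence "a - 1 : {i..<t}" using ne by auto
    thus False using b(2) a(2) by blast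
   qed
   hence "(i,t) : blk_prs (J - {a})" using b by (auto simp: blk_prs_def)
   thus False using inc[of i t] h by (simp add: invs_def)
  qed
  define T where "T = {t. (a,t) : invs w}"
  have T: "a < t" "t<=a + r" if "t : T" for t using that inv 0[of t] by (auto simp: T_def)
  \<comment> \<open>Beyond \<open>a\<close> the permutation is increasing on the block, so the
    positions exchanged with \<open>a\<close> form an initial segment.\<close>
  have down: "s : T" if "t : T" "a < s" "s<=t" for s t
  proof (cases "s = t")
   case False
   have "{s..<t}<=J - {a}" using that(2) that(1) inv by (fastforce simp: T_def blk_prs_def)
   hence "(s,t) : blk_prs (J - {a})" using False that(3) by (simp add: blk_prs_def)
   from inc[OF this] show ?thesis using that(1,2) by (simp add: T_def invs_def)
  qed (use that in simp)
  have fT: "finite T" by (rule finite_subset[of _ "{..a + r}"]) (use T(2) in auto)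
  obtain k where k: "k<=r" "T = {t. a < t & t<=a + k}"
  proof (cases "T = {}")
   case True
   thus thesis by (intro that[of 0]) auto
  next
   case False
   hence m: "Max T : T" using fT by simp
   have "T = {t. a < t & t<=a + (Max T - a)}" using T(1)[OF m] T(1) Max_ge[OF fT] down[OF m] by auto
   thus thesis using T[OF m] by (intro that[of "Max T - a"]) auto
  qed
  have "invs w = invs (cycp a k)" using first k(2) invs_cycp by (auto simp: T_def)
  hence "w = cycp a k" using cycp(1)[OF a1, of k n] k(1) arn by (intro invs_eqI[OF wp]) auto
  thus "w : cycp a ` {..r}" using k(1) by simp
 qed
qed

text \<open>The \<open>r + 1\<close> cycles have alternating signs. Here the parity of the block
  length \<open>r\<close> enters: the incidence is 1 or 0.\<close>

lemma cos_sgn_sum: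
 assumes J: "J<={1..<n}" and a: "a : J" "a - 1 ~: J" and r: "{a..<a + r}<=J" "a + r ~: J"
 shows "(\<Sum>w\<in>mcr n J (J - {a}). sign w) = (if even r then 1 else 0 :: int)"
proof -
 have a1: "1<=a" using a(1) J by auto
 have "r > 0" using a(1) r(2) by (cases r) auto
 hence "a + r - 1 : J" using r(1) by auto
 hence arn: "a + r<=n" using J by force
 have inj: "inj_on (cycp a) {..r}"
 proof (rule inj_onI)
  fix k l assume "cycp a k = cycp a l"
  hence "cycp a k a = cycp a l a" by simp
  thus "k = l" by (simp add: cycp_def)
 qed
 have "(\<Sum>w\<in>mcr n J (J - {a}). sign w) = (\<Sum>k\<le>r. sign (cycp a k))"
  unfolding mcr_cyc[OF assms] by (simp add: sum.reindex[OF inj])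
 also have "... = (\<Sum>k\<le>r. (- 1) ^ k)" by (intro sum.cong HOL.refl cycp(2)[of _ _ n]) (use a1 arn in auto)
 also have "... = (if even r then 1 else 0)" by (induction r) auto
 finally show ?thesis .
qed

definition face_coeff where
 "face_coeff n J j = psgn j J * (\<Sum>w\<in>mcr n J (J - {j}). sign w)"

text \<open>What remains of \<open>bdry\<close> when the braids are forgotten, that is, after
  tensoring with the trivial module.\<close>

definition cbdry where
 "cbdry n J = (\<Sum>j\<in>J. fcm (face_coeff n J j) (frg (J - {j})))"

definition forget :: "cell=>nat set \<Rightarrow>\<^sub>0 int" where
 "forget c = frg (snd c)"

lemma fgt_bdry:
 assumes "finite (snd c)"
 shows "fex forget (bdry n c) = cbdry n (snd c)"
proof -
 have "fcm (sum f A) x = (\<Sum>w\<in>A. fcm (f w) x)" if "finite A" for f :: "(nat=>nat)=>int" and A and x :: "nat set \<Rightarrow>\<^sub>0 int"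
  using that by (induction A) (simp_all add: frag_cmul_distrib)
 thus ?thesis
  by (simp add: bdry_def cbdry_def frag_extend_sum assms fin_mcr frag_extend_cmul forget_def face_coeff_def sum_distrib_left)
qed

definition ccells :: "nat=>nat=>nat set set" where
 "ccells n p = {J. J<={1..<n} & card J = p}"

lemma cbdry_keys:
 assumes "J : ccells n p"
 shows "keys (cbdry n J)<=(%j. J - {j}) ` J" unfolding cbdry_def
proof (rule sum_frag_keys)
 fix j assume "j : J"
 thus "keys (fcm (face_coeff n J j) (frg (J - {j})))<=(%j. J - {j}) ` J"
  using keys_cmul[of "face_coeff n J j" "frg (J - {j})"] by (auto simp: keys_frag_of)
qed

lemma cbdry_keys_ccells:
 assumes "J : ccells n (Suc p)"
 shows "keys (cbdry n J) <= ccells n p"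
proof -
 have "(%j. J - {j}) ` J <= ccells n p" using assms by (auto simp: ccells_def)
 thus ?thesis using cbdry_keys[OF assms] by blast
qed

lemma fext_fext: "fex f (fex g t) = fex (%c. fex f (g c)) t"
proof -
 have "keys t<=UNIV" by simp
 thus ?thesis by (induction t rule: frag_induction) (simp_all add: frag_extend_diff)
qed

lemma fext_diff_fun: "fex (%c. f c - g c) t = fex f t - fex g t"
proof -
 have "keys t<=UNIV" by simp
 thus ?thesis by (induction t rule: frag_induction) (simp_all add: frag_extend_diff algebra_simps)
qed

text \<open>Inherited from \<open>bdry_twice\<close> through \<open>forget\<close>, by means of the
  cell over the trivial braid.\<close>

lemma cbdry_twice:
 assumes "J : ccells n p"
 shows "fex (cbdry n) (cbdry n J) = 0"
proof (cases p)
 case 0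
 hence "J = {}" using assms fin_gens[of J n] by (auto simp: ccells_def)
 thus ?thesis by (simp add: cbdry_def)
next
 case (Suc i)
 have J: "J<={1..<n}" "finite J" using assms fin_gens[of J n] by (auto simp: ccells_def)
 let ?c = "(idd n,J)"
 have c: "?c : cells n (Suc i)" using assms Suc by (simp add: cells_def ccells_def bgrp_one)
 have "fex (cbdry n) (cbdry n J) = fex (cbdry n) (fex forget (bdry n ?c))" using fgt_bdry[of ?c n] J by simp
 also have "... = fex (%c. fex (cbdry n) (forget c)) (bdry n ?c)" by (rule fext_fext)
 also have "... = fex (%c. fex forget (bdry n c)) (bdry n ?c)"
 proof (rule frag_extend_eq)
  fix c assume "c : keys (bdry n ?c)"
  hence "c : cells n i" using bdry_keys[OF c] by (rule rev_subsetD)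
  hence "finite (snd c)" using fin_gens by (auto simp: cells_def)
  thus "fex (cbdry n) (forget c) = fex forget (bdry n c)" by (simp add: forget_def fgt_bdry)
 qed
 also have "... = fex forget (fex (bdry n) (bdry n ?c))" by (rule fext_fext[symmetric])
 also have "... = 0" by (simp add: bdry_twice[OF bgrp_one J(1)])
 finally show ?thesis .
qed

text \<open>
  The quotient of the complex for \<open>n\<close> by that for \<open>n - 1\<close> is contracted in low degrees by an acyclic matching
  that adds or removes the generator \<open>Suc (gap n J)\<close>. By the choice of parity the block that starts there when
  the generator is present has even length, so that the matched incidence coefficients are units.
\<close>

definition gaps :: "nat=>nat set=>nat set" where
 "gaps n J = {z. z < n & odd (n + z) & z ~: J}"

text \<open>The largest gap is chosen because omitting a generator can create gaps but never closes
  one. So the value can only increase on faces, which makes the reduction terminate.\<close>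

definition gap where
 "gap n J = Max (gaps n J)"

lemma fin_gaps [simp]: "finite (gaps n J)" by (rule finite_subset[of _ "{..<n}"]) (auto simp: gaps_def)

lemma gap_in: "gaps n J~={}==>gap n J : gaps n J" unfolding gap_def by (rule Max_in) simp

lemma gap_ge: "z : gaps n J==>z<=gap n J" unfolding gap_def by (rule Max_ge) simp

text \<open>The value \<open>n - 1\<close> is excluded because it lies in \<open>J\<close>, and
  \<open>n - 2\<close> by parity. Hence the matched generator is never \<open>n - 1\<close> itself,
  and partners of cells containing \<open>n - 1\<close> contain it too.\<close>

lemma gap_less:
 assumes "gaps n J~={}" "n - 1 : J"
 shows "Suc (gap n J) < n - 1"
proof -
 have g: "gap n J < n" "odd (n + gap n J)" "gap n J ~: J" using gap_in[OF assms(1)] by (auto simp: gaps_def)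
 have "gap n J~=n - 1" using g(3) assms(2) by metis
 moreover have "gap n J~=n - 2"
 proof
  assume h: "gap n J = n - 2"
  show False
  proof (cases "n >= 2")
   case True
   hence "n + gap n J = 2 * (n - 1)" using h by simp
   thus False using g(2) by simp
  next
   case False
   thus False using h g `gap n J~=n - 1` by auto
  qed
 qed
 ultimately show ?thesis using g(1) by linarith
qed

text \<open>The matched generator \<open>Suc (gap n J)\<close> has the parity that
  \<open>gaps\<close> ignores; so a cell and its partner have the same gap.\<close>

lemma gap_insert:
 assumes "gaps n J~={}" "even (n + a)"
 shows "gaps n (insert a J) = gaps n J" "gaps n (J - {a}) = gaps n J" using assms(2) by (auto simp: gaps_def)

text \<open>Acyclicity of the matching: gaps persist when \<open>j\<close> is omitted, so the
  largest one either stays, together with the generator after it, or moves up.\<close>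

lemma gap_face:
 assumes J: "gaps n J~={}" and up: "Suc (gap n J) : J" and j: "j : J" "j~=Suc (gap n J)" "J<={1..<n}"
 shows "gaps n (J - {j})~={}" "Suc (gap n (J - {j})) : J - {j} | gap n J < gap n (J - {j})"
proof -
 have sub: "gaps n J<=gaps n (J - {j})" by (auto simp: gaps_def)
 thus ne: "gaps n (J - {j})~={}" using J by auto
 show "Suc (gap n (J - {j})) : J - {j} | gap n J < gap n (J - {j})" using gap_ge up j(2) gap_in[OF J] gap_in sub by fastforce
qed

text \<open>The first number after the gap that is missing in \<open>U\<close> cannot be a gap, the
  gap being maximal; nor is the parity wrong if this number is \<open>n\<close>. So the block
  starting at the matched generator has even length.\<close>

lemma gap_face_coeff:
 assumes J: "gaps n U~={}" and up: "Suc (gap n U) : U" and U: "U<={1..<n}"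
 shows "face_coeff n U (Suc (gap n U)) = psgn (Suc (gap n U)) U"
proof -
 let ?a = "Suc (gap n U)"
 have g: "gap n U < n" "odd (n + gap n U)" "gap n U ~: U" using gap_in[OF J] by (auto simp: gaps_def)
 define t where "t = (LEAST t. ?a<=t & t ~: U)"
 have "?a<=n & n ~: U" using g(1) U by auto
 hence t: "?a<=t" "t ~: U" "t<=n"
  unfolding t_def using LeastI[of "%t. ?a<=t & t ~: U" n] Least_le[of "%t. ?a<=t & t ~: U" n] by auto
 have below: "s : U" if "?a<=s" "s < t" for s using not_less_Least[of s "%t. ?a<=t & t ~: U"] that by (auto simp: t_def)
 obtain r where r: "t = ?a + r" using t(1) le_Suc_ex by blast
 have "even r"
 proof (rule ccontr)
  assume "odd r"
  hence "odd (n + t)" using g(2) by (simp add: r)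
  hence "t~=n" by auto
  hence "t : gaps n U" using t `odd (n + t)` by (simp add: gaps_def)
  thus False using gap_ge t(1) by fastforce
 qed
 moreover have "{?a..<?a + r}<=U" using below r by auto
 ultimately have "(\<Sum>w\<in>mcr n U (U - {?a}). sign w) = 1" using cos_sgn_sum[OF U up, of r] g(3) t(2) r by simp
 thus ?thesis by (simp add: face_coeff_def)
qed

text \<open>For odd \<open>n\<close> the number 0 would be a gap. So \<open>n\<close> is even and
  \<open>J\<close> contains all \<open>n / 2\<close> odd numbers, and the bound on \<open>p\<close>
  leaves room for nothing else. All blocks then have length 1, for which the sum of signs
  vanishes.\<close>

lemma gaps_empty_bdry:
 assumes J: "J : ccells n p" and g: "gaps n J = {}" and n: "2 * p<=n + 1"
 shows "2 * p = n" "cbdry n J = 0"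
proof -
 have Jn: "J<={1..<n}" "card J = p" "finite J" using J fin_gens[of J n] by (auto simp: ccells_def)
 obtain m where m: "n = 2 * m" using Jn(1) g by (fastforce simp: gaps_def)
 define D where "D = (%i. 2 * i + 1) ` {..<m}"
 have D: "finite D" "card D = m" unfolding D_def by (simp_all add: card_image inj_on_def)
 have "D<=J"
 proof
  fix z assume "z : D"
  hence "z < n" "odd (n + z)" by (auto simp: D_def m)
  thus "z : J" using g by (auto simp: gaps_def)
 qed
 hence "card D <= card J" by (rule card_mono[OF Jn(3)])
 hence "card D = card J" using D(2) Jn(2) n m by linarith
 with `D<=J` have "D = J" by (intro card_subset_eq[OF Jn(3)])
 thus "2 * p = n" using D(2) Jn(2) m by simp
 have odd: "odd j" if "j : J" for j using that by (auto simp: D_def `D = J`[symmetric])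
 have "face_coeff n J j = 0" if j: "j : J" for j
 proof -
  have "j - 1 ~: J" "j + 1 ~: J" using odd[OF j] odd[of "j - 1"] odd[of "j + 1"] Jn(1) j by auto
  hence "(\<Sum>w\<in>mcr n J (J - {j}). sign w) = 0" using cos_sgn_sum[OF Jn(1) j, of 1] j by (simp add: One_nat_def)
  thus ?thesis by (simp add: face_coeff_def)
 qed
 thus "cbdry n J = 0" by (simp add: cbdry_def)
qed

text \<open>The cells at which the reduction stops: those of the smaller complex, those without a
  gap, and the upper cells of the matching.\<close>

definition rcrit where
 "rcrit n p = {J : ccells n p. n - 1 ~: J | gaps n J = {} | Suc (gap n J) : J}"

text \<open>A lower cell is traded, modulo the boundary of its partner \<open>U\<close>, for the
  other faces of \<open>U\<close>. These are of the kind in \<open>rcrit\<close> or have a larger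
  gap, so the process ends.\<close>

lemma rel_reduce_cell:
 assumes "J : ccells n p"
 shows "EX W. keys W <= ccells n (Suc p) & keys (frg J - fex (cbdry n) W)<=rcrit n p" using assms
proof (induction "n - gap n J" arbitrary: J rule: less_induct)
 case less
 show ?case
 proof (cases "J : rcrit n p")
  case True
  thus ?thesis by (intro exI[of _ 0]) simp
 next
  case False
  hence J: "n - 1 : J" "gaps n J~={}" "Suc (gap n J) ~: J" using less.prems by (auto simp: rcrit_def)
  have Jn: "J<={1..<n}" "card J = p" "finite J" using less.prems fin_gens[of J n] by (auto simp: ccells_def)
  let ?a = "Suc (gap n J)"
  define U where "U = insert ?a J"
  have g: "gap n J < n" "odd (n + gap n J)" "gap n J ~: J" using gap_in[OF J(2)] by (auto simp: gaps_def)
  have al: "?a < n - 1" by (rule gap_less[OF J(2,1)])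
  have gU: "gaps n U = gaps n J" unfolding U_def by (rule gap_insert(1)[OF J(2)]) (use g(2) in simp)
  hence bU: "gap n U = gap n J" by (simp add: gap_def)
  have Un: "U<={1..<n}" using Jn(1) al by (auto simp: U_def)
  have Uc: "U : ccells n (Suc p)" using Un Jn J(3) by (simp add: ccells_def U_def)
  have UJ: "U - {?a} = J" using J(3) by (auto simp: U_def)
  have aU: "?a : U" by (simp add: U_def)
  define sg where "sg = psgn ?a U"
  define T where "T = rcrit n p Un {K : ccells n p. gap n J < gap n K & gap n K < n}"
  have T: "EX W. keys W <= ccells n (Suc p) & keys (frg K - fex (cbdry n) W)<=rcrit n p" if "K : T" for K
  using less.hyps that by (fastforce simp: T_def)
  then obtain W where W: "!!K. K : T==>keys (W K) <= ccells n (Suc p)"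
   "!!K. K : T==>keys (frg K - fex (cbdry n) (W K))<=rcrit n p" by metis
  define u where "u = frg J - fex (cbdry n) (fcm sg (frg U))"
  have "cbdry n U = fcm sg (frg J) + (\<Sum>j\<in>U - {?a}. fcm (face_coeff n U j) (frg (U - {j})))"
   unfolding cbdry_def using sum.remove[OF fin_gens[OF Un] aU, of "%j. fcm (face_coeff n U j) (frg (U - {j}))"]
    gap_face_coeff[of n U] aU Un gU J(2) by (simp add: bU UJ sg_def)
  moreover have "fcm sg (fcm sg (frg J)) = frg J" by (simp add: sg_def psgn_square)
  ultimately have u: "u = - fcm sg (\<Sum>j\<in>U - {?a}. fcm (face_coeff n U j) (frg (U - {j})))"
   by (simp add: u_def frag_extend_cmul frag_cmul_distrib2)
  have "keys (\<Sum>j\<in>U - {?a}. fcm (face_coeff n U j) (frg (U - {j})))<=T"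
  proof (rule sum_frag_keys)
   fix j assume j: "j : U - {?a}"
   let ?K = "U - {j}"
   have Kc: "?K : ccells n p" using Uc j fin_gens[OF Un] by (auto simp: ccells_def)
   have "?K : T"
   proof (cases "n - 1 : ?K")
    case True
    have f: "gaps n ?K~={}" "Suc (gap n ?K) : ?K | gap n U < gap n ?K"
     using gap_face[of n U j] gU J(2) aU bU j Un by auto
    have "gap n ?K < n" using gap_in[OF f(1)] by (simp add: gaps_def)
    thus ?thesis using f Kc by (auto simp: T_def rcrit_def bU)
   qed (use Kc in \<open>auto simp: T_def rcrit_def\<close>)
   thus "keys (fcm (face_coeff n U j) (frg ?K))<=T"
    using keys_cmul[of "face_coeff n U j" "frg ?K"] by (auto simp: keys_frag_of)
  qed
  hence uT: "keys u<=T" unfolding u using keys_cmul by fastforce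
  define V where "V = fcm sg (frg U) + fex W u"
  have "keys (fex W u) <= ccells n (Suc p)" by (rule fext_keys[OF W(1)]) (use uT in blast)
  hence "keys V <= ccells n (Suc p)"
   unfolding V_def using Uc keys_cmul[of sg "frg U"] by (intro keys_diff_sub) (auto simp: keys_frag_of)
  moreover have "frg J - fex (cbdry n) V = fex (%K. frg K - fex (cbdry n) (W K)) u"
 by (auto simp: V_def u_def frag_extend_add fext_fext frag_expansion[symmetric] fext_diff_fun)
  moreover have "keys (fex (%K. frg K - fex (cbdry n) (W K)) u)<=rcrit n p"
   by (rule fext_keys[OF W(2)]) (use uT in blast)
  ultimately show ?thesis by (intro exI[of _ V]) simp
 qed
qed

section \<open>Reduction of relative cycles and stability of coinvariants\<close>

context ring
begin

lemma kcbdry_cl: "f : fsupp R (ccells n (Suc p))==>klift (cbdry n) f : fsupp R (ccells n p)"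
 by (rule klift_cl[OF _ cbdry_keys_ccells])

lemma kcbdry_twice:
 assumes f: "f : fsupp R (ccells n p)"
 shows "klift (cbdry n) (klift (cbdry n) f) = (%x. \<zero>)"
by (auto simp: klift2[OF f] klift_cong[OF f cbdry_twice] klift_zero_map)

lemma cbdry_zero_cells: "f : fsupp R (ccells n 0)==>klift (cbdry n) f = (%x. \<zero>)"
proof -
 assume f: "f : fsupp R (ccells n 0)"
 have "klift (cbdry n) f = klift (%c. 0 :: nat set \<Rightarrow>\<^sub>0 int) f"
  by (rule klift_cong[OF f]) (use fin_gens in \<open>auto simp: ccells_def cbdry_def\<close>)
 thus ?thesis by (simp add: klift_zero_map)
qed

lemma klift_only:
 assumes f: "f : fsupp R S" and "!!b. [|b : S; f b~=\<zero>; b~=b0|]==>Poly_Mapping.lookup (T b) x = 0"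
 shows "klift T f x = [Poly_Mapping.lookup (T b0) x] \<cdot> f b0"
proof -
 have A: "finite (insert b0 {b. f b~=\<zero>})" using fsD(2)[OF f] by simp
 have "klift T f x = (\<Oplus>b\<in>insert b0 {b. f b~=\<zero>}. cvec (f b) (T b) x)"
  by (rule klift_superset[OF A _ fsD(1)[OF f]]) auto
 also have "... = (\<Oplus>b\<in>insert b0 {b. f b~=\<zero>}. if b0 = b then cvec (f b) (T b) x else \<zero>)"
 proof (rule finsum_cong'[OF HOL.refl])
  show "(%b. if b0 = b then cvec (f b) (T b) x else \<zero>) : insert b0 {b. f b~=\<zero>} \<rightarrow> car R"
   using fsD(1)[OF f] by (simp add: cvec_in)
  fix b assume b: "b : insert b0 {b. f b~=\<zero>}"
  show "cvec (f b) (T b) x = (if b0 = b then cvec (f b) (T b) x else \<zero>)"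
  using b assms(2) fsD(3) f by (fastforce simp: cvec_def)
 qed
 also have "... = cvec (f b0) (T b0) x" by (rule add.finprod_singleton[OF _ A]) (simp_all add: cvec_in fsD(1)[OF f])
 finally show ?thesis by (simp add: cvec_def)
qed

lemma psgn_cases: "psgn j J = 1 | psgn j J = - 1" by (cases "even (card {i : J. i < j})") (simp_all add: psgn_def)

lemma unit_multiple_zero:
 assumes "c : car R" "[psgn j J] \<cdot> c = \<zero>"
 shows "c = \<zero>"
proof -
 have "[(- 1 :: int)] \<cdot> c = \<ominus> c" using assms(1) add.int_pow_neg[of c 1] by (simp add: a_inv_def)
 thus ?thesis using assms psgn_cases[of j J] by auto
qed

text \<open>After the reduction the upper cells that contain \<open>n - 1\<close> must be excluded.
  For one with the least gap, its lower partner lies in the boundary of no other remaining cell. The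
  coefficient of the partner in the boundary is zero and equals plus or minus that of the upper
  cell.\<close>

lemma rel_cycle_reduce:
 assumes f: "f : fsupp R (ccells n p)" and n: "2 * p<=n + 1"
  and rel: "!!K. n - 1 : K==>klift (cbdry n) f K = \<zero>"
 obtains w g where "w : fsupp R (ccells n (Suc p))" "g : fsupp R {J : ccells n p. n - 1 ~: J | gaps n J = {}}"
  "f = (%x. klift (cbdry n) w x \<oplus> g x)"
proof -
 obtain W where W: "!!J. J : ccells n p==>keys (W J) <= ccells n (Suc p)"
  "!!J. J : ccells n p==>keys (frg J - fex (cbdry n) (W J))<=rcrit n p" using rel_reduce_cell[of _ n p] by metis
 define w where "w = klift W f"
 have w: "w : fsupp R (ccells n (Suc p))" unfolding w_def by (rule klift_cl[OF f W(1)])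
 define T where "T J = frg J + - fex (cbdry n) (W J)" for J
 define g where "g = klift T f"
 have T: "keys (T J)<=rcrit n p" if "J : ccells n p" for J using W(2)[OF that] by (simp add: T_def)
 have g: "g : fsupp R (rcrit n p)" unfolding g_def by (rule klift_cl[OF f T])
 have sub: "rcrit n p <= ccells n p" by (auto simp: rcrit_def)
 have bw: "klift (cbdry n) w : fsupp R (ccells n p)" by (simp add: kcbdry_cl w)
 have ge: "g = (%x. f x \<ominus> klift (cbdry n) w x)"
  unfolding g_def T_def klift_plus[OF f] klift_mns[OF f] klift_of[OF f] w_def klift2[OF f] amd ..
 have fe: "f = (%x. klift (cbdry n) w x \<oplus> g x)"
  using fsD(1)[OF bw] fsD(1)[OF f] by (simp add: ge feq amd a_ac r_neg2 r_neg)
 have rg: "klift (cbdry n) g K = \<zero>" if "n - 1 : K" for K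
  unfolding ge klift_diff[OF f bw] kcbdry_twice[OF w] by (simp add: rel[OF that] amd)
 have "g : fsupp R {J : ccells n p. n - 1 ~: J | gaps n J = {}}"
 proof (rule fs_subI[OF g], rule ccontr)
  fix U0 assume U0: "U0 : rcrit n p" "g U0~=\<zero>" "U0 ~: {J : ccells n p. n - 1 ~: J | gaps n J = {}}"
  define B where "B U <-> U : rcrit n p & g U~=\<zero> & n - 1 : U & gaps n U~={}" for U
  have "B U0" using U0 by (auto simp: B_def rcrit_def)
  then obtain U where U: "B U" "!!V. B V==>gap n U<=gap n V" using ex_has_least_nat[of B U0 "gap n"] by blast
  let ?a = "Suc (gap n U)"
  have Uc: "U : ccells n p" "n - 1 : U" "gaps n U~={}" "?a : U" "g U~=\<zero>" using U(1) by (auto simp: B_def rcrit_def)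
  have Un: "U<={1..<n}" using Uc(1) by (simp add: ccells_def)
  have al: "?a < n - 1" by (rule gap_less[OF Uc(3,2)])
  define L where "L = U - {?a}"
  have gU: "odd (n + gap n U)" using gap_in[OF Uc(3)] by (simp add: gaps_def)
  have gL: "gaps n L = gaps n U" unfolding L_def by (rule gap_insert(2)[OF Uc(3)]) (use gU in simp)
  hence bL: "gap n L = gap n U" by (simp add: gap_def)
  have nL: "n - 1 : L" using Uc(2) al by (simp add: L_def)
  have aL: "?a ~: L" by (simp add: L_def)
  have "Poly_Mapping.lookup (cbdry n K) L = 0" if K: "K : rcrit n p" "g K~=\<zero>" "K~=U" for K
  proof (rule ccontr)
   assume ne: "Poly_Mapping.lookup (cbdry n K) L~=0"
   have Kc: "K : ccells n p" using K(1) sub by blast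
   have "L : keys (cbdry n K)" using ne by (simp add: in_keys_iff)
   then obtain j where j: "j : K" "L = K - {j}" using cbdry_keys[OF Kc] by blast
   have nK: "n - 1 : K" using nL j by auto
   have "gaps n K~={}" using gaps_empty_bdry(2)[OF Kc _ n] ne by auto
   hence BK: "B K" using K nK by (simp add: B_def)
   have up: "Suc (gap n K) : K" using K(1) nK `gaps n K~={}` by (auto simp: rcrit_def)
   have Kn: "K<={1..<n}" using Kc by (simp add: ccells_def)
   show False
   proof (cases "j = Suc (gap n K)")
    case True
    have gK: "odd (n + gap n K)" using gap_in[OF `gaps n K~={}`] by (simp add: gaps_def)
    have "gaps n L = gaps n K" unfolding j(2) by (rule gap_insert(2)[OF `gaps n K~={}`]) (use gK True in simp)
    hence "gap n K = gap n U" using bL by (simp add: gap_def)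
    hence "K = insert ?a L" "U = insert ?a L" using j True Uc(4) by (auto simp: L_def)
    thus False using K(3) by simp
   next
    case False
    from gap_face(2)[OF `gaps n K~={}` up j(1) False Kn] have "gap n K < gap n U"
     using aL bL by (auto simp: j(2)[symmetric])
    thus False using U(2)[OF BK] by simp
   qed
  qed
  hence "klift (cbdry n) g L = [Poly_Mapping.lookup (cbdry n U) L] \<cdot> g U" by (rule klift_only[OF g])
  moreover have "Poly_Mapping.lookup (cbdry n U) L = psgn ?a U"
  proof -
   have ne: "U - {j}~=L" if "j : U - {?a}" for j using that by (auto simp: L_def)
   have "Poly_Mapping.lookup (cbdry n U) L = (\<Sum>j\<in>U. face_coeff n U j * (if U - {j} = L then 1 else 0))"
    unfolding cbdry_def by (simp add: lookup_sum eq_commute[of L])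
   also have "... = face_coeff n U ?a * (if U - {?a} = L then 1 else 0) + (\<Sum>j\<in>U - {?a}. face_coeff n U j * (if U - {j} = L then 1 else 0))"
    by (rule sum.remove[OF fin_gens[OF Un] Uc(4)])
   also have "... = face_coeff n U ?a" using ne by (simp add: L_def[symmetric])
   finally show ?thesis using gap_face_coeff[OF Uc(3,4) Un] by simp
  qed
  ultimately have "[psgn ?a U] \<cdot> g U = \<zero>" using rg[OF nL] by simp
  thus False using unit_multiple_zero[OF fsD(1)[OF g]] Uc(5) by blast
 qed
 thus thesis using that[OF w _ fe] by blast
qed

lemma ccells_pred: "n >= 1 ==> ccells (n - 1) p = {J : ccells n p. n - 1 ~: J}"
proof -
 assume "n >= 1"
 hence "J<={1..<n - 1} <-> J<={1..<n} & n - 1 ~: J" for J :: "nat set"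
  by (auto simp: subset_iff) (metis One_nat_def Suc_diff_Suc diff_zero less_Suc_eq not_less_eq less_eq_Suc_le)
 thus ?thesis by (auto simp: ccells_def)
qed

lemma stb_inj:
 assumes w: "w : fsupp R (ccells n (Suc q))" and n: "n >= 2 * q + 1"
  and z: "klift (cbdry n) w : fsupp R (ccells (n - 1) q)"
 shows "EX v:fsupp R (ccells (n - 1) (Suc q)). klift (cbdry n) v = klift (cbdry n) w"
proof -
 have n1: "n >= 1" using n by simp
 have "klift (cbdry n) w K = \<zero>" if "n - 1 : K" for K
  by (rule fsD(4)[OF z]) (use that in \<open>unfold ccells_pred[OF n1],simp\<close>)
 note rz = this
 obtain u g where g: "u : fsupp R (ccells n (Suc (Suc q)))" "g : fsupp R {J : ccells n (Suc q). n - 1 ~: J | gaps n J = {}}"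
  "w = (%x. klift (cbdry n) u x \<oplus> g x)" using rel_cycle_reduce[OF w] n rz by auto
 define v where "v = (%J. if n - 1 ~: J then g J else \<zero>)"
 have "v : fsupp R {J : {J : ccells n (Suc q). n - 1 ~: J | gaps n J = {}}. n - 1 ~: J}" unfolding v_def by (rule fs_rstr[OF g(2)])
 hence v: "v : fsupp R (ccells (n - 1) (Suc q))" unfolding ccells_pred[OF n1] by (rule fs_mono) auto
 have vc: "v : fsupp R (ccells n (Suc q))" by (rule fs_mono[OF v]) (unfold ccells_pred[OF n1], auto)
 define r where "r = (%J. if n - 1 : J then g J else \<zero>)"
 have r: "r : fsupp R {J : {J : ccells n (Suc q). n - 1 ~: J | gaps n J = {}}. n - 1 : J}" unfolding r_def by (rule fs_rstr[OF g(2)])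
 have rc: "r : fsupp R (ccells n (Suc q))" by (rule fs_mono[OF r]) auto
 have r0: "klift (cbdry n) r = (%x. \<zero>)"
 proof -
  have "klift (cbdry n) r = klift (%c. 0 :: nat set \<Rightarrow>\<^sub>0 int) r"
   by (rule klift_cong[OF r]) (use n in \<open>auto intro: gaps_empty_bdry(2)[of _ n "Suc q"]\<close>)
  thus ?thesis by (simp add: klift_zero_map)
 qed
 have gv: "g = (%J. v J \<oplus> r J)" using fsD(1)[OF g(2)] by (simp add: v_def r_def feq)
 have gc: "g : fsupp R (ccells n (Suc q))" by (rule fs_mono[OF g(2)]) auto
 have bv: "klift (cbdry n) v : fsupp R (ccells n q)" by (rule kcbdry_cl[OF vc])
 have bu: "klift (cbdry n) u : fsupp R (ccells n (Suc q))" by (rule kcbdry_cl[OF g(1)])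
 have bg: "klift (cbdry n) g = klift (cbdry n) v" unfolding gv klift_add[OF vc rc] r0 by (simp add: fsD(1)[OF bv])
 show ?thesis by (simp add: v bexI g(3) klift_add[OF bu gc] kcbdry_twice[OF g(1)] bg fsD(1)[OF bv])
qed

text \<open>In degree \<open>q\<close> a cell without gaps would force \<open>n = 2 * q\<close>,
  which is excluded; so the reduced cycle lies in the smaller complex.\<close>

lemma stb_surj:
 assumes f: "f : fsupp R (ccells n q)" and n: "n >= 2 * q + 1" and z: "klift (cbdry n) f = (%x. \<zero>)"
 shows "EX u:fsupp R (ccells n (Suc q)). EX g:fsupp R (ccells (n - 1) q). f = (%x. klift (cbdry n) u x \<oplus> g x)
  & klift (cbdry n) g = (%x. \<zero>)"
proof -
 have n1: "n >= 1" using n by simp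
 obtain u g where g: "u : fsupp R (ccells n (Suc q))" "g : fsupp R {J : ccells n q. n - 1 ~: J | gaps n J = {}}"
  "f = (%x. klift (cbdry n) u x \<oplus> g x)" using rel_cycle_reduce[OF f] n z by auto
 have "gaps n J~={}" if "J : ccells n q" for J using gaps_empty_bdry(1)[OF that] n by auto
 hence gp: "g : fsupp R (ccells (n - 1) q)" unfolding ccells_pred[OF n1] by (intro fs_mono[OF g(2)]) auto
 have gc: "g : fsupp R (ccells n q)" by (rule fs_mono[OF g(2)]) auto
 have bu: "klift (cbdry n) u : fsupp R (ccells n q)" by (rule kcbdry_cl[OF g(1)])
 have "klift (cbdry n) f = klift (cbdry n) g"
   by (simp add: g(3) klift_add[OF bu gc] kcbdry_twice[OF g(1)] fsD(1)[OF klift_cl[OF gc subset_UNIV]])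
 thus ?thesis using g(1,3) gp z by auto
qed

end

section \<open>The rook algebra\<close>

definition r_nds where
 "r_nds X = (\<Union>x\<in>X. rend x ` fst x)"

lemma r_nds_icls:
 assumes "(A,p) : BS n"
 shows "r_nds (iclass n (A,p)) = rend (A,p) ` A"
proof -
 let ?K = "iclass n (A,p)"
 have *: "rend y ` fst y = rend (A,p) ` A" if y: "y : ?K" for y
 proof -
  obtain B q where Bq: "y = (B,q)" by (cases y)
  show ?thesis using Bq isotopy_iff y icls_mem r_end_isotopic by auto
 qed
 have "(\<Union>y\<in>?K. rend y ` fst y) = (\<Union>y\<in>?K. rend (A,p) ` A)" by (rule SUP_cong[OF HOL.refl *])
 moreover have "?K~={}" using icls_self[OF assms] by (metis empty_iff)
 ultimately show ?thesis unfolding r_nds_def by (simp only: UN_constant if_False)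
qed

definition del_strand :: "nat=>nat=>strands" where
 "del_strand n i = ({1..n} - {i},%t. restrict of_nat ({1..n} - {i}))"

definition deleted where
 "deleted n i = iclass n (del_strand n i)"

lemma const_str:
 assumes "A<={1..n}"
 shows "(A,%t. restrict of_nat A) : BS n" "a : A==>rend (A,%t. restrict of_nat A) a = a"
proof -
 have "restrict of_nat A : conf n A" by (rule conf_memberI) (use assms in \<open>auto simp: complex_eq_iff\<close>)
 thus "(A,%t. restrict of_nat A) : BS n"
  using assms by (auto simp: braided_strands_def path_def path_image_def pathstart_def pathfinish_def)
 show "rend (A,%t. restrict of_nat A) a = a" if "a : A" by (rule r_end_eqI) (simp add: pathfinish_def that)
qed

lemma del_dia: "deleted n i : diagrams n" unfolding deleted_def del_strand_def by (rule icls_dias[OF const_str(1)]) auto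

text \<open>The strands of \<open>X\<close> are merely prolonged by constant ones. The node
  \<open>i\<close> is free on both sides and no other node is, which accounts for exactly one factor
  \<open>\<epsilon>\<close>.\<close>

lemma del_absorb:
 assumes X: "X : diagrams n" and i: "i : {1..n}" "i ~: r_nds X"
 shows "dcomp n X (deleted n i) = X" "loose_nodes n X (deleted n i) = 1"
proof -
 obtain A p where x: "(A,p) : BS n" "X = iclass n (A,p)" using X by (rule dias_cases)
 let ?B = "{1..n} - {i}" and ?q = "%t::real. restrict of_nat ({1..n} - {i}) :: nat => complex"
 have y: "(?B,?q) : BS n" by (rule const_str(1)) auto
 have R: "rend (A,p) ` A<=?B" using right_end(2)[OF x(1)] i(2) r_nds_icls[OF x(1)] x(2) by auto
 have C: "csupp (A,p) (?B,?q) = A" using R by (auto simp: csupp_def)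
 have P: "path p" "pimg p <= conf n A" using BSD[OF x(1)] by blast+
 have fin: "pfin p : conf n A" by (rule pathfinish_conf[OF x(1)])
 have q: "relabel A (rend (A,p)) o ?q = (%t. pfin p)"
 proof (intro ext)
  fix t a show "(relabel A (rend (A,p)) o ?q) t a = pfin p a"
  proof (cases "a : A")
   case True
   hence "rend (A,p) a : ?B" using R by blast
   thus ?thesis using right_end(1)[OF x(1) True] True by (simp add: relabel_def)
  next
   case False
   thus ?thesis using conf_undefined[OF fin] by (simp add: relabel_def)
  qed
 qed
 have p: "hpaths (conf n A) (relabel A (%a. a) o p) p"
 proof (rule homotopic_paths_eq)
  show "path (relabel A (%a. a) o p)" "pimg (relabel A (%a. a) o p) <= conf n A"
   using path_rel[OF P, of "%a. a" A] by auto
  show "(relabel A (%a. a) o p) t = p t" if "t : {0..1}" for t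
  using P(2) that rel_self by (fastforce simp: path_image_def)
 qed
 have "hpaths (conf n A) ((relabel A (%a. a) o p) +++ (%t. pfin p)) (p +++ (%t. pfin p))"
 using homotopic_paths_join[OF p] fin homotopic_paths_imp_pathfinish[OF p] by (auto simp: path_def pathstart_def)
 also have "hpaths (conf n A) (p +++ (%t. pfin p)) p" by (rule htpc_rid[OF P])
 finally have h: "hpaths (conf n A) ((relabel A (%a. a) o p) +++ (%t. pfin p)) p" .
 have "(strands_comp (A,p) (?B,?q),(A,p)) : isotopy n"
   using str_comp_cl(1)[OF x(1) y] x(1) h isotopy_iff str_comp_eq C q by auto
 thus "dcomp n X (deleted n i) = X"
  unfolding x(2) deleted_def del_strand_def dia_comp_icls[OF x(1) y] by (rule icls_eqI)
 have "{1..n} - rend (A,p) ` A - ?B = {i}" using i R by auto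
 thus "loose_nodes n X (deleted n i) = 1" unfolding x(2) deleted_def del_strand_def lse_nds_icls[OF x(1) y] by simp
qed

text \<open>Free right nodes remain free, which allows \<open>eta_partial\<close> to treat the nodes
  one after the other.\<close>

lemma r_nds_del:
 assumes X: "X : diagrams n"
 shows "r_nds (dcomp n X (deleted n i))<=r_nds X"
proof -
 obtain A p where x: "(A,p) : BS n" "X = iclass n (A,p)" using X by (rule dias_cases)
 let ?B = "{1..n} - {i}" and ?q = "%t::real. restrict of_nat ({1..n} - {i}) :: nat => complex"
 have y: "(?B,?q) : BS n" by (rule const_str(1)) auto
 obtain C r where Cr: "strands_comp (A,p) (?B,?q) = (C,r)" "C = csupp (A,p) (?B,?q)" by (simp add: str_comp_eq)
 have CA: "C<=A" "rend (A,p) ` C<=?B" by (auto simp: Cr(2) csupp_def)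
 have "rend (C,r) a = rend (A,p) a" if "a : C" for a
 proof -
  have "rend (?B,?q) (rend (A,p) a) = rend (A,p) a" using const_str(2) CA that by blast
  moreover have "rend (C,r) a = rend (?B,?q) (rend (A,p) a)"
   using str_comp_cl(2)[OF x(1) y that[unfolded Cr(2)]] unfolding Cr(1) .
  ultimately show ?thesis by (simp only:)
 qed
 hence "rend (C,r) ` C<=rend (A,p) ` A" using CA by auto
 moreover have "(C,r) : BS n" using str_comp_cl(1)[OF x(1) y] unfolding Cr(1) .
 ultimately show ?thesis
  unfolding x(2) deleted_def del_strand_def dia_comp_icls[OF x(1) y] Cr(1) by (simp add: r_nds_icls x(1))
qed

lemma del_not_full:
 assumes "i : {1..n}"
 shows "~ nomiss n (deleted n i)" unfolding deleted_def del_strand_def nomiss_icls[OF const_str(1)[OF Diff_subset]]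
 using assms by (metis Diff_iff insertI1)

lemma not_full_r_node:
 assumes X: "X : diagrams n" "~ nomiss n X"
 obtains i where "i : {1..n}" "i ~: r_nds X"
proof -
 obtain A p where x: "(A,p) : BS n" "X = iclass n (A,p)" using X(1) by (rule dias_cases)
 have A: "A<={1..n}" "A~={1..n}" using BSD(1)[OF x(1)] X(2) nomiss_icls[OF x(1)] x(2) by auto
 hence "card A < n" using psubset_card_mono[of "{1..n}" A] by auto
 hence "card (r_nds X) < card {1..n}" unfolding x(2) r_nds_icls[OF x(1)] card_image[OF r_end_inj[OF x(1)]] by simp
 moreover have "r_nds X<={1..n}" unfolding x(2) r_nds_icls[OF x(1)] using right_end(2)[OF x(1)] by auto
 ultimately have "r_nds X~={1..n}" by auto
 thus thesis using `r_nds X<={1..n}` that by blast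
qed

section \<open>The inclusion of diagrams\<close>

definition inc_str :: "nat=>strands=>strands" where
 "inc_str n x = (insert n (fst x),%t. (snd x t)(n := of_nat n))"

lemma inc_str_pair: "inc_str n (A,p) = (insert n A,%t. (p t)(n := of_nat n))" by (simp add: inc_str_def)

lemma continuous_inc: "cont_on S (%z :: nat => complex. z(n := of_nat n))"
proof (rule continuous_on_coordinatewise_then_product)
 fix a show "cont_on S (%z. (z(n := of_nat n)) a)"
  by (cases "a = n") (simp_all add: continuous_on_product_coordinates[THEN continuous_on_subset])
qed

lemma inc_conf:
 assumes n: "n >= 1" and z: "z : conf (n - 1) A" and A: "A<={1..n - 1}"
 shows "z(n := of_nat n) : conf n (insert n A)"
proof (rule conf_memberI)
 have nA: "n ~: A" using A n by auto
 fix a assume "a : insert n A"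
 thus "1/2 < Re ((z(n := of_nat n)) a) & Re ((z(n := of_nat n)) a) < real n + 1/2"
  using conf_strip[OF z, of a] n nA by (cases "a = n") auto
next
 fix a assume "a ~: insert n A"
 thus "(z(n := of_nat n)) a = undefined" using conf_undefined[OF z, of a] by simp
next
 fix a b assume ab: "a : insert n A" "b : insert n A" "a < b"
 have an: "a : A" "a~=n" using ab A by auto
 show "(z(n := of_nat n)) b - (z(n := of_nat n)) a~=0"
 using conf_strip[OF z an(1)] an complex_eq_iff conf_distinct[OF z an(1), of b] ab by auto
qed

lemma inc_str:
 assumes n: "n >= 1" and x: "(A,p) : BS (n - 1)"
 shows "inc_str n (A,p) : BS n"
  "rend (inc_str n (A,p)) n = n"
  "a : A==>rend (inc_str n (A,p)) a = rend (A,p) a"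
proof -
 note X = BSD[OF x]
 let ?q = "%t. (p t)(n := of_nat n)"
 have nA: "n ~: A" using X(1) n by auto
 have q: "path ?q" using path_continuous_image[OF X(2) continuous_inc[of "pimg p" n]] by (simp add: o_def)
 have im: "pimg ?q <= conf n (insert n A)" using inc_conf n X(1) X(3) by (auto simp: path_image_def)
 have st: "pst ?q = restrict of_nat (insert n A)" using X(4) by (auto simp: pathstart_def feq restrict_def)
 have fi: "pfin ?q a : of_nat ` {1..n}" if "a : insert n A" for a using n X(5) that by (fastforce simp: pathfinish_def)
 show "inc_str n (A,p) : BS n" using inc_str_pair q im st fi n X(1) by (fastforce simp: braided_strands_def)
 show "rend (inc_str n (A,p)) n = n" unfolding inc_str_pair by (rule r_end_eqI) (simp add: pathfinish_def)
 show "rend (inc_str n (A,p)) a = rend (A,p) a" if "a : A" unfolding inc_str_pair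
  by (rule r_end_eqI) (use right_end(1)[OF x that] nA that in \<open>auto simp: pathfinish_def\<close>)
qed

lemma inc_isotopic:
 assumes n: "n >= 1" and h: "((A,p),(B,q)) : isotopy (n - 1)"
 shows "(inc_str n (A,p),inc_str n (B,q)) : isotopy n"
proof -
 have e: "B = A" "(A,p) : BS (n - 1)" "(A,q) : BS (n - 1)" "hpaths (conf (n - 1) A) p q"
  using h by (auto simp: isotopy_iff)
 show ?thesis
   using inc_str(1) n e(2) e(3) e(1) inc_str_pair isotopy_iff homotopic_paths_continuous_image[OF e(4) continuous_inc] inc_conf BSD(1) by (auto simp: o_def)
qed

lemma dia_inc_icls:
 assumes n: "n >= 1" and x: "(A,p) : BS (n - 1)"
 shows "diagram_incl n (iclass (n - 1) (A,p)) = iclass n (inc_str n (A,p))"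
proof -
 have *: "isotopy n `` {(insert n B,%t. (q t)(n := of_nat n))} = iclass n (inc_str n (A,p))"
  if "(B,q) : iclass (n - 1) (A,p)" for B q
  using icls_eqI[OF inc_isotopic[OF n that[unfolded icls_mem]]] by (simp add: iclass_def inc_str_pair)
 thus ?thesis unfolding diagram_incl_def using icls_self[OF x] by blast
qed

lemma dia_inc_cl:
 assumes n: "n >= 1" and X: "X : diagrams (n - 1)"
 shows "diagram_incl n X : diagrams n" "nomiss n (diagram_incl n X) <-> nomiss (n - 1) X"
proof -
 obtain A p where x: "(A,p) : BS (n - 1)" "X = iclass (n - 1) (A,p)" using X by (rule dias_cases)
 note i = inc_str(1)[OF n x(1)]
 show "diagram_incl n X : diagrams n" unfolding x(2) dia_inc_icls[OF n x(1)] by (rule icls_dias[OF i])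
 have "insert n A = {1..n} <-> A = {1..n - 1}"
 proof -
  have e: "{1..n} = insert n {1..n - 1}" and nA: "n ~: A" "n ~: {1..n - 1}" using n BSD(1)[OF x(1)] by auto
  show ?thesis unfolding e using nA by (rule insert_ident)
 qed
 thus "nomiss n (diagram_incl n X) <-> nomiss (n - 1) X" unfolding x(2) dia_inc_icls[OF n x(1)]
  using nomiss_icls[OF x(1)] nomiss_icls[OF i[unfolded inc_str_pair]] by (simp add: inc_str_pair)
qed

lemma dia_inc_comp:
 assumes n: "n >= 1" and X: "X : diagrams (n - 1)" and Y: "Y : diagrams (n - 1)"
 shows "dcomp n (diagram_incl n X) (diagram_incl n Y) = diagram_incl n (dcomp (n - 1) X Y)"
  "loose_nodes n (diagram_incl n X) (diagram_incl n Y) = loose_nodes (n - 1) X Y"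
proof -
 obtain A p where x: "(A,p) : BS (n - 1)" "X = iclass (n - 1) (A,p)" using X by (rule dias_cases)
 obtain B q where y: "(B,q) : BS (n - 1)" "Y = iclass (n - 1) (B,q)" using Y by (rule dias_cases)
 note ix = inc_str[OF n x(1)] and iy = inc_str[OF n y(1)]
 have rn: "rend (A,p) a~=n" if "a : A" for a using right_end(2) x(1) that by fastforce
 define C where "C = csupp (A,p) (B,q)"
 have CA: "C<=A" by (auto simp: C_def csupp_def)
 let ?x = "inc_str n (A,p)" and ?y = "inc_str n (B,q)"
 have C': "csupp ?x ?y = insert n C" using ix(2) ix(3) rn by (auto simp: csupp_def inc_str_def C_def)
 have sc: "strands_comp ?x ?y = inc_str n (strands_comp (A,p) (B,q))"
 proof -
  have "(relabel (insert n C) (%a. a) o (%t. (p t)(n := of_nat n))) t = ((relabel C (%a. a) o p) t)(n := of_nat n)" for t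
   by (auto simp: relabel_def feq restrict_def)
  moreover have "(relabel (insert n C) (rend ?x) o (%t. (q t)(n := of_nat n))) t = ((relabel C (rend (A,p)) o q) t)(n := of_nat n)" for t
  using ix(2) ix(3) rn CA by (fastforce simp: relabel_def)
  ultimately have "(relabel (insert n C) (%a. a) o (%t. (p t)(n := of_nat n))) +++ (relabel (insert n C) (rend ?x) o (%t. (q t)(n := of_nat n)))
   = (%t. (((relabel C (%a. a) o p) +++ (relabel C (rend (A,p)) o q)) t)(n := of_nat n))"
   by (simp add: joinpaths_def feq del: o_apply)
  thus ?thesis using C' unfolding inc_str_pair str_comp_eq C_def[symmetric] by (simp add: inc_str_pair)
 qed
 have scc: "strands_comp (A,p) (B,q) : BS (n - 1)" by (rule str_comp_cl(1)[OF x(1) y(1)])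
 obtain D s where Ds: "strands_comp (A,p) (B,q) = (D,s)" by (cases "strands_comp (A,p) (B,q)")
 show "dcomp n (diagram_incl n X) (diagram_incl n Y) = diagram_incl n (dcomp (n - 1) X Y)"
  unfolding x(2) y(2) dia_inc_icls[OF n x(1)] dia_inc_icls[OF n y(1)] dia_comp_icls[OF x(1) y(1)] Ds
   dia_inc_icls[OF n scc[unfolded Ds]]
  using dia_comp_icls[OF ix(1)[unfolded inc_str_pair] iy(1)[unfolded inc_str_pair]] sc by (simp only: inc_str_pair Ds)
 have "{1..n} - rend ?x ` insert n A - insert n B = {1..n - 1} - rend (A,p) ` A - B" using ix(2,3) by auto
 thus "loose_nodes n (diagram_incl n X) (diagram_incl n Y) = loose_nodes (n - 1) X Y"
  unfolding x(2) y(2) dia_inc_icls[OF n x(1)] dia_inc_icls[OF n y(1)] lse_nds_icls[OF x(1) y(1)]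
  using lse_nds_icls[OF ix(1)[unfolded inc_str_pair] iy(1)[unfolded inc_str_pair]] by (simp add: inc_str_pair)
qed

lemma dia_inc_full: "[|n >= 1; X : fdias (n - 1)|]==>diagram_incl n X : fdias n" by (simp add: fdias_def dia_inc_cl)

text \<open>The two paths differ only in the last strand, which rests in one of them and is raised
  in the other. In both its real part is \<open>n\<close>, to the right of all other
  strands.\<close>

lemma dia_inc_sbraid:
 assumes n: "n >= 1" and w: "w permutes {1..n - 1}"
 shows "diagram_incl n (sbraid (n - 1) w) = sbraid n w"
proof -
 let ?p = "cpath (n - 1) w" and ?q = "cpath n w"
 have wn: "w permutes {1..n}" by (rule permutes_subset[OF w]) auto
 have x: "({1..n - 1},?p) : BS (n - 1)" using cpath_br(1)[OF w] by (simp add: braids_def)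
 have y: "({1..n},?q) : BS n" using cpath_br(1)[OF wn] by (simp add: braids_def)
 let ?r = "%t. (?p t)(n := of_nat n)"
 have ins: "insert n {1..n - 1} = {1..n}" using n by auto
 have i: "({1..n},?r) : BS n" using inc_str(1)[OF n x] unfolding inc_str_pair ins .
 have fn: "pinv w n = n" using permutes_not_in[OF permutes_inv[OF w], of n] n by auto
 have same: "?r t a = ?q t a" if "a : {1..n - 1}" for t a using that by (auto simp: cpath_def)
 have "hpaths (conf n {1..n}) ?r ?q"
 proof (rule htpc_conf_lin)
  show "path ?r" "pimg ?r <= conf n {1..n}" using BSD(2,3)[OF i] .
  show "path ?q" "pimg ?q <= conf n {1..n}" using BSD(2,3)[OF y] .
  show "pst ?r = pst ?q" using BSD(4)[OF i] BSD(4)[OF y] by simp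
  have "?r 1 a = ?q 1 a" for a
  proof -
   consider "a : {1..n - 1}" | "a = n" | "a ~: {1..n}" using ins by blast
   thus ?thesis
   proof cases
    case 2
    thus ?thesis using fn n by (simp add: cpath_finish)
   qed (use same n in \<open>auto simp: cpath_def\<close>)
  qed
  thus "pfin ?r = pfin ?q" by (auto simp: pathfinish_def)
 next
  fix t a b assume t: "t : {0..1::real}" and ab: "a : {1..n}" "b : {1..n}" "a~=b"
  have *: "same_side (?r t n - ?r t c) (?q t n - ?q t c)" if c: "c : {1..n - 1}" for c
  proof -
   have cn: "c~=n" using c n by auto
   have "Re (?p t c) < real (n - 1) + 1/2" using conf_strip[OF cpath_conf[OF w t] c] by simp
   moreover have "?q t c = ?r t c" "?r t c = ?p t c" using same[OF c, of t] cn by simp_all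
   moreover have "Re (?q t n) = real n" using n fn by (simp add: cpath_Re algebra_simps)
   ultimately show ?thesis using n by (auto simp: same_side_def of_nat_diff)
  qed
  have "a : insert n {1..n - 1}" "b : insert n {1..n - 1}" unfolding ins using ab by simp_all
  then consider "a : {1..n - 1}" "b : {1..n - 1}" | "a = n" "b : {1..n - 1}" | "b = n" "a : {1..n - 1}"
   using ab(3) by blast
  thus "same_side (?r t b - ?r t a) (?q t b - ?q t a) | same_side (?r t a - ?r t b) (?q t a - ?q t b)"
  proof cases
   case 1
   thus ?thesis using same by (simp add: same_side_def)
  qed (use * in blast)+
 qed
 hence "(({1..n},?r),({1..n},?q)) : isotopy n" using i y by (simp add: isotopy_iff)
 hence "iclass n (inc_str n ({1..n - 1},?p)) = iclass n ({1..n},?q)" unfolding inc_str_pair ins by (rule icls_eqI)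
 thus ?thesis unfolding sbraid_def wbr_sg[OF w] wbr_sg[OF wn] bclass_def dia_inc_icls[OF n x] .
qed

context ring
begin

definition scal where
 "scal c f = (%x. c \<otimes> f x)"

lemma scal_sg: "c : car R==>scal c (single R b d) = single R b (c \<otimes> d)"
 by (auto simp: scal_def single_def feq)

lemma scal_cl:
 assumes "c : car R" "f : fsupp R S"
 shows "scal c f : fsupp R S"
proof -
 have *: "f i~=\<zero>" if "c \<otimes> f i~=\<zero>" for i using that assms(1) by auto
 show ?thesis unfolding scal_def
  by (rule fsI[of _ "{i. f i~=\<zero>}"]) (simp_all add: fsD(1,2)[OF assms(2)] fsD(3)[OF assms(2) *] * assms(1))
qed

lemma scal_amap: "c : car R==>addmap (FM R S) (FM R S) (scal c)"
 by (rule amapI) (simp_all add: scal_cl, simp add: scal_def r_distr fsD(1)[of _ S])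

lemma scal_cvec: "[|c : car R; d : car R|]==>scal c (cvec d t) = cvec (c \<otimes> d) t"
 by (simp add: scal_def cvec_def add_pow_rdistr_int)

lemma klift_scal:
 assumes c: "c : car R" and f: "f : fsupp R S"
 shows "klift T (scal c f) = scal c (klift T f)"
proof (rule amap_eqI[where F = "%f. klift T (scal c f)" and G = "%f. scal c (klift T f)", OF fag _ _ _ f])
 have k: "addmap (FM R S) (FM R UNIV) (klift T)" by (rule klift_amap) simp
 show "addmap (FM R S) (FM R UNIV) (%f. klift T (scal c f))" by (rule amap_comp[OF scal_amap[OF c] k])
 show "addmap (FM R S) (FM R UNIV) (%f. scal c (klift T f))" by (rule amap_comp[OF k scal_amap[OF c]])
 show "klift T (scal c (single R b d)) = scal c (klift T (single R b d))" if "b : S" "d : car R" for b d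
  using that c by (simp add: scal_sg klift_sg scal_cvec)
qed

lemma sg_zero: "single R b \<zero> = (%x. \<zero>)" by (auto simp: single_def)

lemma sg_add: "[|c : car R; d : car R|]==>(%x. single R b c x \<oplus> single R b d x) = single R b (c \<oplus> d)"
 by (auto simp: single_def feq)

lemma klift_frag_of: "c : car R==>klift (%b. frg (h b)) (single R b c) = single R (h b) c"
 by (simp add: klift_sg cvec_of)

end

section \<open>The rook algebra and its action on the Salvetti complex\<close>

locale rook = cring k for k :: "('k,'m) ring_scheme" (structure) and \<epsilon> :: 'k +
 assumes eps: "\<epsilon> : Units k"
begin

abbreviation BR :: "nat=>(strands set=>'k) ring" where
 "BR n == braided_rook_algebra k \<epsilon> n"

abbreviation triv :: "nat=>(strands set=>'k,'k) module" where
 "triv n == trivial_module k n"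

abbreviation FD :: "nat=>('k,strands set=>'k) module" where
 "FD n == FM k (diagrams n)"

abbreviation FC :: "nat=>nat=>('k,cell=>'k) module" where
 "FC n i == FM k (cells n i)"

lemma BR_simps [simp]:
 "car (BR n) = fsupp k (diagrams n)" "zero (BR n) = (%D. \<zero>)" "add (BR n) = (%f g D. f D \<oplus> g D)"
 by (simp_all add: braided_rook_algebra_def)

lemma BR_one: "one (BR n) = single k (idd n) \<one>" by (simp add: braided_rook_algebra_def single_def)

lemma triv_simps [simp]: "car (triv n) = car k" "zero (triv n) = \<zero>" "add (triv n) = (\<oplus>)"
 by (simp_all add: trivial_module_def)

lemma triv_grp: "abelian_group (triv n)"
 by (rule abelian_groupI) (auto simp: a_ac intro: l_neg bexI[of _ "\<ominus> x" for x])

lemma BR_mult_sg: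
 assumes X: "X : diagrams n" "Y : diagrams n" and c: "c : car k" "d : car k"
 shows "single k X c \<otimes>[BR n] single k Y d = single k (dcomp n X Y) (\<epsilon> [^] loose_nodes n X Y \<otimes> (c \<otimes> d))"
proof
 fix D
 have ec: "\<epsilon> : car k" by (rule Units_closed[OF eps])
 let ?S = "{(X',Y'). single k X c X'~=\<zero> & single k Y d Y'~=\<zero> & dcomp n X' Y' = D}"
 have m: "(single k X c \<otimes>[BR n] single k Y d) D =
   finsum k (%(X',Y'). \<epsilon> [^] loose_nodes n X' Y' \<otimes> (single k X c X' \<otimes> single k Y d Y')) ?S"
  by (simp add: braided_rook_algebra_def)
 show "(single k X c \<otimes>[BR n] single k Y d) D = single k (dcomp n X Y) (\<epsilon> [^] loose_nodes n X Y \<otimes> (c \<otimes> d)) D"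
 proof (cases "c = \<zero> | d = \<zero>")
  case True
  hence "?S = {}" by (auto simp: single_def)
  hence "(single k X c \<otimes>[BR n] single k Y d) D = \<zero>" unfolding m by (simp only: finsum_empty)
  thus ?thesis using True c ec by (auto simp: single_def)
 next
  case False
  hence S: "?S = (if dcomp n X Y = D then {(X,Y)} else {})" by (auto simp: single_def split: if_splits)
  show ?thesis using m S c ec by (auto simp: single_def)
 qed
qed

lemma BR_mult_amap:
 assumes R: "ring (BR n)" and f: "f : fsupp k (diagrams n)"
 shows "addmap (FD n) (FD n) (%g. f \<otimes>[BR n] g)" "addmap (FD n) (FD n) (%g. g \<otimes>[BR n] f)"
proof -
 interpret B: ring "BR n" by fact
 show "addmap (FD n) (FD n) (%g. f \<otimes>[BR n] g)" "addmap (FD n) (FD n) (%g. g \<otimes>[BR n] f)"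
   using B.m_closed f B.r_distr B.l_distr by (auto simp: addmap_def)
qed

text \<open>The augmentation through which the algebra acts on the trivial module
  (\<open>triv_smult\<close>).\<close>

definition tau where
 "tau n f = klift (%X. if nomiss n X then frg () else 0) f ()"

lemma tau_add: "[|f : fsupp k S; g : fsupp k S|]==>tau n (%x. f x \<oplus> g x) = tau n f \<oplus> tau n g"
 by (simp add: tau_def klift_add[of _ S])

lemma tau_cl: "f : fsupp k S==>tau n f : car k" unfolding tau_def by (rule fsD(1)[OF klift_cl[OF _ subset_UNIV]])

lemma tau_sg: "c : car k==>tau n (single k X c) = (if nomiss n X then c else \<zero>)"
 unfolding tau_def by (simp only: klift_sg) (auto simp: cvec_def)

lemma triv_smult: "f : fsupp k S==>f \<odot>[triv n] x = tau n f \<otimes> x"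
proof -
 assume f: "f : fsupp k S"
 have "tau n f = (\<Oplus>X\<in>{X. f X~=\<zero> & nomiss n X}. f X)" unfolding tau_def klift_def
 proof (rule add.finprod_mono_neutral_cong_right)
  show "finite {X. f X~=\<zero>}" by (rule fsD(2)[OF f])
  show "cvec (f X) (if nomiss n X then frg () else 0) () = \<zero>" if "X : {X. f X~=\<zero>} - {X. f X~=\<zero> & nomiss n X}" for X
   using that by (auto simp: cvec_def)
  show "(%b. cvec (f b) (if nomiss n b then frg () else 0) ()) : {X. f X~=\<zero>} \<rightarrow> car k"
   using fsD(1)[OF f] by (simp add: cvec_in)
  show "cvec (f X) (if nomiss n X then frg () else 0) () = f X" if "X : {X. f X~=\<zero> & nomiss n X}" for X
   using that fsD(1)[OF f] by (simp add: cvec_def)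
 qed auto
 thus ?thesis by (simp add: trivial_module_def)
qed

text \<open>Complete diagrams act by left translation and all others as 0. Products are respected by
  \<open>nomiss_comp\<close>, and powers of \<open>\<epsilon>\<close> do not interfere by
  \<open>lse_nds_full\<close>.\<close>

definition act where
 "act n i a xi0 = alift k (FC n i) (%X c. if nomiss n X then scal c (klift (tran n X) xi0) else (%z. \<zero>)) a"

lemma scal_add_l: "[|c : car k; d : car k; f : fsupp k S|]==>scal (c \<oplus> d) f = (%x. scal c f x \<oplus> scal d f x)"
 by (simp add: scal_def l_distr fsD(1))

lemma tran_cl: "[|X : diagrams n; nomiss n X; xi0 : fsupp k (cells n i)|]==>klift (tran n X) xi0 : fsupp k (cells n i)"
 by (rule tran_klift(1)) (simp_all add: fdias_def)

lemma act_l: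
 assumes xi0: "xi0 : fsupp k (cells n i)"
 shows "addmap (FD n) (FC n i) (%a. act n i a xi0)"
  "[|X : diagrams n; c : car k|]==>act n i (single k X c) xi0 = (if nomiss n X then scal c (klift (tran n X) xi0) else (%z. \<zero>))"
proof -
 let ?T = "%X c. if nomiss n X then scal c (klift (tran n X) xi0) else (%z. \<zero>)"
 have T1: "?T X c : car (FC n i)" if "X : diagrams n" "c : car k" for X c
  using that by (auto simp: scal_cl tran_cl xi0 fs_zero)
 have T2: "?T X (c \<oplus> d) = ?T X c \<oplus>[FC n i] ?T X d" if "X : diagrams n" "c : car k" "d : car k" for X c d
  using that by (auto simp: scal_add_l[OF _ _ tran_cl[OF _ _ xi0]])
 show "addmap (FD n) (FC n i) (%a. act n i a xi0)" unfolding act_def by (rule alift(1)[OF ring_axioms fag T1 T2])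
 show "act n i (single k X c) xi0 = ?T X c" if "X : diagrams n" "c : car k"
  unfolding act_def by (rule alift(2)[of k "FC n i" "diagrams n" ?T X c, OF ring_axioms fag T1 T2 that])
qed

lemma act_r:
 assumes a: "a : fsupp k (diagrams n)"
 shows "addmap (FC n i) (FC n i) (act n i a)" using a
proof (induction rule: fs_ind)
 case zero
 have "act n i (%i. \<zero>) xi0 = (%z. \<zero>)" if "xi0 : fsupp k (cells n i)" for xi0
  using amap_zero[OF fag fag act_l(1)[OF that]] by simp
 thus ?case by (intro amapI) (simp_all add: fs_zero fs_add)
next
 case (add X c g)
 have s: "addmap (FC n i) (FC n i) (act n i (single k X c))"
 proof (cases "nomiss n X")
  case True
  have "addmap (FC n i) (FC n i) (%xi0. scal c (klift (tran n X) xi0))"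
   by (rule amap_comp[OF klift_amap scal_amap[OF add(2)]]) (rule tran_keys, simp add: fdias_def add(1) True)
  thus ?thesis using act_l(2)[OF _ add(1,2)] True by (simp add: addmap_def Pi_iff fs_add)
 next
  case False
  thus ?thesis using act_l(2)[OF _ add(1,2)] by (intro amapI) (simp_all add: fs_add fs_zero)
 qed
 have e: "act n i (%x. single k X c x \<oplus> g x) xi0 = (%z. act n i (single k X c) xi0 z \<oplus> act n i g xi0 z)" if "xi0 : fsupp k (cells n i)" for xi0
  using amapD(2)[OF act_l(1)[OF that], of "single k X c" g] add(3) fs_sg[OF add(1,2)] by simp
 have "addmap (FC n i) (FC n i) (%xi0. act n i (single k X c) xi0 \<oplus>[FC n i] act n i g xi0)"
  by (rule amap_add[OF fag s add(4)])
 thus ?case by (simp add: addmap_def Pi_iff e fs_add)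
qed

lemma act_sg_sg:
 assumes "X : diagrams n" "c : car k" "(Y,J) : cells n i" "d : car k"
 shows "act n i (single k X c) (single k (Y,J) d) = (if nomiss n X then single k (dcomp n X Y,J) (c \<otimes> d) else (%z. \<zero>))"
 using assms by (simp add: act_l(2) fs_sg klift_sg tran_def cvec_of scal_sg)

lemma act_cl: "[|a : fsupp k (diagrams n); xi0 : fsupp k (cells n i)|]==>act n i a xi0 : fsupp k (cells n i)"
 using amapD(1)[OF act_r, of a n xi0 i] by simp

text \<open>An identity that is additive both in the algebra element and in the chain is reduced to
  multiples of one diagram and of one cell.\<close>

lemma act_eqI:
 assumes N: "abelian_group N" and F: "addmap (FC n i) N F"
  and G1: "!!a. a : fsupp k (diagrams n)==>addmap (FC n i) N (G a)"
  and G2: "!!xi0. xi0 : fsupp k (cells n i)==>addmap (FD n) N (%a. G a xi0)"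
  and eq: "!!X c Y J d. [|X : diagrams n; c : car k; (Y,J) : cells n i; d : car k|] ==>
   F (act n i (single k X c) (single k (Y,J) d)) = G (single k X c) (single k (Y,J) d)"
  and a: "a : fsupp k (diagrams n)" and xi0: "xi0 : fsupp k (cells n i)"
 shows "F (act n i a xi0) = G a xi0"
proof (rule amap_eqI[where F = "%a. F (act n i a xi0)" and G = "%a. G a xi0", OF N amap_comp[OF act_l(1)[OF xi0] F] G2[OF xi0] _ a])
 fix X c assume X: "X : diagrams n" "c : car k"
 note s = fs_sg[OF X]
 show "F (act n i (single k X c) xi0) = G (single k X c) xi0"
 proof (rule amap_eqI[where F = "%xi0. F (act n i (single k X c) xi0)" and G = "G (single k X c)", OF N amap_comp[OF act_r[OF s] F] G1[OF s] _ xi0])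
  show "F (act n i (single k X c) (single k b d)) = G (single k X c) (single k b d)" if "b : cells n i" "d : car k" for b d
   using eq[OF X, of "fst b" "snd b" d] that by simp
 qed
qed

lemma act_mult:
 assumes R: "ring (BR n)" and a: "a : fsupp k (diagrams n)" and b: "b : fsupp k (diagrams n)" and xi0: "xi0 : fsupp k (cells n i)"
 shows "act n i (a \<otimes>[BR n] b) xi0 = act n i a (act n i b xi0)"
proof -
 have ec: "\<epsilon> : car k" by (rule Units_closed[OF eps])
 have 1: "act n i (single k X c) (act n i b xi0) = act n i (single k X c \<otimes>[BR n] b) xi0" if X: "X : diagrams n" and c: "c : car k" for X c
 proof (rule act_eqI[where F = "act n i (single k X c)" and G = "%b xi0. act n i (single k X c \<otimes>[BR n] b) xi0", OF fag _ _ _ _ b xi0])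
  note s = fs_sg[OF X c]
  show "addmap (FC n i) (FC n i) (act n i (single k X c))" by (rule act_r[OF s])
  show "addmap (FC n i) (FC n i) (act n i (single k X c \<otimes>[BR n] a))" if "a : fsupp k (diagrams n)" for a
   by (rule act_r) (use amapD(1)[OF BR_mult_amap(1)[OF R s], of a] that in simp)
  show "addmap (FD n) (FC n i) (%a. act n i (single k X c \<otimes>[BR n] a) xi0)" if "xi0 : fsupp k (cells n i)" for xi0
   by (rule amap_comp[OF BR_mult_amap(1)[OF R s] act_l(1)[OF that]])
  show "act n i (single k X c) (act n i (single k Y d) (single k (Z,J) e)) = act n i (single k X c \<otimes>[BR n] single k Y d) (single k (Z,J) e)"
   if Y: "Y : diagrams n" and d: "d : car k" and Z: "(Z,J) : cells n i" and e: "e : car k" for Y d Z J e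
  proof -
   note XY = dia_comp_cl[OF X Y]
   have cd: "c \<otimes> d : car k" using c d by simp
   have lc: "\<epsilon> [^] loose_nodes n X Y \<otimes> (c \<otimes> d) : car k" using c d ec by simp
   have z: "act n i (single k X c) (%z. \<zero>) = (%z. \<zero>)" using amap_zero[OF fag fag act_r[OF s]] by simp
   have Zf: "Z : fdias n" "J<={1..<n}" "card J = i" using Z by (auto simp: cells_def)
   show ?thesis
   proof (cases "nomiss n Y")
    case True
    hence Yf: "Y : fdias n" using Y by (simp add: fdias_def)
    have YZ: "(dcomp n Y Z,J) : cells n i" using Zf bgrp_cl[OF Yf Zf(1)] by (simp add: cells_def)
    have de: "d \<otimes> e : car k" using d e by simp
    have l: "loose_nodes n X Y = 0" using lse_nds_full[OF X Y] True by simp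
    show ?thesis
    proof (cases "nomiss n X")
     case X': True
     hence Xf: "X : fdias n" using X by (simp add: fdias_def)
     show ?thesis using True X' nomiss_comp[OF X Y] bgrp_assoc[OF Xf Yf Zf(1)] c d e
      by (simp add: BR_mult_sg[OF X Y c d] act_sg_sg[OF XY lc Z e] act_sg_sg[OF Y d Z e] act_sg_sg[OF XY cd Z e] act_sg_sg[OF X c YZ de] l m_assoc)
    next
     case X': False
     thus ?thesis using True nomiss_comp[OF X Y]
      by (simp add: BR_mult_sg[OF X Y c d] act_sg_sg[OF XY lc Z e] act_sg_sg[OF Y d Z e] act_sg_sg[OF X c YZ de])
    qed
   next
    case False
    thus ?thesis using nomiss_comp[OF X Y]
     by (simp add: BR_mult_sg[OF X Y c d] act_sg_sg[OF XY lc Z e] act_sg_sg[OF Y d Z e] z)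
   qed
  qed
 qed
 note bx = act_cl[OF b xi0]
 show ?thesis
 using amap_eqI fag 1[symmetric] a amap_comp[OF BR_mult_amap(2)[OF R b] act_l(1)[OF xi0]] act_l(1)[OF bx] by blast
qed

lemma act_one:
 assumes xi0: "xi0 : fsupp k (cells n i)"
 shows "act n i \<one>[BR n] xi0 = xi0"
proof -
 have id: "idd n : diagrams n" "nomiss n (idd n)" using bgrp_one[of n] by (simp_all add: fdias_def)
 have "klift (tran n (idd n)) xi0 = klift frg xi0"
  by (rule klift_cong[OF xi0]) (auto simp: cells_def tran_def bgrp_one_simps)
 hence "klift (tran n (idd n)) xi0 = xi0" by (simp add: klift_of[OF xi0])
 thus ?thesis using act_l(2)[OF xi0 id(1) one_closed] id(2) fsD(1)[OF xi0] by (simp add: BR_one scal_def)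
qed

definition Qmod :: "nat=>nat=>(strands set=>'k,cell=>'k) module" where
 "Qmod n i = \<lparr>carrier = fsupp k (cells n i),monoid.mult = undefined,one = undefined,
  zero = (%z. \<zero>),add = (%f g z. f z \<oplus> g z),smult = act n i\<rparr>"

lemma Qmod_simps [simp]: "car (Qmod n i) = fsupp k (cells n i)" "zero (Qmod n i) = (%z. \<zero>)"
 "add (Qmod n i) = (%f g z. f z \<oplus> g z)" "smult (Qmod n i) = act n i" by (simp_all add: Qmod_def)

lemma Qmod_grp: "abelian_group (Qmod n i)"
proof -
 interpret F: abelian_group "FC n i" by (rule fag)
 show ?thesis
 proof (rule abelian_groupI)
  fix x y z assume h: "x : car (Qmod n i)" "y : car (Qmod n i)" "z : car (Qmod n i)"
  thus "x \<oplus>[Qmod n i] y \<oplus>[Qmod n i] z = x \<oplus>[Qmod n i] (y \<oplus>[Qmod n i] z)"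
   using F.a_assoc[of x y z] by simp
 next
  fix x y assume h: "x : car (Qmod n i)" "y : car (Qmod n i)"
  thus "x \<oplus>[Qmod n i] y : car (Qmod n i)" "x \<oplus>[Qmod n i] y = y \<oplus>[Qmod n i] x"
   using F.a_closed[of x y] F.a_comm[of x y] by simp_all
 next
  fix x assume h: "x : car (Qmod n i)"
  thus "\<zero>[Qmod n i] \<oplus>[Qmod n i] x = x" using F.l_zero[of x] by simp
  show "EX y:car (Qmod n i). y \<oplus>[Qmod n i] x = \<zero>[Qmod n i]"
   using h F.l_neg[of x] F.a_inv_closed[of x] by (intro bexI[of _ "\<ominus>[FC n i] x"]) simp_all
 qed (simp add: fs_zero)
qed

lemma Qmod_amap: "addmap (Qmod n i) N f <-> addmap (FC n i) N f" "addmap M (Qmod n i) g <-> addmap M (FC n i) g"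
 by (simp_all add: addmap_def)

lemma Qmod_l_mod:
 assumes R: "ring (BR n)"
 shows "left_module (BR n) (Qmod n i)"
proof -
 have "left_module_axioms (BR n) (Qmod n i)"
 proof
  show "a \<odot>[Qmod n i] x : car (Qmod n i)" if "a : car (BR n)" "x : car (Qmod n i)" for a x
   using that by (simp add: act_cl)
  show "(a \<oplus>[BR n] b) \<odot>[Qmod n i] x = a \<odot>[Qmod n i] x \<oplus>[Qmod n i] b \<odot>[Qmod n i] x"
   if "a : car (BR n)" "b : car (BR n)" "x : car (Qmod n i)" for a b x
   using amapD(2)[OF act_l(1), of x n i a b] that by simp
  show "a \<odot>[Qmod n i] (x \<oplus>[Qmod n i] y) = a \<odot>[Qmod n i] x \<oplus>[Qmod n i] a \<odot>[Qmod n i] y"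
   if "a : car (BR n)" "x : car (Qmod n i)" "y : car (Qmod n i)" for a x y
   using amapD(2)[OF act_r, of a n x i y] that by simp
  show "(a \<otimes>[BR n] b) \<odot>[Qmod n i] x = a \<odot>[Qmod n i] (b \<odot>[Qmod n i] x)"
   if "a : car (BR n)" "b : car (BR n)" "x : car (Qmod n i)" for a b x using act_mult[OF R, of a b x i] that by simp
  show "\<one>[BR n] \<odot>[Qmod n i] x = x" if "x : car (Qmod n i)" for x using that by (simp add: act_one)
 qed
 thus ?thesis using R Qmod_grp by (simp add: left_module_def)
qed

lemma Qmod_bdry_lin:
 assumes R: "ring (BR n)"
 shows "linear_map (BR n) (Qmod n (Suc i)) (Qmod n i) (klift (bdry n))"
proof (rule lin_alongI)
 have b: "addmap (FC n (Suc i)) (FC n i) (klift (bdry n))" by (rule klift_amap[OF bdry_keys])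
 show "addmap (Qmod n (Suc i)) (Qmod n i) (klift (bdry n))" unfolding Qmod_amap by (rule b)
 fix a x assume "a : car (BR n)" "x : car (Qmod n (Suc i))"
 hence a: "a : fsupp k (diagrams n)" and x: "x : fsupp k (cells n (Suc i))" by simp_all
 have "klift (bdry n) (act n (Suc i) a x) = act n i a (klift (bdry n) x)"
 proof (rule amap_eqI[where F = "%a. klift (bdry n) (act n (Suc i) a x)" and G = "%a. act n i a (klift (bdry n) x)", OF fag _ _ _ a])
  note bx = kbdry_cl[OF x]
  show "addmap (FD n) (FC n i) (%a. klift (bdry n) (act n (Suc i) a x))" by (rule amap_comp[OF act_l(1)[OF x] b])
  show "addmap (FD n) (FC n i) (%a. act n i a (klift (bdry n) x))" by (rule act_l(1)[OF bx])
  show "klift (bdry n) (act n (Suc i) (single k X c) x) = act n i (single k X c) (klift (bdry n) x)" if X: "X : diagrams n" and c: "c : car k" for X c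
  proof (cases "nomiss n X")
   case True
   hence Xf: "X : fdias n" using X by (simp add: fdias_def)
   show ?thesis using True by (simp add: act_l(2)[OF x X c] act_l(2)[OF bx X c] klift_scal[OF c tran_klift(1)[OF Xf x]] tran_klift(2)[OF Xf x])
  next
   case False
   thus ?thesis by (simp add: act_l(2)[OF x X c] act_l(2)[OF bx X c] klift_zero)
  qed
 qed
 thus "klift (bdry n) (a \<odot>[Qmod n (Suc i)] x) = id a \<odot>[Qmod n i] klift (bdry n) x" by simp
qed

lemma Qmod_aug_lin:
 assumes R: "ring (BR n)"
 shows "linear_map (BR n) (Qmod n 0) (triv n) aug"
proof (rule lin_alongI)
 have b: "addmap (FC n 0) (triv n) aug" by (rule amapI) (simp_all add: aug_cl aug_add)
 show "addmap (Qmod n 0) (triv n) aug" unfolding Qmod_amap by (rule b)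
 fix a x assume "a : car (BR n)" "x : car (Qmod n 0)"
 hence a: "a : fsupp k (diagrams n)" and x: "x : fsupp k (cells n 0)" by simp_all
 have "aug (act n 0 a x) = tau n a \<otimes> aug x"
 proof (rule act_eqI[where F = aug and G = "%a x. tau n a \<otimes> aug x", OF triv_grp b _ _ _ a x])
  show "addmap (FC n 0) (triv n) (%x. tau n a \<otimes> aug x)" if "a : fsupp k (diagrams n)" for a
   by (rule amapI) (simp_all add: aug_cl aug_add tau_cl[OF that] r_distr)
  show "addmap (FD n) (triv n) (%a. tau n a \<otimes> aug x)" if "x : fsupp k (cells n 0)" for x
   by (rule amapI) (simp_all add: aug_cl[OF that] tau_cl tau_add[of _ "diagrams n"] l_distr)
  show "aug (act n 0 (single k X c) (single k (Y,J) d)) = tau n (single k X c) \<otimes> aug (single k (Y,J) d)"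
   if "X : diagrams n" "c : car k" "(Y,J) : cells n 0" "d : car k" for X c Y J d
   using that by (simp add: act_sg_sg aug_sg tau_sg) (simp add: aug_def klift_zero)
 qed
 thus "aug (a \<odot>[Qmod n 0] x) = id a \<odot>[triv n] aug x" by (simp add: triv_smult[OF a])
qed

lemma Qmod_res:
 assumes R: "ring (BR n)"
 shows "resolution (BR n) (triv n) (Qmod n) (%i. klift (bdry n)) aug" unfolding resolution_def
proof (intro conjI allI)
 show "aug ` car (Qmod n 0) = car (triv n)"
 proof
  show "aug ` car (Qmod n 0) <= car (triv n)" using aug_cl by auto
  show "car (triv n)<=aug ` car (Qmod n 0)"
  proof
   fix c assume "c : car (triv n)"
   hence c: "c : car k" by simp
   have "single k (idd n,{}) c : fsupp k (cells n 0)" by (rule fs_sg[OF _ c]) (simp add: cells_def bgrp_one)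
   thus "c : aug ` car (Qmod n 0)" using aug_sg[OF c] by (intro image_eqI[of _ _ "single k (idd n,{}) c"]) simp_all
  qed
 qed
 show "{x : car (Qmod n 0). aug x = \<zero>[triv n]} = klift (bdry n) ` car (Qmod n (Suc 0))"
 using kbdry_exact_aug aug_kbdry kbdry_cl by (auto simp: One_nat_def)
 show "{x : car (Qmod n (Suc i)). klift (bdry n) x = \<zero>[Qmod n i]} = klift (bdry n) ` car (Qmod n (Suc (Suc i)))" for i
 using kbdry_exact kbdry_twice kbdry_cl by fastforce
qed (simp_all add: triv_grp Qmod_l_mod R Qmod_bdry_lin Qmod_aug_lin)

end

text \<open>A permutation that preserves the blocks of a \<open>J\<close> below \<open>n - 1\<close>
  fixes \<open>n\<close>; so the representatives are the same in both symmetric groups.\<close>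

lemma mcr_pred:
 assumes J: "J<={1..<n - 1}"
 shows "mcr (n - 1) J K = mcr n J K"
proof -
 have "w permutes {1..n - 1}" if w: "w permutes {1..n}" "invs w<=blk_prs J" for w
 proof (rule permutes_superset[OF w(1)])
  have par: "w : para n J" using w by (simp add: para_def)
  fix x assume "x : {1..n} - {1..n - 1}"
  hence x: "x = n" "n >= 1" by auto
  have "~ w n<=n - 1" using x J para_boundary_iff par by fastforce
  moreover have "w n : {1..n}" using permutes_in_image[OF w(1), of n] x by simp
  ultimately show "w x = x" using x by simp
 qed
 moreover have "w permutes {1..n}" if "w permutes {1..n - 1}" for w by (rule permutes_subset[OF that]) auto
 ultimately show ?thesis by (auto simp: mcr_def para_def)
qed

section \<open>An element annihilated by the diagrams with missing edges\<close>

context rook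
begin

definition nonfull where
 "nonfull n = {X : diagrams n. ~ nomiss n X}"

text \<open>The number \<open>m\<close> is the parameter of the induction in
  \<open>eta_partial\<close>; for \<open>m = n\<close> every diagram with missing edges is
  included.\<close>

definition miss where
 "miss n m = {X : diagrams n. EX i:{1..m}. i ~: r_nds X}"

lemma act_nonfull:
 assumes a: "a : fsupp k (nonfull n)" and xi0: "xi0 : fsupp k (cells n i)"
 shows "act n i a xi0 = (%z. \<zero>)" using a
proof (induction rule: fs_ind)
 case zero
 show ?case using amap_zero[OF fag fag act_l(1)[OF xi0]] by simp
next
 case (add X c g)
 have X: "X : diagrams n" "~ nomiss n X" using add(1) by (simp_all add: nonfull_def)
 have g: "g : fsupp k (diagrams n)" by (rule fs_mono[OF add(3)]) (auto simp: nonfull_def)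
 show ?case using amapD(2)[OF act_l(1)[OF xi0], of "single k X c" g] fs_sg[OF X(1) add(2)] g
  by (simp add: act_l(2)[OF xi0 X(1) add(2)] X(2) add(4))
qed

lemma BR_mult_cl:
 assumes R: "ring (BR n)" and T: "T<=diagrams n" and T': "T'<=diagrams n"
  and U: "!!X Y. [|X : T; Y : T'|]==>dcomp n X Y : U" and f: "f : fsupp k T" and g: "g : fsupp k T'"
 shows "f \<otimes>[BR n] g : fsupp k U"
proof -
 note fd = fs_mono[OF f T] and gd = fs_mono[OF g T']
 have ec: "\<epsilon> : car k" by (rule Units_closed[OF eps])
 have 1: "single k X c \<otimes>[BR n] g : fsupp k U" if X: "X : T" and c: "c : car k" for X c using g
 proof (induction rule: fs_ind)
  case zero
  show ?case using amap_zero[OF fag fag BR_mult_amap(1)[OF R fs_sg[OF _ c]], of X] X T by (auto simp: fs_zero)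
 next
  case (add Y d h)
  have Xd: "X : diagrams n" and Yd: "Y : diagrams n" using X add(1) T T' by blast+
  have "single k X c \<otimes>[BR n] single k Y d : fsupp k U"
   unfolding BR_mult_sg[OF Xd Yd c add(2)] by (rule fs_sg[OF U[OF X add(1)]]) (simp add: c add(2) ec)
  from fs_add[OF this add(4)] show ?case
   using amapD(2)[OF BR_mult_amap(1)[OF R fs_sg[OF Xd c]], of "single k Y d" h] fs_sg[OF Yd add(2)] fs_mono[OF add(3) T'] by simp
 qed
 show ?thesis using f
 proof (induction rule: fs_ind)
  case zero
  show ?case using amap_zero[OF fag fag BR_mult_amap(2)[OF R gd]] by (simp add: fs_zero)
 next
  case (add X c h)
  have "X : diagrams n" using add(1) T by blast
  thus ?case
   using fs_add[OF 1[OF add(1,2)] add(4)] amapD(2)[OF BR_mult_amap(2)[OF R gd], of "single k X c" h] fs_sg[of X "diagrams n" c]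
    fs_mono[OF add(3) T] add(2) by simp
 qed
qed

lemma BR_diff: "[|f : fsupp k (diagrams n); g : fsupp k (diagrams n); ring (BR n)|]==>f \<ominus>[BR n] g = (%D. f D \<ominus> g D)"
proof -
 assume f: "f : fsupp k (diagrams n)" and g: "g : fsupp k (diagrams n)" and R: "ring (BR n)"
 interpret B: ring "BR n" by fact
 have "\<ominus>[BR n] g = (%D. \<ominus> g D)" by (simp add: g fs_umns fsD(1)[OF g] l_neg B.minus_equality)
 thus ?thesis by (simp add: amd[of "BR n"] amd[of k])
qed

text \<open>
  The strand-deleting diagrams \<open>e\<^sub>i\<close> satisfy \<open>x e\<^sub>i = \<epsilon> x\<close> whenever the right node \<open>i\<close> of \<open>x\<close> is unattached,
  so the product of the elements \<open>1 - \<epsilon>\<^sup>- e\<^sub>i\<close> is annihilated by all diagrams with missing edges.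
\<close>

lemma eta_partial:
 assumes R: "ring (BR n)" and m: "m<=n"
 shows "EX et:fsupp k (diagrams n). et \<ominus>[BR n] \<one>[BR n] : fsupp k (nonfull n)
  & (ALL f:fsupp k (miss n m). f \<otimes>[BR n] et = \<zero>[BR n])" using m
proof (induction m)
 case 0
 interpret B: ring "BR n" by (rule R)
 have "f \<otimes>[BR n] \<one>[BR n] = \<zero>[BR n]" if f: "f : fsupp k (miss n 0)" for f
 using f fs_empty B.l_null B.one_closed by (auto simp: miss_def)
 moreover have "\<one>[BR n] \<ominus>[BR n] \<one>[BR n] : fsupp k (nonfull n)"
  using B.r_neg[OF B.one_closed] by (simp add: amd fs_zero)
 moreover have "\<one>[BR n] : fsupp k (diagrams n)" using B.one_closed by simp
 ultimately show ?case by (intro bexI[of _ "\<one>[BR n]"] conjI ballI)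
next
 case (Suc m)
 interpret B: ring "BR n" by (rule R)
 obtain et where et: "et : fsupp k (diagrams n)" "et \<ominus>[BR n] \<one>[BR n] : fsupp k (nonfull n)"
  "ALL f:fsupp k (miss n m). f \<otimes>[BR n] et = \<zero>[BR n]" using Suc by auto
 have ec: "\<epsilon> : car k" "inv \<epsilon> : car k" "\<epsilon> \<otimes> inv \<epsilon> = \<one>" using eps by (simp_all add: Units_closed)
 let ?E = "deleted n (Suc m)"
 define u where "u = single k ?E (inv \<epsilon>)"
 have u: "u : fsupp k (nonfull n)" by (simp add: u_def fs_sg ec(2) del_dia del_not_full Suc.prems nonfull_def)
 have nd: "nonfull n<=diagrams n" and md: "miss n j<=diagrams n" for j by (auto simp: nonfull_def miss_def)
 note ud = fs_mono[OF u nd]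
 \<comment> \<open>The new factor \<open>1 - u\<close> stands on the left and meets a diagram first.
   It annihilates the diagrams that are free at node \<open>Suc m\<close>; from the others it leaves
   diagrams free at an earlier node, which \<open>et\<close> annihilates.\<close>
 define th where "th = et \<ominus>[BR n] u \<otimes>[BR n] et"
 have c: "et : car (BR n)" "u : car (BR n)" using et(1) ud by simp_all
 have uet: "u \<otimes>[BR n] et : fsupp k (nonfull n)"
  by (rule BR_mult_cl[OF R nd subset_refl _ u et(1)]) (simp add: nonfull_def nomiss_comp dia_comp_cl)
 have "th : car (BR n)" using c by (simp only: th_def B.minus_closed B.m_closed)
 moreover have "th \<ominus>[BR n] \<one>[BR n] : fsupp k (nonfull n)"
 proof -
  have "th \<ominus>[BR n] \<one>[BR n] = (et \<ominus>[BR n] \<one>[BR n]) \<ominus>[BR n] u \<otimes>[BR n] et"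
   using c B.m_closed[OF c(2,1)] B.one_closed unfolding th_def amd by (simp only: B.a_ac B.a_inv_closed B.a_closed)
  also have "... = (%D. (et \<ominus>[BR n] \<one>[BR n]) D \<ominus> (u \<otimes>[BR n] et) D)"
   by (rule BR_diff[OF fs_mono[OF et(2) nd] fs_mono[OF uet nd] R])
  also have "... : fsupp k (nonfull n)" by (rule fs_diff[OF et(2) uet])
  finally show ?thesis .
 qed
 moreover have "f \<otimes>[BR n] th = \<zero>[BR n]" if f: "f : fsupp k (miss n (Suc m))" for f
 proof -
  have fc: "f : car (BR n)" using fs_mono[OF f md] by simp
  have "f \<ominus>[BR n] f \<otimes>[BR n] u : fsupp k (miss n m)" using f
  proof (induction rule: fs_ind)
   case zero
   have z: "(%i. \<zero>) = \<zero>[BR n]" by simp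
   have "\<zero>[BR n] \<ominus>[BR n] \<zero>[BR n] \<otimes>[BR n] u = \<zero>[BR n]"
    unfolding B.l_null[OF c(2)] amd by (rule B.r_neg[OF B.zero_closed])
   thus ?case unfolding z by (simp add: fs_zero)
  next
   case (add X d g)
   have X: "X : diagrams n" using add(1) md by blast
   let ?s = "single k X d"
   have s: "?s : car (BR n)" using fs_sg[OF X add(2)] by simp
   have g: "g : car (BR n)" using fs_mono[OF add(3) md] by simp
   have "?s \<ominus>[BR n] ?s \<otimes>[BR n] u : fsupp k (miss n m)"
   proof (cases "Suc m : r_nds X")
    case False
    have "Suc m : {1..n}" using Suc.prems by simp
    note da = del_absorb[OF X this False]
    have "?s \<otimes>[BR n] u = ?s"
    proof -
     have "\<epsilon> [^] (1 :: nat) = \<epsilon>" using ec(1) by (simp add: One_nat_def)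
     moreover have "\<epsilon> \<otimes> (d \<otimes> inv \<epsilon>) = d" using m_lcomm[OF ec(1) add(2) ec(2)] ec(3) add(2) by simp
     ultimately show ?thesis unfolding u_def BR_mult_sg[OF X del_dia add(2) ec(2)] da by (simp only:)
    qed
    hence "?s \<ominus>[BR n] ?s \<otimes>[BR n] u = \<zero>[BR n]" using B.r_neg[OF s] by (simp only: amd)
    thus ?thesis by (simp add: fs_zero)
   next
    case True
    hence Xm: "X : miss n m" using add(1) by (auto simp: miss_def le_Suc_eq)
    have "dcomp n X ?E : miss n m"
     using Xm r_nds_del[OF X, of "Suc m"] dia_comp_cl[OF X del_dia] by (auto simp: miss_def)
    hence su: "?s \<otimes>[BR n] u : fsupp k (miss n m)"
     unfolding u_def BR_mult_sg[OF X del_dia add(2) ec(2)] by (rule fs_sg) (use ec add(2) in simp)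
    have sm: "?s : fsupp k (miss n m)" by (rule fs_sg[OF Xm add(2)])
    show ?thesis unfolding BR_diff[OF fs_mono[OF sm md] fs_mono[OF su md] R] by (rule fs_diff[OF sm su])
   qed
   from fs_add[OF this add(4)]
   have "(?s \<ominus>[BR n] ?s \<otimes>[BR n] u) \<oplus>[BR n] (g \<ominus>[BR n] g \<otimes>[BR n] u) : fsupp k (miss n m)" by simp
   also have "(?s \<ominus>[BR n] ?s \<otimes>[BR n] u) \<oplus>[BR n] (g \<ominus>[BR n] g \<otimes>[BR n] u) = (?s \<oplus>[BR n] g) \<ominus>[BR n] (?s \<oplus>[BR n] g) \<otimes>[BR n] u"
    unfolding B.l_distr[OF s g c(2)] amd B.minus_add[OF B.m_closed[OF s c(2)] B.m_closed[OF g c(2)]]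
    using s g B.m_closed[OF s c(2)] B.m_closed[OF g c(2)] by (simp only: B.a_ac B.a_closed B.a_inv_closed)
   finally show ?case by simp
  qed
  hence "(f \<ominus>[BR n] f \<otimes>[BR n] u) \<otimes>[BR n] et = \<zero>[BR n]" using et(3) by (rule bspec[rotated])
  moreover have "f \<otimes>[BR n] th = (f \<ominus>[BR n] f \<otimes>[BR n] u) \<otimes>[BR n] et"
   unfolding th_def amd using fc c
   by (simp only: B.r_distr B.l_distr B.a_inv_closed B.m_closed B.r_minus B.l_minus B.m_assoc)
  ultimately show ?thesis by (simp only:)
 qed
 ultimately show ?case by (intro bexI[of _ th] conjI ballI) simp_all
qed

text \<open>\<open>et\<close> differs from the unit by incomplete diagrams, which act as 0 on
  chains; so it acts on the resolution as the identity.\<close>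

lemma eta:
 assumes R: "ring (BR n)"
 obtains et where "et : fsupp k (diagrams n)" "!!i xi0. xi0 : fsupp k (cells n i)==>act n i et xi0 = xi0"
  "!!X c. [|X : diagrams n; ~ nomiss n X; c : car k|]==>single k X c \<otimes>[BR n] et = \<zero>[BR n]"
proof -
 interpret B: ring "BR n" by (rule R)
 obtain et where et: "et : fsupp k (diagrams n)" "et \<ominus>[BR n] \<one>[BR n] : fsupp k (nonfull n)"
  "ALL f:fsupp k (miss n n). f \<otimes>[BR n] et = \<zero>[BR n]" using eta_partial[OF R order_refl] by blast
 have 1: "act n i et xi0 = xi0" if xi0: "xi0 : fsupp k (cells n i)" for i xi0
 proof -
  have c: "et : car (BR n)" using et(1) by simp
  have "et = (et \<ominus>[BR n] \<one>[BR n]) \<oplus>[BR n] \<one>[BR n]"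
   unfolding amd using c B.one_closed by (simp only: B.a_assoc B.a_inv_closed B.l_neg B.r_zero)
  hence "act n i et xi0 = act n i ((et \<ominus>[BR n] \<one>[BR n]) \<oplus>[BR n] \<one>[BR n]) xi0" by (rule arg_cong)
  also have "... = (%z. act n i (et \<ominus>[BR n] \<one>[BR n]) xi0 z \<oplus> act n i \<one>[BR n] xi0 z)"
   using amapD(2)[OF act_l(1)[OF xi0], of "et \<ominus>[BR n] \<one>[BR n]" "\<one>[BR n]"] B.minus_closed[OF c B.one_closed] B.one_closed by simp
  also have "... = xi0" unfolding act_nonfull[OF et(2) xi0] act_one[OF xi0] using fsD(1)[OF xi0] by simp
  finally show ?thesis .
 qed
 have 2: "single k X c \<otimes>[BR n] et = \<zero>[BR n]" if X: "X : diagrams n" "~ nomiss n X" and c: "c : car k" for X c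
 proof -
  obtain i where "i : {1..n}" "i ~: r_nds X" using not_full_r_node[OF X] .
  hence "X : miss n n" using X(1) by (auto simp: miss_def)
  from bspec[OF et(3) fs_sg[OF this c]] show ?thesis .
 qed
 show thesis by (rule that[OF et(1) 1 2])
qed

text \<open>Preimages of the values at the cells over the trivial braid are multiplied by
  \<open>et\<close>. Incomplete diagrams then annihilate them, just as they annihilate the cells, so
  the extension by braids is linear over the whole algebra. As \<open>et\<close> acts as the
  identity on the cells, it is still a lift.\<close>

lemma Qmod_lifts:
 assumes R: "ring (BR n)" and ph: "ring_map (BR n) B ph" and N: "left_module B N" and N': "abelian_group N'"
  and p: "linear_map B N N' p"
 shows "lifts (BR n) ph (Qmod n i) N N' p" unfolding lifts_def
proof (intro allI impI)
 fix u assume u: "lin_along (BR n) ph (Qmod n i) N' u" and im: "ALL x:car (Qmod n i). u x : p ` car N"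
 note Nsm = l_mod_axioms'[OF N] and Ng = l_mod_grp[OF N] and h = ring_mapD[OF ph, simplified]
 note u' = linD[OF u, simplified] and p' = linD[OF p, simplified]
 obtain et where et: "et : fsupp k (diagrams n)" "!!xi0. xi0 : fsupp k (cells n i)==>act n i et xi0 = xi0"
  "!!X c. [|X : diagrams n; ~ nomiss n X; c : car k|]==>single k X c \<otimes>[BR n] et = \<zero>[BR n]"
  by (rule eta[OF R]) (rule that)
 interpret B: ring "BR n" by (rule R)
 define e where "e J = single k (idd n,J) \<one>" for J :: "nat set"
 define G where "G = {J. J<={1..<n} & card J = i}"
 have e: "e J : fsupp k (cells n i)" if "J : G" for J
  unfolding e_def by (rule fs_sg) (use that bgrp_one in \<open>simp_all add: cells_def G_def\<close>)
 have "EX y. y : car N & p y = u (e J)" if "J : G" for J using im e[OF that] by (metis Qmod_simps(1) imageE)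
 then obtain y where y: "!!J. J : G==>y J : car N" "!!J. J : G==>p (y J) = u (e J)" by metis
 define m where "m J = ph et \<odot>[N] y J" for J
 have m: "m J : car N" if "J : G" for J unfolding m_def by (rule Nsm(1)[OF h(1)[OF et(1)] y(1)[OF that]])
 define T where "T z c = ph (single k (fst z) c) \<odot>[N] m (snd z)" for z c
 have cz: "fst z : diagrams n" "nomiss n (fst z)" "snd z : G" if "z : cells n i" for z
  using that by (auto simp: cells_def fdias_def G_def)
 have T1: "T z c : car N" if "z : cells n i" "c : car k" for z c
  unfolding T_def by (rule Nsm(1)[OF h(1) m]) (use that cz in \<open>simp_all add: fs_sg\<close>)
 have T2: "T z (c \<oplus> d) = T z c \<oplus>[N] T z d" if "z : cells n i" "c : car k" "d : car k" for z c d
  unfolding T_def sg_add[OF that(2,3), symmetric] using that cz by (simp add: h fs_sg Nsm(2) m)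
 let ?v = "alift k N T"
 have va: "addmap (FC n i) N ?v" by (rule alift(1)[OF ring_axioms Ng T1 T2])
 have vs: "?v (single k z c) = T z c" if "z : cells n i" "c : car k" for z c
  by (rule alift(2)[OF ring_axioms Ng T1 T2 that])
 have key: "ph (single k X c) \<odot>[N] m J = ph (single k X c \<otimes>[BR n] et) \<odot>[N] y J"
  if "X : diagrams n" "c : car k" "J : G" for X c J using that et(1) by (simp add: m_def h fs_sg Nsm(4) y(1))
 have f0: "ph (%D. \<zero>) \<odot>[N] x = \<zero>[N]" if x: "x : car N" for x
 proof -
  interpret N: abelian_group N by (rule Ng)
  have z: "(%D. \<zero>) : fsupp k (diagrams n)" by (rule fs_zero)
  have c: "ph (%D. \<zero>) \<odot>[N] x : car N" by (rule Nsm(1)[OF h(1)[OF z] x])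
  show ?thesis using c h(2)[OF z z] Nsm(2)[OF h(1)[OF z] h(1)[OF z] x] by auto
 qed
 have vl: "?v (act n i a xi0) = ph a \<odot>[N] ?v xi0" if a: "a : fsupp k (diagrams n)" and xi0: "xi0 : fsupp k (cells n i)" for a xi0
 proof (rule act_eqI[where F = ?v and G = "%a xi0. ph a \<odot>[N] ?v xi0", OF Ng va _ _ _ a xi0])
  have vc: "?v xi0 : car N" if "xi0 : fsupp k (cells n i)" for xi0 using amapD(1)[OF va] that by simp
  show "addmap (FC n i) N (%xi0. ph a \<odot>[N] ?v xi0)" if a: "a : fsupp k (diagrams n)" for a
   by (rule amapI) (simp_all add: Nsm(1) h(1)[OF a] vc, use amapD(2)[OF va] in \<open>simp add: Nsm(3) h(1)[OF a] vc\<close>)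
  show "addmap (FD n) N (%a. ph a \<odot>[N] ?v xi0)" if "xi0 : fsupp k (cells n i)" for xi0
   by (rule amapI) (simp_all add: Nsm(1,2) h vc[OF that])
  show "?v (act n i (single k X c) (single k (Y,J) d)) = ph (single k X c) \<odot>[N] ?v (single k (Y,J) d)"
   if X: "X : diagrams n" and c: "c : car k" and Y: "(Y,J) : cells n i" and d: "d : car k" for X c Y J d
  proof -
   have Yd: "Y : diagrams n" "nomiss n Y" "J : G" using cz[OF Y] by simp_all
   have l: "loose_nodes n X Y = 0" using lse_nds_full[OF X Yd(1)] Yd(2) by simp
   have XYd: "dcomp n X Y : diagrams n" by (rule dia_comp_cl[OF X Yd(1)])
   have ml: "single k X c \<otimes>[BR n] single k Y d = single k (dcomp n X Y) (c \<otimes> d)"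
   by (simp add: BR_mult_sg X Yd(1) c d l)
   have "ph (single k X c) \<odot>[N] ?v (single k (Y,J) d) = ph (single k X c \<otimes>[BR n] single k Y d) \<odot>[N] m J"
    using h(3)[OF fs_sg[OF X c] fs_sg[OF Yd(1) d]] Nsm(4)[OF h(1)[OF fs_sg[OF X c]] h(1)[OF fs_sg[OF Yd(1) d]] m[OF Yd(3)]]
    by (simp add: vs[OF Y d] T_def)
   also have "... = ph (single k (dcomp n X Y) (c \<otimes> d)) \<odot>[N] m J" unfolding ml ..
   also have "... = ?v (act n i (single k X c) (single k (Y,J) d))"
 using Y XYd nomiss_comp X act_sg_sg c d vs amap_zero[OF fag Ng va] key Yd(3) et(3) f0 y(1) by (auto simp: cells_def fdias_def T_def)
   finally show ?thesis by simp
  qed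
 qed
 have pv: "p (?v xi0) = u xi0" if xi0: "xi0 : fsupp k (cells n i)" for xi0
 proof (rule amap_eqI[where F = "%xi0. p (?v xi0)" and G = u, OF N' _ _ _ xi0])
  show "addmap (FC n i) N' (%xi0. p (?v xi0))" by (rule amap_comp[OF va lin_amap[OF p]])
  show "addmap (FC n i) N' u" using lin_amap[OF u] by (simp add: Qmod_amap)
  show "p (?v (single k z c)) = u (single k z c)" if z: "z : cells n i" and c: "c : car k" for z c
  proof -
   obtain X J where zX: "z = (X,J)" by (cases z)
   have X: "X : diagrams n" "nomiss n X" "J : G" using cz[OF z] zX by simp_all
   note s = fs_sg[OF X(1) c]
   have set: "single k X c \<otimes>[BR n] et : fsupp k (diagrams n)" using B.m_closed[of "single k X c" et] s et(1) by simp
   have "p (?v (single k z c)) = ph (single k X c \<otimes>[BR n] et) \<odot>[N'] p (y J)"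
   using vs z c zX key X(1) X(3) p'(3) h(1) set y(1) by (auto simp: T_def)
   also have "... = u (act n i (single k X c \<otimes>[BR n] et) (e J))" unfolding y(2)[OF X(3)] using u'(3)[OF set e[OF X(3)]] by simp
   also have "act n i (single k X c \<otimes>[BR n] et) (e J) = act n i (single k X c) (e J)"
    unfolding act_mult[OF R s et(1) e[OF X(3)]] et(2)[OF e[OF X(3)]] ..
   also have "act n i (single k X c) (e J) = single k z c"
 using bgrp_one X c act_sg_sg bgrp_one_simps zX by (auto simp: cells_def G_def fdias_def e_def)
   finally show ?thesis .
  qed
 qed
 show "EX v. lin_along (BR n) ph (Qmod n i) N v & (ALL x:car (Qmod n i). p (v x) = u x)"
  using va vl pv by (intro exI[of _ ?v] conjI ballI lin_alongI) (simp_all add: Qmod_amap)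
qed

end

section \<open>Tor\<close>

definition cell_inc :: "nat => cell => cell \<Rightarrow>\<^sub>0 int" where
 "cell_inc n c = frg (diagram_incl n (fst c),snd c)"

lemma cell_inc_keys:
 assumes n: "n >= 1" and c: "c : cells (n - 1) i"
 shows "keys (cell_inc n c) <= cells n i"
proof -
 obtain X J where XJ: "c = (X,J)" "X : fdias (n - 1)" "J<={1..<n - 1}" "card J = i" using c by (auto simp: cells_def)
 show ?thesis using dia_inc_full n XJ subset_trans[OF XJ(3)] by (auto simp: cell_inc_def cells_def)
qed

text \<open>Coset representatives, signs and permutation braids are the same for
  \<open>n - 1\<close> and for \<open>n\<close>, so the two boundaries correspond term by
  term.\<close>

lemma cell_inc_bdry:
 assumes n: "n >= 1" and c: "c : cells (n - 1) i"
 shows "fex (cell_inc n) (bdry (n - 1) c) = fex (bdry n) (cell_inc n c)"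
proof -
 obtain X J where XJ: "c = (X,J)" "X : fdias (n - 1)" "J<={1..<n - 1}" using c by (auto simp: cells_def)
 have fin: "finite J" by (rule fin_gens[OF XJ(3)])
 have e: "diagram_incl n (dcomp (n - 1) X (sbraid (n - 1) w)) = dcomp n (diagram_incl n X) (sbraid n w)"
  if "w : mcr (n - 1) J K" for w K
 proof -
  have w: "w permutes {1..n - 1}" by (rule mcr_perm[OF that])
  have "X : diagrams (n - 1)" "sbraid (n - 1) w : diagrams (n - 1)" using XJ(2) sbraid_full[OF w] by (simp_all add: fdias_def)
  from dia_inc_comp(1)[OF n this] show ?thesis by (simp add: dia_inc_sbraid[OF n w])
 qed
 have "fex (cell_inc n) (bdry (n - 1) c) = (\<Sum>j\<in>J. \<Sum>w\<in>mcr (n - 1) J (J - {j}).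
   fcm (psgn j J * sign w) (frg (dcomp n (diagram_incl n X) (sbraid n w),J - {j})))"
  by (simp add: XJ(1) bdry_def frag_extend_sum fin fin_mcr frag_extend_cmul cell_inc_def e cong: sum.cong)
 thus ?thesis by (simp add: XJ(1) mcr_pred[OF XJ(3)] bdry_def cell_inc_def)
qed

lemma cbdry_pred:
 assumes "J<={1..<n - 1}"
 shows "cbdry (n - 1) J = cbdry n J" by (simp add: cbdry_def face_coeff_def mcr_pred[OF assms])

context rook
begin

lemma algebra_inc_klift:
 assumes f: "f : fsupp k S"
 shows "algebra_incl k n f = klift (%X. frg (diagram_incl n X)) f"
proof
 fix D
 show "algebra_incl k n f D = klift (%X. frg (diagram_incl n X)) f D" unfolding algebra_incl_def klift_def
 proof (rule add.finprod_mono_neutral_cong_left)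
  show "finite {X. f X~=\<zero>}" by (rule fsD(2)[OF f])
  show "cvec (f X) (frg (diagram_incl n X)) D = \<zero>" if "X : {X. f X~=\<zero>} - {X. f X~=\<zero> & diagram_incl n X = D}" for X
   using that by (auto simp: cvec_def)
  show "(%X. cvec (f X) (frg (diagram_incl n X)) D) : {X. f X~=\<zero>} \<rightarrow> car k"
   using fsD(1)[OF f] by (simp add: cvec_in)
  show "f X = cvec (f X) (frg (diagram_incl n X)) D" if "X : {X. f X~=\<zero> & diagram_incl n X = D}" for X
   using that fsD(1)[OF f] by (simp add: cvec_def)
 qed auto
qed

lemma algebra_inc_sg: "c : car k==>algebra_incl k n (single k X c) = single k (diagram_incl n X) c"
 by (subst algebra_inc_klift[of _ UNIV]) (simp_all add: fs_sg klift_frag_of)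

lemma algebra_inc_amap:
 assumes n: "n >= 1"
 shows "addmap (FD (n - 1)) (FD n) (algebra_incl k n)"
proof -
 have "addmap (FD (n - 1)) (FD n) (klift (%X. frg (diagram_incl n X)))"
  by (rule klift_amap) (simp add: dia_inc_cl[OF n])
 thus ?thesis unfolding addmap_def Pi_iff by (simp add: algebra_inc_klift[of _ "diagrams (n - 1)"] fs_add)
qed

lemma inc_ring_map:
 assumes n: "n >= 1" and R: "ring (BR (n - 1))" and R': "ring (BR n)"
 shows "ring_map (BR (n - 1)) (BR n) (algebra_incl k n)"
proof -
 let ?i = "algebra_incl k n"
 note ia = algebra_inc_amap[OF n]
 have cl: "?i f : fsupp k (diagrams n)" if "f : fsupp k (diagrams (n - 1))" for f using amapD(1)[OF ia, of f] that by simp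
 have ec: "\<epsilon> : car k" by (rule Units_closed[OF eps])
 have 1: "?i (single k X c \<otimes>[BR (n - 1)] g) = ?i (single k X c) \<otimes>[BR n] ?i g"
  if X: "X : diagrams (n - 1)" and c: "c : car k" and g: "g : fsupp k (diagrams (n - 1))" for X c g
 proof (rule amap_eqI[where F = "%g. ?i (single k X c \<otimes>[BR (n - 1)] g)" and G = "%g. ?i (single k X c) \<otimes>[BR n] ?i g", OF fag _ _ _ g])
  note s = fs_sg[OF X c]
  show "addmap (FD (n - 1)) (FD n) (%g. ?i (single k X c \<otimes>[BR (n - 1)] g))" by (rule amap_comp[OF BR_mult_amap(1)[OF R s] ia])
  show "addmap (FD (n - 1)) (FD n) (%g. ?i (single k X c) \<otimes>[BR n] ?i g)" by (rule amap_comp[OF ia BR_mult_amap(1)[OF R' cl[OF s]]])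
  show "?i (single k X c \<otimes>[BR (n - 1)] single k Y d) = ?i (single k X c) \<otimes>[BR n] ?i (single k Y d)"
   if Y: "Y : diagrams (n - 1)" and d: "d : car k" for Y d
   using c d ec by (simp add: BR_mult_sg[OF X Y c d] algebra_inc_sg
     BR_mult_sg[OF dia_inc_cl(1)[OF n X] dia_inc_cl(1)[OF n Y] c d] dia_inc_comp[OF n X Y])
 qed
 have "?i (f \<otimes>[BR (n - 1)] g) = ?i f \<otimes>[BR n] ?i g" if f: "f : fsupp k (diagrams (n - 1))" and g: "g : fsupp k (diagrams (n - 1))" for f g
 proof (rule amap_eqI[where F = "%f. ?i (f \<otimes>[BR (n - 1)] g)" and G = "%f. ?i f \<otimes>[BR n] ?i g", OF fag _ _ _ f])
  show "addmap (FD (n - 1)) (FD n) (%f. ?i (f \<otimes>[BR (n - 1)] g))" by (rule amap_comp[OF BR_mult_amap(2)[OF R g] ia])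
  show "addmap (FD (n - 1)) (FD n) (%f. ?i f \<otimes>[BR n] ?i g)" by (rule amap_comp[OF ia BR_mult_amap(2)[OF R' cl[OF g]]])
 qed (rule 1[OF _ _ g])
 moreover have "?i (%D. f D \<oplus> g D) = (%D. ?i f D \<oplus> ?i g D)" if "f : fsupp k (diagrams (n - 1))" "g : fsupp k (diagrams (n - 1))" for f g
  using amapD(2)[OF ia, of f g] that by simp
 ultimately show ?thesis using cl by (simp add: ring_map_def Pi_iff)
qed

lemma tau_inc:
 assumes n: "n >= 1" and f: "f : fsupp k (diagrams (n - 1))"
 shows "tau n (algebra_incl k n f) = tau (n - 1) f" unfolding algebra_inc_klift[OF f] tau_def klift2[OF f]
 by (rule fun_cong[OF klift_cong[OF f]]) (simp add: dia_inc_cl(2)[OF n])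

lemma cell_inc_lin:
 assumes n: "n >= 1"
 shows "lin_along (BR (n - 1)) (algebra_incl k n) (Qmod (n - 1) i) (Qmod n i) (klift (cell_inc n))"
proof (rule lin_alongI)
 have b: "addmap (FC (n - 1) i) (FC n i) (klift (cell_inc n))" by (rule klift_amap[OF cell_inc_keys[OF n]])
 thus "addmap (Qmod (n - 1) i) (Qmod n i) (klift (cell_inc n))" by (simp only: Qmod_amap)
 fix a x assume "a : car (BR (n - 1))" "x : car (Qmod (n - 1) i)"
 hence a: "a : fsupp k (diagrams (n - 1))" and x: "x : fsupp k (cells (n - 1) i)" by simp_all
 have ic: "algebra_incl k n a : fsupp k (diagrams n)" if "a : fsupp k (diagrams (n - 1))" for a
  using amapD(1)[OF algebra_inc_amap[OF n], of a] that by simp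
 have "klift (cell_inc n) (act (n - 1) i a x) = act n i (algebra_incl k n a) (klift (cell_inc n) x)"
 proof (rule act_eqI[where F = "klift (cell_inc n)" and G = "%a x. act n i (algebra_incl k n a) (klift (cell_inc n) x)", OF fag b _ _ _ a x])
  show "addmap (FC (n - 1) i) (FC n i) (%x. act n i (algebra_incl k n a) (klift (cell_inc n) x))" if "a : fsupp k (diagrams (n - 1))" for a
   by (rule amap_comp[OF b act_r[OF ic[OF that]]])
  show "addmap (FD (n - 1)) (FC n i) (%a. act n i (algebra_incl k n a) (klift (cell_inc n) x))" if x: "x : fsupp k (cells (n - 1) i)" for x
  proof -
   have "klift (cell_inc n) x : fsupp k (cells n i)" using amapD(1)[OF b, of x] x by simp
   from amap_comp[OF algebra_inc_amap[OF n] act_l(1)[OF this]] show ?thesis .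
  qed
  show "klift (cell_inc n) (act (n - 1) i (single k X c) (single k (Y,J) d))
    = act n i (algebra_incl k n (single k X c)) (klift (cell_inc n) (single k (Y,J) d))"
   if X: "X : diagrams (n - 1)" and c: "c : car k" and Y: "(Y,J) : cells (n - 1) i" and d: "d : car k" for X c Y J d
  proof -
   have Yd: "Y : diagrams (n - 1)" using Y by (simp add: cells_def fdias_def)
   have Y': "(diagram_incl n Y,J) : cells n i" using cell_inc_keys[OF n Y] by (simp add: cell_inc_def)
   show ?thesis
   by (simp add: act_sg_sg algebra_inc_sg dia_inc_cl(1) n Y' dia_inc_cl(2) dia_inc_comp(1) Yd klift_zero that klift_sg cell_inc_def cvec_of)
  qed
 qed
 thus "klift (cell_inc n) (a \<odot>[Qmod (n - 1) i] x) = algebra_incl k n a \<odot>[Qmod n i] klift (cell_inc n) x" by simp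
qed

lemma cell_inc_res_map:
 assumes n: "n >= 1"
 shows "resolution_map (BR (n - 1)) (algebra_incl k n) id (Qmod (n - 1)) (%i. klift (bdry (n - 1))) aug
  (Qmod n) (%i. klift (bdry n)) aug (%i. klift (cell_inc n))" unfolding resolution_map_def
proof (intro conjI allI ballI)
 show "klift (cell_inc n) (klift (bdry (n - 1)) x) = klift (bdry n) (klift (cell_inc n) x)" if "x : car (Qmod (n - 1) (Suc i))" for i x
 proof -
  have x: "x : fsupp k (cells (n - 1) (Suc i))" using that by simp
  show ?thesis unfolding klift2[OF x] by (rule klift_cong[OF x cell_inc_bdry[OF n]])
 qed
 show "aug (klift (cell_inc n) x) = id (aug x)" if "x : car (Qmod (n - 1) 0)" for x
 proof -
  have x: "x : fsupp k (cells (n - 1) 0)" using that by simp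
  show ?thesis unfolding aug_def klift2[OF x] by (simp add: cell_inc_def)
 qed
qed (rule cell_inc_lin[OF n])

lemma fgt_bdry_klift:
 assumes x: "x : fsupp k (cells n i)"
 shows "klift forget (klift (bdry n) x) = klift (cbdry n) (klift forget x)" unfolding klift2[OF x]
proof (rule klift_cong[OF x])
 fix c assume "c : cells n i"
 hence "finite (snd c)" using fin_gens by (auto simp: cells_def)
 thus "fex forget (bdry n c) = fex (cbdry n) (forget c)" by (simp add: fgt_bdry) (simp add: forget_def)
qed

lemma fgt_cl:
 assumes x: "x : fsupp k (cells n i)"
 shows "klift forget x : fsupp k (ccells n i)" by (rule klift_cl[OF x]) (auto simp: forget_def cells_def ccells_def)

lemma fgt_inc:
 assumes x: "x : fsupp k (cells (n - 1) i)"
 shows "klift forget (klift (cell_inc n) x) = klift forget x"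
 unfolding klift2[OF x] by (simp add: cell_inc_def forget_def[abs_def])

text \<open>A section of \<open>forget\<close>. It serves only to pick representatives and does not
  commute with the boundaries in general.\<close>

definition base_cell :: "nat=>nat set => cell \<Rightarrow>\<^sub>0 int" where
 "base_cell n J = frg (idd n,J)"

lemma base_cell_cl:
 assumes w: "w : fsupp k (ccells n i)"
 shows "klift (base_cell n) w : fsupp k (cells n i)" "klift forget (klift (base_cell n) w) = w"
proof -
 show "klift (base_cell n) w : fsupp k (cells n i)"
  by (rule klift_cl[OF w]) (auto simp: base_cell_def cells_def ccells_def bgrp_one)
 show "klift forget (klift (base_cell n) w) = w"
  unfolding klift2[OF w] by (simp add: base_cell_def forget_def klift_of[OF w])
qed

lemma cbdry_pred_klift:
 assumes w: "w : fsupp k (ccells (n - 1) i)"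
 shows "klift (cbdry (n - 1)) w = klift (cbdry n) w" by (rule klift_cong[OF w]) (simp add: ccells_def cbdry_pred)

end

lemma res_map_comp:
 assumes f: "resolution_map A ph nu0 S dS eS T dT eT f" and g: "resolution_map B ps0 \<mu> T dT eT U dU eU g"
  and ph: "ring_map A B ph" and eq: "\<rho> = (%a. ps0 (ph a))" "ka = (%c. \<mu> (nu0 c))"
 shows "resolution_map A \<rho> ka S dS eS U dU eU (%i x. g i (f i x))"
proof -
 have fl: "lin_along A ph (S i) (T i) (f i)" for i using f by (simp add: resolution_map_def)
 have gl: "lin_along B ps0 (T i) (U i) (g i)" for i using g by (simp add: resolution_map_def)
 have fd: "f i (dS i x) = dT i (f (Suc i) x)" if "x : car (S (Suc i))" for i x using f that by (simp add: resolution_map_def)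
 have gd: "g i (dT i x) = dU i (g (Suc i) x)" if "x : car (T (Suc i))" for i x using g that by (simp add: resolution_map_def)
 have fe: "eT (f 0 x) = nu0 (eS x)" if "x : car (S 0)" for x using f that by (simp add: resolution_map_def)
 have ge: "eU (g 0 x) = \<mu> (eT x)" if "x : car (T 0)" for x using g that by (simp add: resolution_map_def)
 show ?thesis unfolding resolution_map_def eq
 proof (intro conjI allI ballI)
  show "lin_along A (%a. ps0 (ph a)) (S i) (U i) (%x. g i (f i x))" for i by (rule lin_comp[OF fl gl ring_mapD(1)[OF ph]])
  show "g i (f i (dS i x)) = dU i (g (Suc i) (f (Suc i) x))" if "x : car (S (Suc i))" for i x
   unfolding fd[OF that] by (rule gd[OF linD(1)[OF fl that]])
  show "eU (g 0 (f 0 x)) = \<mu> (nu0 (eS x))" if "x : car (S 0)" for x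
   unfolding ge[OF linD(1)[OF fl that]] fe[OF that] ..
 qed
qed

lemma res_map_id: "resolution_map A id id S dS eS S dS eS (%i x. x)" by (simp add: resolution_map_def linear_along_def)

context rook
begin

abbreviation qd :: "nat=>nat=>(cell=>'k) => cell=>'k" where
 "qd n == %i. klift (bdry n)"

lemma diff_zero_iff:
 assumes "u : car k" "v : car k"
 shows "u \<ominus> v = \<zero> <-> u = v"
proof
 assume h: "u \<ominus> v = \<zero>"
 have "u = (u \<ominus> v) \<oplus> v" using assms by (simp add: amd a_assoc l_neg)
 thus "u = v" using assms by (simp add: h)
qed (use assms in \<open>simp add: amd r_neg\<close>)

lemma fgt_add: "[|f : fsupp k S; g : fsupp k S|]==>klift forget (%x. f x \<oplus> g x) = (%x. klift forget f x \<oplus> klift forget g x)"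
 by (rule klift_add)

lemma Qmod_diff:
 assumes "f : fsupp k (cells n i)" "g : fsupp k (cells n i)"
 shows "f \<ominus>[Qmod n i] g = (%x. f x \<ominus> g x)"
proof -
 interpret Q: abelian_group "Qmod n i" by (rule Qmod_grp)
 have "\<ominus>[Qmod n i] g = (%x. \<ominus> g x)"
   by (simp add: fs_umns assms(2) fsD(1)[OF assms(2)] l_neg Q.minus_equality)
 thus ?thesis by (simp add: amd[of "Qmod n i"] amd[of k])
qed

lemma fgt_act:
 assumes a: "a : fsupp k (diagrams n)" and x: "x : fsupp k (cells n i)"
 shows "klift forget (act n i a x) = scal (tau n a) (klift forget x)"
proof (rule act_eqI[where F = "klift forget" and G = "%a x. scal (tau n a) (klift forget x)" and N = "FM k UNIV", OF fag _ _ _ _ a x])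
 show b: "addmap (FC n i) (FM k UNIV) (klift forget)" by (rule klift_amap) simp
 show "addmap (FC n i) (FM k UNIV) (%x. scal (tau n a) (klift forget x))" if "a : fsupp k (diagrams n)" for a
  by (rule amap_comp[OF b scal_amap[OF tau_cl[OF that]]])
 show "addmap (FD n) (FM k UNIV) (%a. scal (tau n a) (klift forget x))" if x: "x : fsupp k (cells n i)" for x
 proof (rule amapI)
  have fx: "klift forget x : fsupp k UNIV" by (rule klift_cl[OF x subset_UNIV])
  show "scal (tau n a) (klift forget x) : car (FM k UNIV)" if "a : car (FD n)" for a
   using scal_cl[OF tau_cl fx] that by simp
  show "scal (tau n (a \<oplus>[FD n] b)) (klift forget x) = scal (tau n a) (klift forget x) \<oplus>[FM k UNIV] scal (tau n b) (klift forget x)"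
   if "a : car (FD n)" "b : car (FD n)" for a b
   using that by (simp add: tau_add[of _ "diagrams n"] scal_add_l[OF tau_cl tau_cl fx])
 qed
 show "klift forget (act n i (single k X c) (single k (Y,J) d)) = scal (tau n (single k X c)) (klift forget (single k (Y,J) d))"
  if "X : diagrams n" "c : car k" "(Y,J) : cells n i" "d : car k" for X c Y J d
  using that by (simp add: act_sg_sg tau_sg klift_sg forget_def cvec_of scal_sg klift_zero) (simp add: sg_zero)
qed

end

lemma cos_eq_iff:
 assumes "group G" "subgroup N G" "a : car G" "b : car G"
 shows "N #>\<^bsub>G\<^esub> a = N #>\<^bsub>G\<^esub> b <-> a \<otimes>[G] inv\<^bsub>G\<^esub> b : N"
proof -
 interpret group G by fact
 have N: "N <= car G" by (rule subgroup.subset[OF assms(2)])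
 have c: "a \<otimes>[G] inv\<^bsub>G\<^esub> b : car G" using assms by simp
 show ?thesis by (metis coset_join1 coset_mult_inv2 assms(2,3,4) N c coset_mult_inv1 coset_join2)
qed

lemma hom_grp_hom: "[|h : hom G H; group G; group H|]==>group_hom G H h"
 by (simp add: group_hom_def group_hom_axioms_def)

text \<open>The homomorphism theorem for the composite of \<open>h\<close> with the projection onto
  the quotient; accordingly \<open>h\<close> must be surjective only modulo
  \<open>K\<close>.\<close>

lemma quo_map_iso:
 assumes G: "group G" and H: "comm_group H" and K: "subgroup K H" and h: "h : hom G H"
  and N: "!!x. x : car G==>h x : K <-> x : N" "N <= car G"
  and surj: "!!y. y : car H==>EX x:car G. y \<otimes>[H] inv\<^bsub>H\<^esub> h x : K"
 shows "quotient_map_into H K h : iso (G Mod N) (H Mod K)"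
proof -
 interpret H: comm_group H by (rule H)
 interpret K: normal K H by (rule H.subgroup_imp_normal[OF K])
 let ?h = "%x. K #>\<^bsub>H\<^esub> h x"
 have hc: "h x : car H" if "x : car G" for x using hom_in_carrier[OF h that] .
 interpret L: group_hom G "H Mod K" ?h
  using hom_compose[OF h K.r_coset_hom_Mod] by (intro hom_grp_hom G K.factorgroup_is_group) (simp add: comp_def)
 have "?h x = K <-> h x : K" if "x : car G" for x
  using H.coset_join1[OF _ hc[OF that] K] H.coset_join2[OF hc[OF that] K] by blast
 hence "kernel G (H Mod K) ?h = N" unfolding kernel_def using N by auto
 moreover have "?h ` car G = car (H Mod K)"
 proof
  show "car (H Mod K)<=?h ` car G"
  proof
   fix Y assume "Y : car (H Mod K)"
   then obtain y where y: "y : car H" "Y = K #>\<^bsub>H\<^esub> y" by (auto simp: carrier_FactGroup)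
   obtain x where "x : car G" "y \<otimes>[H] inv\<^bsub>H\<^esub> h x : K" using surj[OF y(1)] by (elim bexE)
   thus "Y : ?h ` car G" using cos_eq_iff[OF H.group_axioms K y(1) hc] y(2) by blast
  qed
 qed auto
 ultimately show ?thesis using L.FactGroup_iso_set by (simp add: quotient_map_into_def)
qed

lemma quo_map_into_cos:
 assumes h: "group_hom G H h" and N: "N<=kernel G H h" "subgroup N G" and a: "a : car G"
 shows "the_elem (h ` (N #>\<^bsub>G\<^esub> a)) = h a"
proof -
 interpret group_hom G H h by (rule h)
 have "h ` (N #>\<^bsub>G\<^esub> a) = {h a}" using G.rcos_self a N(2) N(1) by (auto simp: kernel_def r_coset_def)
 thus ?thesis by simp
qed

lemma hom_fext:
 assumes "!!b. b : S==>keys (g b)<=S'"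
 shows "fex g : hom (free_Abelian_group S) (free_Abelian_group S')"
proof (rule homI)
 fix x assume "x : car (free_Abelian_group S)"
 thus "fex g x : car (free_Abelian_group S')" using keys_frag_extend[of g x] assms by auto
qed (simp add: frag_extend_add)

section \<open>Tensor products with the trivial module\<close>

type_synonym ('k, 'p) bmod = "(strands set=>'k,'p) module"

context rook
begin

abbreviation Fr :: "('k,'p) bmod=>('k \<times> 'p \<Rightarrow>\<^sub>0 int) monoid" where
 "Fr P == free_Abelian_group (car k \<times> car P)"

abbreviation Rel :: "nat=>('k,'p) bmod=>('k \<times> 'p \<Rightarrow>\<^sub>0 int) set" where
 "Rel n P == tensor_relations (BR n) (triv n) P"

abbreviation T :: "nat=>('k,'p) bmod=>('k \<times> 'p \<Rightarrow>\<^sub>0 int) set monoid" where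
 "T n P == tensor (BR n) (triv n) P"

definition ten where
 "ten n P c x = Rel n P #>\<^bsub>Fr P\<^esub> frg (c,x)"

abbreviation kap :: "nat=>('k,'p) bmod=>'p=>('k \<times> 'p \<Rightarrow>\<^sub>0 int) set" where
 "kap n P == ten n P \<one>"

text \<open>Every tensor has the form \<open>ten n P \<one> x\<close> by \<open>kap_img\<close>. So
  the tensor product is \<open>P\<close> modulo this subgroup, and Tor can be computed with elements
  of \<open>P\<close>.\<close>

definition Aug where
 "Aug n P = kernel (add_monoid P) (T n P) (kap n P)"

lemma const:
 assumes "c : car k"
 shows "single k (idd n) c : fsupp k (diagrams n)" "tau n (single k (idd n) c) = c"
 using assms bgrp_one[of n] by (simp_all add: fs_sg fdias_def tau_sg)

lemma T_simps: "T n P = Fr P Mod Rel n P" by (simp add: tensor_def)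

context
 fixes n :: nat and P :: "('k,'p) bmod"
 assumes P: "left_module (BR n) P"
begin

lemma frag_cl: "[|c : car k; x : car P|]==>frg (c,x) : car (Fr P)" by simp

lemma P_add: "[|x : car P; y : car P|]==>x \<oplus>[P] y : car P"
 by (rule abelian_monoid.a_closed[OF abelian_group.axioms(1)[OF l_mod_grp[OF P]]])

lemma P_smult: "[|a : fsupp k (diagrams n); x : car P|]==>a \<odot>[P] x : car P"
 using l_mod_axioms'(1)[OF P, of a x] by simp

lemma Rel_sg: "subgroup (Rel n P) (Fr P)"
proof -
 have k: "keys (frg u - frg v)<=S" if "u : S" "v : S" for u v :: "'k \<times> 'p" and S
  by (rule keys_diff_sub(1)) (use that in simp_all)
 have k': "keys (frg u - frg v - frg w)<=S" if "u : S" "v : S" "w : S" for u v w :: "'k \<times> 'p" and S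
  by (intro keys_diff_sub(1)) (use that in simp_all)
 show ?thesis unfolding tensor_relations_def triv_simps
  by (rule group.generate_is_subgroup[OF group_free_Abelian_group], intro Un_least subsetI; elim CollectE exE conjE; hypsubst)
   (simp_all only: BR_simps triv_smult carrier_free_Abelian_group_iff, (rule k' k; simp add: P_add P_smult tau_cl)+)
qed

lemma Rel_normal: "Rel n P \<lhd> Fr P" by (rule comm_group.subgroup_imp_normal[OF abelian_free_Abelian_group Rel_sg])

lemma T_grp: "comm_group (T n P)"
 unfolding T_simps by (rule comm_group.abelian_FactGroup[OF abelian_free_Abelian_group Rel_sg])

lemma proj_hom: "(%t. Rel n P #>\<^bsub>Fr P\<^esub> t) : hom (Fr P) (T n P)"
 unfolding T_simps by (rule normal.r_coset_hom_Mod[OF Rel_normal])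

text \<open>The part of the universal property of the tensor product that is used: a balanced
  biadditive map annihilates all relations.\<close>

lemma Rel_kernel:
 assumes N: "group N" and g: "g : hom (Fr P) N"
  and 1: "!!c c' x. [|c : car k; c' : car k; x : car P|]==>g (frg (c \<oplus> c',x)) = g (frg (c,x)) \<otimes>[N] g (frg (c',x))"
  and 2: "!!c x y. [|c : car k; x : car P; y : car P|]==>g (frg (c,x \<oplus>[P] y)) = g (frg (c,x)) \<otimes>[N] g (frg (c,y))"
  and 3: "!!a c x. [|a : fsupp k (diagrams n); c : car k; x : car P|]==>g (frg (tau n a \<otimes> c,x)) = g (frg (c,a \<odot>[P] x))"
 shows "Rel n P<=kernel (Fr P) N g"
proof -
 interpret N: group N by (rule N)
 interpret group_hom "Fr P" N g by (rule hom_grp_hom[OF g group_free_Abelian_group N])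
 let ?S = "car k \<times> car P"
 have d: "s - t : car (Fr P)" "g (s - t) = g s \<otimes>[N] inv\<^bsub>N\<^esub> g t" if "s : car (Fr P)" "t : car (Fr P)" for s t
  using that hom_mult[of s "inv\<^bsub>Fr P\<^esub> t"] hom_inv[of t] keys_diff_sub(1)[of s ?S t] by simp_all
 have m: "frg u - frg v : kernel (Fr P) N g" if "u : ?S" "v : ?S" "g (frg u) = g (frg v)" for u v
  using d[of "frg u" "frg v"] that hom_closed[of "frg v"] by (simp add: kernel_def)
 have a: "frg u - frg v - frg w : kernel (Fr P) N g"
  if u: "u : ?S" "v : ?S" "w : ?S" and e: "g (frg u) = g (frg v) \<otimes>[N] g (frg w)" for u v w
 proof -
  have c: "frg u : car (Fr P)" "frg v : car (Fr P)" "frg w : car (Fr P)" using u by simp_all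
  have "frg v + frg w : car (Fr P)" using keys_diff_sub(2)[of "frg v" ?S "frg w"] u by simp
  moreover have "g (frg v + frg w) = g (frg u)" using hom_mult[OF c(2,3)] e by simp
  ultimately have "g (frg u - (frg v + frg w)) = \<one>[N]" "frg u - (frg v + frg w) : car (Fr P)"
   using d[OF c(1), of "frg v + frg w"] hom_closed[OF c(1)] by simp_all
  thus ?thesis by (simp add: kernel_def diff_diff_eq)
 qed
 show ?thesis unfolding tensor_relations_def triv_simps
  by (rule group.generate_subgroup_incl[OF group_free_Abelian_group _ subgroup_kernel], intro Un_least subsetI; elim CollectE exE conjE; hypsubst)
   (simp_all only: BR_simps triv_smult, (rule a[OF _ _ _ 1] a[OF _ _ _ 2] m[OF _ _ 3]; simp add: P_add P_smult tau_cl)+)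
qed

lemma ten_cl: "[|c : car k; x : car P|]==>ten n P c x : car (T n P)"
 unfolding ten_def by (rule hom_in_carrier[OF proj_hom frag_cl])

lemma ten_add_r: "[|c : car k; x : car P; y : car P|]==>ten n P c (x \<oplus>[P] y) = ten n P c x \<otimes>[T n P] ten n P c y"
 and ten_add_left: "[|c : car k; c' : car k; x : car P|]==>ten n P (c \<oplus> c') x = ten n P c x \<otimes>[T n P] ten n P c' x"
 and ten_smult: "[|a : fsupp k (diagrams n); c : car k; x : car P|]==>ten n P (tau n a \<otimes> c) x = ten n P c (a \<odot>[P] x)"
proof -
 note G = group_free_Abelian_group Rel_sg
 let ?S = "car k \<times> car P"
 have e: "Rel n P #>\<^bsub>Fr P\<^esub> frg u = (Rel n P #>\<^bsub>Fr P\<^esub> frg v) \<otimes>[T n P] (Rel n P #>\<^bsub>Fr P\<^esub> frg w)"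
  if u: "u : ?S" "v : ?S" "w : ?S" and r: "frg u - frg v - frg w : Rel n P" for u v w
 proof -
  have c: "frg u : car (Fr P)" "frg v : car (Fr P)" "frg w : car (Fr P)" using u by simp_all
  have s: "frg v + frg w : car (Fr P)" using keys_diff_sub(2)[of "frg v" ?S "frg w"] u by simp
  show ?thesis using hom_mult[OF proj_hom c(2,3)] cos_eq_iff[OF G c(1) s] r s by (simp add: algebra_simps)
 qed
 show "ten n P c (x \<oplus>[P] y) = ten n P c x \<otimes>[T n P] ten n P c y" if "c : car k" "x : car P" "y : car P"
  unfolding ten_def by (rule e) (use that P_add in \<open>simp_all,unfold tensor_relations_def,rule_tac generate.incl,rule_tac UnI1,rule_tac UnI2,auto\<close>)
 show "ten n P (c \<oplus> c') x = ten n P c x \<otimes>[T n P] ten n P c' x" if "c : car k" "c' : car k" "x : car P"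
  unfolding ten_def by (rule e) (use that in \<open>simp_all,unfold tensor_relations_def,rule_tac generate.incl,rule_tac UnI1,rule_tac UnI1,auto\<close>)
 show "ten n P (tau n a \<otimes> c) x = ten n P c (a \<odot>[P] x)" if "a : fsupp k (diagrams n)" "c : car k" "x : car P"
 proof -
  have "frg (a \<odot>[triv n] c,x) - frg (c,a \<odot>[P] x) : Rel n P"
   unfolding tensor_relations_def by (rule generate.incl, rule UnI2, intro CollectI exI conjI HOL.refl) (use that in simp_all)
  thus ?thesis unfolding ten_def triv_smult[OF that(1)]
   using cos_eq_iff[OF G frag_cl frag_cl, of "tau n a \<otimes> c" x c "a \<odot>[P] x"] that by (simp add: tau_cl P_smult)
 qed
qed

lemma kap_hom: "group_hom (add_monoid P) (T n P) (kap n P)" using ten_cl ten_add_r T_grp l_mod_grp[OF P]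
 by (intro hom_grp_hom homI) (simp_all add: comm_group_def abelian_group.a_group)

lemma kap_mns: "[|x : car P; y : car P|]==>kap n P (x \<ominus>[P] y) = kap n P x \<otimes>[T n P] inv\<^bsub>T n P\<^esub> kap n P y"
 using group_hom.hom_inv[OF kap_hom, of y] ten_add_r[OF one_closed, of x "\<ominus>[P] y"] abelian_group.a_inv_closed[OF l_mod_grp[OF P], of y]
 by (simp add: amd a_inv_def)

lemma kap_zero: "kap n P \<zero>[P] = \<one>[T n P]" using group_hom.hom_one[OF kap_hom] by simp

lemma Aug_iff: "x : Aug n P <-> x : car P & kap n P x = \<one>[T n P]" by (simp add: Aug_def kernel_def)

lemma kap_eq_iff:
 assumes "x : car P" "y : car P"
 shows "kap n P x = kap n P y <-> x \<ominus>[P] y : Aug n P"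
proof -
 interpret T: comm_group "T n P" by (rule T_grp)
 interpret P: abelian_group P by (rule l_mod_grp[OF P])
 show ?thesis using assms ten_cl[OF one_closed] by (auto simp: Aug_iff kap_mns T.inv_solve_right')
qed

text \<open>The coefficient \<open>c\<close> of a tensor moves into the second factor as
  \<open>c\<close> times the identity diagram; differences of tensors become differences in
  \<open>P\<close>.\<close>

lemma kap_img: "kap n P ` car P = car (T n P)"
proof
 interpret P: abelian_group P by (rule l_mod_grp[OF P])
 interpret p: group_hom "Fr P" "T n P" "%t. Rel n P #>\<^bsub>Fr P\<^esub> t"
  using T_grp by (intro hom_grp_hom proj_hom group_free_Abelian_group) (simp add: comm_group_def)
 show "car (T n P)<=kap n P ` car P"
 proof
  fix X assume "X : car (T n P)"
  then obtain t where t: "keys t <= car k \<times> car P" "X = Rel n P #>\<^bsub>Fr P\<^esub> t" by (auto simp: T_simps carrier_FactGroup)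
  have "t : car (Fr P) & (EX x:car P. Rel n P #>\<^bsub>Fr P\<^esub> t = kap n P x)"
  proof (rule free_Abelian_group_induct[OF t(1)])
   show "0 : car (Fr P) & (EX x:car P. Rel n P #>\<^bsub>Fr P\<^esub> 0 = kap n P x)"
    using p.hom_one kap_zero by (auto intro!: bexI[of _ "\<zero>[P]"])
  next
   fix s t :: "'k \<times> 'p \<Rightarrow>\<^sub>0 int"
   assume "s : car (Fr P) & (EX x:car P. Rel n P #>\<^bsub>Fr P\<^esub> s = kap n P x)" "t : car (Fr P) & (EX x:car P. Rel n P #>\<^bsub>Fr P\<^esub> t = kap n P x)"
   then obtain x y where s: "s : car (Fr P)" "x : car P" "Rel n P #>\<^bsub>Fr P\<^esub> s = kap n P x"
    and t: "t : car (Fr P)" "y : car P" "Rel n P #>\<^bsub>Fr P\<^esub> t = kap n P y" by blast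
   have "Rel n P #>\<^bsub>Fr P\<^esub> (s - t) = kap n P (x \<ominus>[P] y)"
    using p.hom_mult[OF s(1) p.G.inv_closed[OF t(1)]] p.hom_inv[OF t(1)] s t by (simp add: kap_mns)
   thus "s - t : car (Fr P) & (EX x:car P. Rel n P #>\<^bsub>Fr P\<^esub> (s - t) = kap n P x)"
    using s t keys_diff_sub(1)[of s "car k \<times> car P" t] by auto
  next
   fix p assume "p : car k \<times> car P"
   then obtain c x where p: "p = (c,x)" "c : car k" "x : car P" by auto
   show "frg p : car (Fr P) & (EX x:car P. Rel n P #>\<^bsub>Fr P\<^esub> frg p = kap n P x)"
   using p P_smult ten_smult[OF const(1)[OF p(2)] one_closed p(3)] const(1)[OF p(2)] const(2) by (auto simp: ten_def)
  qed
  thus "X : kap n P ` car P" using t(2) by blast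
 qed
 show "kap n P ` car P <= car (T n P)" using ten_cl by auto
qed

end

text \<open>Compatibility with the augmentations makes the identity of \<open>k\<close> linear along
  \<open>ph\<close>, so that maps of tensor products are induced. Both the identity and the
  inclusion of algebras are of this kind.\<close>

definition aug_map where
 "aug_map n n' ph <-> ring_map (BR n) (BR n') ph & (ALL a:fsupp k (diagrams n). tau n' (ph a) = tau n a)"

lemma aug_map: "aug_map n n' ph==>a : fsupp k (diagrams n)==>ph a : fsupp k (diagrams n') & tau n' (ph a) = tau n a"
 using ring_mapD(1)[of "BR n" "BR n'" ph a] by (simp add: aug_map_def)

lemma aug_map_id: "aug_map n n id" by (simp add: aug_map_def ring_map_id)

lemma ten_map_kap:
 fixes P :: "('k,'p) bmod" and P' :: "('k,'r) bmod"
 assumes P: "left_module (BR n) P" and P': "left_module (BR n') P'" and f: "lin_along (BR n) ph P P' f"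
  and ph: "aug_map n n' ph" and x: "x : car P"
 shows "tensor_map (BR n') (triv n') P' id f (kap n P x) = kap n' P' (f x)"
proof -
 note fD = linD[OF f]
 let ?F = "fex (%(c,x). frg (id c,f x))"
 let ?G = "%t. Rel n' P' #>\<^bsub>Fr P'\<^esub> ?F t"
 have T: "group (T n' P')" using T_grp[OF P'] by (simp add: comm_group_def)
 have "?F : hom (Fr P) (Fr P')" by (rule hom_fext) (auto simp: fD(1))
 from hom_compose[OF this proj_hom[OF P']] have g: "?G : hom (Fr P) (T n' P')" by (simp add: comp_def)
 have G: "?G (frg (c,x)) = ten n' P' c (f x)" for c x by (simp add: ten_def)
 have "Rel n P<=kernel (Fr P) (T n' P') ?G"
 proof (rule Rel_kernel[OF P T g])
  show "?G (frg (tau n a \<otimes> c,y)) = ?G (frg (c,a \<odot>[P] y))" if "a : fsupp k (diagrams n)" "c : car k" "y : car P" for a c y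
   unfolding G using ten_smult[OF P' conjunct1[OF aug_map[OF ph that(1)]] that(2) fD(1)[OF that(3)]] fD(3)[of a y] that aug_map[OF ph that(1)] by simp
 qed (simp_all only: G fD ten_add_left[OF P'] ten_add_r[OF P'])
 from quo_map_into_cos[OF hom_grp_hom[OF g group_free_Abelian_group T] this Rel_sg[OF P] frag_cl[OF P one_closed x]]
 show ?thesis by (simp add: tensor_map_def quotient_map_into_def ten_def)
qed

end

lemma sg_shift:
 assumes G: "abelian_group G" and B: "subgroup B (add_monoid G)" and c: "u : car G" "v : car G"
 shows "[|u \<ominus>[G] v : B; v : B|]==>u : B" "u \<ominus>[G] v : B==>v \<ominus>[G] u : B"
  "[|w : car G; u \<ominus>[G] v : B; v \<ominus>[G] w : B|]==>u \<ominus>[G] w : B"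
proof -
 interpret G: abelian_group G by (rule G)
 note B = subgroup.m_closed[OF B, simplified] subgroup.m_inv_closed[OF B, folded a_inv_def]
 show "[|u \<ominus>[G] v : B; v : B|]==>u : B" using B(1) c G.a_assoc G.l_neg by (fastforce simp: amd)
 show "u \<ominus>[G] v : B==>v \<ominus>[G] u : B" using B(2) c G.minus_add G.a_comm by (fastforce simp: amd)
 show "u \<ominus>[G] w : B" if "w : car G" and h: "u \<ominus>[G] v : B" "v \<ominus>[G] w : B"
 proof -
  show ?thesis using B(1)[OF h] c that(1) G.a_assoc G.r_neg1 by (auto simp: amd)
 qed
qed

context rook
begin

text \<open>Cycles of the tensored complex, pulled back to elements of \<open>P q\<close> along
  \<open>kap\<close>; \<open>Bd\<close> does the same for boundaries.\<close>

definition Zc where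
 "Zc n P d q x <-> x : car (P q) & (ALL i. q = Suc i --> d i x : Aug n (P i))"

definition Bd where
 "Bd n P d q = {x : car (P q). EX y:car (P (Suc q)). kap n (P q) x = kap n (P q) (d q y)}"

lemma Zc_car: "Zc n P d q x==>x : car (P q)" by (simp add: Zc_def)

lemma ten_map_hom:
 assumes P: "left_module (BR n) P" and P': "left_module (BR n') P'" and f: "lin_along (BR n) ph P P' f" and ph: "aug_map n n' ph"
 shows "tensor_map (BR n') (triv n') P' id f : hom (T n P) (T n' P')"
proof (rule homI)
 note t = ten_map_kap[OF P P' f ph] and fD = linD[OF f]
 fix X assume "X : car (T n P)"
 then obtain x where x: "x : car P" "X = kap n P x" unfolding kap_img[OF P, symmetric] by auto
 show "tensor_map (BR n') (triv n') P' id f X : car (T n' P')"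
  unfolding x(2) t[OF x(1)] by (rule ten_cl[OF P' one_closed fD(1)[OF x(1)]])
 fix Y assume "Y : car (T n P)"
 then obtain y where y: "y : car P" "Y = kap n P y" unfolding kap_img[OF P, symmetric] by auto
 show "tensor_map (BR n') (triv n') P' id f (X \<otimes>[T n P] Y) = tensor_map (BR n') (triv n') P' id f X \<otimes>[T n' P'] tensor_map (BR n') (triv n') P' id f Y"
  unfolding x(2) y(2) ten_add_r[OF P one_closed x(1) y(1), symmetric] t[OF x(1)] t[OF y(1)] t[OF P_add[OF P x(1) y(1)]]
   fD(2)[OF x(1) y(1)] by (rule ten_add_r[OF P' one_closed fD(1)[OF x(1)] fD(1)[OF y(1)]])
qed

context
 fixes n :: nat and P :: "nat=>('k,'p) bmod" and d :: "nat=>'p=>'p" and e :: "'p=>'k"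
 assumes res: "resolution (BR n) (triv n) P d e"
begin

lemmas rd = resD[OF res]

lemma ten_d: "x : car (P (Suc i))==>tensor_map (BR n) (triv n) (P i) id (d i) (kap n (P (Suc i)) x) = kap n (P i) (d i x)"
 by (rule ten_map_kap[OF rd(2) rd(2) rd(4) aug_map_id])

lemma ten_d_hom: "group_hom (T n (P (Suc i))) (T n (P i)) (tensor_map (BR n) (triv n) (P i) id (d i))"
 using T_grp[OF rd(2)] by (intro hom_grp_hom ten_map_hom[OF rd(2) rd(2) rd(4) aug_map_id]) (simp_all add: comm_group_def)

lemma Bd_sg: "subgroup (Bd n P d q) (add_monoid (P q))"
proof -
 interpret Q: abelian_group "P q" by (rule rd(3))
 interpret S: abelian_group "P (Suc q)" by (rule rd(3))
 note k = kap_mns[OF rd(2)] and a = amap_mns_eq[OF rd(3) rd(3) lin_amap[OF rd(4)]] and dc = linD(1)[OF rd(4)]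
 have m: "x \<ominus>[P q] y : Bd n P d q" if xy: "x : Bd n P d q" "y : Bd n P d q" for x y
 proof -
  obtain u v where "x : car (P q)" "u : car (P (Suc q))" "kap n (P q) x = kap n (P q) (d q u)"
   "y : car (P q)" "v : car (P (Suc q))" "kap n (P q) y = kap n (P q) (d q v)" using xy by (auto simp: Bd_def)
  thus ?thesis unfolding Bd_def by (intro CollectI conjI bexI[of _ "u \<ominus>[P (Suc q)] v"]) (simp_all add: k a dc)
 qed
 have z: "\<zero>[P q] : Bd n P d q" unfolding Bd_def
  by (intro CollectI conjI bexI[of _ "\<zero>[P (Suc q)]"]) (simp_all add: amap_zero[OF rd(3) rd(3) lin_amap[OF rd(4)]])
 have c: "Bd n P d q <= car (P q)" by (auto simp: Bd_def)
 have n: "\<ominus>[P q] x : Bd n P d q" if "x : Bd n P d q" for x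
  using m[OF z that] subsetD[OF c that] by (simp add: amd)
 have "x \<oplus>[P q] y : Bd n P d q" if "x : Bd n P d q" "y : Bd n P d q" for x y
  using m[OF that(1) n[OF that(2)]] subsetD[OF c] that by (simp add: amd)
 thus ?thesis using z c n by (intro group.subgroupI[OF Q.a_group]) (auto simp flip: a_inv_def)
qed

lemma Zc_d: "y : car (P (Suc q))==>Zc n P d q (d q y)"
 using rd(8)[of y q] linD(1)[OF rd(4)] by (auto simp: Zc_def cyc_simps Aug_iff[OF rd(2)] kap_zero[OF rd(2)] abelian_group.axioms(1)[OF rd(3)] abelian_monoid.zero_closed)

lemma kap_cycle: "x : car (P q)==>kap n (P q) x : tor_cycles (BR n) (triv n) P d q <-> Zc n P d q x"
 by (cases q) (auto simp: tor_cycles_def Zc_def kernel_def ten_cl[OF rd(2)] ten_d Aug_iff[OF rd(2)] linD(1)[OF rd(4)])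

lemma cyc_sg: "subgroup (tor_cycles (BR n) (triv n) P d q) (T n (P q))"
 using group_hom.subgroup_kernel[OF ten_d_hom] group.subgroup_self[of "T n (P 0)"] T_grp[OF rd(2)]
 by (cases q) (simp_all add: tor_cycles_def comm_group_def)

lemma tor_cycE: "X : tor_cycles (BR n) (triv n) P d q==>EX x. Zc n P d q x & X = kap n (P q) x"
 using subgroup.mem_carrier[OF cyc_sg] kap_cycle unfolding kap_img[OF rd(2), symmetric] by blast

lemma tor_bds_eq: "tor_boundaries (BR n) (triv n) P d q = (%y. kap n (P q) (d q y)) ` car (P (Suc q))"
 unfolding tor_boundaries_def kap_img[OF rd(2), symmetric] image_image by (rule image_cong[OF HOL.refl ten_d])

lemma kap_boundary: "x : car (P q)==>kap n (P q) x : tor_boundaries (BR n) (triv n) P d q <-> x : Bd n P d q"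
 by (auto simp: tor_bds_eq Bd_def)

lemma bds_sg:
 "subgroup (tor_boundaries (BR n) (triv n) P d q) ((T n (P q))\<lparr>carrier := tor_cycles (BR n) (triv n) P d q\<rparr>)"
proof (rule group.subgroup_incl[OF comm_group.axioms(2)[OF T_grp[OF rd(2)]] _ cyc_sg])
 show "subgroup (tor_boundaries (BR n) (triv n) P d q) (T n (P q))"
  unfolding tor_boundaries_def by (rule group_hom.img_is_subgroup[OF ten_d_hom])
 show "tor_boundaries (BR n) (triv n) P d q<=tor_cycles (BR n) (triv n) P d q"
  using kap_cycle[OF linD(1)[OF rd(4)]] Zc_d by (auto simp: tor_bds_eq)
qed

lemma cyc_grp: "comm_group ((T n (P q))\<lparr>carrier := tor_cycles (BR n) (triv n) P d q\<rparr>)"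
 using subgroup.mem_carrier[OF cyc_sg] comm_monoid.m_comm[OF comm_group.axioms(1)[OF T_grp[OF rd(2)]]]
 by (intro group.group_comm_groupI[OF group.subgroup_imp_group[OF comm_group.axioms(2)[OF T_grp[OF rd(2)]] cyc_sg]]) simp

end

lemma ch_map_Zc:
 assumes S: "resolution (BR n) (triv n) S dS eS" and U: "resolution (BR n') (triv n') U dU eU" and ph: "aug_map n n' ph"
  and f: "resolution_map (BR n) ph nu0 S dS eS U dU eU f"
 shows "x : car (S i)==>tensor_map (BR n') (triv n') (U i) id (f i) (kap n (S i) x) = kap n' (U i) (f i x)"
  "Zc n S dS q x==>Zc n' U dU q (f q x)" "x : Bd n S dS q==>f q x : Bd n' U dU q"
proof -
 note sd = resD[OF S] and ud = resD[OF U]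
 have fl: "lin_along (BR n) ph (S i) (U i) (f i)" and fd: "!!x. x : car (S (Suc i))==>f i (dS i x) = dU i (f (Suc i) x)" for i
  using f by (simp_all add: resolution_map_def)
 have t: "tensor_map (BR n') (triv n') (U i) id (f i) (kap n (S i) x) = kap n' (U i) (f i x)" if "x : car (S i)" for i x
  by (rule ten_map_kap[OF sd(2) ud(2) fl ph that])
 thus "x : car (S i)==>tensor_map (BR n') (triv n') (U i) id (f i) (kap n (S i) x) = kap n' (U i) (f i x)" .
 have a: "f i y : Aug n' (U i)" if "y : Aug n (S i)" for i y
 proof -
  note y = that[unfolded Aug_iff[OF sd(2)]]
  have "kap n' (U i) (f i y) = \<one>[T n' (U i)]"
   using t[of y i] t[of "\<zero>[S i]" i] y amap_zero[OF sd(3) ud(3) lin_amap[OF fl]] abelian_monoid.zero_closed[OF abelian_group.axioms(1)[OF sd(3)]]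
   by (simp add: kap_zero[OF sd(2)] kap_zero[OF ud(2)])
  thus ?thesis using y linD(1)[OF fl] by (simp add: Aug_iff[OF ud(2)])
 qed
 show "Zc n' U dU q (f q x)" if "Zc n S dS q x" using that a linD(1)[OF fl] by (auto simp: Zc_def simp flip: fd)
 show "f q x : Bd n' U dU q" if x: "x : Bd n S dS q"
 proof -
  obtain y where y: "x : car (S q)" "y : car (S (Suc q))" "kap n (S q) x = kap n (S q) (dS q y)" using x by (auto simp: Bd_def)
  hence "kap n' (U q) (f q x) = kap n' (U q) (dU q (f (Suc q) y))"
   using t[of x q] t[of "dS q y" q] linD(1)[OF sd(4)] fd[of y q] by simp
  thus ?thesis using y linD(1)[OF fl] by (auto simp: Bd_def)
 qed
qed

text \<open>For a cycle \<open>x\<close> the element \<open>d x\<close> is trivial in the tensor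
  product, and so is its image under the homotopy. Only the boundary of \<open>h x\<close>
  remains.\<close>

lemma htpc_Bd:
 assumes S: "resolution (BR n) (triv n) S dS eS" and U: "resolution (BR n') (triv n') U dU eU" and ph: "aug_map n n' ph"
  and f: "resolution_map (BR n) ph nu0 S dS eS U dU eU f" and g: "resolution_map (BR n) ph nu0 S dS eS U dU eU g"
  and l: "!!i. lifts (BR n) ph (S i) (U (Suc i)) (U i) (dU i)" and x: "Zc n S dS q x"
 shows "f q x \<ominus>[U q] g q x : Bd n' U dU q"
proof -
 note sd = resD[OF S] and ud = resD[OF U]
 obtain h where h: "!!i. lin_along (BR n) ph (S i) (U (Suc i)) (h i)"
  "!!x. x : car (S 0)==>f 0 x \<ominus>[U 0] g 0 x = dU 0 (h 0 x)"
  "!!i x. x : car (S (Suc i))==>f (Suc i) x \<ominus>[U (Suc i)] g (Suc i) x \<ominus>[U (Suc i)] h i (dS i x) = dU (Suc i) (h (Suc i) x)"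
  by (rule ch_htpy_ex[OF S U conjunct1[OF ph[unfolded aug_map_def]] f g l]) (rule that)
 have fl: "lin_along (BR n) ph (S i) (U i) (f i)" and gl: "lin_along (BR n) ph (S i) (U i) (g i)" for i
  using f g by (simp_all add: resolution_map_def)
 have xc: "x : car (S q)" using x by (simp add: Zc_def)
 interpret Q: abelian_group "U q" by (rule ud(3))
 define y where "y = f q x \<ominus>[U q] g q x"
 have yc: "y : car (U q)" unfolding y_def using linD(1)[OF fl xc] linD(1)[OF gl xc] by simp
 have "kap n' (U q) y = kap n' (U q) (dU q (h q x))"
 proof (cases q)
  case 0
  thus ?thesis using h(2)[of x] xc by (simp add: y_def)
 next
  case (Suc i)
  have dx: "dS i x : car (S i)" "kap n (S i) (dS i x) = \<one>[T n (S i)]" using x Suc by (simp_all add: Zc_def Aug_iff[OF sd(2)])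
  note t = ten_map_kap[OF sd(2)[of i] ud(2)[of "Suc i"] h(1)[of i] ph]
  have "kap n' (U q) (h i (dS i x)) = \<one>[T n' (U q)]"
   using t[OF dx(1)] t[OF abelian_monoid.zero_closed[OF abelian_group.axioms(1)[OF sd(3)[of i]]]] amap_zero[OF sd(3)[of i] ud(3)[of "Suc i"] lin_amap[OF h(1)[of i]]]
   by (simp add: dx(2) kap_zero[OF sd(2)] kap_zero[OF ud(2)] Suc)
  moreover have hc: "h i (dS i x) : car (U q)" using linD(1)[OF h(1) dx(1)] Suc by simp
  ultimately have "kap n' (U q) y = kap n' (U q) (y \<ominus>[U q] h i (dS i x))"
   using kap_mns[OF ud(2) yc hc] ten_cl[OF ud(2) one_closed yc] T_grp[OF ud(2)[of q]] by (simp add: comm_group_def group_def monoid.inv_one)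
  thus ?thesis using h(3)[of x i] xc by (simp add: y_def Suc)
 qed
 thus ?thesis using yc linD(1)[OF h(1) xc] unfolding Bd_def y_def by blast
qed

text \<open>The quotients of tensor products are unfolded here once and for all: bijectivity is
  tested on elements of the resolutions, up to \<open>Bd\<close>.\<close>

theorem tor_map_iso:
 assumes S: "resolution (BR n) (triv n) S dS eS" and U: "resolution (BR n') (triv n') U dU eU" and ph: "aug_map n n' ph"
  and f: "resolution_map (BR n) ph id S dS eS U dU eU f"
  and inj: "!!x. [|Zc n S dS q x; f q x : Bd n' U dU q|]==>x : Bd n S dS q"
  and surj: "!!y. Zc n' U dU q y==>EX x. Zc n S dS q x & y \<ominus>[U q] f q x : Bd n' U dU q"
 shows "tor_map (BR n') (triv n') U dU id f q : iso (tor (BR n) (triv n) S dS q) (tor (BR n') (triv n') U dU q)"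
 unfolding tor_map_def tor_def
proof (rule quo_map_iso)
 note sd = resD[OF S] and ud = resD[OF U] and c = ch_map_Zc[OF S U ph f]
 have fl: "lin_along (BR n) ph (S q) (U q) (f q)" using f by (simp add: resolution_map_def)
 note fc = linD(1)[OF fl]
 show "group ((T n (S q))\<lparr>carrier := tor_cycles (BR n) (triv n) S dS q\<rparr>)" using cyc_grp[OF S] by (simp only: comm_group_def)
 show "comm_group ((T n' (U q))\<lparr>carrier := tor_cycles (BR n') (triv n') U dU q\<rparr>)" by (rule cyc_grp[OF U])
 show "subgroup (tor_boundaries (BR n') (triv n') U dU q) ((T n' (U q))\<lparr>carrier := tor_cycles (BR n') (triv n') U dU q\<rparr>)"
  by (rule bds_sg[OF U])
 show "tor_boundaries (BR n) (triv n) S dS q <= car ((T n (S q))\<lparr>carrier := tor_cycles (BR n) (triv n) S dS q\<rparr>)"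
  by (rule subgroup.subset[OF bds_sg[OF S]])
 have m: "tensor_map (BR n') (triv n') (U q) id (f q) X : tor_cycles (BR n') (triv n') U dU q" if X: "X : tor_cycles (BR n) (triv n) S dS q" for X
 proof -
  obtain x where "Zc n S dS q x & X = kap n (S q) x" by (rule exE[OF tor_cycE[OF S X]])
  thus ?thesis using kap_cycle[OF U, of "f q x" q] c(1)[of x q] c(2)[of q x] fc[of x] Zc_car[of n S dS q x] by simp
 qed
 show "tensor_map (BR n') (triv n') (U q) id (f q) : hom ((T n (S q))\<lparr>carrier := tor_cycles (BR n) (triv n) S dS q\<rparr>) ((T n' (U q))\<lparr>carrier := tor_cycles (BR n') (triv n') U dU q\<rparr>)"
 proof (rule homI)
  fix X Y assume "X : car ((T n (S q))\<lparr>carrier := tor_cycles (BR n) (triv n) S dS q\<rparr>)" "Y : car ((T n (S q))\<lparr>carrier := tor_cycles (BR n) (triv n) S dS q\<rparr>)"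
  hence "X : car (T n (S q))" "Y : car (T n (S q))" using subgroup.mem_carrier[OF cyc_sg[OF S]] by simp_all
  from hom_mult[OF ten_map_hom[OF sd(2) ud(2) fl ph] this]
  show "tensor_map (BR n') (triv n') (U q) id (f q) (X \<otimes>[(T n (S q))\<lparr>carrier := tor_cycles (BR n) (triv n) S dS q\<rparr>] Y)
   = tensor_map (BR n') (triv n') (U q) id (f q) X \<otimes>[(T n' (U q))\<lparr>carrier := tor_cycles (BR n') (triv n') U dU q\<rparr>] tensor_map (BR n') (triv n') (U q) id (f q) Y" by simp
 qed (simp add: m)
 show "tensor_map (BR n') (triv n') (U q) id (f q) X : tor_boundaries (BR n') (triv n') U dU q <-> X : tor_boundaries (BR n) (triv n) S dS q"
  if X: "X : car ((T n (S q))\<lparr>carrier := tor_cycles (BR n) (triv n) S dS q\<rparr>)" for X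
 proof -
  obtain x where x: "Zc n S dS q x & X = kap n (S q) x" using tor_cycE[OF S, of X q] X by auto
  note xc = Zc_car[OF conjunct1[OF x]]
  show ?thesis unfolding conjunct2[OF x] c(1)[OF xc] kap_boundary[OF U fc[OF xc]] kap_boundary[OF S xc]
   by (rule iffI[OF inj[OF conjunct1[OF x]] c(3)])
 qed
 show "EX X:car ((T n (S q))\<lparr>carrier := tor_cycles (BR n) (triv n) S dS q\<rparr>). Y \<otimes>[(T n' (U q))\<lparr>carrier := tor_cycles (BR n') (triv n') U dU q\<rparr>]
   inv\<^bsub>(T n' (U q))\<lparr>carrier := tor_cycles (BR n') (triv n') U dU q\<rparr>\<^esub> tensor_map (BR n') (triv n') (U q) id (f q) X : tor_boundaries (BR n') (triv n') U dU q"
  if Y: "Y : car ((T n' (U q))\<lparr>carrier := tor_cycles (BR n') (triv n') U dU q\<rparr>)" for Y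
 proof -
  obtain y where y: "Zc n' U dU q y & Y = kap n' (U q) y" using tor_cycE[OF U, of Y q] Y by auto
  obtain x where x: "Zc n S dS q x & y \<ominus>[U q] f q x : Bd n' U dU q" using surj[OF conjunct1[OF y]] by (rule exE)
  note xc = Zc_car[OF conjunct1[OF x]] and yc = Zc_car[OF conjunct1[OF y]]
  have X: "kap n (S q) x : tor_cycles (BR n) (triv n) S dS q" using kap_cycle[OF S xc] x by simp
  have "inv\<^bsub>(T n' (U q))\<lparr>carrier := tor_cycles (BR n') (triv n') U dU q\<rparr>\<^esub> kap n' (U q) (f q x) = inv\<^bsub>T n' (U q)\<^esub> kap n' (U q) (f q x)"
   by (rule group.m_inv_consistent[OF comm_group.axioms(2)[OF T_grp[OF ud(2)]] cyc_sg[OF U]]) (use m[OF X] c(1)[OF xc] in simp)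
  thus ?thesis using x y X kap_boundary[OF U, of "y \<ominus>[U q] f q x" q] kap_mns[OF ud(2) yc fc[OF xc]]
   by (intro bexI[of _ "kap n (S q) x"]) (auto simp: c(1)[OF xc] Bd_def)
 qed
qed

end

section \<open>Tor from the Salvetti resolution\<close>

context rook
begin

text \<open>The cell over \<open>X\<close> is \<open>X\<close> applied to the cell over the trivial
  braid. Since \<open>X\<close> has augmentation 1, it disappears when it is moved to the other
  tensor factor.\<close>

lemma base_cell_kap:
 assumes R: "ring (BR n)" and x: "x : fsupp k (cells n i)"
 shows "kap n (Qmod n i) (klift (base_cell n) (klift forget x)) = kap n (Qmod n i) x" using x
proof (induction rule: fs_ind)
 case zero
 thus ?case by (simp add: klift_zero)
next
 case (add b c g)
 note P = Qmod_l_mod[OF R, of i]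
 let ?r = "%x. klift (base_cell n) (klift forget x)"
 have s: "single k b c : fsupp k (cells n i)" by (rule fs_sg[OF add(1,2)])
 have rc: "?r y : fsupp k (cells n i)" if "y : fsupp k (cells n i)" for y by (rule base_cell_cl(1)[OF fgt_cl[OF that]])
 obtain X J where b: "b = (X,J)" by (cases b)
 have X: "X : fdias n" "J<={1..<n}" "card J = i" using add(1) by (auto simp: b cells_def)
 note o1 = bgrp_one[of n]
 have oJ: "(idd n,J) : cells n i" using X o1 by (simp add: cells_def)
 let ?o = "single k (idd n,J) \<one>"
 have e: "kap n (Qmod n i) (single k (Y,J) c) = ten n (Qmod n i) c ?o" if Y: "Y : fdias n" for Y
 proof -
  have Yd: "Y : diagrams n" "nomiss n Y" using Y by (simp_all add: fdias_def)
  show ?thesis using ten_smult[OF P fs_sg[OF Yd(1) add(2)] one_closed, of ?o] fs_sg[OF oJ one_closed] add(2) Yd(2)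
   by (simp add: tau_sg act_sg_sg[OF Yd(1) add(2) oJ one_closed] bgrp_one_simps[OF Y])
 qed
 have "?r (single k b c) = single k (idd n,J) c"
  using add(2) by (simp add: b klift_sg forget_def cvec_of base_cell_def)
 hence rs: "kap n (Qmod n i) (?r (single k b c)) = kap n (Qmod n i) (single k b c)" using e[OF X(1)] e[OF o1] by (simp add: b)
 have "?r (%z. single k b c z \<oplus> g z) = (%z. ?r (single k b c) z \<oplus> ?r g z)"
  unfolding klift_add[OF s add(3)] by (rule klift_add[OF fgt_cl[OF s] fgt_cl[OF add(3)]])
 thus ?case
  using ten_add_r[OF P one_closed, of "?r (single k b c)" "?r g"] ten_add_r[OF P one_closed, of "single k b c" g] rc[OF s] rc[OF add(3)] s add(3)
  by (simp add: rs add(4))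
qed

text \<open>By \<open>Rel_kernel\<close>, \<open>forget\<close> factors through the tensor product;
  conversely, \<open>base_cell_kap\<close> recovers the tensor from its image. So tensoring leaves
  exactly the chains on the types \<open>J\<close>.\<close>

lemma Aug_fgt:
 assumes R: "ring (BR n)" and x: "x : fsupp k (cells n i)"
 shows "x : Aug n (Qmod n i) <-> klift forget x = (%J. \<zero>)"
proof
 note P = Qmod_l_mod[OF R, of i]
 show "x : Aug n (Qmod n i)" if z: "klift forget x = (%J. \<zero>)"
  using base_cell_kap[OF R x] kap_zero[OF P] x by (simp add: z klift_zero Aug_iff[OF P])
 let ?N = "FM k UNIV :: ('k,nat set=>'k) module"
 let ?f = "%(c,x). scal c (klift forget x)"
 interpret N: abelian_group ?N by (rule fag)
 have fc: "klift forget y : fsupp k UNIV" if "y : fsupp k (cells n i)" for y by (rule klift_cl[OF that]) simp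
 have "?f ` (car k \<times> car (Qmod n i)) <= car (add_monoid ?N)" using fc scal_cl by auto
 from comm_group.free_Abelian_group_universal[OF N.a_comm_group this] obtain g where g: "g : hom (Fr (Qmod n i)) (add_monoid ?N)"
  "!!p. p : car k \<times> car (Qmod n i)==>g (frg p) = ?f p" by blast
 have gf: "g (frg (c,y)) = scal c (klift forget y)" if "c : car k" "y : fsupp k (cells n i)" for c y
  using g(2)[of "(c,y)"] that by simp
 have "Rel n (Qmod n i)<=kernel (Fr (Qmod n i)) (add_monoid ?N) g"
 proof (rule Rel_kernel[OF P N.a_group g(1)])
  show "g (frg (c \<oplus> c',y)) = g (frg (c,y)) \<otimes>[add_monoid ?N] g (frg (c',y))"
   if "c : car k" "c' : car k" "y : car (Qmod n i)" for c c' y using that by (simp add: gf scal_add_l[OF _ _ fc])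
  show "g (frg (c,y \<oplus>[Qmod n i] y')) = g (frg (c,y)) \<otimes>[add_monoid ?N] g (frg (c,y'))"
   if "c : car k" "y : car (Qmod n i)" "y' : car (Qmod n i)" for c y y'
   using that fsD(1)[OF fc, of y] fsD(1)[OF fc, of y'] fs_add[of y _ y']
   by (simp add: gf fgt_add[of _ "cells n i"] fs_add) (simp add: scal_def r_distr)
  show "g (frg (tau n a \<otimes> c,y)) = g (frg (c,a \<odot>[Qmod n i] y))"
   if "a : fsupp k (diagrams n)" "c : car k" "y : car (Qmod n i)" for a c y
   using that fsD(1)[OF fc, of y] tau_cl[OF that(1)] by (simp add: gf act_cl fgt_act) (simp add: scal_def m_ac)
 qed
 moreover assume "x : Aug n (Qmod n i)"
 hence "Rel n (Qmod n i) #>\<^bsub>Fr (Qmod n i)\<^esub> frg (\<one>,x) = Rel n (Qmod n i)"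
  unfolding Aug_iff[OF P] by (simp add: ten_def T_simps)
 hence "frg (\<one>,x) : Rel n (Qmod n i)"
  by (rule group.coset_join1[OF group_free_Abelian_group _ _ Rel_sg[OF P]]) (use x in simp)
 ultimately have "g (frg (\<one>,x)) = (%J. \<zero>)" by (auto simp: kernel_def)
 thus "klift forget x = (%J. \<zero>)" using gf[OF one_closed x] fsD(1)[OF fc[OF x]] by (simp add: scal_def)
qed

lemma fgt_diff:
 "[|x : fsupp k (cells n i); y : fsupp k (cells n i)|]==>klift forget (x \<ominus>[Qmod n i] y) = (%J. klift forget x J \<ominus> klift forget y J)"
 by (simp add: Qmod_diff klift_diff)

lemma Qmod_Zc:
 assumes R: "ring (BR n)" and x: "x : fsupp k (cells n q)"
 shows "Zc n (Qmod n) (qd n) q x <-> klift (cbdry n) (klift forget x) = (%J. \<zero>)"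
proof (cases q)
 case 0
 thus ?thesis using x cbdry_zero_cells[OF fgt_cl[OF x[unfolded 0]]] by (simp add: Zc_def)
next
 case (Suc i)
 show ?thesis using x Aug_fgt[OF R kbdry_cl[OF x[unfolded Suc]]] by (simp add: Zc_def Suc fgt_bdry_klift[OF x])
qed

lemma Qmod_Bd:
 assumes R: "ring (BR n)" and x: "x : fsupp k (cells n q)"
 shows "x : Bd n (Qmod n) (qd n) q <-> (EX w:fsupp k (ccells n (Suc q)). klift forget x = klift (cbdry n) w)"
proof -
 have e: "kap n (Qmod n q) x = kap n (Qmod n q) (klift (bdry n) y) <-> klift forget x = klift (cbdry n) (klift forget y)"
  if y: "y : fsupp k (cells n (Suc q))" for y
 proof -
  interpret Q: abelian_group "Qmod n q" by (rule Qmod_grp)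
  note by' = kbdry_cl[OF y]
  have c: "x \<ominus>[Qmod n q] klift (bdry n) y : fsupp k (cells n q)" using Q.minus_closed[of x "klift (bdry n) y"] x by' by simp
  have "klift forget (x \<ominus>[Qmod n q] klift (bdry n) y) = (%J. \<zero>) <-> klift forget x = klift forget (klift (bdry n) y)"
   unfolding fgt_diff[OF x by'] feq by (simp add: diff_zero_iff fsD(1)[OF fgt_cl[OF x]] fsD(1)[OF fgt_cl[OF by']])
  thus ?thesis using kap_eq_iff[OF Qmod_l_mod[OF R], of x q "klift (bdry n) y"] x by' Aug_fgt[OF R c] fgt_bdry_klift[OF y] by simp
 qed
 show ?thesis
 proof
  assume "x : Bd n (Qmod n) (qd n) q"
  then obtain y where y: "y : fsupp k (cells n (Suc q))" "kap n (Qmod n q) x = kap n (Qmod n q) (klift (bdry n) y)" by (auto simp: Bd_def)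
  thus "EX w:fsupp k (ccells n (Suc q)). klift forget x = klift (cbdry n) w" using e[OF y(1)] fgt_cl[OF y(1)] by blast
 next
  assume "EX w:fsupp k (ccells n (Suc q)). klift forget x = klift (cbdry n) w"
  then obtain w where w: "w : fsupp k (ccells n (Suc q))" "klift forget x = klift (cbdry n) w" by blast
  note bw = base_cell_cl[OF w(1)]
  show "x : Bd n (Qmod n) (qd n) q" unfolding Bd_def
   using x by (intro CollectI conjI bexI[of _ "klift (base_cell n) w"]) (simp_all add: e[OF bw(1)] bw w(2))
 qed
qed

text \<open>\<open>stb_inj\<close> and \<open>stb_surj\<close> carry over because
  \<open>cell_inc\<close> leaves the types of cells unchanged (\<open>fgt_inc\<close>).\<close>

lemma Qmod_stb:
 assumes n: "n >= 2 * q + 1" and R: "ring (BR (n - 1))" and R': "ring (BR n)"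
 shows "[|x : fsupp k (cells (n - 1) q); klift (cell_inc n) x : Bd n (Qmod n) (qd n) q|]==>x : Bd (n - 1) (Qmod (n - 1)) (qd (n - 1)) q"
  "Zc n (Qmod n) (qd n) q y==>EX x. Zc (n - 1) (Qmod (n - 1)) (qd (n - 1)) q x & y \<ominus>[Qmod n q] klift (cell_inc n) x : Bd n (Qmod n) (qd n) q"
proof -
 have n1: "n >= 1" using n by simp
 have gc: "klift (cell_inc n) x : fsupp k (cells n i)" if "x : fsupp k (cells (n - 1) i)" for x i
  by (rule klift_cl[OF that cell_inc_keys[OF n1]])
 show "x : Bd (n - 1) (Qmod (n - 1)) (qd (n - 1)) q"
  if x: "x : fsupp k (cells (n - 1) q)" and b: "klift (cell_inc n) x : Bd n (Qmod n) (qd n) q"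
 proof -
  from b obtain w where w: "w : fsupp k (ccells n (Suc q))" "klift forget x = klift (cbdry n) w"
   unfolding Qmod_Bd[OF R' gc[OF x]] fgt_inc[OF x] by blast
  obtain v where v: "v : fsupp k (ccells (n - 1) (Suc q))" "klift (cbdry n) v = klift (cbdry n) w"
   by (metis fgt_cl x w(2) stb_inj w(1) n)
  show ?thesis unfolding Qmod_Bd[OF R x] using v w(2) cbdry_pred_klift[OF v(1)] by (intro bexI[of _ v]) simp_all
 qed
 show "EX x. Zc (n - 1) (Qmod (n - 1)) (qd (n - 1)) q x & y \<ominus>[Qmod n q] klift (cell_inc n) x : Bd n (Qmod n) (qd n) q"
  if c: "Zc n (Qmod n) (qd n) q y"
 proof -
  have y: "y : fsupp k (cells n q)" using Zc_car[OF c] by simp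
  have "klift (cbdry n) (klift forget y) = (%J. \<zero>)" using c Qmod_Zc[OF R' y] by simp
  from stb_surj[OF fgt_cl[OF y] n this] obtain u g where g: "u : fsupp k (ccells n (Suc q))"
   "g : fsupp k (ccells (n - 1) q)" "klift forget y = (%x. klift (cbdry n) u x \<oplus> g x)" "klift (cbdry n) g = (%x. \<zero>)"
   by (elim bexE conjE) (rule that)
  define x where "x = klift (base_cell (n - 1)) g"
  note x = base_cell_cl[OF g(2), folded x_def]
  have 1: "Zc (n - 1) (Qmod (n - 1)) (qd (n - 1)) q x"
   unfolding Qmod_Zc[OF R x(1)] x(2) cbdry_pred_klift[OF g(2)] by (rule g(4))
  interpret Q: abelian_group "Qmod n q" by (rule Qmod_grp)
  have "y \<ominus>[Qmod n q] klift (cell_inc n) x : Bd n (Qmod n) (qd n) q"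
   using Qmod_Bd R' g(1) Q.minus_closed y gc x(1) fgt_diff fgt_inc x(2) g(3) fsD(1)[OF kcbdry_cl[OF g(1)]] fsD(1)[OF g(2)] a_assoc r_neg by (auto simp: amd)
  with 1 show ?thesis by (intro exI conjI)
 qed
qed

text \<open>\<open>left_module\<close> contains the ring axioms of its algebra, so the given
  projective modules supply them for the rook algebra.\<close>

lemma proj_BR_ring: "projective_resolution (BR n) N P d e==>ring (BR n)"
 unfolding projective_resolution_def by (elim conjE) (drule spec, simp only: projective_module_def left_module_def)

lemma triv_lin:
 assumes ph: "aug_map n n' ph"
 shows "lin_along (BR n) ph (triv n) (triv n') id" unfolding linear_along_def
proof (intro conjI ballI)
 fix a x assume "a : car (BR n)" and x: "x : car (triv n)"
 hence a: "a : fsupp k (diagrams n)" by simp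
 show "id (a \<odot>[triv n] x) = ph a \<odot>[triv n'] id x"
  using triv_smult[OF a] triv_smult[OF conjunct1[OF aug_map[OF ph a]]] aug_map[OF ph a] by simp
qed simp_all

text \<open>Each given resolution is compared with the Salvetti resolution in both directions. The
  comparison maps are mutually inverse and compatible with the inclusion only up to homotopy. On
  cycles this means up to boundaries, by \<open>htpc_Bd\<close>, as the criterion
  \<open>tor_map_iso\<close> allows.\<close>

theorem tor_stability:
 fixes P :: "nat=>('k,'p) bmod" and P' :: "nat=>('k,'r) bmod"
 assumes n: "n >= 2 * q + 1" and P: "projective_resolution (BR (n - 1)) (triv (n - 1)) P d e"
  and P': "projective_resolution (BR n) (triv n) P' d' e'"
  and f: "resolution_map (BR (n - 1)) (algebra_incl k n) id P d e P' d' e' f"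
 shows "tor_map (BR n) (triv n) P' d' id f q : iso (tor (BR (n - 1)) (triv (n - 1)) P d q) (tor (BR n) (triv n) P' d' q)"
proof -
 have n1: "n >= 1" using n by simp
 let ?m = "n - 1"
 let ?Q = "Qmod ?m" and ?Q' = "Qmod n" and ?g = "klift (cell_inc n)"
 note R = proj_BR_ring[OF P] and R' = proj_BR_ring[OF P']
 note rP = proj_res_res[OF P triv_grp] and rP' = proj_res_res[OF P' triv_grp]
 note rQ = Qmod_res[OF R] and rQ' = Qmod_res[OF R']
 have ia: "aug_map ?m n (algebra_incl k n)" using inc_ring_map[OF n1 R R'] tau_inc[OF n1] by (simp only: aug_map_def) simp
 note ir = inc_ring_map[OF n1 R R'] and tid = triv_lin[OF aug_map_id]
 have pP: "projective_module (BR ?m) (P i)" and pP': "projective_module (BR n) (P' i)" for i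
  using P P' by (simp_all add: projective_resolution_def)
 note dP = resD[OF rP] and dP' = resD[OF rP'] and dQ = resD[OF rQ] and dQ' = resD[OF rQ']
 obtain al0 where al0: "resolution_map (BR ?m) id id ?Q (qd ?m) aug P d e al0"
  by (rule ch_map_ex[OF rQ rP tid ring_map_id Qmod_lifts[OF R ring_map_id dP(2) triv_grp dP(5)] Qmod_lifts[OF R ring_map_id dP(2) dP(3) dP(4)]])
 obtain be where be: "resolution_map (BR ?m) id id P d e ?Q (qd ?m) aug be"
  by (rule ch_map_ex[OF rP rQ tid ring_map_id proj_lifts[OF pP ring_map_id dQ(2) triv_grp dQ(5)] proj_lifts[OF pP ring_map_id dQ(2) dQ(3) dQ(4)]])
 obtain al0' where al0': "resolution_map (BR n) id id ?Q' (qd n) aug P' d' e' al0'"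
  by (rule ch_map_ex[OF rQ' rP' tid ring_map_id Qmod_lifts[OF R' ring_map_id dP'(2) triv_grp dP'(5)] Qmod_lifts[OF R' ring_map_id dP'(2) dP'(3) dP'(4)]])
 obtain be' where be': "resolution_map (BR n) id id P' d' e' ?Q' (qd n) aug be'"
  by (rule ch_map_ex[OF rP' rQ' tid ring_map_id proj_lifts[OF pP' ring_map_id dQ'(2) triv_grp dQ'(5)] proj_lifts[OF pP' ring_map_id dQ'(2) dQ'(3) dQ'(4)]])
 note g = cell_inc_res_map[OF n1]
 note c = res_map_comp[where ka = id]
 have al0be: "resolution_map (BR ?m) id id P d e P d e (%i x. al0 i (be i x))" by (rule c[OF be al0 ring_map_id]) (simp_all add: feq)
 have al0be': "resolution_map (BR n) id id P' d' e' P' d' e' (%i x. al0' i (be' i x))" by (rule c[OF be' al0' ring_map_id]) (simp_all add: feq)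
 have bef: "resolution_map (BR ?m) (algebra_incl k n) id P d e ?Q' (qd n) aug (%i x. be' i (f i x))" by (rule c[OF f be' ir]) (simp_all add: feq)
 have gbe: "resolution_map (BR ?m) (algebra_incl k n) id P d e ?Q' (qd n) aug (%i x. ?g (be i x))" by (rule c[OF be g ring_map_id]) (simp_all add: feq)
 have al0g: "resolution_map (BR ?m) (algebra_incl k n) id ?Q (qd ?m) aug P' d' e' (%i x. al0' i (?g x))" by (rule c[OF g al0' ir]) (simp_all add: feq)
 have fal0: "resolution_map (BR ?m) (algebra_incl k n) id ?Q (qd ?m) aug P' d' e' (%i x. f i (al0 i x))" by (rule c[OF al0 f ring_map_id]) (simp_all add: feq)
 have lin: "lin_along (BR ?m) id (?Q i) (P i) (al0 i)" "lin_along (BR ?m) id (P i) (?Q i) (be i)"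
  "lin_along (BR n) id (?Q' i) (P' i) (al0' i)" "lin_along (BR n) id (P' i) (?Q' i) (be' i)"
  "lin_along (BR ?m) (algebra_incl k n) (P i) (P' i) (f i)" "lin_along (BR ?m) (algebra_incl k n) (?Q i) (?Q' i) ?g" for i
  using al0 be al0' be' f g by (simp_all only: resolution_map_def simp_thms)
 note l = lin[THEN linD(1)]
 note B = Bd_sg[OF rP, of q] Bd_sg[OF rP', of q] Bd_sg[OF rQ', of q]
 have inj: "x : Bd ?m P d q" if x: "Zc ?m P d q x" and b: "f q x : Bd n P' d' q" for x
 proof -
  note xc = Zc_car[OF x]
  note bx = l(2)[OF xc] and fx = l(5)[OF xc]
  note gbx = l(6)[OF bx] and bfx = l(4)[OF fx] and abx = l(1)[OF bx]
  \<comment> \<open>The square formed by \<open>f\<close>, \<open>cell_inc\<close> and the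
    comparison maps commutes on cycles up to boundaries. So \<open>be q x\<close> becomes a boundary
    under the inclusion, and by stability it is one already.\<close>
  have 1: "be' q (f q x) \<ominus>[?Q' q] ?g (be q x) : Bd n ?Q' (qd n) q"
   by (rule htpc_Bd[OF rP rQ' ia bef gbe proj_lifts[OF pP ir dQ'(2) dQ'(3) dQ'(4)] x])
  have "be q x : Bd ?m ?Q (qd ?m) q"
   using Qmod_stb(1) n R R' bx sg_shift(1)[OF dQ'(3) B(3) gbx bfx sg_shift(2)[OF dQ'(3) B(3) bfx gbx 1] ch_map_Zc(3)[OF rP' rQ' aug_map_id be' b]] by auto
  from ch_map_Zc(3)[OF rQ rP aug_map_id al0 this] have 2: "al0 q (be q x) : Bd ?m P d q" .
  have 3: "al0 q (be q x) \<ominus>[P q] x : Bd ?m P d q"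
   by (rule htpc_Bd[OF rP rP aug_map_id al0be res_map_id proj_lifts[OF pP ring_map_id dP(2) dP(3) dP(4)] x])
  show ?thesis by (rule sg_shift(1)[OF dP(3) B(1) xc abx sg_shift(2)[OF dP(3) B(1) abx xc 3] 2])
 qed
 have surj: "EX x. Zc ?m P d q x & y \<ominus>[P' q] f q x : Bd n P' d' q" if y: "Zc n P' d' q y" for y
 proof -
  note yc = Zc_car[OF y]
  obtain z where z: "Zc ?m ?Q (qd ?m) q z & be' q y \<ominus>[?Q' q] ?g z : Bd n ?Q' (qd n) q"
   by (rule exE[OF Qmod_stb(2)[OF n R R' ch_map_Zc(2)[OF rP' rQ' aug_map_id be' y]]])
  note zc = Zc_car[OF conjunct1[OF z]]
  note gz = l(6)[OF zc] and bfy = l(4)[OF yc]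
  note ab = l(3)[OF bfy] and ag = l(3)[OF gz] and fa = l(5)[OF l(1)[OF zc]]
  have 1: "al0' q (be' q y) \<ominus>[P' q] al0' q (?g z) : Bd n P' d' q"
   using ch_map_Zc(3)[OF rQ' rP' aug_map_id al0' conjunct2[OF z]]
   by (simp only: amap_mns_eq[OF dQ'(3) dP'(3) lin_amap[OF lin(3)] bfy gz])
  have 2: "al0' q (be' q y) \<ominus>[P' q] y : Bd n P' d' q"
   by (rule htpc_Bd[OF rP' rP' aug_map_id al0be' res_map_id proj_lifts[OF pP' ring_map_id dP'(2) dP'(3) dP'(4)] y])
  have 3: "al0' q (?g z) \<ominus>[P' q] f q (al0 q z) : Bd n P' d' q"
   by (rule htpc_Bd[OF rQ rP' ia al0g fal0 Qmod_lifts[OF R ir dP'(2) dP'(3) dP'(4)] conjunct1[OF z]])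
  \<comment> \<open>The three differences are chained, from \<open>y\<close> to its double
    comparison, on to the image of \<open>z\<close> under the inclusion, and from there to
    \<open>f q (al0 q z)\<close>.\<close>
  note s = sg_shift[OF dP'(3) B(2)]
  show ?thesis
   using ch_map_Zc(2)[OF rQ rP aug_map_id al0 conjunct1[OF z]] s(3) yc ag fa s(3)[OF yc ab ag s(2)[OF ab yc 2] 1] 3 by blast
 qed
 show ?thesis by (rule tor_map_iso[OF rP rP' ia f inj surj])
qed

end

theorem corollary7p9:
  fixes k :: "('k, 'm) ring_scheme" and \<epsilon> :: 'k and n q :: nat
    and P :: "nat \<Rightarrow> (strands set \<Rightarrow> 'k, 'p) module" and d :: "nat \<Rightarrow> 'p \<Rightarrow> 'p" and e :: "'p \<Rightarrow> 'k"
    and P' :: "nat \<Rightarrow> (strands set \<Rightarrow> 'k, 'r) module" and d' :: "nat \<Rightarrow> 'r \<Rightarrow> 'r" and e' :: "'r \<Rightarrow> 'k"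
    and f :: "nat \<Rightarrow> 'p \<Rightarrow> 'r"
  assumes "cring k" and "\<epsilon> \<in> Units k" and "n \<ge> 2 * q + 1"
    and "projective_resolution (braided_rook_algebra k \<epsilon> (n - 1)) (trivial_module k (n - 1)) P d e"
    and "projective_resolution (braided_rook_algebra k \<epsilon> n) (trivial_module k n) P' d' e'"
    and "resolution_map (braided_rook_algebra k \<epsilon> (n - 1)) (algebra_incl k n) id P d e P' d' e' f"
  shows "tor_map (braided_rook_algebra k \<epsilon> n) (trivial_module k n) P' d' id f q
    \<in> iso (tor (braided_rook_algebra k \<epsilon> (n - 1)) (trivial_module k (n - 1)) P d q)
          (tor (braided_rook_algebra k \<epsilon> n) (trivial_module k n) P' d' q)"
proof -
 interpret rook k \<epsilon> using assms(1,2) by (simp add: rook_def rook_axioms_def)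
 show ?thesis by (rule tor_stability[OF assms(3-6)])
qed

end
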